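(* Let $w(z;\rho)$ be a regular semi-classical weight with exponents $\rho=(\rho_0,\dots,\rho_M)$ and singularities $z_0=0$ and $z_1(t),\dots,z_M(t)$ moving differentiably with a deformation variable $t$; let $j$ be such that $z_j\ne0$. Denote by $Y_n(z;\rho_j\pm1)$, $B_n(z;\rho_j\pm1)$ the matrices $Y_n,B_n$ for the weight $(z-z_j)^{\pm1}w(z;\rho)$, where $B_n$ is the deformation matrix, i.e. $\frac{d}{dt}Y_n=B_nY_n$. Let $R^{j\pm}_n(z;\rho_j)$ be the Schlesinger transformation matrices, with $Y_n(z;\rho_j\pm1)=R^{j\pm}_n(z;\rho_j)Y_n(z;\rho_j)$, whose explicit forms are given in the context. Then $$\frac{d}{dt}R^{j\pm}_n(z;\rho_j)+R^{j\pm}_n(z;\rho_j)\,B_n(z;\rho_j)=B_n(z;\rho_j\pm1)\,R^{j\pm}_n(z;\rho_j)$$ (for $n\ge0$ in the $+$ case and $n\ge1$ in the $-$ case).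
   Context: $\mathbb T$ is the unit circle. For a complex-valued weight $w$ on $\mathbb T$ put $w_k=\int_{\mathbb T}\frac{d\zeta}{2\pi i\zeta}w(\zeta)\zeta^{-k}$ and $I_n[w]=\det[w_{j-k}]_{j,k=0,\dots,n-1}$, $I_0=1$. If $I_n[w]\ne0$ for all $n\ge0$, the bi-orthogonal system of $w$ is: polynomials $\phi_n,\bar\phi_n$ of degree $n$ with the same leading coefficient $\kappa_n$ satisfying $\int_{\mathbb T}\frac{d\zeta}{2\pi i\zeta}w(\zeta)\phi_m(\zeta)\bar\phi_n(\bar\zeta)=\delta_{m,n}$ with $\bar\zeta=1/\zeta$ ($\bar\phi_n$ is a separate polynomial, not in general the complex conjugate of $\phi_n$; $\kappa_n^2=I_n/I_{n+1}$, with a choice of square root $\kappa_n$, differentiable in $t$, fixed for each weight); $\phi^*_n(z)=z^n\bar\phi_n(1/z)$; and the associated functions, for $z\notin\mathbb T$ and $n>0$, $\xi_n(z)=\int_{\mathbb T}\frac{d\zeta}{2\pi i\zeta}\frac{\zeta+z}{\zeta-z}w(\zeta)\phi_n(\zeta)$, $\ \xi^*_n(z)=-z^n\int_{\mathbb T}\frac{d\zeta}{2\pi i\zeta}\frac{\zeta+z}{\zeta-z}w(\zeta)\bar\phi_n(\bar\zeta)$, and $\xi_0(z)=\kappa_0[w_0+F(z)]$, $\xi^*_0(z)=\kappa_0[w_0-F(z)]$ with $F(z)=\int_{\mathbb T}\frac{d\zeta}{2\pi i\zeta}\frac{\zeta+z}{\zeta-z}w(\zeta)$. Put $$Y_n(z)=\begin{pmatrix}\phi_n(z)&\xi_n(z)/w(z)\\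 \phi^*_n(z)&-\xi^*_n(z)/w(z)\end{pmatrix},\qquad \det Y_n(z)=-\frac{2z^n}{w(z)}.$$ Regular semi-classical weights: $M\ge1$, $z_0=0,z_1,\dots,z_M$ are distinct points of $\mathbb C$, and $\frac{w'(z)}{w(z)}=\frac{2V(z)}{W(z)}=\sum_{j=0}^M\frac{\rho_j}{z-z_j}$ with $W(z)=\prod_{j=0}^M(z-z_j)$, $\deg V<M+1$, $\rho_j\in\mathbb C\setminus\mathbb Z_{\ge0}$; e.g. $w(z)=\prod_{j=0}^M(z-z_j)^{\rho_j}$, possibly with different constant (also $t$-independent) factors on different arcs of $\mathbb T$. The exponents $\rho_j$ do not depend on $t$ and are restricted so that the trigonometric moments of all weights considered exist. Values $\xi_n(z_j),\xi^*_n(z_j)$ at a singular point on $\mathbb T$ are understood as limits. The bi-orthogonal systems of $w$ and of all shifted weights considered are assumed to exist, with $r_n\bar r_n\ne0,1$ for $n\ge1$, where $r_n=\phi_n(0)/\kappa_n$, $\bar r_n=\bar\phi_n(0)/\kappa_n$. It is known from earlier work that (dot denoting $d/dt$) $\frac{d}{dt}Y_n=B_nY_n$ with $$B_n=B_\infty-\sum_{j=1}^M\frac{A_{n,j}}{z-z_j}\dot z_j,\qquad B_\infty=\begin{pmatrix}\frac{\dot\kappa_n}{\kappa_n}&0\\ \frac{\dot\kappa_n\bar\phi_n(0)+\kappa_n\dot{\bar\phi}_n(0)}{\kappa_n^2}&-\frac{\dot\kappa_n}{\kappa_n}\end{pmatrix},$$ $$A_{n,j}=-\frac{\rho_j}{2z_j^n}\begin{pmatrix}\phi^*_n(z_j)\xi_n(z_j)&-\phi_n(z_j)\xi_n(z_j)\\-\phi^*_n(z_j)\xi^*_n(z_j)&\phi_n(z_j)\xi^*_n(z_j)\end{pmatrix},\quad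 j=1,\dots,M.$$ Schlesinger matrices ($\kappa_n^\pm$ is the leading coefficient for $(z-z_j)^{\pm1}w$; $\phi_n(z_j)\ne0$ for all $n\ge0$ is assumed in the $+$ case, $\xi^*_n(z_j)\neq0$ for all $n\ge0$ in the $-$ case): $$R^{j+}_n=\frac{1}{z-z_j}\frac{\kappa^+_n}{\kappa_n}\begin{pmatrix} z-\frac{\kappa_n\phi_{n+1}(z_j)}{\kappa_{n+1}\phi_n(z_j)} & \frac{\phi_{n+1}(0)}{\kappa_{n+1}}\\ \frac{\phi^*_n(z_j)}{\phi_n(z_j)}z & -z_j\end{pmatrix},\quad R^{j-}_n=\frac{\kappa^-_n}{\kappa_n}\begin{pmatrix}\frac{\kappa_n\xi^*_n(z_j)}{\kappa_{n-1}\xi^*_{n-1}(z_j)} & \frac{\kappa_n\xi_n(z_j)}{\kappa_{n-1}\xi^*_{n-1}(z_j)}\\ \frac{\bar\phi_n(0)\xi^*_n(z_j)}{\kappa_{n-1}\xi^*_{n-1}(z_j)}\frac{z}{z_j} & 1-\frac{\kappa_n\xi^*_n(z_j)}{\kappa_{n-1}\xi^*_{n-1}(z_j)}\frac{z}{z_j}\end{pmatrix}.$$ *)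

theory Defs
  imports "HOL-Analysis.Analysis" "HOL-Computational_Algebra.Polynomial"
begin

section \<open>Weights on the unit circle and their bi-orthogonal systems\<close>

text \<open>
  The mean over the unit circle with respect to \<open>d\<zeta> / (2 \<pi> i \<zeta>)\<close>, written in the
  parametrisation \<open>\<zeta> = cis \<theta>\<close> as a Lebesgue integral. A weight is a function
  \<open>complex \<Rightarrow> complex\<close> of which only the values on the unit circle matter; its values at the
  finitely many singular points are irrelevant.
\<close>

definition circle_mean :: "(complex \<Rightarrow> complex) \<Rightarrow> complex" where
  "circle_mean f = (LINT \<theta>:{0..2*pi}|lborel. f (cis \<theta>)) / complex_of_real (2 * pi)"

definition moment :: "(complex \<Rightarrow> complex) \<Rightarrow> int \<Rightarrow> complex" where
  "moment w k = circle_mean (\<lambda>\<zeta>. w \<zeta> * \<zeta> powi (- k))"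

text \<open>Since \<open>\<bar>\<zeta>\<^sup>k\<bar> = 1\<close> on the circle, this is absolute convergence of each trigonometric moment.\<close>

definition moments_exist :: "(complex \<Rightarrow> complex) \<Rightarrow> bool" where
  "moments_exist w \<longleftrightarrow> set_integrable lborel {0..2*pi} (\<lambda>\<theta>. w (cis \<theta>))"

text \<open>
  \<open>\<phi>b\<close> is the second family of polynomials (it is not the complex conjugate of \<open>\<phi>\<close>).
  The common leading coefficient is \<open>kappa \<phi> n\<close>. Existence of such a system forces
  all Toeplitz determinants of \<open>w\<close> to be nonzero.
\<close>

definition kappa :: "(nat \<Rightarrow> complex poly) \<Rightarrow> nat \<Rightarrow> complex" where
  "kappa \<phi> n = lead_coeff (\<phi> n)"

definition biorthogonal_system ::
    "(complex \<Rightarrow> complex) \<Rightarrow> (nat \<Rightarrow> complex poly) \<Rightarrow> (nat \<Rightarrow> complex poly) \<Rightarrow> bool" where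
  "biorthogonal_system w \<phi> \<phi>b \<longleftrightarrow>
     (\<forall>n. degree (\<phi> n) = n \<and> degree (\<phi>b n) = n \<and> lead_coeff (\<phi>b n) = kappa \<phi> n) \<and>
     (\<forall>m n. circle_mean (\<lambda>\<zeta>. w \<zeta> * poly (\<phi> m) \<zeta> * poly (\<phi>b n) (1 / \<zeta>)) = (if m = n then 1 else 0))"

text \<open>\<open>phi_star\<close> is only evaluated at nonzero points.\<close>

definition phi_star :: "(nat \<Rightarrow> complex poly) \<Rightarrow> nat \<Rightarrow> complex \<Rightarrow> complex" where
  "phi_star \<phi>b n x = x ^ n * poly (\<phi>b n) (1 / x)"

definition Caratheodory_fun :: "(complex \<Rightarrow> complex) \<Rightarrow> complex \<Rightarrow> complex" where
  "Caratheodory_fun w x = circle_mean (\<lambda>\<zeta>. (\<zeta> + x) / (\<zeta> - x) * w \<zeta>)"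

definition xi ::
    "(complex \<Rightarrow> complex) \<Rightarrow> (nat \<Rightarrow> complex poly) \<Rightarrow> nat \<Rightarrow> complex \<Rightarrow> complex" where
  "xi w \<phi> n x =
     (if n = 0 then kappa \<phi> 0 * (moment w 0 + Caratheodory_fun w x)
      else circle_mean (\<lambda>\<zeta>. (\<zeta> + x) / (\<zeta> - x) * w \<zeta> * poly (\<phi> n) \<zeta>))"

definition xi_star ::
    "(complex \<Rightarrow> complex) \<Rightarrow> (nat \<Rightarrow> complex poly) \<Rightarrow> (nat \<Rightarrow> complex poly)
      \<Rightarrow> nat \<Rightarrow> complex \<Rightarrow> complex" where
  "xi_star w \<phi> \<phi>b n x =
     (if n = 0 then kappa \<phi> 0 * (moment w 0 - Caratheodory_fun w x)
      else - (x ^ n) * circle_mean (\<lambda>\<zeta>. (\<zeta> + x) / (\<zeta> - x) * w \<zeta> * poly (\<phi>b n) (1 / \<zeta>)))"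

text \<open>
  \<open>xi\<close> and \<open>xi_star\<close> are defined off the unit circle; their values at a point \<open>p\<close> of the circle
  are limits, with the argument tending to \<open>p\<close> through the complement of the circle.
\<close>

definition circle_limit_exists :: "(complex \<Rightarrow> complex) \<Rightarrow> complex \<Rightarrow> bool" where
  "circle_limit_exists f p \<longleftrightarrow> (\<exists>l. (f \<longlongrightarrow> l) (at p within - sphere 0 1))"

definition value_at :: "(complex \<Rightarrow> complex) \<Rightarrow> complex \<Rightarrow> complex" where
  "value_at f p = (if p \<in> sphere 0 1 then Lim (at p within - sphere 0 1) f else f p)"


section \<open>Deformations of regular semi-classical weights\<close>

text \<open>
  \<open>z k t\<close> is the position of the \<open>k\<close>-th singularity at time \<open>t\<close>, and \<open>\<rho> k\<close> its (constant) exponent.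
\<close>

definition moving_singularities :: "real set \<Rightarrow> nat \<Rightarrow> (nat \<Rightarrow> real \<Rightarrow> complex) \<Rightarrow> bool" where
  "moving_singularities S M z \<longleftrightarrow>
     (\<forall>t\<in>S. z 0 t = 0 \<and> inj_on (\<lambda>k. z k t) {0..M} \<and> (\<forall>k\<in>{1..M}. z k differentiable (at t)))"

text \<open>
  The first condition is \<open>w' / w = (\<Sum>k\<le>M. \<rho> k / (\<zeta> - z k))\<close>, i.e. \<open>w' / w = 2 V / W\<close> with
  \<open>W = (\<Prod>k\<le>M. \<zeta> - z k)\<close>, on every open arc between singular points. The derivative is taken along
  the circle, since \<open>w\<close> may carry different constant factors on different arcs. The second condition
  states that these factors do not depend on \<open>t\<close>: for \<open>w = c * (\<Prod>k\<le>M. (\<zeta> - z k t) powr \<rho> k)\<close> with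
  locally constant \<open>c\<close> it is the logarithmic \<open>t\<close>-derivative. Both are written without dividing
  by \<open>w\<close>, so that a factor may be \<open>0\<close> on some arcs.
\<close>

definition semiclassical_deformation ::
    "real set \<Rightarrow> nat \<Rightarrow> (nat \<Rightarrow> real \<Rightarrow> complex) \<Rightarrow> (nat \<Rightarrow> complex)
      \<Rightarrow> (real \<Rightarrow> complex \<Rightarrow> complex) \<Rightarrow> bool" where
  "semiclassical_deformation S M z \<rho> w \<longleftrightarrow>
     (\<forall>t\<in>S. \<forall>\<zeta>\<in>sphere 0 1 - (\<lambda>k. z k t) ` {0..M}.
        (w t has_field_derivative w t \<zeta> * (\<Sum>k=0..M. \<rho> k / (\<zeta> - z k t))) (at \<zeta> within sphere 0 1) \<and>
        ((\<lambda>s. w s \<zeta>) has_vector_derivative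
           - w t \<zeta> * (\<Sum>k=0..M. \<rho> k * vector_derivative (z k) (at t) / (\<zeta> - z k t))) (at t))"

text \<open>
  The standing assumptions on the bi-orthogonal system of a (possibly shifted) weight:
  the moments and the system exist at all times, \<open>r n * rb n \<noteq> 0, 1\<close>, the leading coefficients are
  differentiable in \<open>t\<close>, and the values of the associated functions at singular points on the circle
  exist as limits.
\<close>

definition admissible_system ::
    "real set \<Rightarrow> nat \<Rightarrow> (nat \<Rightarrow> real \<Rightarrow> complex) \<Rightarrow> (real \<Rightarrow> complex \<Rightarrow> complex)
      \<Rightarrow> (real \<Rightarrow> nat \<Rightarrow> complex poly) \<Rightarrow> (real \<Rightarrow> nat \<Rightarrow> complex poly) \<Rightarrow> bool" where
  "admissible_system S M z w \<phi> \<phi>b \<longleftrightarrow>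
     (\<forall>t\<in>S.
        moments_exist (w t) \<and>
        biorthogonal_system (w t) (\<phi> t) (\<phi>b t) \<and>
        (\<forall>n\<ge>1. let r = poly (\<phi> t n) 0 / kappa (\<phi> t) n; rb = poly (\<phi>b t n) 0 / kappa (\<phi> t) n
               in r * rb \<noteq> 0 \<and> r * rb \<noteq> 1) \<and>
        (\<forall>n. (\<lambda>s. kappa (\<phi> s) n) differentiable (at t)) \<and>
        (\<forall>k\<in>{1..M}. z k t \<in> sphere 0 1 \<longrightarrow>
           (\<forall>n. circle_limit_exists (xi (w t) (\<phi> t) n) (z k t) \<and>
                circle_limit_exists (xi_star (w t) (\<phi> t) (\<phi>b t) n) (z k t))))"

definition shift_weight ::
    "int \<Rightarrow> (real \<Rightarrow> complex) \<Rightarrow> (real \<Rightarrow> complex \<Rightarrow> complex) \<Rightarrow> real \<Rightarrow> complex \<Rightarrow> complex" where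
  "shift_weight e zj w t \<zeta> = (\<zeta> - zj t) powi e * w t \<zeta>"


section \<open>The deformation matrix\<close>

definition matrix2 :: "complex \<Rightarrow> complex \<Rightarrow> complex \<Rightarrow> complex \<Rightarrow> complex^2^2" where
  "matrix2 a b c d = vector [vector [a, b], vector [c, d]]"

definition cscale :: "complex \<Rightarrow> complex^2^2 \<Rightarrow> complex^2^2" where
  "cscale a X = (\<chi> i k. a * X $ i $ k)"

text \<open>The residue matrix at the singularity \<open>p\<close> with exponent \<open>r\<close>.\<close>

definition A_matrix ::
    "(complex \<Rightarrow> complex) \<Rightarrow> (nat \<Rightarrow> complex poly) \<Rightarrow> (nat \<Rightarrow> complex poly)
      \<Rightarrow> complex \<Rightarrow> complex \<Rightarrow> nat \<Rightarrow> complex^2^2" where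
  "A_matrix w \<phi> \<phi>b r p n =
     (let f = poly (\<phi> n) p; fs = phi_star \<phi>b n p;
          x = value_at (xi w \<phi> n) p; xs = value_at (xi_star w \<phi> \<phi>b n) p
      in cscale (- r / (2 * p ^ n)) (matrix2 (fs * x) (- f * x) (- fs * xs) (f * xs)))"

definition B_infinity ::
    "(real \<Rightarrow> nat \<Rightarrow> complex poly) \<Rightarrow> (real \<Rightarrow> nat \<Rightarrow> complex poly) \<Rightarrow> nat \<Rightarrow> real \<Rightarrow> complex^2^2" where
  "B_infinity \<phi> \<phi>b n t =
     (let k = kappa (\<phi> t) n; dk = vector_derivative (\<lambda>s. kappa (\<phi> s) n) (at t);
          b = poly (\<phi>b t n) 0; db = vector_derivative (\<lambda>s. poly (\<phi>b s n) 0) (at t)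
      in matrix2 (dk / k) 0 ((dk * b + k * db) / k ^ 2) (- dk / k))"

text \<open>
  The coefficient matrix of the deformation equation \<open>dY/dt = B ** Y\<close>, at the spectral point \<open>x\<close>,
  where \<open>Y\<close> has the columns \<open>(\<phi>, \<phi>\<^sup>*)\<close> and \<open>(\<xi>, - \<xi>\<^sup>*) / w\<close>.
\<close>

definition B_matrix ::
    "nat \<Rightarrow> (nat \<Rightarrow> real \<Rightarrow> complex) \<Rightarrow> (nat \<Rightarrow> complex) \<Rightarrow> (real \<Rightarrow> complex \<Rightarrow> complex)
      \<Rightarrow> (real \<Rightarrow> nat \<Rightarrow> complex poly) \<Rightarrow> (real \<Rightarrow> nat \<Rightarrow> complex poly)
      \<Rightarrow> nat \<Rightarrow> real \<Rightarrow> complex \<Rightarrow> complex^2^2" where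
  "B_matrix M z \<rho> w \<phi> \<phi>b n t x =
     B_infinity \<phi> \<phi>b n t -
     (\<Sum>k=1..M. cscale (vector_derivative (z k) (at t) / (x - z k t))
                  (A_matrix (w t) (\<phi> t) (\<phi>b t) (\<rho> k) (z k t) n))"


section \<open>The Schlesinger matrices\<close>

text \<open>
  \<open>p\<close> is the shifted singularity, \<open>x\<close> the spectral point, and \<open>\<kappa>'\<close> the sequence of leading
  coefficients for the shifted weight.
\<close>

definition R_plus ::
    "(nat \<Rightarrow> complex poly) \<Rightarrow> (nat \<Rightarrow> complex poly) \<Rightarrow> (nat \<Rightarrow> complex)
      \<Rightarrow> complex \<Rightarrow> nat \<Rightarrow> complex \<Rightarrow> complex^2^2" where
  "R_plus \<phi> \<phi>b \<kappa>' p n x =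
     (let \<kappa> = kappa \<phi>
      in cscale (1 / (x - p) * (\<kappa>' n / \<kappa> n))
           (matrix2 (x - \<kappa> n * poly (\<phi> (n + 1)) p / (\<kappa> (n + 1) * poly (\<phi> n) p))
                    (poly (\<phi> (n + 1)) 0 / \<kappa> (n + 1))
                    (phi_star \<phi>b n p / poly (\<phi> n) p * x)
                    (- p)))"

definition R_minus ::
    "(complex \<Rightarrow> complex) \<Rightarrow> (nat \<Rightarrow> complex poly) \<Rightarrow> (nat \<Rightarrow> complex poly) \<Rightarrow> (nat \<Rightarrow> complex)
      \<Rightarrow> complex \<Rightarrow> nat \<Rightarrow> complex \<Rightarrow> complex^2^2" where
  "R_minus w \<phi> \<phi>b \<kappa>' p n x =
     (let \<kappa> = kappa \<phi>;
          \<xi> = (\<lambda>m. value_at (xi w \<phi> m) p); \<xi>s = (\<lambda>m. value_at (xi_star w \<phi> \<phi>b m) p)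
      in cscale (\<kappa>' n / \<kappa> n)
           (matrix2 (\<kappa> n * \<xi>s n / (\<kappa> (n - 1) * \<xi>s (n - 1)))
                    (\<kappa> n * \<xi> n / (\<kappa> (n - 1) * \<xi>s (n - 1)))
                    (poly (\<phi>b n) 0 * \<xi>s n / (\<kappa> (n - 1) * \<xi>s (n - 1)) * (x / p))
                    (1 - \<kappa> n * \<xi>s n / (\<kappa> (n - 1) * \<xi>s (n - 1)) * (x / p))))"

end

theory Submission
  imports Defs
begin

text \<open>
  Put \<open>L g = circle_mean (\<lambda>\<zeta>. w \<zeta> * g \<zeta>)\<close>, \<open>\<Phi> = (\<phi>\<^sub>n, \<phi>\<^sub>n\<^sup>*)\<close> and \<open>U = (\<xi>\<^sub>n, - \<xi>\<^sub>n\<^sup>*)\<close>; up to a constant vector \<open>U\<close>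
  is \<open>2 L [\<zeta> \<Phi> / (\<zeta> - x)]\<close>. The existence of boundary values of the Caratheodory function from both sides of
  the circle forces the weight to vanish at singular points on the circle, so that \<open>w / (\<zeta> - z\<^sub>k)\<close>
  is integrable and \<open>d/dt (L g) = - (\<Sum>k. \<rho>\<^sub>k z\<^sub>k' L [g / (\<zeta> - z\<^sub>k)])\<close> by dominated convergence. Orthogonality
  then gives \<open>\<Phi>' = B \<Phi>\<close> and \<open>U' = (B - \<sigma>) U\<close> with \<open>\<sigma> = (\<Sum>k. \<rho>\<^sub>k z\<^sub>k' / (x - z\<^sub>k))\<close>, and it identifies \<open>R \<Phi>\<close> and
  \<open>R U\<close> with \<open>\<Phi>\<close> and a scalar multiple of \<open>U\<close> for the shifted weight. Differentiating these identities
  shows that \<open>dR/dt + R B - B' R\<close> annihilates the two independent columns \<open>\<Phi>\<close> and \<open>U\<close> for generic \<open>x\<close>,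
  hence vanishes, and the exceptional \<open>x\<close> follow by continuity.
\<close>

section \<open>Integrals over the circle\<close>

text \<open>The obstacle is analytic. A weight is only given on the circle, so the quotient by w(z)
  in the second column of Y is never formed off it: \<open>U\<close> stays unnormalised, and the
  missing factor reappears as \<sigma> and as the scalar (x - z_j)^(-e) between the functions of the
  second kind of the two weights. Singular points may lie on the circle and move along it, so near
  them the weight at time s is not controlled pointwise by the weight at time t. The majorant for
  the difference quotients is therefore built in two zones, farther from and nearer to z_k than 4 L
  |s - t|, where L is a Lipschitz constant of the singular points. The differential equation dY/dt =
  B Y is proved rather than presupposed: the t-derivative of a polynomial of the system is recovered
  from its top coefficient and its pairings with lower monomials, and quotients of
  Christoffel-Darboux type have exactly the pairings that the moving poles of w'/w produce.\<close>

lemma AE_cis_notin: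
  assumes "finite A"
  shows "AE \<theta> in lborel. \<theta> \<in> {0..2*pi} \<longrightarrow> cis \<theta> \<notin> A"
proof -
  \<comment> \<open>\<open>Arg2pi\<close> inverts \<open>cis\<close> only on [0, 2 pi), so the end
    point 2 pi, which repeats the angle 0, is added by hand.\<close>
  have "{\<theta> \<in> {0..2*pi}. cis \<theta> \<in> A} \<subseteq> insert (2*pi) (Arg2pi ` A)"
  proof
    fix \<theta> assume "\<theta> \<in> {\<theta> \<in> {0..2*pi}. cis \<theta> \<in> A}"
    moreover have "Arg2pi (cis \<theta>) = \<theta>" if "0 \<le> \<theta>" "\<theta> < 2*pi"
      using Arg2pi_unique[of 1 \<theta> "cis \<theta>"] that by (simp add: cis_conv_exp)
    ultimately show "\<theta> \<in> insert (2*pi) (Arg2pi ` A)" by force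
  qed
  hence "finite {\<theta> \<in> {0..2*pi}. cis \<theta> \<in> A}"
    using assms by (meson finite.insertI finite_imageI finite_subset)
  hence "{\<theta> \<in> {0..2*pi}. cis \<theta> \<in> A} \<in> null_sets lborel"
    by (intro finite_imp_null_set_lborel)
  thus ?thesis
    by (rule AE_I') auto
qed

lemma borel_measurable_cis [measurable]: "cis \<in> borel_measurable borel"
  by (intro borel_measurable_continuous_onI continuous_intros)

lemma moments_exist_measurable:
  assumes "moments_exist f"
  shows "(\<lambda>\<theta>. indicator {0..2*pi} \<theta> *\<^sub>R f (cis \<theta>)) \<in> borel_measurable lborel"
  using assms unfolding moments_exist_def set_integrable_def by (rule borel_measurable_integrable)

text \<open>Identities between rational expressions in \<zeta> break at poles, where division by
  zero yields 0; the finite set \<open>A\<close> absorbs these points. Integrability of both sides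
  supplies the measurability for the almost-everywhere argument.\<close>

lemma circle_mean_cong:
  assumes "finite A" "moments_exist f" "moments_exist g"
    "\<And>\<zeta>. cmod \<zeta> = 1 \<Longrightarrow> \<zeta> \<notin> A \<Longrightarrow> f \<zeta> = g \<zeta>"
  shows "circle_mean f = circle_mean g"
proof -
  have "AE \<theta> in lborel. indicator {0..2*pi} \<theta> *\<^sub>R f (cis \<theta>) = indicator {0..2*pi} \<theta> *\<^sub>R g (cis \<theta>)"
    using AE_cis_notin[OF assms(1)] by eventually_elim (use assms(4) in \<open>auto simp: indicator_def\<close>)
  hence "(LINT \<theta>:{0..2*pi}|lborel. f (cis \<theta>)) = (LINT \<theta>:{0..2*pi}|lborel. g (cis \<theta>))"
    unfolding set_lebesgue_integral_def using assms(2,3)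
    by (intro integral_cong_AE moments_exist_measurable)
  thus ?thesis unfolding circle_mean_def by simp
qed

lemma circle_mean_cong_strong:
  assumes "\<And>\<zeta>. cmod \<zeta> = 1 \<Longrightarrow> f \<zeta> = g \<zeta>"
  shows "circle_mean f = circle_mean g" "moments_exist f = moments_exist g"
  unfolding circle_mean_def moments_exist_def using assms by simp_all

lemma moments_exist_add: "moments_exist f \<Longrightarrow> moments_exist g \<Longrightarrow> moments_exist (\<lambda>\<zeta>. f \<zeta> + g \<zeta>)"
  unfolding moments_exist_def by (rule set_integral_add)

lemma moments_exist_diff: "moments_exist f \<Longrightarrow> moments_exist g \<Longrightarrow> moments_exist (\<lambda>\<zeta>. f \<zeta> - g \<zeta>)"
  unfolding moments_exist_def by (rule set_integral_diff)

lemma moments_exist_mult_left: "moments_exist f \<Longrightarrow> moments_exist (\<lambda>\<zeta>. c * f \<zeta>)"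
  unfolding moments_exist_def by (rule set_integrable_mult_right)

lemma moments_exist_mult_right: "moments_exist f \<Longrightarrow> moments_exist (\<lambda>\<zeta>. f \<zeta> * c)"
  unfolding moments_exist_def by (rule set_integrable_mult_left)

lemma moments_exist_zero: "moments_exist (\<lambda>\<zeta>. 0)"
  unfolding moments_exist_def set_integrable_def by simp

lemma moments_exist_sum:
  "(\<And>i. i \<in> I \<Longrightarrow> moments_exist (f i)) \<Longrightarrow> moments_exist (\<lambda>\<zeta>. \<Sum>i\<in>I. f i \<zeta>)"
  by (induction I rule: infinite_finite_induct) (auto simp: moments_exist_zero moments_exist_add)

lemma circle_mean_add:
  "moments_exist f \<Longrightarrow> moments_exist g \<Longrightarrow> circle_mean (\<lambda>\<zeta>. f \<zeta> + g \<zeta>) = circle_mean f + circle_mean g"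
  unfolding moments_exist_def circle_mean_def by (simp add: set_integral_add add_divide_distrib)

lemma circle_mean_diff:
  "moments_exist f \<Longrightarrow> moments_exist g \<Longrightarrow> circle_mean (\<lambda>\<zeta>. f \<zeta> - g \<zeta>) = circle_mean f - circle_mean g"
  unfolding moments_exist_def circle_mean_def by (simp add: set_integral_diff diff_divide_distrib)

lemma circle_mean_mult_left: "circle_mean (\<lambda>\<zeta>. c * f \<zeta>) = c * circle_mean f"
  unfolding circle_mean_def by simp

lemma circle_mean_mult_right: "circle_mean (\<lambda>\<zeta>. f \<zeta> * c) = circle_mean f * c"
  unfolding circle_mean_def by simp

lemma circle_mean_zero: "circle_mean (\<lambda>\<zeta>. 0) = 0"
  unfolding circle_mean_def by simp

lemma circle_mean_sum:
  "(\<And>i. i \<in> I \<Longrightarrow> moments_exist (f i)) \<Longrightarrow>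
    circle_mean (\<lambda>\<zeta>. \<Sum>i\<in>I. f i \<zeta>) = (\<Sum>i\<in>I. circle_mean (f i))"
  by (induction I rule: infinite_finite_induct)
    (auto simp: circle_mean_zero circle_mean_add moments_exist_sum)

lemma circle_measurable_continuous:
  assumes "continuous_on (sphere 0 1) g"
  shows "(\<lambda>\<theta>. g (cis \<theta>)) \<in> borel_measurable borel"
  by (intro borel_measurable_continuous_onI continuous_on_compose2[OF assms] continuous_intros) auto

text \<open>A continuous factor is bounded on the compact circle. Polynomials in \<zeta> or 1 /
  \<zeta> and Cauchy kernels with pole off the circle enter the integrals this way.\<close>

lemma moments_exist_times_continuous:
  assumes w: "moments_exist w" and g: "continuous_on (sphere 0 1) g"
  shows "moments_exist (\<lambda>\<zeta>. w \<zeta> * g \<zeta>)"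
proof -
  have "bounded (g ` sphere 0 1)"
    using g by (intro compact_imp_bounded compact_continuous_image) auto
  then obtain C where C: "\<And>\<zeta>. cmod \<zeta> = 1 \<Longrightarrow> cmod (g \<zeta>) \<le> C"
    unfolding bounded_iff by (metis imageI mem_sphere_0)
  have m: "(\<lambda>\<theta>. g (cis \<theta>)) \<in> borel_measurable lborel"
    using circle_measurable_continuous[OF g] by simp
  have "integrable lborel (\<lambda>\<theta>. (indicator {0..2*pi} \<theta> *\<^sub>R w (cis \<theta>)) * g (cis \<theta>))"
  proof (rule Bochner_Integration.integrable_bound)
    show "integrable lborel (\<lambda>\<theta>. C *\<^sub>R (indicator {0..2*pi} \<theta> *\<^sub>R w (cis \<theta>)))"
      using w unfolding moments_exist_def set_integrable_def by (intro integrable_scaleR_right)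
    show "(\<lambda>\<theta>. (indicator {0..2*pi} \<theta> *\<^sub>R w (cis \<theta>)) * g (cis \<theta>)) \<in> borel_measurable lborel"
      by (intro borel_measurable_times m moments_exist_measurable[OF w])
    have "0 \<le> C" using order_trans[OF norm_ge_zero C[of 1]] by simp
    thus "AE \<theta> in lborel. norm ((indicator {0..2*pi} \<theta> *\<^sub>R w (cis \<theta>)) * g (cis \<theta>))
       \<le> norm (C *\<^sub>R (indicator {0..2*pi} \<theta> *\<^sub>R w (cis \<theta>)))"
      using C by (intro AE_I2) (auto simp: norm_mult indicator_def mult.commute[of C] intro!: mult_left_mono)
  qed
  thus ?thesis unfolding moments_exist_def set_integrable_def by (simp add: mult.assoc)
qed

lemma moments_exist_continuous:
  assumes "continuous_on (sphere 0 1) g"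
  shows "moments_exist g"
  unfolding moments_exist_def
  by (intro borel_integrable_atLeastAtMost' continuous_on_compose2[OF assms] continuous_intros) auto

lemma moments_exist_bound:
  assumes "moments_exist f" "finite A"
    "\<And>\<zeta>. cmod \<zeta> = 1 \<Longrightarrow> \<zeta> \<notin> A \<Longrightarrow> cmod (g \<zeta>) \<le> cmod (f \<zeta>)"
    "(\<lambda>\<theta>. indicator {0..2*pi} \<theta> *\<^sub>R g (cis \<theta>)) \<in> borel_measurable lborel"
  shows "moments_exist g"
  unfolding moments_exist_def set_integrable_def
proof (rule Bochner_Integration.integrable_bound)
  show "integrable lborel (\<lambda>\<theta>. indicator {0..2*pi} \<theta> *\<^sub>R f (cis \<theta>))"
    using assms(1) unfolding moments_exist_def set_integrable_def .
  show "AE \<theta> in lborel. norm (indicator {0..2*pi} \<theta> *\<^sub>R g (cis \<theta>)) \<le> norm (indicator {0..2*pi} \<theta> *\<^sub>R f (cis \<theta>))"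
    using AE_cis_notin[OF assms(2)] by eventually_elim (use assms(3) in \<open>auto simp: indicator_def\<close>)
qed (use assms in auto)

lemma moments_exist_cmod:
  assumes "moments_exist f" shows "moments_exist (\<lambda>\<zeta>. of_real (cmod (f \<zeta>)))"
proof (rule moments_exist_bound[OF assms, of "{}"])
  have "(\<lambda>\<theta>. complex_of_real (norm (indicator {0..2*pi} \<theta> *\<^sub>R f (cis \<theta>)))) \<in> borel_measurable lborel"
    using moments_exist_measurable[OF assms] by measurable
  thus "(\<lambda>\<theta>. indicator {0..2*pi} \<theta> *\<^sub>R complex_of_real (cmod (f (cis \<theta>)))) \<in> borel_measurable lborel"
    by (simp add: scaleR_conv_of_real norm_mult)
qed auto

text \<open>A continuous branch of log (cis \<theta> - p) along the line of angles, up to an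
  additive constant. For |p| <= 1 the factor cis \<theta> is split off, for |p| > 1 the factor - p;
  either way the argument left for \<open>Ln\<close> lies in the open right half plane unless cis
  \<theta> = p, so the cut is never met.\<close>

definition log_branch :: "complex \<Rightarrow> real \<Rightarrow> complex" where
  "log_branch p \<theta> = (if cmod p \<le> 1 then \<i> * \<theta> + Ln (1 - p / cis \<theta>) else Ln (1 - cis \<theta> / p))"

lemma has_vector_derivative_cis: "(cis has_vector_derivative \<i> * cis \<theta>) (at \<theta> within T)"
proof -
  have "((\<lambda>u. exp (\<i> * u)) has_field_derivative \<i> * exp (\<i> * of_real \<theta>)) (at (of_real \<theta>))"
    by (auto intro!: derivative_eq_intros)
  hence "((\<lambda>u. exp (\<i> * of_real u)) has_vector_derivative \<i> * exp (\<i> * of_real \<theta>)) (at \<theta> within T)"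
    by (rule has_vector_derivative_real_field)
  thus ?thesis by (simp add: cis_conv_exp cis_conv_exp[abs_def])
qed

text \<open>The closed unit disc meets the half plane Re >= 1 only in the point 1.\<close>

lemma Re_one_minus_pos:
  fixes q :: complex
  assumes "cmod q \<le> 1" "q \<noteq> 1"
  shows "Re (1 - q) > 0"
proof (rule ccontr)
  assume "\<not> Re (1 - q) > 0"
  hence "Re q \<ge> 1" by simp
  moreover have "Re q \<le> cmod q" by (rule complex_Re_le_cmod)
  ultimately have r: "Re q = 1" "cmod q = 1" using assms(1) by auto
  hence "(Im q)\<^sup>2 = 0" using cmod_power2[of q] by simp
  hence "q = 1" using r by (simp add: complex_eq_iff)
  thus False using assms(2) by simp
qed

lemma log_branch_deriv:
  assumes "cis \<theta> \<noteq> p"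
  shows "(log_branch p has_vector_derivative \<i> * cis \<theta> / (cis \<theta> - p)) (at \<theta> within T)"
proof -
  have cd: "(cis has_vector_derivative \<i> * cis \<theta>) (at \<theta> within T)"
    using has_vector_derivative_cis[of \<theta> T] by simp
  show ?thesis
  proof (cases "cmod p \<le> 1")
    case True
    have q: "p / cis \<theta> \<noteq> 1" "cmod (p / cis \<theta>) \<le> 1" using assms True by (auto simp: norm_divide)
    have re: "Re (1 - p / cis \<theta>) > 0" using Re_one_minus_pos[OF q(2,1)] .
    have "((\<lambda>u. \<i> * u + Ln (1 - p / exp (\<i> * u))) has_field_derivative
        \<i> + (\<i> * p / exp (\<i> * of_real \<theta>)) / (1 - p / exp (\<i> * of_real \<theta>))) (at (of_real \<theta>))"
      using re assms by (auto intro!: derivative_eq_intros simp: cis_conv_exp complex_nonpos_Reals_iff power2_eq_square; simp add: divide_inverse mult_ac)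
    hence "((\<lambda>u. \<i> * of_real u + Ln (1 - p / exp (\<i> * of_real u))) has_vector_derivative
        \<i> + (\<i> * p / exp (\<i> * of_real \<theta>)) / (1 - p / exp (\<i> * of_real \<theta>))) (at \<theta> within T)"
      by (rule has_vector_derivative_real_field)
    moreover have "\<i> + (\<i> * p / cis \<theta>) / (1 - p / cis \<theta>) = \<i> * cis \<theta> / (cis \<theta> - p)"
      using assms by (simp add: divide_simps) (simp add: algebra_simps)
    moreover have "(\<lambda>u. \<i> * of_real u + Ln (1 - p / exp (\<i> * of_real u))) = log_branch p"
      using True by (auto simp: log_branch_def cis_conv_exp fun_eq_iff)
    ultimately show ?thesis by (simp add: cis_conv_exp)
  next
    case False
    have q: "cis \<theta> / p \<noteq> 1" "cmod (cis \<theta> / p) \<le> 1" using assms False by (auto simp: norm_divide divide_le_eq)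
    have re: "Re (1 - cis \<theta> / p) > 0" using Re_one_minus_pos[OF q(2,1)] .
    have "p \<noteq> 0" using False by auto
    have "((\<lambda>u. Ln (1 - exp (\<i> * u) / p)) has_field_derivative
        (- \<i> * exp (\<i> * of_real \<theta>) / p) / (1 - exp (\<i> * of_real \<theta>) / p)) (at (of_real \<theta>))"
      using re \<open>p \<noteq> 0\<close> by (auto intro!: derivative_eq_intros simp: cis_conv_exp complex_nonpos_Reals_iff divide_simps power2_eq_square)
    hence "((\<lambda>u. Ln (1 - exp (\<i> * of_real u) / p)) has_vector_derivative
        (- \<i> * exp (\<i> * of_real \<theta>) / p) / (1 - exp (\<i> * of_real \<theta>) / p)) (at \<theta> within T)"
      by (rule has_vector_derivative_real_field)
    moreover have "(- \<i> * cis \<theta> / p) / (1 - cis \<theta> / p) = \<i> * cis \<theta> / (cis \<theta> - p)"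
      using assms \<open>p \<noteq> 0\<close> by (simp add: divide_simps) (simp add: algebra_simps)?
    moreover have "(\<lambda>u. Ln (1 - exp (\<i> * of_real u) / p)) = log_branch p"
      using False by (auto simp: log_branch_def cis_conv_exp fun_eq_iff)
    ultimately show ?thesis by (simp add: cis_conv_exp)
  qed
qed

text \<open>Let d be the difference of the two values of the branch. Re d is the logarithm of the
  ratio of the distances to p, and the modulus of exp (r d) also sees - Im r Im d. The bound 3 pi
  for |Im d| is 2 pi from the angles (present only for |p| <= 1) plus less than pi / 2 from each of
  the two values of \<open>Ln\<close>.\<close>

lemma exp_log_branch_bound:
  assumes "cis \<theta> \<noteq> p" "cis \<theta>' \<noteq> p" "\<bar>\<theta> - \<theta>'\<bar> \<le> 2 * pi"
  shows "cmod (exp (r * (log_branch p \<theta> - log_branch p \<theta>')))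
     \<le> exp (3 * pi * \<bar>Im r\<bar>) * (cmod (cis \<theta> - p) / cmod (cis \<theta>' - p)) powr Re r"
proof -
  \<comment> \<open>The constant \<open>c\<close> is the logarithm of the modulus of the factor
    split off, so 0 or ln |p|, and it cancels in differences.\<close>
  have *: "\<exists>c. (\<forall>\<theta>. cis \<theta> \<noteq> p \<longrightarrow> Re (log_branch p \<theta>) = ln (cmod (cis \<theta> - p)) - c) \<and>
     (\<forall>\<theta> \<theta>'. cis \<theta> \<noteq> p \<longrightarrow> cis \<theta>' \<noteq> p \<longrightarrow> \<bar>\<theta> - \<theta>'\<bar> \<le> 2 * pi \<longrightarrow>
       \<bar>Im (log_branch p \<theta> - log_branch p \<theta>')\<bar> \<le> 3 * pi)"
  proof (cases "cmod p \<le> 1")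
    case True
    have re: "1 - p / cis \<theta> \<noteq> 0 \<and> \<bar>Im (Ln (1 - p / cis \<theta>))\<bar> < pi/2" if "cis \<theta> \<noteq> p" for \<theta>
    proof -
      have q: "p / cis \<theta> \<noteq> 1" "cmod (p / cis \<theta>) \<le> 1" using that True by (auto simp: norm_divide)
      show ?thesis using Re_one_minus_pos[OF q(2,1)] Re_Ln_pos_lt[of "1 - p / cis \<theta>"] q(1) by auto
    qed
    have "Re (log_branch p \<theta>) = ln (cmod (cis \<theta> - p)) - 0" if "cis \<theta> \<noteq> p" for \<theta>
    proof -
      have "cmod (1 - p / cis \<theta>) = cmod ((cis \<theta> - p) / cis \<theta>)" by (simp add: field_simps)
      thus ?thesis using True re[OF that] by (simp add: log_branch_def norm_divide)
    qed
    moreover have "\<bar>Im (log_branch p \<theta> - log_branch p \<theta>')\<bar> \<le> 3 * pi"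
      if "cis \<theta> \<noteq> p" "cis \<theta>' \<noteq> p" "\<bar>\<theta> - \<theta>'\<bar> \<le> 2 * pi" for \<theta> \<theta>'
      using re[OF that(1)] re[OF that(2)] that(3) True by (simp add: log_branch_def) linarith
    ultimately show ?thesis by blast
  next
    case False
    have re: "1 - cis \<theta> / p \<noteq> 0 \<and> \<bar>Im (Ln (1 - cis \<theta> / p))\<bar> < pi/2" if "cis \<theta> \<noteq> p" for \<theta>
    proof -
      have q: "cis \<theta> / p \<noteq> 1" "cmod (cis \<theta> / p) \<le> 1" using that False by (auto simp: norm_divide divide_le_eq)
      show ?thesis using Re_one_minus_pos[OF q(2,1)] Re_Ln_pos_lt[of "1 - cis \<theta> / p"] q(1) by auto
    qed
    have p: "p \<noteq> 0" using False by auto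
    have "Re (log_branch p \<theta>) = ln (cmod (cis \<theta> - p)) - ln (cmod p)" if "cis \<theta> \<noteq> p" for \<theta>
    proof -
      have "cmod (1 - cis \<theta> / p) = cmod ((p - cis \<theta>) / p)" using p by (simp add: field_simps)
      thus ?thesis using False re[OF that] that p by (simp add: log_branch_def norm_divide norm_minus_commute ln_div)
    qed
    moreover have "\<bar>Im (log_branch p \<theta> - log_branch p \<theta>')\<bar> \<le> 3 * pi"
      if "cis \<theta> \<noteq> p" "cis \<theta>' \<noteq> p" "\<bar>\<theta> - \<theta>'\<bar> \<le> 2 * pi" for \<theta> \<theta>'
      using re[OF that(1)] re[OF that(2)] that(3) False by (simp add: log_branch_def) linarith
    ultimately show ?thesis by blast
  qed
  then obtain c where c: "\<And>\<theta>. cis \<theta> \<noteq> p \<Longrightarrow> Re (log_branch p \<theta>) = ln (cmod (cis \<theta> - p)) - c"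
    "\<bar>Im (log_branch p \<theta> - log_branch p \<theta>')\<bar> \<le> 3 * pi" using assms by blast
  define d where "d = log_branch p \<theta> - log_branch p \<theta>'"
  have "Re d = ln (cmod (cis \<theta> - p) / cmod (cis \<theta>' - p))"
    using assms c(1) by (simp add: d_def ln_div)
  moreover have "- (Im r * Im d) \<le> \<bar>Im r\<bar> * \<bar>Im d\<bar>"
    by (metis abs_ge_minus_self abs_mult)
  moreover have "\<bar>Im r\<bar> * \<bar>Im d\<bar> \<le> \<bar>Im r\<bar> * (3 * pi)"
    using c(2) unfolding d_def by (intro mult_left_mono) auto
  ultimately have "Re (r * d) \<le> 3 * pi * \<bar>Im r\<bar> + Re r * ln (cmod (cis \<theta> - p) / cmod (cis \<theta>' - p))"
    by (simp add: algebra_simps)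
  hence "exp (Re (r * d)) \<le> exp (3 * pi * \<bar>Im r\<bar>) * exp (Re r * ln (cmod (cis \<theta> - p) / cmod (cis \<theta>' - p)))"
    by (simp flip: exp_add)
  thus ?thesis using assms by (simp add: powr_def d_def)
qed

text \<open>On an arc free of singular points the equation is linear, with the derivative of the sum
  of the \<rho>_k \<open>log_branch\<close> as coefficient; dividing w by the exponential of that
  sum leaves a function with derivative 0.\<close>

lemma circle_ode_solution:
  assumes ode: "\<And>\<theta>. \<theta> \<in> {a..b} \<Longrightarrow>
      (w has_field_derivative w (cis \<theta>) * (\<Sum>k\<in>I. \<rho> k / (cis \<theta> - z k))) (at (cis \<theta>) within sphere 0 1)"
    and ns: "\<And>\<theta> k. \<theta> \<in> {a..b} \<Longrightarrow> k \<in> I \<Longrightarrow> cis \<theta> \<noteq> z k"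
    and th: "\<theta> \<in> {a..b}" "\<theta>' \<in> {a..b}"
  shows "w (cis \<theta>) = w (cis \<theta>') * exp (\<Sum>k\<in>I. \<rho> k * (log_branch (z k) \<theta> - log_branch (z k) \<theta>'))"
proof -
  define E where "E \<theta> = exp (- (\<Sum>k\<in>I. \<rho> k * log_branch (z k) \<theta>))" for \<theta>
  have const: "((\<lambda>x. w (cis x) * E x) has_vector_derivative 0) (at x within {a..b})" if x: "x \<in> {a..b}" for x
  proof -
    have w': "((\<lambda>x. w (cis x)) has_vector_derivative \<i> * cis x * (w (cis x) * (\<Sum>k\<in>I. \<rho> k / (cis x - z k)))) (at x within {a..b})"
    proof -
      have "((w \<circ> cis) has_vector_derivative (\<i> * cis x) * (w (cis x) * (\<Sum>k\<in>I. \<rho> k / (cis x - z k)))) (at x within {a..b})"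
        using has_vector_derivative_cis[of x "{a..b}"]
        by (intro field_vector_diff_chain_within has_field_derivative_subset[OF ode[OF x]]) auto
      thus ?thesis by (simp add: o_def)
    qed
    have s': "((\<lambda>x. - (\<Sum>k\<in>I. \<rho> k * log_branch (z k) x)) has_vector_derivative
        - (\<Sum>k\<in>I. \<rho> k * (\<i> * cis x / (cis x - z k)))) (at x within {a..b})"
      using ns[OF x] by (intro derivative_intros log_branch_deriv) auto
    have E': "(E has_vector_derivative - (\<Sum>k\<in>I. \<rho> k * (\<i> * cis x / (cis x - z k))) * E x) (at x within {a..b})"
      using field_vector_diff_chain_within[OF s', of exp "exp (- (\<Sum>k\<in>I. \<rho> k * log_branch (z k) x))"]
      by (simp add: E_def[abs_def] o_def DERIV_exp has_field_derivative_at_within)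
    have "((\<lambda>x. w (cis x) * E x) has_vector_derivative
        w (cis x) * (- (\<Sum>k\<in>I. \<rho> k * (\<i> * cis x / (cis x - z k))) * E x) +
        \<i> * cis x * (w (cis x) * (\<Sum>k\<in>I. \<rho> k / (cis x - z k))) * E x) (at x within {a..b})"
      by (rule has_vector_derivative_mult[OF w' E'])
    thus ?thesis
      by (simp add: sum_distrib_left sum_distrib_right mult_ac)
  qed
  obtain c where c: "\<And>x. x \<in> {a..b} \<Longrightarrow> w (cis x) * E x = c"
    using has_vector_derivative_zero_constant[of "{a..b}" "\<lambda>x. w (cis x) * E x"] const by auto
  have "w (cis \<theta>) * E \<theta> = w (cis \<theta>') * E \<theta>'" using c th by metis
  hence "w (cis \<theta>) = w (cis \<theta>') * (E \<theta>' / E \<theta>)" by (simp add: E_def field_simps)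
  also have "E \<theta>' / E \<theta> = exp (\<Sum>k\<in>I. \<rho> k * (log_branch (z k) \<theta> - log_branch (z k) \<theta>'))"
    by (simp add: E_def exp_diff[symmetric] sum_subtractf right_diff_distrib)
  finally show ?thesis .
qed

lemma circle_ode_bound:
  assumes ode: "\<And>\<theta>. \<theta> \<in> {a..b} \<Longrightarrow>
      (w has_field_derivative w (cis \<theta>) * (\<Sum>k\<in>I. \<rho> k / (cis \<theta> - z k))) (at (cis \<theta>) within sphere 0 1)"
    and ns: "\<And>\<theta> k. \<theta> \<in> {a..b} \<Longrightarrow> k \<in> I \<Longrightarrow> cis \<theta> \<noteq> z k"
    and th: "\<theta> \<in> {a..b}" "\<theta>' \<in> {a..b}" and ab: "b - a \<le> 2 * pi" and "finite I"
  shows "cmod (w (cis \<theta>)) \<le> cmod (w (cis \<theta>')) *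
    (\<Prod>k\<in>I. exp (3 * pi * \<bar>Im (\<rho> k)\<bar>) * (cmod (cis \<theta> - z k) / cmod (cis \<theta>' - z k)) powr Re (\<rho> k))"
proof -
  have "cmod (w (cis \<theta>)) = cmod (w (cis \<theta>')) *
      (\<Prod>k\<in>I. cmod (exp (\<rho> k * (log_branch (z k) \<theta> - log_branch (z k) \<theta>'))))"
    using circle_ode_solution[OF ode ns th] \<open>finite I\<close>
    by (simp only: norm_mult exp_sum prod_norm)
  also have "\<dots> \<le> cmod (w (cis \<theta>')) *
    (\<Prod>k\<in>I. exp (3 * pi * \<bar>Im (\<rho> k)\<bar>) * (cmod (cis \<theta> - z k) / cmod (cis \<theta>' - z k)) powr Re (\<rho> k))"
    using th ab by (intro mult_left_mono prod_mono conjI exp_log_branch_bound ns) auto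
  finally show ?thesis .
qed

section \<open>The Poisson kernel and boundary values\<close>

text \<open>The mean is complex-valued, so the real majorant \<open>h\<close> is embedded into the
  complex numbers and its mean read off with \<open>Re\<close>.\<close>

lemma circle_mean_norm_bound:
  assumes f: "moments_exist f" and h: "moments_exist (\<lambda>\<zeta>. of_real (h \<zeta>))" and A: "finite A"
    and b: "\<And>\<zeta>. cmod \<zeta> = 1 \<Longrightarrow> \<zeta> \<notin> A \<Longrightarrow> cmod (f \<zeta>) \<le> h \<zeta>"
  shows "cmod (circle_mean f) \<le> Re (circle_mean (\<lambda>\<zeta>. of_real (h \<zeta>)))"
proof -
  have "complex_integrable lborel (\<lambda>\<theta>. complex_of_real (indicator {0..2*pi} \<theta> * h (cis \<theta>)))"
    using h unfolding moments_exist_def set_integrable_def by (simp add: scaleR_conv_of_real)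
  hence h': "integrable lborel (\<lambda>\<theta>. indicator {0..2*pi} \<theta> * h (cis \<theta>))"
    by (simp only: complex_of_real_integrable_eq)
  have "cmod (LINT \<theta>:{0..2*pi}|lborel. f (cis \<theta>)) \<le> (LINT \<theta>|lborel. indicator {0..2*pi} \<theta> * h (cis \<theta>))"
  proof -
    have f': "complex_integrable lborel (\<lambda>\<theta>. indicator {0..2*pi} \<theta> *\<^sub>R f (cis \<theta>))"
      using f unfolding moments_exist_def set_integrable_def .
    have "AE \<theta> in lborel. cmod (indicator {0..2*pi} \<theta> *\<^sub>R f (cis \<theta>)) \<le> indicator {0..2*pi} \<theta> * h (cis \<theta>)"
      using AE_cis_notin[OF A] by eventually_elim (use b in \<open>auto simp: indicator_def\<close>)
    hence "(LINT \<theta>|lborel. cmod (indicator {0..2*pi} \<theta> *\<^sub>R f (cis \<theta>))) \<le> (LINT \<theta>|lborel. indicator {0..2*pi} \<theta> * h (cis \<theta>))"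
      by (intro integral_mono_AE integrable_norm f' h')
    thus ?thesis unfolding set_lebesgue_integral_def
      by (rule order_trans[OF integral_norm_bound])
  qed
  moreover have "circle_mean (\<lambda>\<zeta>. of_real (h \<zeta>)) = of_real ((LINT \<theta>|lborel. indicator {0..2*pi} \<theta> * h (cis \<theta>)) / (2 * pi))"
    by (simp add: circle_mean_def set_lebesgue_integral_def scaleR_conv_of_real flip: of_real_mult)
  ultimately show ?thesis
    by (simp add: circle_mean_def norm_divide divide_right_mono del: of_real_mult)
qed

text \<open>The logarithm branch is a primitive, so the integral is its increment over a full turn:
  the summand i \<theta> of the inner branch contributes 2 pi i, while the outer branch is
  periodic.\<close>

lemma circle_mean_Cauchy_kernel:
  assumes "cmod x \<noteq> 1"
  shows "circle_mean (\<lambda>\<zeta>. \<zeta> / (\<zeta> - x)) = (if cmod x < 1 then 1 else 0)"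
proof -
  have nz: "cis \<theta> \<noteq> x" for \<theta> using assms by auto
  have "(LINT \<theta>:{0..2*pi}|lborel. \<i> * cis \<theta> / (cis \<theta> - x)) = log_branch x (2*pi) - log_branch x 0"
    unfolding set_lebesgue_integral_def
    by (rule integral_FTC_atLeastAtMost) (use nz in \<open>auto intro!: log_branch_deriv continuous_intros\<close>)
  also have "\<dots> = (if cmod x < 1 then \<i> * (2 * pi) else 0)"
    using assms by (auto simp: log_branch_def)
  finally have "\<i> * (LINT \<theta>:{0..2*pi}|lborel. cis \<theta> / (cis \<theta> - x)) = \<i> * (if cmod x < 1 then 2 * pi else 0)"
    by (simp add: times_divide_eq_right[symmetric] del: times_divide_eq_right)
  hence "(LINT \<theta>:{0..2*pi}|lborel. cis \<theta> / (cis \<theta> - x)) = of_real (if cmod x < 1 then 2 * pi else 0)"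
    using mult_cancel_left[of \<i>] by auto
  thus ?thesis by (simp add: circle_mean_def)
qed

definition poisson_kernel :: "real \<Rightarrow> complex \<Rightarrow> complex \<Rightarrow> real" where
  "poisson_kernel r p \<zeta> = (1 - r\<^sup>2) / (cmod (\<zeta> - of_real r * p))\<^sup>2"

text \<open>The points r p and p / r are mirror images in the circle, and for \<zeta> on it the
  kernel at the mirror image is minus the complex conjugate of the kernel at r p. The difference is
  thus twice a real part, which is the Poisson kernel.\<close>

lemma Caratheodory_kernel_jump:
  assumes "cmod p = 1" "cmod \<zeta> = 1" "0 < r" "r < 1"
  shows "(\<zeta> + of_real r * p) / (\<zeta> - of_real r * p) - (\<zeta> + p / of_real r) / (\<zeta> - p / of_real r)
    = 2 * of_real (poisson_kernel r p \<zeta>)"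
proof -
  have z: "\<zeta> * cnj \<zeta> = 1" "p * cnj p = 1"
    using assms by (simp_all add: complex_norm_square[symmetric])
  have nz: "\<zeta> - of_real r * p \<noteq> 0" "\<zeta> - p / of_real r \<noteq> 0" "of_real r * \<zeta> - p \<noteq> 0"
  proof -
    show "\<zeta> - of_real r * p \<noteq> 0"
      using assms norm_mult[of "of_real r" p] by auto
    have "cmod (p / of_real r) = 1 / r" using assms by (simp add: norm_divide)
    hence "cmod (p / of_real r) \<noteq> 1" using assms by simp
    thus n: "\<zeta> - p / of_real r \<noteq> 0" using assms by auto
    show "of_real r * \<zeta> - p \<noteq> 0" using n assms by (simp add: field_simps)
  qed
  have r0: "complex_of_real r \<noteq> 0" using assms by simp
  have e: "(cmod (\<zeta> - of_real r * p))\<^sup>2 = (\<zeta> - of_real r * p) * (cnj \<zeta> - of_real r * cnj p)"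
    using complex_norm_square[of "\<zeta> - of_real r * p"] by simp
  have nz2: "cnj \<zeta> - of_real r * cnj p \<noteq> 0" using nz(1) complex_cnj_cancel_iff[of \<zeta> "of_real r * p"] by auto
  have "(\<zeta> + p / of_real r) / (\<zeta> - p / of_real r) = (of_real r * \<zeta> + p) / (of_real r * \<zeta> - p)"
    using r0 nz by (simp add: divide_simps) (simp add: algebra_simps)?
  also have "\<dots> = (of_real r * cnj p + cnj \<zeta>) / (of_real r * cnj p - cnj \<zeta>)"
  proof -
    have "(of_real r * \<zeta> + p) * (of_real r * cnj p - cnj \<zeta>) = (of_real r * cnj p + cnj \<zeta>) * (of_real r * \<zeta> - p)"
      using z by algebra
    thus ?thesis using nz(3) nz2 by (simp add: frac_eq_eq)
  qed
  finally have 1: "(\<zeta> + p / of_real r) / (\<zeta> - p / of_real r) = - ((of_real r * cnj p + cnj \<zeta>) / (cnj \<zeta> - of_real r * cnj p))"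
    by (metis minus_diff_eq minus_divide_right)
  have "complex_of_real (poisson_kernel r p \<zeta>) = (1 - of_real r ^ 2) / ((\<zeta> - of_real r * p) * (cnj \<zeta> - of_real r * cnj p))"
    unfolding poisson_kernel_def of_real_divide e by simp
  moreover have "(\<zeta> + of_real r * p) * (cnj \<zeta> - of_real r * cnj p) + (of_real r * cnj p + cnj \<zeta>) * (\<zeta> - of_real r * p) = 2 * (1 - of_real r ^ 2)"
    using z by algebra
  ultimately show ?thesis unfolding 1 using nz nz2
    by (simp add: add_frac_eq)
qed

lemma continuous_on_resolvent:
  assumes "cmod x \<noteq> 1"
  shows "continuous_on (sphere 0 1) (\<lambda>\<zeta>. 1 / (\<zeta> - x))"
  using assms by (intro continuous_intros) auto

lemma continuous_on_Caratheodory_kernel: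
  assumes "cmod x \<noteq> 1"
  shows "continuous_on (sphere 0 1) (\<lambda>\<zeta>. (\<zeta> + x) / (\<zeta> - x))"
  using assms by (intro continuous_intros) auto

lemma continuous_on_poisson_kernel:
  assumes "cmod p = 1" "0 < r" "r < 1"
  shows "continuous_on (sphere 0 1) (\<lambda>\<zeta>. complex_of_real (poisson_kernel r p \<zeta>))"
proof -
  have "\<zeta> - of_real r * p \<noteq> 0" if "cmod \<zeta> = 1" for \<zeta>
    using assms that norm_mult[of "of_real r" p] by auto
  thus ?thesis unfolding poisson_kernel_def by (intro continuous_intros) auto
qed

lemma Caratheodory_fun_jump:
  assumes w: "moments_exist w" and "cmod p = 1" "0 < r" "r < 1"
  shows "Caratheodory_fun w (of_real r * p) - Caratheodory_fun w (p / of_real r)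
    = 2 * circle_mean (\<lambda>\<zeta>. w \<zeta> * of_real (poisson_kernel r p \<zeta>))"
proof -
  have n: "cmod (of_real r * p) \<noteq> 1" "cmod (p / of_real r) \<noteq> 1"
    using assms by (auto simp: norm_mult norm_divide)
  have i: "moments_exist (\<lambda>\<zeta>. (\<zeta> + x) / (\<zeta> - x) * w \<zeta>)" if "cmod x \<noteq> 1" for x
    using moments_exist_times_continuous[OF w continuous_on_Caratheodory_kernel[OF that]] by (simp add: mult.commute)
  have "Caratheodory_fun w (of_real r * p) - Caratheodory_fun w (p / of_real r)
     = circle_mean (\<lambda>\<zeta>. (\<zeta> + of_real r * p) / (\<zeta> - of_real r * p) * w \<zeta> - (\<zeta> + p / of_real r) / (\<zeta> - p / of_real r) * w \<zeta>)"
    unfolding Caratheodory_fun_def using i n by (intro circle_mean_diff[symmetric]) auto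
  also have "\<dots> = circle_mean (\<lambda>\<zeta>. 2 * (w \<zeta> * of_real (poisson_kernel r p \<zeta>)))"
    using Caratheodory_kernel_jump[OF assms(2) _ assms(3,4)]
    by (intro circle_mean_cong_strong, subst left_diff_distrib[symmetric]) simp
  finally show ?thesis by (simp only: circle_mean_mult_left)
qed

text \<open>The total mass is the jump for the weight 1, whose Caratheodory function follows from
  the mean of the Cauchy kernel.\<close>

lemma circle_mean_poisson_kernel:
  assumes "cmod p = 1" "0 < r" "r < 1"
  shows "circle_mean (\<lambda>\<zeta>. of_real (poisson_kernel r p \<zeta>)) = 1"
proof -
  have c: "Caratheodory_fun (\<lambda>_. 1) x = 2 * (if cmod x < 1 then 1 else 0) - circle_mean (\<lambda>_. 1)" if x: "cmod x \<noteq> 1" for x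
  proof -
    have ne: "\<zeta> - x \<noteq> 0" if "cmod \<zeta> = 1" for \<zeta> using x that by auto
    have m: "moments_exist (\<lambda>\<zeta>. \<zeta> / (\<zeta> - x))"
      using ne by (intro moments_exist_continuous continuous_intros) auto
    have "Caratheodory_fun (\<lambda>_. 1) x = circle_mean (\<lambda>\<zeta>. 2 * (\<zeta> / (\<zeta> - x)) - 1)"
      unfolding Caratheodory_fun_def using ne by (intro circle_mean_cong_strong) (simp add: divide_simps)
    also have "\<dots> = circle_mean (\<lambda>\<zeta>. 2 * (\<zeta> / (\<zeta> - x))) - circle_mean (\<lambda>_. 1)"
      by (intro circle_mean_diff moments_exist_mult_left m moments_exist_continuous continuous_intros)
    finally show ?thesis by (simp only: circle_mean_mult_left circle_mean_Cauchy_kernel[OF x])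
  qed
  have n: "cmod (of_real r * p) < 1" "cmod (p / of_real r) > 1"
    using assms by (auto simp: norm_mult norm_divide)
  have "2 * circle_mean (\<lambda>\<zeta>. 1 * of_real (poisson_kernel r p \<zeta>)) = 2"
    by (subst Caratheodory_fun_jump[symmetric])
       (use n assms in \<open>auto simp: c moments_exist_continuous\<close>)
  thus ?thesis by simp
qed

text \<open>Approximate identity for a weight that is only integrable, with continuity at the single
  point p: close to p the oscillation of w is below e / 2, and elsewhere the kernel itself is
  uniformly small.\<close>

lemma poisson_approximation:
  assumes w: "moments_exist w" and p: "cmod p = 1" and cont: "continuous (at p within sphere 0 1) w"
  shows "((\<lambda>r. circle_mean (\<lambda>\<zeta>. w \<zeta> * of_real (poisson_kernel r p \<zeta>))) \<longlongrightarrow> w p) (at_left 1)"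
proof (rule tendstoI)
  fix e :: real assume e: "e > 0"
  obtain d where d: "d > 0" "\<And>\<zeta>. cmod \<zeta> = 1 \<Longrightarrow> dist \<zeta> p < d \<Longrightarrow> dist (w \<zeta>) (w p) < e / 2"
  proof -
    from cont e obtain d where "d > 0" "\<forall>x\<in>sphere 0 1. dist x p < d \<longrightarrow> dist (w x) (w p) < e/2"
      unfolding continuous_within_eps_delta using half_gt_zero by blast
    thus ?thesis by (intro that[of d]) auto
  qed
  define K where "K = Re (circle_mean (\<lambda>\<zeta>. of_real (cmod (w \<zeta>) + cmod (w p))))"
  \<comment> \<open>If \<zeta> is at distance at least d from p and 1 - r < d / 2, then it is at
    distance at least d / 2 from r p. \<open>c r\<close> is the resulting bound of the kernel; it
    tends to 0 as r tends to 1.\<close>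
  define c where "c r = (1 - r\<^sup>2) / (d/2)\<^sup>2" for r :: real
  have "(\<lambda>r. e/2 + c r * K) \<midarrow>1\<rightarrow> e/2 + c 1 * K"
    unfolding c_def using d by (intro tendsto_intros) auto
  hence "((\<lambda>r. e/2 + c r * K) \<longlongrightarrow> e/2) (at_left 1)"
    by (rule filterlim_mono) (auto simp: c_def at_le)
  from order_tendstoD(2)[OF this, of e] have "eventually (\<lambda>r. e/2 + c r * K < e) (at_left 1)"
    using e by simp
  moreover have "eventually (\<lambda>r. r > max 0 (1 - d/2)) (at_left (1::real))"
    using d by (intro eventually_at_leftI[of "max 0 (1 - d/2)"]) auto
  moreover have "eventually (\<lambda>r. r < (1::real)) (at_left 1)"
    by (simp add: eventually_at_filter)
  ultimately show "eventually (\<lambda>r. dist (circle_mean (\<lambda>\<zeta>. w \<zeta> * of_real (poisson_kernel r p \<zeta>))) (w p) < e) (at_left 1)"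
  proof eventually_elim
    case (elim r)
    hence r: "0 < r" "r < 1" "1 - r < d/2" by auto
    have cP: "continuous_on (sphere 0 1) (\<lambda>\<zeta>. complex_of_real (poisson_kernel r p \<zeta>))"
      using p r by (intro continuous_on_poisson_kernel)
    have mP: "moments_exist (\<lambda>\<zeta>. complex_of_real (poisson_kernel r p \<zeta>))"
      by (rule moments_exist_continuous[OF cP])
    have mwP: "moments_exist (\<lambda>\<zeta>. w \<zeta> * of_real (poisson_kernel r p \<zeta>))"
      by (rule moments_exist_times_continuous[OF w cP])
    have mK: "moments_exist (\<lambda>\<zeta>. complex_of_real (cmod (w \<zeta>) + cmod (w p)))"
      using moments_exist_add[OF moments_exist_cmod[OF w] moments_exist_continuous[OF continuous_on_const]] by simp
    have "circle_mean (\<lambda>\<zeta>. w \<zeta> * of_real (poisson_kernel r p \<zeta>)) - w p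
      = circle_mean (\<lambda>\<zeta>. w \<zeta> * of_real (poisson_kernel r p \<zeta>)) - circle_mean (\<lambda>\<zeta>. w p * of_real (poisson_kernel r p \<zeta>))"
      using circle_mean_poisson_kernel[OF p r(1,2)] by (simp add: circle_mean_mult_left)
    also have "\<dots> = circle_mean (\<lambda>\<zeta>. w \<zeta> * of_real (poisson_kernel r p \<zeta>) - w p * of_real (poisson_kernel r p \<zeta>))"
      by (intro circle_mean_diff[symmetric] mwP moments_exist_mult_left mP)
    also have "cmod \<dots> \<le> Re (circle_mean (\<lambda>\<zeta>. of_real (e/2 * poisson_kernel r p \<zeta> + c r * (cmod (w \<zeta>) + cmod (w p)))))"
    proof (rule circle_mean_norm_bound[where A = "{}"])
      show "moments_exist (\<lambda>\<zeta>. w \<zeta> * of_real (poisson_kernel r p \<zeta>) - w p * of_real (poisson_kernel r p \<zeta>))"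
        by (intro moments_exist_diff mwP moments_exist_mult_left mP)
      show "moments_exist (\<lambda>\<zeta>. complex_of_real (e/2 * poisson_kernel r p \<zeta> + c r * (cmod (w \<zeta>) + cmod (w p))))"
        using moments_exist_add[OF moments_exist_mult_left[OF mP, of "e/2"] moments_exist_mult_left[OF mK, of "c r"]] by simp
      fix \<zeta> :: complex assume z: "cmod \<zeta> = 1"
      have P0: "poisson_kernel r p \<zeta> \<ge> 0" using r by (simp add: poisson_kernel_def power_le_one)
      have c0: "c r \<ge> 0" using r by (simp add: c_def power_le_one)
      have "cmod (w \<zeta> - w p) * poisson_kernel r p \<zeta> \<le> e/2 * poisson_kernel r p \<zeta> + c r * (cmod (w \<zeta>) + cmod (w p))"
      proof (cases "dist \<zeta> p < d")
        case True
        hence "cmod (w \<zeta> - w p) * poisson_kernel r p \<zeta> \<le> e/2 * poisson_kernel r p \<zeta>"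
          using d(2)[OF z True] P0 by (intro mult_right_mono) (auto simp: dist_norm)
        thus ?thesis using c0 by (simp add: add_increasing2)
      next
        case False
        have "cmod (p - of_real r * p) = 1 - r"
        proof -
          have "p - of_real r * p = of_real (1 - r) * p" by (simp add: algebra_simps)
          thus ?thesis using p r by (simp only: norm_mult norm_of_real) simp
        qed
        moreover have "d \<le> cmod (\<zeta> - p)" using False by (simp add: dist_norm)
        moreover have "cmod (\<zeta> - p) \<le> cmod (\<zeta> - of_real r * p) + cmod (p - of_real r * p)"
          by (metis norm_triangle_ineq4 diff_diff_eq2 diff_add_cancel)
        ultimately have "d/2 \<le> cmod (\<zeta> - of_real r * p)" using r by linarith
        hence "poisson_kernel r p \<zeta> \<le> c r"
          unfolding poisson_kernel_def c_def using d r by (intro divide_left_mono power_mono mult_pos_pos) (auto simp: power_le_one)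
        hence "cmod (w \<zeta> - w p) * poisson_kernel r p \<zeta> \<le> (cmod (w \<zeta>) + cmod (w p)) * c r"
          using P0 by (intro mult_mono norm_triangle_ineq4) auto
        moreover have "e/2 * poisson_kernel r p \<zeta> \<ge> 0" using P0 e by simp
        ultimately show ?thesis by (simp add: mult.commute)
      qed
      thus "cmod (w \<zeta> * of_real (poisson_kernel r p \<zeta>) - w p * of_real (poisson_kernel r p \<zeta>))
         \<le> e/2 * poisson_kernel r p \<zeta> + c r * (cmod (w \<zeta>) + cmod (w p))"
        using P0 by (simp add: left_diff_distrib[symmetric] norm_mult)
    qed simp
    also have "circle_mean (\<lambda>\<zeta>. of_real (e/2 * poisson_kernel r p \<zeta> + c r * (cmod (w \<zeta>) + cmod (w p))))
       = of_real (e/2) * circle_mean (\<lambda>\<zeta>. of_real (poisson_kernel r p \<zeta>)) + of_real (c r) * circle_mean (\<lambda>\<zeta>. of_real (cmod (w \<zeta>) + cmod (w p)))"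
      unfolding of_real_add[of "e/2 * _"] of_real_mult
      by (subst circle_mean_add) (auto simp only: circle_mean_mult_left intro!: moments_exist_mult_left mP mK)
    also have "Re \<dots> = e/2 + c r * K"
      using circle_mean_poisson_kernel[OF p r(1,2)] by (simp add: K_def)
    also have "\<dots> < e" using elim by simp
    finally show ?case by (simp add: dist_norm)
  qed
qed

text \<open>The limit is taken from both sides of the circle: the values at r q and q / r come
  within e of the same number, so the jump, which is twice the Poisson mean, is below 2 e, and the
  Poisson mean tends to w q. The bound concerns points q near p, since the value of w at the
  singular point itself carries no information.\<close>

lemma weight_vanishes_at_limit_point:
  assumes w: "moments_exist w" and p: "cmod p = 1"
    and lim: "circle_limit_exists (Caratheodory_fun w) p" and e: "e > 0"
  obtains d where "d > 0" "\<And>q. cmod q = 1 \<Longrightarrow> dist q p < d \<Longrightarrow> continuous (at q within sphere 0 1) w \<Longrightarrow> cmod (w q) \<le> e"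
proof -
  from lim obtain l where l: "(Caratheodory_fun w \<longlongrightarrow> l) (at p within - sphere 0 1)"
    unfolding circle_limit_exists_def by blast
  from tendstoD[OF l e] obtain d where d: "d > 0"
    "\<And>y. cmod y \<noteq> 1 \<Longrightarrow> dist y p < d \<Longrightarrow> dist (Caratheodory_fun w y) l < e"
    unfolding eventually_at by (metis ComplI dist_commute mem_sphere dist_0_norm p)
  show ?thesis
  proof (rule that[OF d(1)])
    fix q assume q: "cmod q = 1" "dist q p < d" "continuous (at q within sphere 0 1) w"
    have "(\<lambda>r::real. dist (of_real r * q) p) \<midarrow>1\<rightarrow> dist (of_real 1 * q) p" by (intro tendsto_intros)
    hence "((\<lambda>r::real. dist (of_real r * q) p) \<longlongrightarrow> dist q p) (at_left 1)" by (rule filterlim_mono) (auto simp: at_le)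
    hence 1: "eventually (\<lambda>r::real. dist (of_real r * q) p < d) (at_left 1)" using q by (intro order_tendstoD)
    have "(\<lambda>r::real. dist (q / of_real r) p) \<midarrow>1\<rightarrow> dist (q / of_real 1) p" by (intro tendsto_intros) auto
    hence "((\<lambda>r::real. dist (q / of_real r) p) \<longlongrightarrow> dist q p) (at_left 1)" by (rule filterlim_mono) (auto simp: at_le)
    hence 2: "eventually (\<lambda>r::real. dist (q / of_real r) p < d) (at_left 1)" using q by (intro order_tendstoD)
    have 3: "eventually (\<lambda>r::real. 0 < r \<and> r < 1) (at_left 1)" by (intro eventually_at_leftI[of 0]) auto
    have "eventually (\<lambda>r. cmod (circle_mean (\<lambda>\<zeta>. w \<zeta> * of_real (poisson_kernel r q \<zeta>))) \<le> e) (at_left 1)"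
      using 1 2 3
    proof eventually_elim
      case (elim r)
      have n: "cmod (of_real r * q) \<noteq> 1" "cmod (q / of_real r) \<noteq> 1"
        using elim q by (auto simp: norm_mult norm_divide)
      have "cmod (2 * circle_mean (\<lambda>\<zeta>. w \<zeta> * of_real (poisson_kernel r q \<zeta>))) = dist (Caratheodory_fun w (of_real r * q)) (Caratheodory_fun w (q / of_real r))"
        using Caratheodory_fun_jump[OF w q(1), of r] elim by (simp add: dist_norm)
      also have "\<dots> \<le> dist (Caratheodory_fun w (of_real r * q)) l + dist (Caratheodory_fun w (q / of_real r)) l"
        by (rule dist_triangle2)
      also have "\<dots> < e + e" using d(2)[OF n(1)] d(2)[OF n(2)] elim by (intro add_strict_mono) auto
      finally show ?case by (simp add: norm_mult)
    qed
    thus "cmod (w q) \<le> e"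
      by (intro tendsto_upperbound[OF tendsto_norm[OF poisson_approximation[OF w q(1,3)]]]) auto
  qed
qed

section \<open>Weights near a singular point on the circle\<close>

text \<open>A crude form of Jordan's inequality, enough to compare arcs and chords up to a factor 4.
  Up to pi / 3 the cosine is at least 1 / 2; beyond, sin v >= 1 / 2 while v / 4 <= pi / 8 < 1 /
  2.\<close>

lemma sin_ge_quarter:
  assumes "0 \<le> v" "v \<le> pi/2"
  shows "v / 4 \<le> sin v"
proof (cases "v \<le> pi/3")
  case True
  show ?thesis
  proof (cases "v = 0")
    case False
    hence "v > 0" using assms by simp
    then obtain c where c: "0 < c" "c < v" "sin v - sin 0 = (v - 0) * cos c"
      using MVT2[of 0 v sin cos] by (auto intro: DERIV_sin)
    have "cos (pi/3) \<le> cos c" using c True by (intro cos_monotone_0_pi_le) auto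
    hence "v * (1/4) \<le> v * cos c" using \<open>v > 0\<close> by (intro mult_left_mono) (auto simp: cos_60)
    thus ?thesis using c by simp
  qed simp
next
  case False
  have "sin (pi/3) \<le> sin v" using assms False by (intro sin_monotone_2pi_le) auto
  moreover have "sin (pi/3) \<ge> 1/2" by (simp add: sin_60 real_le_rsqrt)
  ultimately show ?thesis using assms pi_less_4 by simp
qed

lemma cmod_cis_diff: "cmod (cis a - cis c) = 2 * \<bar>sin ((a - c) / 2)\<bar>"
proof -
  have "(cmod (cis a - cis c))\<^sup>2 = (cos a - cos c)\<^sup>2 + (sin a - sin c)\<^sup>2"
    by (simp add: cmod_power2)
  also have "\<dots> = 2 - 2 * cos (a - c)"
    using sin_cos_squared_add[of a] sin_cos_squared_add[of c] by (simp add: cos_diff power2_diff algebra_simps)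
  also have "\<dots> = (2 * sin ((a - c) / 2))\<^sup>2"
  proof -
    have "2 * ((a - c) / 2) = a - c" by simp
    thus ?thesis using cos_double_sin[of "(a - c)/2"] by (simp only: power_mult_distrib) simp
  qed
  finally have "sqrt ((cmod (cis a - cis c))\<^sup>2) = sqrt ((2 * sin ((a - c) / 2))\<^sup>2)" by simp
  hence "\<bar>cmod (cis a - cis c)\<bar> = \<bar>2 * sin ((a - c) / 2)\<bar>" by (simp only: real_sqrt_abs)
  thus ?thesis by (simp add: abs_mult)
qed

lemma cmod_cis_diff_le: "cmod (cis a - cis c) \<le> \<bar>a - c\<bar>"
  using abs_sin_x_le_abs_x[of "(a - c) / 2"] by (simp add: cmod_cis_diff)

lemma cmod_cis_diff_ge:
  assumes "\<bar>a - c\<bar> \<le> pi"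
  shows "\<bar>a - c\<bar> / 4 \<le> cmod (cis a - cis c)"
proof -
  have "\<bar>sin ((a - c) / 2)\<bar> = sin (\<bar>a - c\<bar> / 2)"
  proof (cases "a \<ge> c")
    case True
    thus ?thesis using assms by (simp add: sin_ge_zero)
  next
    case False
    have "sin ((a - c) / 2) = - sin ((c - a) / 2)" by (metis minus_diff_eq minus_divide_left sin_minus)
    moreover have "sin ((c - a) / 2) \<ge> 0" using assms False by (intro sin_ge_zero) auto
    ultimately show ?thesis using False by simp
  qed
  thus ?thesis using sin_ge_quarter[of "\<bar>a - c\<bar> / 2"] assms by (simp add: cmod_cis_diff)
qed

lemma cis_eq_near: "cis a = cis c \<Longrightarrow> \<bar>a - c\<bar> \<le> pi \<Longrightarrow> a = c"
  using cmod_cis_diff_ge[of a c] by simp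

text \<open>The angle is taken in a window centred at c, so that it is controlled by the chord to
  cis c.\<close>

lemma obtain_angle_near:
  assumes "cmod \<zeta> = 1"
  obtains a where "\<zeta> = cis a" "\<bar>a - c\<bar> \<le> pi" "\<bar>a - c\<bar> \<le> 4 * cmod (\<zeta> - cis c)"
proof -
  define b where "b = Arg (\<zeta> / cis c)"
  have "cis b = \<zeta> / cis c" unfolding b_def using assms
    by (subst cis_Arg) (auto simp: sgn_div_norm norm_divide)
  hence 1: "\<zeta> = cis (c + b)" by (simp add: cis_mult[symmetric] field_simps)
  have 2: "\<bar>c + b - c\<bar> \<le> pi" using Arg_bounded[of "\<zeta> / cis c"] by (simp add: b_def abs_le_iff)
  show ?thesis using that[OF 1 2] cmod_cis_diff_ge[OF 2] 1 by simp
qed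

text \<open>The primitive \<open>F\<close> is odd about c and, as b > 0, continuous there, so the
  fundamental theorem applies with c as the only exceptional point although the integrand may blow
  up at it. Nonnegativity turns integrability into absolute integrability.\<close>

lemma abs_powr_integrable:
  fixes b c x y :: real
  assumes "0 < b" "x \<le> y"
  shows "set_integrable lborel {x..y} (\<lambda>u. \<bar>u - c\<bar> powr (b - 1))"
proof -
  define F where "F u = sgn (u - c) * \<bar>u - c\<bar> powr b / b" for u
  have "((\<lambda>u. \<bar>u - c\<bar> powr (b - 1)) has_integral (F y - F x)) {x..y}"
  proof (rule fundamental_theorem_of_calculus_interior_strong[of "{c}"])
    fix u assume u: "u \<in> {x<..<y} - {c}"
    show "(F has_vector_derivative \<bar>u - c\<bar> powr (b - 1)) (at u)"
    proof (cases "u > c")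
      case True
      have "((\<lambda>u. (u - c) powr b / b) has_real_derivative (u - c) powr (b - 1)) (at u)"
        using True assms by (auto intro!: derivative_eq_intros)
      moreover have "eventually (\<lambda>u. u \<in> {c<..}) (nhds u)" using True by (intro eventually_nhds_in_open) auto
      hence "eventually (\<lambda>u. F u = (u - c) powr b / b) (nhds u)"
        by eventually_elim (auto simp: F_def)
      ultimately have "(F has_real_derivative (u - c) powr (b - 1)) (at u)"
        by (subst DERIV_cong_ev) auto
      thus ?thesis using True by (simp add: has_real_derivative_iff_has_vector_derivative)
    next
      case False
      hence "u < c" using u by auto
      have "((\<lambda>u. - ((c - u) powr b / b)) has_real_derivative (c - u) powr (b - 1)) (at u)"
        using \<open>u < c\<close> assms by (auto intro!: derivative_eq_intros)
      moreover have "eventually (\<lambda>u. u \<in> {..<c}) (nhds u)" using \<open>u < c\<close> by (intro eventually_nhds_in_open) auto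
      hence "eventually (\<lambda>u. F u = - ((c - u) powr b / b)) (nhds u)"
        by eventually_elim (auto simp: F_def)
      ultimately have "(F has_real_derivative (c - u) powr (b - 1)) (at u)"
        by (subst DERIV_cong_ev) auto
      thus ?thesis using \<open>u < c\<close> by (simp add: has_real_derivative_iff_has_vector_derivative)
    qed
  next
    show "continuous_on {x..y} F"
    proof (intro continuous_at_imp_continuous_on ballI)
      fix u
      have "isCont (\<lambda>u. \<bar>u - c\<bar> powr b) c" using assms by (intro continuous_intros) auto
      show "isCont F u"
      proof (cases "u = c")
        case True
        have "((\<lambda>u. \<bar>u - c\<bar> powr b / b) \<longlongrightarrow> \<bar>c - c\<bar> powr b / b) (at c)"
          using assms by (intro tendsto_intros) auto
        hence "((\<lambda>u. \<bar>u - c\<bar> powr b / b) \<longlongrightarrow> 0) (at c)" by simp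
        hence "(F \<longlongrightarrow> 0) (at c)"
          by (rule Lim_null_comparison[rotated]) (use assms in \<open>auto simp: F_def abs_mult sgn_if\<close>)
        thus ?thesis using True by (simp add: isCont_def F_def)
      next
        case False
        hence "isCont (\<lambda>u. sgn (u - c)) u" by (intro continuous_intros isCont_sgn) auto
        thus ?thesis unfolding F_def using False assms by (intro continuous_intros) auto
      qed
    qed
  qed (use assms in auto)
  hence "(\<lambda>u. \<bar>u - c\<bar> powr (b - 1)) integrable_on {x..y}" by blast
  hence "set_integrable lebesgue {x..y} (\<lambda>u. \<bar>u - c\<bar> powr (b - 1))"
    by (intro nonnegative_absolutely_integrable_1) auto
  thus ?thesis unfolding set_integrable_def by (subst (asm) integrable_completion) auto
qed

lemma moments_exist_powr_distance:
  assumes p: "cmod p = 1" and b: "0 < b" "b \<le> 1"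
  shows "moments_exist (\<lambda>\<zeta>. of_real (cmod (\<zeta> - p) powr (b - 1)))"
proof -
  obtain c where c: "p = cis c" using p by (metis obtain_angle_near)
  define c' where "c' = c - 2 * pi * \<lfloor>c / (2*pi)\<rfloor>"
  have "c' = 2 * pi * frac (c / (2*pi))" by (simp add: c'_def frac_def right_diff_distrib)
  hence c'b: "0 \<le> c'" "c' < 2*pi"
    using frac_ge_0[of "c/(2*pi)"] frac_lt_1[of "c/(2*pi)"] by auto
  have c': "p = cis c'"
  proof -
    have "cis c' = cis c / cis (2 * pi * \<lfloor>c / (2*pi)\<rfloor>)" unfolding c'_def by (rule cis_divide[symmetric])
    also have "cis (2 * pi * \<lfloor>c / (2*pi)\<rfloor>) = 1" by (rule cis_multiple_2pi) auto
    finally show ?thesis using c by (simp only: div_by_1)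
  qed
  \<comment> \<open>The angle of p is normalised to c' in [0, 2 pi), but an angle near either end of
    [0, 2 pi] may be closest to a translate of c'; the three summands cover the three
    candidates.\<close>
  define h where "h u = \<bar>u - c'\<bar> powr (b - 1) + \<bar>u - (c' - 2*pi)\<bar> powr (b - 1) + \<bar>u - (c' + 2*pi)\<bar> powr (b - 1)" for u
  have h: "set_integrable lborel {0..2*pi} (\<lambda>u. 4 powr (1 - b) * h u)"
    unfolding h_def by (intro set_integrable_mult_right set_integral_add abs_powr_integrable b) auto
  show ?thesis
    unfolding moments_exist_def set_integrable_def
  proof (rule Bochner_Integration.integrable_bound[OF h[unfolded set_integrable_def]])
    show "(\<lambda>\<theta>. indicator {0..2*pi} \<theta> *\<^sub>R complex_of_real (cmod (cis \<theta> - p) powr (b - 1))) \<in> borel_measurable lborel"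
      by measurable
    have main: "cmod (cis u - p) powr (b - 1) \<le> 4 powr (1 - b) * h u" if u: "u \<in> {0..2*pi}" "cis u \<noteq> p" for u
    proof -
      have "\<exists>k\<in>{c', c' - 2*pi, c' + 2*pi}. cis k = p \<and> \<bar>u - k\<bar> \<le> pi"
      proof -
        have "cis (c' - 2*pi) = p" "cis (c' + 2*pi) = p"
          by (metis c' cis_2pi cis_divide div_by_1, metis c' cis_2pi cis_mult mult_1_right)
        moreover have "\<bar>u - c'\<bar> \<le> pi \<or> \<bar>u - (c' - 2*pi)\<bar> \<le> pi \<or> \<bar>u - (c' + 2*pi)\<bar> \<le> pi"
        proof -
          have "u - c' \<le> pi \<and> c' - u \<le> pi \<or> u - c' > pi \<or> c' - u > pi" by linarith
          thus ?thesis using u(1) c'b unfolding abs_le_iff by force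
        qed
        ultimately show ?thesis by (metis c' insertI1 insertI2)
      qed
      then obtain k where k: "k \<in> {c', c' - 2*pi, c' + 2*pi}" "cis k = p" "\<bar>u - k\<bar> \<le> pi" by blast
      have "u \<noteq> k" using u(2) k(2) by blast
      \<comment> \<open>The chord is at least a quarter of the angle and the exponent b - 1 is not
        positive, hence the factor 4^(1 - b).\<close>
      have "cmod (cis u - p) powr (b - 1) \<le> (\<bar>u - k\<bar> / 4) powr (b - 1)"
        using cmod_cis_diff_ge[OF k(3)] b k(2) \<open>u \<noteq> k\<close> by (intro powr_mono2') auto
      also have "\<dots> = 4 powr (1 - b) * \<bar>u - k\<bar> powr (b - 1)"
        by (simp add: powr_divide powr_diff powr_minus divide_simps)
      also have "\<dots> \<le> 4 powr (1 - b) * h u"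
        using k(1) by (intro mult_left_mono) (auto simp: h_def)
      finally show ?thesis .
    qed
    have h0: "h u \<ge> 0" for u by (simp add: h_def)
    show "AE \<theta> in lborel. cmod (indicator {0..2*pi} \<theta> *\<^sub>R complex_of_real (cmod (cis \<theta> - p) powr (b - 1)))
       \<le> norm (indicator {0..2*pi} \<theta> *\<^sub>R (4 powr (1 - b) * h \<theta>))"
      using AE_cis_notin[of "{p}", simplified]
    proof eventually_elim
      case (elim u)
      show ?case
      proof (cases "u \<in> {0..2*pi}")
        case True
        hence "cis u \<noteq> p" using elim by simp
        thus ?thesis using main[OF True] h0[of u] True by (simp add: abs_mult)
      qed simp
    qed
  qed
qed

lemma ratio_powr_bound:
  fixes x y d D a :: real
  assumes "0 < d" "d \<le> x" "x \<le> D" "d \<le> y" "y \<le> D"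
  shows "(x / y) powr a \<le> (D / d) powr \<bar>a\<bar>"
proof (cases "a \<ge> 0")
  case True
  have "x / y \<le> D / d" using assms by (intro frac_le) auto
  thus ?thesis using True assms by (simp add: powr_mono2)
next
  case False
  have "y / x \<le> D / d" using assms by (intro frac_le) auto
  hence "(y / x) powr \<bar>a\<bar> \<le> (D / d) powr \<bar>a\<bar>" using assms by (intro powr_mono2) auto
  moreover have "(x / y) powr a = (y / x) powr \<bar>a\<bar>"
    using False assms by (simp add: powr_divide powr_minus field_simps)
  ultimately show ?thesis by simp
qed

text \<open>Bounds the joint contribution of singular points whose distances from the arc lie in
  [d, D]. The product also runs over the point that is treated separately; its factor supplies the
  exponential of the imaginary part and is otherwise at least 1.\<close>

definition comparison_const :: "'i set \<Rightarrow> ('i \<Rightarrow> complex) \<Rightarrow> real \<Rightarrow> real \<Rightarrow> real" where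
  "comparison_const I \<rho> d D = (\<Prod>l\<in>I. exp (3 * pi * \<bar>Im (\<rho> l)\<bar>) * (D / d) powr \<bar>Re (\<rho> l)\<bar>)"

lemma comparison_const_pos: "0 < d \<Longrightarrow> 0 < D \<Longrightarrow> comparison_const I \<rho> d D > 0"
  unfolding comparison_const_def by (intro prod_pos) auto

text \<open>A Harnack-type inequality along an arc: only z_k may come close, so its ratio of
  distances is kept, while the other singular points disappear into the constant.\<close>

lemma circle_ode_comparison:
  assumes ode: "\<And>\<theta>. \<theta> \<in> {a..b} \<Longrightarrow>
      (w has_field_derivative w (cis \<theta>) * (\<Sum>l\<in>I. \<rho> l / (cis \<theta> - z l))) (at (cis \<theta>) within sphere 0 1)"
    and th: "\<theta> \<in> {a..b}" "\<theta>' \<in> {a..b}" and ab: "b - a \<le> 2 * pi" and I: "finite I" "k \<in> I"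
    and ns: "\<And>\<theta>. \<theta> \<in> {a..b} \<Longrightarrow> cis \<theta> \<noteq> z k"
    and far: "\<And>\<theta> l. \<theta> \<in> {a..b} \<Longrightarrow> l \<in> I \<Longrightarrow> l \<noteq> k \<Longrightarrow> d \<le> cmod (cis \<theta> - z l) \<and> cmod (cis \<theta> - z l) \<le> D"
    and d: "0 < d" "d \<le> D"
  shows "cmod (w (cis \<theta>)) \<le> cmod (w (cis \<theta>')) * comparison_const I \<rho> d D *
     (cmod (cis \<theta> - z k) / cmod (cis \<theta>' - z k)) powr Re (\<rho> k)"
proof -
  define f where "f l = exp (3 * pi * \<bar>Im (\<rho> l)\<bar>) * (D / d) powr \<bar>Re (\<rho> l)\<bar>" for l
  define g where "g l = exp (3 * pi * \<bar>Im (\<rho> l)\<bar>) * (cmod (cis \<theta> - z l) / cmod (cis \<theta>' - z l)) powr Re (\<rho> l)" for l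
  have "cmod (w (cis \<theta>)) \<le> cmod (w (cis \<theta>')) * prod g I"
    unfolding g_def
  proof (rule circle_ode_bound[OF ode _ th ab I(1)])
    show "cis \<theta> \<noteq> z l" if "\<theta> \<in> {a..b}" "l \<in> I" for \<theta> l
      using that ns far[of \<theta> l] d by (cases "l = k") auto
  qed
  moreover have "prod g I \<le> comparison_const I \<rho> d D * (cmod (cis \<theta> - z k) / cmod (cis \<theta>' - z k)) powr Re (\<rho> k)"
  proof -
  have "prod g I = g k * prod g (I - {k})" by (rule prod.remove[OF I])
  also have "\<dots> \<le> g k * prod f (I - {k})"
    using far th d by (intro mult_left_mono prod_mono conjI)
      (auto simp: g_def f_def intro!: ratio_powr_bound mult_nonneg_nonneg)
  also have "\<dots> \<le> (f k * (cmod (cis \<theta> - z k) / cmod (cis \<theta>' - z k)) powr Re (\<rho> k)) * prod f (I - {k})"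
  proof -
    have "1 \<le> (D / d) powr \<bar>Re (\<rho> k)\<bar>" using d by (intro ge_one_powr_ge_zero) auto
    thus ?thesis
      unfolding g_def by (intro mult_right_mono prod_nonneg) (auto simp: f_def)
  qed
  also have "\<dots> = comparison_const I \<rho> d D * (cmod (cis \<theta> - z k) / cmod (cis \<theta>' - z k)) powr Re (\<rho> k)"
    unfolding comparison_const_def f_def[symmetric] prod.remove[OF I, of f] by (simp add: mult_ac)
  finally show ?thesis .
  qed
  ultimately show ?thesis
    unfolding mult.assoc by (meson mult_left_mono norm_ge_zero order_trans)
qed

section \<open>A semi-classical weight at a fixed time\<close>

locale semiclassical_weight =
  fixes I :: "nat set" and z :: "nat \<Rightarrow> complex" and \<rho> :: "nat \<Rightarrow> complex" and w :: "complex \<Rightarrow> complex"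
  assumes finite_I: "finite I" and inj_z: "inj_on z I"
    and ode: "\<And>\<zeta>. cmod \<zeta> = 1 \<Longrightarrow> \<zeta> \<notin> z ` I \<Longrightarrow>
      (w has_field_derivative w \<zeta> * (\<Sum>l\<in>I. \<rho> l / (\<zeta> - z l))) (at \<zeta> within sphere 0 1)"
    and moments: "moments_exist w"
    and lim: "\<And>k. k \<in> I \<Longrightarrow> cmod (z k) = 1 \<Longrightarrow> circle_limit_exists (Caratheodory_fun w) (z k)"
begin

lemma continuous_nonsingular:
  "cmod \<zeta> = 1 \<Longrightarrow> \<zeta> \<notin> z ` I \<Longrightarrow> continuous (at \<zeta> within sphere 0 1) w"
  using ode by (rule DERIV_continuous)

lemma separation:
  assumes "k \<in> I"
  obtains e where "0 < e" "e \<le> 1" "\<And>l. l \<in> I \<Longrightarrow> l \<noteq> k \<Longrightarrow> 2 * e \<le> cmod (z k - z l)"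
proof -
  define e where "e = Min (insert 1 ((\<lambda>l. cmod (z k - z l) / 2) ` (I - {k})))"
  have "e > 0" unfolding e_def
    using finite_I inj_z assms by (subst Min_gr_iff) (auto simp: inj_on_def)
  moreover have "e \<le> 1" unfolding e_def using finite_I by (intro Min_le) auto
  moreover have "2 * e \<le> cmod (z k - z l)" if "l \<in> I" "l \<noteq> k" for l
  proof -
    have "e \<le> cmod (z k - z l) / 2" unfolding e_def using finite_I that by (intro Min_le) auto
    thus ?thesis by simp
  qed
  ultimately show ?thesis using that by blast
qed

text \<open>The existence of the limit of the Caratheodory function from both sides of the circle forces
  the weight to vanish at the singular point, by the jump relation for the Poisson kernel.\<close>

lemma local_behaviour:
  assumes k: "k \<in> I" "cmod (z k) = 1"
  obtains C e where "C > 0" "e > 0"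
    "\<And>\<zeta>. cmod \<zeta> = 1 \<Longrightarrow> \<zeta> \<noteq> z k \<Longrightarrow> cmod (\<zeta> - z k) < e \<Longrightarrow>
       if Re (\<rho> k) > 0 then cmod (w \<zeta>) \<le> C * cmod (\<zeta> - z k) powr Re (\<rho> k) else w \<zeta> = 0"
proof -
  obtain c where c: "z k = cis c" using k(2) by (metis obtain_angle_near)
  obtain e where e: "0 < e" "e \<le> 1" and sep: "\<And>l. l \<in> I \<Longrightarrow> l \<noteq> k \<Longrightarrow> 2 * e \<le> cmod (z k - z l)"
    using separation[OF k(1)] by metis
  define D where "D = 1 + (\<Sum>l\<in>I. cmod (z l))"
  have D: "cmod (\<zeta> - z l) \<le> D" if "cmod \<zeta> = 1" "l \<in> I" for \<zeta> l
  proof -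
    have "cmod (z l) \<le> (\<Sum>l\<in>I. cmod (z l))" using finite_I that(2) by (intro member_le_sum) auto
    thus ?thesis using norm_triangle_ineq4[of \<zeta> "z l"] that(1) by (simp add: D_def)
  qed
  have D1: "D \<ge> 1" unfolding D_def by (simp add: sum_nonneg)
  define K where "K = comparison_const I \<rho> e D"
  have K: "K > 0" unfolding K_def using e D1 by (intro comparison_const_pos) auto
  have near: "cmod (cis (c + s) - z k) \<le> \<bar>s\<bar>" "\<bar>s\<bar> / 4 \<le> cmod (cis (c + s) - z k)" if "\<bar>s\<bar> \<le> e" for s
    using cmod_cis_diff_le[of "c + s" c] cmod_cis_diff_ge[of "c + s" c] that e pi_ge_two by (auto simp: c)
  have sepc: "e \<le> cmod (cis (c + s) - z l)" if "\<bar>s\<bar> \<le> e" "l \<in> I" "l \<noteq> k" for s l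
  proof -
    have "cmod (z k - z l) \<le> cmod (z k - cis (c + s)) + cmod (cis (c + s) - z l)"
      using norm_triangle_ineq[of "z k - cis (c + s)" "cis (c + s) - z l"] by simp
    thus ?thesis using sep[OF that(2,3)] near(1)[OF that(1)] that(1) by (simp add: norm_minus_commute)
  qed
  \<comment> \<open>The condition u v > 0 puts both points on the same side of the singular point,
    so the arc between them avoids it.\<close>
  have comp: "cmod (w (cis (c + u))) \<le> cmod (w (cis (c + v))) * K *
      (cmod (cis (c + u) - z k) / cmod (cis (c + v) - z k)) powr Re (\<rho> k)"
    if "\<bar>u\<bar> \<le> e" "\<bar>v\<bar> \<le> e" "u * v > 0" for u v
    unfolding K_def
  proof (rule circle_ode_comparison[where a = "c + min u v" and b = "c + max u v"])
    have uv: "\<bar>s\<bar> \<le> e \<and> s \<noteq> 0" if "\<theta> \<in> {c + min u v..c + max u v}" "s = \<theta> - c" for \<theta> s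
      using that \<open>\<bar>u\<bar> \<le> e\<close> \<open>\<bar>v\<bar> \<le> e\<close> \<open>u * v > 0\<close> by (auto simp: zero_less_mult_iff abs_le_iff)
    have ns: "cis \<theta> \<noteq> z k" if "\<theta> \<in> {c + min u v..c + max u v}" for \<theta>
      using near(2)[of "\<theta> - c"] uv[OF that refl] by auto
    have far: "e \<le> cmod (cis \<theta> - z l)" if "\<theta> \<in> {c + min u v..c + max u v}" "l \<in> I" "l \<noteq> k" for \<theta> l
      using sepc[of "\<theta> - c" l] uv[OF that(1) refl] that by auto
    show "(w has_field_derivative w (cis \<theta>) * (\<Sum>l\<in>I. \<rho> l / (cis \<theta> - z l))) (at (cis \<theta>) within sphere 0 1)"
      if "\<theta> \<in> {c + min u v..c + max u v}" for \<theta>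
    proof (rule ode)
      show "cis \<theta> \<notin> z ` I"
        using ns[OF that] far[OF that] e by force
    qed simp
    show "cis \<theta> \<noteq> z k" if "\<theta> \<in> {c + min u v..c + max u v}" for \<theta> using ns[OF that] .
    show "e \<le> cmod (cis \<theta> - z l) \<and> cmod (cis \<theta> - z l) \<le> D"
      if "\<theta> \<in> {c + min u v..c + max u v}" "l \<in> I" "l \<noteq> k" for \<theta> l
      using far[OF that] D that by auto
    show "(c + max u v) - (c + min u v) \<le> 2 * pi" using that e pi_ge_two by auto
  qed (use k finite_I e D1 in auto)
  \<comment> \<open>One summand for each outer end point, so that \<open>C\<close> serves both sides
    of z_k; adding 1 to the modulus keeps it positive even if w vanishes there.\<close>
  define C where "C = (1 + cmod (w (cis (c + e)))) * K / cmod (cis (c + e) - z k) powr Re (\<rho> k)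
     + (1 + cmod (w (cis (c - e)))) * K / cmod (cis (c - e) - z k) powr Re (\<rho> k)"
  have nzp: "cmod (cis (c + e) - z k) > 0" "cmod (cis (c - e) - z k) > 0"
    using near(2)[of e] near(2)[of "-e"] e by auto
  have "C > 0" unfolding C_def using K nzp by (intro add_pos_pos divide_pos_pos mult_pos_pos add_pos_nonneg) auto
  moreover have "e / 4 > 0" using e by simp
  moreover have "if Re (\<rho> k) > 0 then cmod (w \<zeta>) \<le> C * cmod (\<zeta> - z k) powr Re (\<rho> k) else w \<zeta> = 0"
    if \<zeta>: "cmod \<zeta> = 1" "\<zeta> \<noteq> z k" "cmod (\<zeta> - z k) < e / 4" for \<zeta>
  proof -
    obtain a where a: "\<zeta> = cis a" "\<bar>a - c\<bar> \<le> 4 * cmod (\<zeta> - cis c)"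
      by (rule obtain_angle_near[OF \<zeta>(1), of c]) 
    define u where "u = a - c"
    have u: "\<bar>u\<bar> < e" "u \<noteq> 0" "\<zeta> = cis (c + u)" using a \<zeta> by (auto simp: u_def c)
    define s where "s = sgn u"
    have s: "s = 1 \<or> s = -1" "u * s > 0" using u(2) by (auto simp: s_def sgn_if)
    show ?thesis
    proof (cases "Re (\<rho> k) > 0")
      case True
      have "cmod (w \<zeta>) \<le> cmod (w (cis (c + e * s))) * K * (cmod (\<zeta> - z k) / cmod (cis (c + e * s) - z k)) powr Re (\<rho> k)"
        unfolding u(3) using u s e by (intro comp) (auto simp: zero_less_mult_iff)
      also have "\<dots> = (cmod (w (cis (c + e * s))) * K / cmod (cis (c + e * s) - z k) powr Re (\<rho> k)) * cmod (\<zeta> - z k) powr Re (\<rho> k)"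
        by (simp add: powr_divide)
      also have "\<dots> \<le> C * cmod (\<zeta> - z k) powr Re (\<rho> k)"
      proof (rule mult_right_mono)
        have "cmod (w (cis (c + e * s))) * K / cmod (cis (c + e * s) - z k) powr Re (\<rho> k)
          \<le> (1 + cmod (w (cis (c + e * s)))) * K / cmod (cis (c + e * s) - z k) powr Re (\<rho> k)"
          using K by (intro divide_right_mono mult_right_mono) auto
        also have "\<dots> \<le> C" using s(1) K by (auto simp: C_def)
        finally show "cmod (w (cis (c + e * s))) * K / cmod (cis (c + e * s) - z k) powr Re (\<rho> k) \<le> C" .
      qed simp
      finally show ?thesis using True by simp
    next
      case False
      \<comment> \<open>For Re \<rho>_k <= 0 the comparison runs towards the singularity: |w
        \<zeta>| is at most the value of |w| at a point arbitrarily close to z_k, times the factor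
        \<open>K'\<close>, which depends on \<zeta> only. Since |w| becomes arbitrarily small there,
        w \<zeta> = 0.\<close>
      define m where "m = - Re (\<rho> k)"
      have m: "m \<ge> 0" using False by (simp add: m_def)
      define K' where "K' = K * 2 powr m / cmod (\<zeta> - z k) powr m"
      have K': "K' > 0" using K \<zeta>(2) by (simp add: K'_def)
      have "cmod (w \<zeta>) \<le> \<epsilon>" if \<epsilon>: "\<epsilon> > 0" for \<epsilon>
      proof -
        obtain d where d: "d > 0" "\<And>q. cmod q = 1 \<Longrightarrow> dist q (z k) < d \<Longrightarrow> continuous (at q within sphere 0 1) w \<Longrightarrow> cmod (w q) \<le> \<epsilon> / K'"
          using weight_vanishes_at_limit_point[OF moments k(2) lim[OF k], of "\<epsilon> / K'"] \<epsilon> K' by auto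
        define v where "v = s * min (d / 2) e"
        have v: "\<bar>v\<bar> \<le> e" "u * v > 0" "\<bar>v\<bar> < d" "v \<noteq> 0"
          using s d(1) e by (auto simp: v_def min_def zero_less_mult_iff mult_less_0_iff abs_mult)
        have vz: "cmod (cis (c + v) - z k) > 0" using near(2)[OF v(1)] v(4) by auto
        have v2: "cmod (cis (c + v) - z k) \<le> 2" using near(1)[OF v(1)] v(1) e by linarith
        have "cis (c + v) \<notin> z ` I" using sepc[OF v(1)] vz e by force
        hence wv: "cmod (w (cis (c + v))) \<le> \<epsilon> / K'"
          using near(1)[OF v(1)] v(3) by (intro d(2) continuous_nonsingular) (auto simp: dist_norm)
        have "cmod (w \<zeta>) \<le> cmod (w (cis (c + v))) * K * (cmod (\<zeta> - z k) / cmod (cis (c + v) - z k)) powr Re (\<rho> k)"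
          unfolding u(3) using u v by (intro comp) auto
        also have "(cmod (\<zeta> - z k) / cmod (cis (c + v) - z k)) powr Re (\<rho> k) = cmod (cis (c + v) - z k) powr m / cmod (\<zeta> - z k) powr m"
          by (simp add: m_def powr_divide powr_minus divide_simps)
        also have "cmod (w (cis (c + v))) * K * (cmod (cis (c + v) - z k) powr m / cmod (\<zeta> - z k) powr m)
           \<le> (\<epsilon> / K') * K * (2 powr m / cmod (\<zeta> - z k) powr m)"
          using wv K K' \<epsilon> v2 m by (intro mult_mono divide_right_mono powr_mono2 mult_nonneg_nonneg) auto
        also have "\<dots> = \<epsilon>" using K' K \<zeta>(2) by (simp add: K'_def)
        finally show ?thesis .
      qed
      hence "cmod (w \<zeta>) \<le> 0" by (rule field_le_epsilon[of _ 0, simplified])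
      thus ?thesis using False by simp
    qed
  qed
  ultimately show ?thesis using that by blast
qed

text \<open>Let x be the distance to z_k and a = Re \<rho>_k. Near z_k the weight is zero or, for a
  > 0, of order x^a, so w / x is of the integrable order x^(a - 1). Away from z_k the pole is
  bounded by 1 / e.\<close>

lemma moments_exist_pole:
  assumes k: "k \<in> I"
  shows "moments_exist (\<lambda>\<zeta>. w \<zeta> / (\<zeta> - z k))"
proof (cases "cmod (z k) = 1")
  case False
  thus ?thesis using moments_exist_times_continuous[OF moments continuous_on_resolvent[OF False]] by simp
next
  case True
  obtain C e where C: "C > 0" "e > 0" and loc:
    "\<And>\<zeta>. cmod \<zeta> = 1 \<Longrightarrow> \<zeta> \<noteq> z k \<Longrightarrow> cmod (\<zeta> - z k) < e \<Longrightarrow>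
       if Re (\<rho> k) > 0 then cmod (w \<zeta>) \<le> C * cmod (\<zeta> - z k) powr Re (\<rho> k) else w \<zeta> = 0"
    using local_behaviour[OF k True] by metis
  \<comment> \<open>The exponent is capped at 1 to fit the integrability of powers of the distance
    with 0 < b <= 1. The excess x^(a - b) is at most 2^|a|, as chords are at most 2.\<close>
  define b where "b = (if Re (\<rho> k) > 0 then min 1 (Re (\<rho> k)) else 1)"
  have b: "0 < b" "b \<le> 1" by (auto simp: b_def)
  define a where "a = Re (\<rho> k)"
  show ?thesis
  proof (rule moments_exist_bound[where A = "{z k}"])
    show "moments_exist (\<lambda>\<zeta>. complex_of_real (1 / e * cmod (w \<zeta>)) + of_real (C * 2 powr \<bar>a\<bar> * cmod (\<zeta> - z k) powr (b - 1)))"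
      using moments_exist_add[OF moments_exist_mult_left[OF moments_exist_cmod[OF moments], of "1/e"]
         moments_exist_mult_left[OF moments_exist_powr_distance[OF True b], of "C * 2 powr \<bar>a\<bar>"]]
      by simp
    have "(\<lambda>\<theta>. (indicator {0..2*pi} \<theta> *\<^sub>R w (cis \<theta>)) / (cis \<theta> - z k)) \<in> borel_measurable lborel"
      using moments_exist_measurable[OF moments] by measurable
    thus "(\<lambda>\<theta>. indicator {0..2*pi} \<theta> *\<^sub>R (w (cis \<theta>) / (cis \<theta> - z k))) \<in> borel_measurable lborel"
      by (simp add: scaleR_conv_of_real)
    fix \<zeta> :: complex assume \<zeta>: "cmod \<zeta> = 1" "\<zeta> \<notin> {z k}"
    define x where "x = cmod (\<zeta> - z k)"
    have x: "x > 0" "x \<le> 2" using \<zeta> True norm_triangle_ineq4[of \<zeta> "z k"] by (auto simp: x_def)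
    have "cmod (w \<zeta>) / x \<le> 1 / e * cmod (w \<zeta>) + C * 2 powr \<bar>a\<bar> * x powr (b - 1)"
    proof (cases "x < e")
      case False
      hence "cmod (w \<zeta>) / x \<le> 1 / e * cmod (w \<zeta>)" using C by (simp add: frac_le)
      thus ?thesis using C by (simp add: add_increasing2)
    next
      case True
      have "cmod (w \<zeta>) / x \<le> C * 2 powr \<bar>a\<bar> * x powr (b - 1)"
      proof (cases "a > 0")
        case True
        have "cmod (w \<zeta>) \<le> C * x powr a" using loc[of \<zeta>] \<zeta> \<open>x < e\<close> \<open>a > 0\<close> by (simp add: x_def a_def)
        hence "cmod (w \<zeta>) / x \<le> C * x powr a / x" using x by (intro divide_right_mono) auto
        also have "\<dots> = C * (x powr (a - b) * x powr (b - 1))" using x by (simp add: powr_diff field_simps)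
        also have "\<dots> \<le> C * (2 powr \<bar>a\<bar> * x powr (b - 1))"
        proof (intro mult_left_mono mult_right_mono)
          have "x powr (a - b) \<le> 2 powr (a - b)" using x True by (intro powr_mono2) (auto simp: b_def a_def)
          also have "\<dots> \<le> 2 powr \<bar>a\<bar>" using b by (intro powr_mono) auto
          finally show "x powr (a - b) \<le> 2 powr \<bar>a\<bar>" .
        qed (use C in auto)
        finally show ?thesis by simp
      next
        case False
        hence "w \<zeta> = 0" using loc[of \<zeta>] \<zeta> \<open>x < e\<close> by (simp add: x_def a_def)
        thus ?thesis using C by simp
      qed
      thus ?thesis using C by (simp add: add_increasing)
    qed
    hence "cmod (w \<zeta> / (\<zeta> - z k)) \<le> 1 / e * cmod (w \<zeta>) + C * 2 powr \<bar>a\<bar> * x powr (b - 1)"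
      by (simp add: norm_divide x_def)
    also have "\<dots> \<le> cmod (complex_of_real (1 / e * cmod (w \<zeta>)) + of_real (C * 2 powr \<bar>a\<bar> * x powr (b - 1)))"
      unfolding of_real_add[symmetric] norm_of_real by simp
    finally show "cmod (w \<zeta> / (\<zeta> - z k)) \<le> cmod (complex_of_real (1 / e * cmod (w \<zeta>)) + of_real (C * 2 powr \<bar>a\<bar> * cmod (\<zeta> - z k) powr (b - 1)))"
      by (simp add: x_def)
  qed simp
qed

end

section \<open>Boundary values on the circle as radial limits\<close>

lemma value_at_eqI:
  assumes p: "cmod p = 1" and ex: "circle_limit_exists f p"
    and r: "\<And>i::nat. 0 < r i" "\<And>i. r i < 1" "r \<longlonglongrightarrow> (1::real)"
    and lim: "(\<lambda>i. f (of_real (r i) * p)) \<longlonglongrightarrow> v"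
  shows "value_at f p = v"
proof -
  obtain l where l: "(f \<longlongrightarrow> l) (at p within - sphere 0 1)"
    using ex unfolding circle_limit_exists_def by blast
  have n: "cmod (of_real (r i) * p) < 1" for i using r(1,2)[of i] p by (simp add: norm_mult)
  have mem: "of_real (r i) * p \<in> - sphere 0 1 - {p}" for i using n[of i] p by auto
  have "(\<lambda>i. of_real (r i) * p) \<longlonglongrightarrow> of_real 1 * p"
    by (intro tendsto_intros r(3))
  hence conv: "(\<lambda>i. of_real (r i) * p) \<longlonglongrightarrow> p" by simp
  have "filterlim (\<lambda>i. of_real (r i) * p) (at p within - sphere 0 1) sequentially"
    unfolding filterlim_at using conv mem by auto
  hence "(\<lambda>i. f (of_real (r i) * p)) \<longlonglongrightarrow> l" and "at p within - sphere 0 1 \<noteq> bot"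
    using filterlim_compose[OF l] by (auto simp: filterlim_def trivial_limit_sequentially[unfolded trivial_limit_def] filtermap_bot_iff bot_unique)
  moreover from this have "l = v" using LIMSEQ_unique lim by blast
  ultimately show ?thesis using l p by (simp add: value_at_def tendsto_Lim)
qed

text \<open>Dominated convergence: 1 - r <= |\<zeta> - r p| gives |\<zeta> - p| <= 2 |\<zeta> - r
  p|, so every kernel along the radius is at most 4 / |\<zeta> - p|, and f / (\<zeta> - p) is
  integrable by hypothesis.\<close>

lemma radial_limit_Caratheodory:
  assumes f: "moments_exist f" and p: "cmod p = 1" and fp: "moments_exist (\<lambda>\<zeta>. f \<zeta> / (\<zeta> - p))"
    and r: "\<And>i::nat. 0 < r i" "\<And>i. r i < 1" "r \<longlonglongrightarrow> (1::real)"
  shows "(\<lambda>i. circle_mean (\<lambda>\<zeta>. (\<zeta> + of_real (r i) * p) / (\<zeta> - of_real (r i) * p) * f \<zeta>))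
     \<longlonglongrightarrow> circle_mean (\<lambda>\<zeta>. (\<zeta> + p) / (\<zeta> - p) * f \<zeta>)"
proof -
  have m: "moments_exist (\<lambda>\<zeta>. (\<zeta> + of_real (r i) * p) / (\<zeta> - of_real (r i) * p) * f \<zeta>)" for i
  proof -
    have "cmod (of_real (r i) * p) \<noteq> 1" using r(1,2)[of i] p by (simp add: norm_mult)
    thus ?thesis using moments_exist_times_continuous[OF f continuous_on_Caratheodory_kernel] by (simp add: mult.commute)
  qed
  have "(\<lambda>i. LINT \<theta>|lborel. indicator {0..2*pi} \<theta> *\<^sub>R ((cis \<theta> + of_real (r i) * p) / (cis \<theta> - of_real (r i) * p) * f (cis \<theta>)))
     \<longlonglongrightarrow> (LINT \<theta>|lborel. indicator {0..2*pi} \<theta> *\<^sub>R ((cis \<theta> + p) / (cis \<theta> - p) * f (cis \<theta>)))"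
  proof (rule integral_dominated_convergence[where w = "\<lambda>\<theta>. 4 * cmod (indicator {0..2*pi} \<theta> *\<^sub>R (f (cis \<theta>) / (cis \<theta> - p)))"])
    have "(\<lambda>\<theta>. (indicator {0..2*pi} \<theta> *\<^sub>R f (cis \<theta>)) * ((cis \<theta> + p) / (cis \<theta> - p))) \<in> borel_measurable lborel"
      using moments_exist_measurable[OF f] by measurable
    thus "(\<lambda>\<theta>. indicator {0..2*pi} \<theta> *\<^sub>R ((cis \<theta> + p) / (cis \<theta> - p) * f (cis \<theta>))) \<in> borel_measurable lborel"
      by (simp add: mult.commute)
    show "(\<lambda>\<theta>. indicator {0..2*pi} \<theta> *\<^sub>R ((cis \<theta> + of_real (r i) * p) / (cis \<theta> - of_real (r i) * p) * f (cis \<theta>))) \<in> borel_measurable lborel" for i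
      using moments_exist_measurable[OF m[of i]] .
    show "integrable lborel (\<lambda>\<theta>. 4 * cmod (indicator {0..2*pi} \<theta> *\<^sub>R (f (cis \<theta>) / (cis \<theta> - p))))"
      using fp unfolding moments_exist_def set_integrable_def by (intro integrable_mult_right integrable_norm)
    have "AE \<theta> in lborel. \<theta> \<in> {0..2*pi} \<longrightarrow> cis \<theta> \<notin> {p}" by (rule AE_cis_notin) simp
    thus "AE \<theta> in lborel. (\<lambda>i. indicator {0..2*pi} \<theta> *\<^sub>R ((cis \<theta> + of_real (r i) * p) / (cis \<theta> - of_real (r i) * p) * f (cis \<theta>)))
      \<longlonglongrightarrow> indicator {0..2*pi} \<theta> *\<^sub>R ((cis \<theta> + p) / (cis \<theta> - p) * f (cis \<theta>))"
    proof eventually_elim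
      case (elim \<theta>)
      show ?case
      proof (cases "\<theta> \<in> {0..2*pi}")
        case True
        hence "cis \<theta> - of_real 1 * p \<noteq> 0" using elim by simp
        have "(\<lambda>i. (cis \<theta> + of_real (r i) * p) / (cis \<theta> - of_real (r i) * p) * f (cis \<theta>))
           \<longlonglongrightarrow> (cis \<theta> + of_real 1 * p) / (cis \<theta> - of_real 1 * p) * f (cis \<theta>)"
          by (intro tendsto_intros r(3) \<open>cis \<theta> - of_real 1 * p \<noteq> 0\<close>)
        thus ?thesis using True by simp
      qed simp
    qed
    show "AE \<theta> in lborel. cmod (indicator {0..2*pi} \<theta> *\<^sub>R ((cis \<theta> + of_real (r i) * p) / (cis \<theta> - of_real (r i) * p) * f (cis \<theta>)))
       \<le> 4 * cmod (indicator {0..2*pi} \<theta> *\<^sub>R (f (cis \<theta>) / (cis \<theta> - p)))" for i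
      using AE_cis_notin[of "{p}", simplified]
    proof eventually_elim
      case (elim \<theta>)
      have "cmod ((cis \<theta> + of_real (r i) * p) / (cis \<theta> - of_real (r i) * p)) \<le> 4 / cmod (cis \<theta> - p)" if "cis \<theta> \<noteq> p"
      proof -
        have 1: "cmod (cis \<theta> + of_real (r i) * p) \<le> 2"
          using norm_triangle_ineq[of "cis \<theta>" "of_real (r i) * p"] r(1,2)[of i] p by (simp add: norm_mult)
        have 2: "cmod (of_real (r i) * p - p) = 1 - r i"
        proof -
          have "of_real (r i) * p - p = - of_real (1 - r i) * p" by (simp add: algebra_simps)
          thus ?thesis using p r(2)[of i] by (simp only: norm_mult norm_minus_cancel norm_of_real) simp
        qed
        have 3: "1 - r i \<le> cmod (cis \<theta> - of_real (r i) * p)"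
          using norm_triangle_ineq2[of "cis \<theta>" "of_real (r i) * p"] r(1,2)[of i] p by (simp add: norm_mult)
        have 4: "cmod (cis \<theta> - p) \<le> cmod (cis \<theta> - of_real (r i) * p) + cmod (of_real (r i) * p - p)"
          using norm_triangle_ineq[of "cis \<theta> - of_real (r i) * p" "of_real (r i) * p - p"] by simp
        have 5: "cmod (cis \<theta> - p) \<le> 2 * cmod (cis \<theta> - of_real (r i) * p)" using 2 3 4 by linarith
        have "cmod (cis \<theta> + of_real (r i) * p) / cmod (cis \<theta> - of_real (r i) * p) \<le> 2 / (cmod (cis \<theta> - p) / 2)"
          using 1 5 that by (intro frac_le) auto
        thus ?thesis by (simp add: norm_divide)
      qed
      from mult_right_mono[OF this norm_ge_zero[of "f (cis \<theta>)"]] show ?case using elim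
        by (auto simp: indicator_def norm_mult norm_divide)
    qed
  qed
  thus ?thesis unfolding circle_mean_def set_lebesgue_integral_def by (intro tendsto_divide tendsto_const) auto
qed

section \<open>Differentiation of the moments\<close>

text \<open>This form of the derivative is the one to which dominated convergence along sequences of
  times applies.\<close>

lemma has_vector_derivative_quotient:
  fixes f :: "real \<Rightarrow> complex"
  shows "(f has_vector_derivative D) (at t) \<longleftrightarrow> ((\<lambda>s. (f s - f t) / of_real (s - t)) \<longlongrightarrow> D) (at t)"
proof -
  have eq: "norm (f s - f t - (s - t) *\<^sub>R D) / norm (s - t) = norm ((f s - f t) / of_real (s - t) - D)" if "s \<noteq> t" for s
  proof -
    have "(f s - f t) / of_real (s - t) - D = (f s - f t - (s - t) *\<^sub>R D) / of_real (s - t)"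
      using that by (simp add: scaleR_conv_of_real field_simps)
    thus ?thesis by (simp add: norm_divide flip: of_real_diff)
  qed
  have "(f has_vector_derivative D) (at t) \<longleftrightarrow> ((\<lambda>s. norm (f s - f t - (s - t) *\<^sub>R D) / norm (s - t)) \<longlongrightarrow> 0) (at t)"
    unfolding has_vector_derivative_def has_derivative_iff_norm
    using bounded_linear_scaleR_left[of D] by (auto simp: bounded_linear_scaleR_left)
  also have "\<dots> \<longleftrightarrow> ((\<lambda>s. norm ((f s - f t) / of_real (s - t) - D)) \<longlongrightarrow> 0) (at t)"
    by (intro filterlim_cong refl) (use eq in \<open>auto simp: eventually_at_filter intro!: always_eventually\<close>)
  also have "\<dots> \<longleftrightarrow> ((\<lambda>s. (f s - f t) / of_real (s - t)) \<longlongrightarrow> D) (at t)"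
    unfolding tendsto_norm_zero_iff by (rule Lim_null[symmetric])
  finally show ?thesis .
qed

lemma has_vector_derivative_imp_local_Lipschitz:
  fixes f :: "real \<Rightarrow> complex"
  assumes "(f has_vector_derivative D) (at t)"
  shows "eventually (\<lambda>s. cmod (f s - f t) \<le> (cmod D + 1) * \<bar>s - t\<bar>) (nhds t)"
proof -
  have "((\<lambda>s. cmod ((f s - f t) / of_real (s - t))) \<longlongrightarrow> cmod D) (at t)"
    using assms unfolding has_vector_derivative_quotient by (rule tendsto_norm)
  hence "eventually (\<lambda>s. cmod ((f s - f t) / of_real (s - t)) < cmod D + 1) (at t)"
    by (rule order_tendstoD) simp
  hence "eventually (\<lambda>s. s \<noteq> t \<longrightarrow> cmod ((f s - f t) / of_real (s - t)) < cmod D + 1) (nhds t)"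
    by (simp add: eventually_at_filter)
  thus ?thesis
  proof eventually_elim
    case (elim s)
    show ?case
    proof (cases "s = t")
      case False
      hence "cmod (f s - f t) / \<bar>s - t\<bar> < cmod D + 1" using elim by (simp add: norm_divide flip: of_real_diff)
      thus ?thesis using False by (simp add: divide_less_eq)
    qed simp
  qed
qed

lemma cmod_exp_minus_one_le: "cmod (exp v - 1) \<le> exp (cmod v) * cmod v"
proof -
  have "cmod (exp v - exp 0) \<le> exp (cmod v) * cmod (v - 0)"
  proof (rule field_differentiable_bound[of "cball 0 (cmod v)" exp exp])
    fix u :: complex assume "u \<in> cball 0 (cmod v)"
    thus "cmod (exp u) \<le> exp (cmod v)" using norm_exp[of u] by (intro order_trans[OF norm_exp]) auto
  qed (auto intro: has_field_derivative_at_within DERIV_exp)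
  thus ?thesis by simp
qed

locale weight_deformation =
  fixes S :: "real set" and M :: nat and z :: "nat \<Rightarrow> real \<Rightarrow> complex" and \<rho> :: "nat \<Rightarrow> complex"
    and w :: "real \<Rightarrow> complex \<Rightarrow> complex"
  assumes open_S: "open S" and moving: "moving_singularities S M z"
    and semiclassical: "semiclassical_deformation S M z \<rho> w"
    and moments: "\<And>t. t \<in> S \<Longrightarrow> moments_exist (w t)"
    and lim: "\<And>t k. t \<in> S \<Longrightarrow> k \<in> {1..M} \<Longrightarrow> cmod (z k t) = 1 \<Longrightarrow> circle_limit_exists (Caratheodory_fun (w t)) (z k t)"
begin

definition "zd k t = vector_derivative (z k) (at t)"

lemma z0: "t \<in> S \<Longrightarrow> z 0 t = 0"
  using moving by (auto simp: moving_singularities_def)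

lemma z_deriv: 
  assumes "t \<in> S" "k \<in> {0..M}" shows "(z k has_vector_derivative zd k t) (at t)"
proof (cases "k = 0")
  case False
  thus ?thesis using moving assms unfolding zd_def moving_singularities_def
    by (auto intro!: vector_derivative_works[THEN iffD1])
next
  case True
  have "(z 0 has_vector_derivative 0) (at t)"
  proof (rule has_vector_derivative_transform_within_open[OF _ open_S assms(1)])
    show "((\<lambda>_. 0) has_vector_derivative 0) (at t)" by simp
  qed (simp add: z0)
  thus ?thesis using True unfolding zd_def by (simp add: vector_derivative_at)
qed

lemma zd0: "t \<in> S \<Longrightarrow> zd 0 t = 0"
proof -
  assume t: "t \<in> S"
  have "(z 0 has_vector_derivative 0) (at t)"
  proof (rule has_vector_derivative_transform_within_open[OF _ open_S t])
    show "((\<lambda>_. 0) has_vector_derivative 0) (at t)" by simp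
  qed (simp add: z0)
  thus ?thesis unfolding zd_def by (rule vector_derivative_at)
qed

lemma semiclassical_weight: 
  assumes t: "t \<in> S" shows "semiclassical_weight {0..M} (\<lambda>k. z k t) \<rho> (w t)"
proof
  show "inj_on (\<lambda>k. z k t) {0..M}" using moving t by (auto simp: moving_singularities_def)
  show "(w t has_field_derivative w t \<zeta> * (\<Sum>l\<in>{0..M}. \<rho> l / (\<zeta> - z l t))) (at \<zeta> within sphere 0 1)"
    if "cmod \<zeta> = 1" "\<zeta> \<notin> (\<lambda>k. z k t) ` {0..M}" for \<zeta>
    using semiclassical t that unfolding semiclassical_deformation_def by auto
  show "circle_limit_exists (Caratheodory_fun (w t)) (z k t)" if "k \<in> {0..M}" "cmod (z k t) = 1" for k
    using lim[OF t, of k] that z0[OF t] by (cases "k = 0") auto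
qed (use moments[OF t] in auto)

lemma w_time_deriv:
  assumes "t \<in> S" "cmod \<zeta> = 1" "\<zeta> \<notin> (\<lambda>k. z k t) ` {0..M}"
  shows "((\<lambda>s. w s \<zeta>) has_vector_derivative - w t \<zeta> * (\<Sum>k=0..M. \<rho> k * zd k t / (\<zeta> - z k t))) (at t)"
  using semiclassical assms unfolding semiclassical_deformation_def zd_def by auto

text \<open>For fixed \<zeta> the ratio of the weights at times s and t is the product of the
  quotients (\<zeta> - z_k(s)) / (\<zeta> - z_k(t)) raised to the powers \<rho>_k. A displacement of
  at most a quarter of the distance keeps these quotients 1 - Q in the right half plane, where the
  principal logarithm is differentiable; |exp E - 1| is then estimated linearly in the
  displacements.\<close>

lemma time_comparison:
  assumes J: "{min s t..max s t} \<subseteq> S" and \<zeta>: "cmod \<zeta> = 1"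
    and q: "\<And>k u. k \<in> {0..M} \<Longrightarrow> u \<in> {min s t..max s t} \<Longrightarrow> cmod (z k u - z k t) \<le> cmod (\<zeta> - z k t) / 4"
    and ns: "\<And>k. k \<in> {0..M} \<Longrightarrow> \<zeta> \<noteq> z k t"
  shows "cmod (w s \<zeta> - w t \<zeta>) \<le> cmod (w t \<zeta>) *
     (exp (\<Sum>k=0..M. cmod (\<rho> k)) * (2 * (\<Sum>k=0..M. cmod (\<rho> k) * (cmod (z k s - z k t) / cmod (\<zeta> - z k t)))))"
proof -
  define J where "J = {min s t..max s t}"
  define Q where "Q k u = (z k u - z k t) / (\<zeta> - z k t)" for k u
  have Qb: "cmod (Q k u) \<le> 1/4" if "k \<in> {0..M}" "u \<in> J" for k u
    using q[of k u] ns[of k] that by (simp add: Q_def norm_divide divide_le_eq J_def)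
  have Re1: "Re (1 - Q k u) > 0" if "k \<in> {0..M}" "u \<in> J" for k u
    using Qb[OF that] complex_Re_le_cmod[of "Q k u"] by simp
  have nsu: "\<zeta> \<noteq> z k u" if "k \<in> {0..M}" "u \<in> J" for k u
    using q[of k u] ns[of k] that by (auto simp: J_def)
  define E where "E u = (\<Sum>k=0..M. \<rho> k * Ln (1 - Q k u))" for u
  have E': "(E has_vector_derivative (\<Sum>k=0..M. \<rho> k * (- zd k u / (\<zeta> - z k u)))) (at u within J)" if u: "u \<in> J" for u
    unfolding E_def
  proof (rule has_vector_derivative_sum)
    fix k assume k: "k \<in> {0..M}"
    have "(z k has_vector_derivative zd k u) (at u within J)"
      using subsetD[OF J] u unfolding J_def by (intro has_vector_derivative_at_within[OF z_deriv] k) blast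
    hence "((\<lambda>u. 1 - (z k u - z k t) * (1 / (\<zeta> - z k t))) has_vector_derivative 0 - (zd k u - 0) * (1 / (\<zeta> - z k t))) (at u within J)"
      by (intro has_vector_derivative_diff has_vector_derivative_mult_left has_vector_derivative_const)
    hence 1: "((\<lambda>u. 1 - Q k u) has_vector_derivative - zd k u / (\<zeta> - z k t)) (at u within J)"
      by (simp add: Q_def)
    have 2: "(Ln has_field_derivative inverse (1 - Q k u)) (at (1 - Q k u) within (\<lambda>u. 1 - Q k u) ` J)"
      using Re1[OF k u] by (intro has_field_derivative_at_within[OF has_field_derivative_Ln]) (auto simp: complex_nonpos_Reals_iff)
    have "(Ln \<circ> (\<lambda>u. 1 - Q k u) has_vector_derivative (- zd k u / (\<zeta> - z k t)) * inverse (1 - Q k u)) (at u within J)"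
      by (rule field_vector_diff_chain_within[OF 1 2])
    moreover have "1 - Q k u = (\<zeta> - z k u) / (\<zeta> - z k t)" using ns[OF k] by (simp add: Q_def field_simps)
    hence "(- zd k u / (\<zeta> - z k t)) * inverse (1 - Q k u) = - zd k u / (\<zeta> - z k u)"
      using ns[OF k] nsu[OF k u] by simp
    ultimately have "((\<lambda>u. Ln (1 - Q k u)) has_vector_derivative - zd k u / (\<zeta> - z k u)) (at u within J)"
      by (simp add: o_def)
    thus "((\<lambda>u. \<rho> k * Ln (1 - Q k u)) has_vector_derivative \<rho> k * (- zd k u / (\<zeta> - z k u))) (at u within J)"
      by (rule has_vector_derivative_mult_right)
  qed
  have const: "((\<lambda>u. w u \<zeta> * exp (- E u)) has_vector_derivative 0) (at u within J)" if u: "u \<in> J" for u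
  proof -
    have uS: "u \<in> S" using subsetD[OF J] u unfolding J_def by blast
    have w': "((\<lambda>u. w u \<zeta>) has_vector_derivative - w u \<zeta> * (\<Sum>k=0..M. \<rho> k * zd k u / (\<zeta> - z k u))) (at u within J)"
    proof -
      have "\<zeta> \<notin> (\<lambda>k. z k u) ` {0..M}" using nsu[OF _ u] by blast
      thus ?thesis by (rule has_vector_derivative_at_within[OF w_time_deriv[OF uS \<zeta>]])
    qed
    have e': "((\<lambda>u. exp (- E u)) has_vector_derivative - (\<Sum>k=0..M. \<rho> k * (- zd k u / (\<zeta> - z k u))) * exp (- E u)) (at u within J)"
      using field_vector_diff_chain_within[OF has_vector_derivative_minus[OF E'[OF u]], of exp "exp (- E u)"]
      by (simp add: o_def DERIV_exp has_field_derivative_at_within)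
    from has_vector_derivative_mult[OF w' e'] show ?thesis
      by (simp add: sum_negf)
  qed
  obtain c where c: "\<And>u. u \<in> J \<Longrightarrow> w u \<zeta> * exp (- E u) = c"
    using has_vector_derivative_zero_constant[of J "\<lambda>u. w u \<zeta> * exp (- E u)"] const by (auto simp: J_def)
  have "E t = 0" by (simp add: E_def Q_def)
  hence "w s \<zeta> * exp (- E s) = w t \<zeta>" using c[of s] c[of t] by (auto simp: J_def)
  hence ws: "w s \<zeta> = w t \<zeta> * exp (E s)" by (simp add: exp_minus field_simps)
  define B where "B = 2 * (\<Sum>k=0..M. cmod (\<rho> k) * (cmod (z k s - z k t) / cmod (\<zeta> - z k t)))"
  have "cmod (E s) \<le> (\<Sum>k=0..M. cmod (\<rho> k) * (2 * cmod (Q k s)))"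
    unfolding E_def
  proof (rule sum_norm_le)
    fix k assume k: "k \<in> {0..M}"
    have "cmod (Ln (1 + (- Q k s))) \<le> 2 * cmod (- Q k s)"
      using Qb[OF k, of s] by (intro norm_Ln_le) (auto simp: J_def)
    thus "cmod (\<rho> k * Ln (1 - Q k s)) \<le> cmod (\<rho> k) * (2 * cmod (Q k s))"
      by (simp add: norm_mult mult_left_mono)
  qed
  also have "\<dots> = B" by (simp add: B_def Q_def norm_divide sum_distrib_left mult_ac)
  finally have EB: "cmod (E s) \<le> B" .
  have "B = (\<Sum>k=0..M. cmod (\<rho> k) * (2 * cmod (Q k s)))"
    by (simp add: B_def Q_def norm_divide sum_distrib_left mult_ac)
  also have "\<dots> \<le> (\<Sum>k=0..M. cmod (\<rho> k))"
    using Qb[of _ s] by (intro sum_mono mult_left_le) (fastforce simp: J_def)+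
  finally have BR: "B \<le> (\<Sum>k=0..M. cmod (\<rho> k))" .
  have "cmod (w s \<zeta> - w t \<zeta>) = cmod (w t \<zeta>) * cmod (exp (E s) - 1)"
    by (simp add: ws norm_mult[symmetric] right_diff_distrib)
  also have "\<dots> \<le> cmod (w t \<zeta>) * (exp (\<Sum>k=0..M. cmod (\<rho> k)) * B)"
  proof (intro mult_left_mono)
    have "cmod (exp (E s) - 1) \<le> exp (cmod (E s)) * cmod (E s)" by (rule cmod_exp_minus_one_le)
    also have "\<dots> \<le> exp (\<Sum>k=0..M. cmod (\<rho> k)) * B"
      using EB BR by (intro mult_mono) auto
    finally show "cmod (exp (E s) - 1) \<le> exp (\<Sum>k=0..M. cmod (\<rho> k)) * B" .
  qed simp
  finally show ?thesis by (simp add: B_def)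
qed

text \<open>A common Lipschitz constant for all singular points, with one of the two times fixed at
  t. It sets the scale 4 L |s - t| that separates the far zone from the near zone.\<close>

lemma local_Lipschitz:
  assumes t: "t \<in> S"
  obtains L d where "L \<ge> 1" "d > 0" "\<And>s. \<bar>s - t\<bar> < d \<Longrightarrow> s \<in> S"
    "\<And>s k. \<bar>s - t\<bar> < d \<Longrightarrow> k \<in> {0..M} \<Longrightarrow> cmod (z k s - z k t) \<le> L * \<bar>s - t\<bar>"
proof -
  define L where "L = (\<Sum>k=0..M. cmod (zd k t)) + 1"
  have "eventually (\<lambda>s. \<forall>k\<in>{0..M}. cmod (z k s - z k t) \<le> (cmod (zd k t) + 1) * \<bar>s - t\<bar>) (nhds t)"
    by (intro eventually_ball_finite ballI has_vector_derivative_imp_local_Lipschitz z_deriv t) auto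
  moreover have "eventually (\<lambda>s. s \<in> S) (nhds t)" using open_S t by (rule eventually_nhds_in_open)
  ultimately have "eventually (\<lambda>s. s \<in> S \<and> (\<forall>k\<in>{0..M}. cmod (z k s - z k t) \<le> L * \<bar>s - t\<bar>)) (nhds t)"
  proof eventually_elim
    case (elim s)
    have "cmod (z k s - z k t) \<le> L * \<bar>s - t\<bar>" if k: "k \<in> {0..M}" for k
    proof -
      have "cmod (zd k t) \<le> (\<Sum>k=0..M. cmod (zd k t))" using k by (intro member_le_sum) auto
      hence "(cmod (zd k t) + 1) * \<bar>s - t\<bar> \<le> L * \<bar>s - t\<bar>" by (intro mult_right_mono) (auto simp: L_def)
      thus ?thesis using elim k by (meson order_trans)
    qed
    thus ?case using elim by blast
  qed
  then obtain d where "d > 0" "\<And>s. dist s t < d \<Longrightarrow> s \<in> S \<and> (\<forall>k\<in>{0..M}. cmod (z k s - z k t) \<le> L * \<bar>s - t\<bar>)"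
    unfolding eventually_nhds_metric by blast
  moreover have "L \<ge> 1" by (simp add: L_def sum_nonneg)
  ultimately show ?thesis using that[of L d] by (auto simp: dist_real_def)
qed

end

section \<open>An integrable majorant for the difference quotients of the weight\<close>

context weight_deformation
begin

text \<open>In the far zone every singular point has moved by at most a quarter of its distance to
  \<zeta>, so the comparison in time applies. The first bound majorises the difference quotient by
  poles of w at time t, which are integrable; the second compares sizes only and is used at the
  outer edge of the near zone.\<close>

lemma far_bound:
  assumes L: "\<And>s. \<bar>s - t\<bar> < d \<Longrightarrow> s \<in> S"
    "\<And>s k. \<bar>s - t\<bar> < d \<Longrightarrow> k \<in> {0..M} \<Longrightarrow> cmod (z k s - z k t) \<le> L * \<bar>s - t\<bar>"
    and s: "\<bar>s - t\<bar> < d" and \<zeta>: "cmod \<zeta> = 1" and L0: "L > 0"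
    and far: "\<And>k. k \<in> {0..M} \<Longrightarrow> \<zeta> \<noteq> z k t \<and> 4 * L * \<bar>s - t\<bar> \<le> cmod (\<zeta> - z k t)"
  shows "cmod (w s \<zeta> - w t \<zeta>) \<le> \<bar>s - t\<bar> *
      (exp (\<Sum>k=0..M. cmod (\<rho> k)) * 2 * L * (\<Sum>k=0..M. cmod (\<rho> k) * (cmod (w t \<zeta>) / cmod (\<zeta> - z k t))))"
    and "cmod (w s \<zeta>) \<le> cmod (w t \<zeta>) * (1 + exp (\<Sum>k=0..M. cmod (\<rho> k)) * (\<Sum>k=0..M. cmod (\<rho> k)))"
proof -
  define R where "R = (\<Sum>k=0..M. cmod (\<rho> k))"
  have 1: "cmod (w s \<zeta> - w t \<zeta>) \<le> cmod (w t \<zeta>) *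
     (exp R * (2 * (\<Sum>k=0..M. cmod (\<rho> k) * (cmod (z k s - z k t) / cmod (\<zeta> - z k t)))))"
    unfolding R_def
  proof (rule time_comparison)
    have J: "\<bar>u - t\<bar> \<le> \<bar>s - t\<bar>" if "u \<in> {min s t..max s t}" for u using that by auto
    show "{min s t..max s t} \<subseteq> S" using J s L(1) by (meson le_less_trans subsetI)
    show "cmod (z k u - z k t) \<le> cmod (\<zeta> - z k t) / 4" if "k \<in> {0..M}" "u \<in> {min s t..max s t}" for k u
    proof -
      have "cmod (z k u - z k t) \<le> L * \<bar>u - t\<bar>" using J[OF that(2)] s by (intro L(2) that) auto
      also have "\<dots> \<le> L * \<bar>s - t\<bar>" using J[OF that(2)] L0 by (intro mult_left_mono) auto
      finally show ?thesis using far[OF that(1)] by simp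
    qed
  qed (use far \<zeta> in auto)
  have "(\<Sum>k=0..M. cmod (\<rho> k) * (cmod (z k s - z k t) / cmod (\<zeta> - z k t)))
     \<le> (\<Sum>k=0..M. cmod (\<rho> k) * (L * \<bar>s - t\<bar> / cmod (\<zeta> - z k t)))"
    using L(2) s by (intro sum_mono mult_left_mono divide_right_mono) auto
  hence "cmod (w s \<zeta> - w t \<zeta>) \<le> cmod (w t \<zeta>) *
     (exp R * (2 * (\<Sum>k=0..M. cmod (\<rho> k) * (L * \<bar>s - t\<bar> / cmod (\<zeta> - z k t)))))"
    by (intro order_trans[OF 1] mult_left_mono) auto
  also have "\<dots> = \<bar>s - t\<bar> * (exp R * 2 * L * (\<Sum>k=0..M. cmod (\<rho> k) * (cmod (w t \<zeta>) / cmod (\<zeta> - z k t))))"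
    by (simp add: sum_distrib_left mult_ac)
  finally show "cmod (w s \<zeta> - w t \<zeta>) \<le> \<bar>s - t\<bar> *
      (exp (\<Sum>k=0..M. cmod (\<rho> k)) * 2 * L * (\<Sum>k=0..M. cmod (\<rho> k) * (cmod (w t \<zeta>) / cmod (\<zeta> - z k t))))"
    by (simp add: R_def)
  have "(\<Sum>k=0..M. cmod (\<rho> k) * (cmod (z k s - z k t) / cmod (\<zeta> - z k t))) \<le> (\<Sum>k=0..M. cmod (\<rho> k) * (1/4))"
  proof (intro sum_mono mult_left_mono)
    fix k assume k: "k \<in> {0..M}"
    have "cmod (z k s - z k t) \<le> cmod (\<zeta> - z k t) / 4" using L(2)[OF s k] far[OF k] by linarith
    thus "cmod (z k s - z k t) / cmod (\<zeta> - z k t) \<le> 1/4" using far[OF k] by (simp add: divide_le_eq)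
  qed auto
  also have "\<dots> = R / 4" by (simp add: R_def sum_divide_distrib)
  also have "\<dots> \<le> R / 2" by (simp add: R_def sum_nonneg)
  finally have "cmod (w s \<zeta> - w t \<zeta>) \<le> cmod (w t \<zeta>) * (exp R * (2 * (R / 2)))"
    by (intro order_trans[OF 1] mult_left_mono) auto
  hence "cmod (w s \<zeta>) \<le> cmod (w t \<zeta>) + cmod (w t \<zeta>) * (exp R * R)"
    using norm_triangle_sub[of "w s \<zeta>" "w t \<zeta>"] by simp
  thus "cmod (w s \<zeta>) \<le> cmod (w t \<zeta>) * (1 + exp (\<Sum>k=0..M. cmod (\<rho> k)) * (\<Sum>k=0..M. cmod (\<rho> k)))"
    by (simp add: R_def algebra_simps)
qed

text \<open>Close to a singular point on the circle, the weight at time \<open>s\<close> is compared, along the circle,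
  with its value at one of the two points at distance of order \<open>\<bar>s - t\<bar>\<close>; the arc to one of them
  avoids the singularity at time \<open>s\<close>.\<close>

lemma near_bound:
  assumes t: "t \<in> S" and L: "\<And>s. \<bar>s - t\<bar> < d \<Longrightarrow> s \<in> S"
    "\<And>s k. \<bar>s - t\<bar> < d \<Longrightarrow> k \<in> {0..M} \<Longrightarrow> cmod (z k s - z k t) \<le> L * \<bar>s - t\<bar>"
    and L1: "L \<ge> 1" and d: "d > 0" and k: "k \<in> {0..M}"
  obtains h \<delta> where "\<delta> > 0" "moments_exist (\<lambda>\<zeta>. of_real (h \<zeta>))" "\<And>\<zeta>. h \<zeta> \<ge> 0"
    "\<And>s \<zeta>. \<bar>s - t\<bar> < \<delta> \<Longrightarrow> cmod \<zeta> = 1 \<Longrightarrow> \<zeta> \<notin> (\<lambda>l. z l s) ` {0..M} \<Longrightarrow> \<zeta> \<noteq> z k t \<Longrightarrow>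
       cmod (\<zeta> - z k t) < 4 * L * \<bar>s - t\<bar> \<Longrightarrow> cmod (w s \<zeta>) \<le> \<bar>s - t\<bar> * h \<zeta>"
proof (cases "cmod (z k t) = 1")
  case False
  \<comment> \<open>If z_k(t) is off the circle, the near zone misses the circle for s this close to
    t, so the claim is vacuous.\<close>
  define \<delta> where "\<delta> = \<bar>1 - cmod (z k t)\<bar> / (4 * L)"
  show ?thesis
  proof (rule that[of \<delta> "\<lambda>_. 0"])
    show "\<delta> > 0" using False L1 by (simp add: \<delta>_def)
    show "moments_exist (\<lambda>\<zeta>. of_real 0)" by (simp add: moments_exist_zero)
    fix s \<zeta> assume a: "\<bar>s - t\<bar> < \<delta>" "cmod \<zeta> = 1" "cmod (\<zeta> - z k t) < 4 * L * \<bar>s - t\<bar>"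
    have "\<bar>1 - cmod (z k t)\<bar> \<le> cmod (\<zeta> - z k t)" using norm_triangle_ineq3[of \<zeta> "z k t"] a(2) by simp
    also have "\<dots> < 4 * L * \<bar>s - t\<bar>" by fact
    also have "\<dots> < 4 * L * \<delta>" using a(1) L1 by simp
    also have "\<dots> = \<bar>1 - cmod (z k t)\<bar>" using L1 by (simp add: \<delta>_def)
    finally show "cmod (w s \<zeta>) \<le> \<bar>s - t\<bar> * 0" by simp
  qed simp
next
  case True
  interpret W: semiclassical_weight "{0..M}" "\<lambda>k. z k t" \<rho> "w t" by (rule semiclassical_weight[OF t])
  obtain c where c: "z k t = cis c" using True by (metis obtain_angle_near)
  obtain e where e: "0 < e" "e \<le> 1" and sep: "\<And>l. l \<in> {0..M} \<Longrightarrow> l \<noteq> k \<Longrightarrow> 2 * e \<le> cmod (z k t - z l t)"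
    using W.separation[OF k] by metis
  obtain C e' where C: "C > 0" "e' > 0" and loc:
    "\<And>\<zeta>. cmod \<zeta> = 1 \<Longrightarrow> \<zeta> \<noteq> z k t \<Longrightarrow> cmod (\<zeta> - z k t) < e' \<Longrightarrow>
       if Re (\<rho> k) > 0 then cmod (w t \<zeta>) \<le> C * cmod (\<zeta> - z k t) powr Re (\<rho> k) else w t \<zeta> = 0"
    using W.local_behaviour[OF k True] by metis
  define D where "D = 2 + (\<Sum>l=0..M. cmod (z l t))"
  have D2: "D \<ge> 2" unfolding D_def by (simp add: sum_nonneg)
  define K where "K = comparison_const {0..M} \<rho> e D"
  have K: "K > 0" unfolding K_def using e D2 by (intro comparison_const_pos) auto
  define a where "a = Re (\<rho> k)"
  define b where "b = (if a > 0 then min 1 a else 1)"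
  have b: "0 < b" "b \<le> 1" by (auto simp: b_def)
  define R where "R = 1 + exp (\<Sum>k=0..M. cmod (\<rho> k)) * (\<Sum>k=0..M. cmod (\<rho> k))"
  have R: "R \<ge> 1" by (simp add: R_def sum_nonneg)
  \<comment> \<open>The factors as they arise, with T = |s - t|: \<open>R\<close> compares the two
    times at the edge point, C (32 L)^a T^a bounds w at time t there, \<open>K\<close> belongs to
    the comparison along the arc, and (4 L)^(1 - b) comes from trading T for the distance to
    z_k.\<close>
  define G where "G = R * C * (32 * L) powr a * K * (4 * L) powr (1 - b)"
  have G: "G > 0" using R C K L1 by (simp add: G_def)
  define h where "h \<zeta> = G * cmod (\<zeta> - z k t) powr (b - 1)" for \<zeta>
  define \<delta> where "\<delta> = min (min d 1) (min (e / (64 * L)) (e' / (64 * L)))"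
  show ?thesis
  proof (rule that[of \<delta> h])
    show "\<delta> > 0" using d e C L1 by (simp add: \<delta>_def)
    show "moments_exist (\<lambda>\<zeta>. of_real (h \<zeta>))"
      using moments_exist_mult_left[OF moments_exist_powr_distance[OF True b], of G] by (simp add: h_def)
    show "h \<zeta> \<ge> 0" for \<zeta> using G by (simp add: h_def)
  next
    fix s \<zeta> assume s: "\<bar>s - t\<bar> < \<delta>" and \<zeta>: "cmod \<zeta> = 1" "\<zeta> \<notin> (\<lambda>l. z l s) ` {0..M}" "\<zeta> \<noteq> z k t"
      and near: "cmod (\<zeta> - z k t) < 4 * L * \<bar>s - t\<bar>"
    define T where "T = \<bar>s - t\<bar>"
    have T: "T > 0" using near le_less_trans[OF norm_ge_zero near] L1 by (simp add: T_def zero_less_mult_iff)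
    have sd: "\<bar>s - t\<bar> < d" "T < 1" "64 * L * T < e" "64 * L * T < e'"
      using s L1 by (auto simp: \<delta>_def T_def field_simps)
    have sS: "s \<in> S" using L(1) sd by blast
    \<comment> \<open>Half the angular width of the arc around z_k(t). In the near zone the angle of
      \<zeta> is below 16 L T = H / 2. A point at angle H or - H has chord at least H / 4 = 8 L T,
      so it lies in the far zone with respect to z_k, and even after z_k has moved by L T it is
      farther from it than \<zeta> (at least 7 L T against at most 5 L T).\<close>
    define H where "H = 32 * L * T"
    have H: "0 < H" "2 * H < e" "2 * H < e'" using sd T L1 by (auto simp: H_def)
    have LT: "0 < L * T" "64 * (L * T) < e" using T L1 sd(3) by (auto simp: mult.assoc)
    obtain u where u: "\<zeta> = cis (c + u)" "\<bar>u\<bar> < H / 2"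
    proof -
      obtain al where "\<zeta> = cis al" "\<bar>al - c\<bar> \<le> 4 * cmod (\<zeta> - cis c)" using obtain_angle_near[OF \<zeta>(1), of c] by metis
      thus ?thesis using that[of "al - c"] near by (simp add: c[symmetric] H_def T_def)
    qed
    have arc: "cmod (cis (c + v) - z k t) \<le> \<bar>v\<bar>" "\<bar>v\<bar> / 4 \<le> cmod (cis (c + v) - z k t)" if "\<bar>v\<bar> \<le> H" for v
      using cmod_cis_diff_le[of "c + v" c] cmod_cis_diff_ge[of "c + v" c] that H e pi_ge_two by (auto simp: c)
    have arcl: "e + L * T \<le> cmod (cis (c + v) - z l t)" if "\<bar>v\<bar> \<le> H" "l \<in> {0..M}" "l \<noteq> k" for v l
    proof -
      have "cmod (z k t - z l t) \<le> cmod (z k t - cis (c + v)) + cmod (cis (c + v) - z l t)"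
        using norm_triangle_ineq[of "z k t - cis (c + v)" "cis (c + v) - z l t"] by simp
      moreover have "H = 32 * (L * T)" by (simp add: H_def)
      ultimately show ?thesis
        using sep[OF that(2,3)] arc(1)[OF that(1)] that(1) LT by (simp add: norm_minus_commute)
    qed
    have zs: "cmod (z l s - z l t) \<le> L * T" if "l \<in> {0..M}" for l using L(2)[OF sd(1) that] by (simp add: T_def)
    have arcls: "e \<le> cmod (cis (c + v) - z l s)" if "\<bar>v\<bar> \<le> H" "l \<in> {0..M}" "l \<noteq> k" for v l
    proof -
      have "cmod (cis (c + v) - z l t) \<le> cmod (cis (c + v) - z l s) + cmod (z l s - z l t)"
        using norm_triangle_ineq[of "cis (c + v) - z l s" "z l s - z l t"] by simp
      thus ?thesis using arcl[OF that] zs[OF that(2)] by linarith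
    qed
    have Ds: "cmod (cis \<theta> - z l s) \<le> D" if "l \<in> {0..M}" for \<theta> l
    proof -
      have "cmod (z l t) \<le> (\<Sum>l=0..M. cmod (z l t))" using that by (intro member_le_sum) auto
      moreover have "L * T \<le> 1" using LT e by simp
      moreover have "cmod (z l s) \<le> cmod (z l t) + cmod (z l s - z l t)" using norm_triangle_sub[of "z l s" "z l t"] by simp
      ultimately show ?thesis using norm_triangle_ineq4[of "cis \<theta>" "z l s"] zs[OF that] by (simp add: D_def)
    qed
    have uk: "cis (c + u) \<noteq> z k s" using \<zeta>(2) k u(1) by auto
    \<comment> \<open>If the arcs from \<zeta> to both end points met z_k(s), the two angles would
      agree, as \<open>cis\<close> is injective on short intervals; both would then be the angle of
      \<zeta>, which is not singular at time s.\<close>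
    have "\<exists>v\<in>{H, - H}. \<forall>\<theta>\<in>{c + min u v..c + max u v}. cis \<theta> \<noteq> z k s"
    proof (rule ccontr)
      assume "\<not> ?thesis"
      then obtain p q where p: "p \<in> {c + min u H..c + max u H}" "cis p = z k s"
        and q: "q \<in> {c + min u (- H)..c + max u (- H)}" "cis q = z k s" by blast
      have "min u H = u" "max u H = H" "min u (- H) = - H" "max u (- H) = u" using u H by auto
      hence pq: "c + u \<le> p" "p \<le> c + H" "c - H \<le> q" "q \<le> c + u" using p q by auto
      have "\<bar>p - q\<bar> \<le> pi" using pq H e pi_ge_two by auto
      hence "p = q" using p q by (intro cis_eq_near) auto
      hence "p = c + u" using pq by simp
      thus False using p uk by simp
    qed
    then obtain v where v: "v = H \<or> v = - H" and free: "\<And>\<theta>. \<theta> \<in> {c + min u v..c + max u v} \<Longrightarrow> cis \<theta> \<noteq> z k s" by blast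
    have va: "\<bar>v\<bar> = H" using v H by auto
    have bet: "\<bar>\<theta> - c\<bar> \<le> H" if "\<theta> \<in> {c + min u v..c + max u v}" for \<theta> using that va u(2) by (auto simp: abs_le_iff)
    define \<eta> where "\<eta> = cis (c + v)"
    have \<eta>k: "8 * (L * T) \<le> cmod (\<eta> - z k t)" "cmod (\<eta> - z k t) \<le> H"
      using arc[of v] va by (auto simp: \<eta>_def H_def)
    have comp: "cmod (w s (cis (c + u))) \<le> cmod (w s \<eta>) * K * (cmod (cis (c + u) - z k s) / cmod (\<eta> - z k s)) powr Re (\<rho> k)"
      unfolding K_def \<eta>_def
    proof (rule circle_ode_comparison[where a = "c + min u v" and b = "c + max u v" and z = "\<lambda>k. z k s"])
      interpret Ws: semiclassical_weight "{0..M}" "\<lambda>k. z k s" \<rho> "w s" by (rule semiclassical_weight[OF sS])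
      have far: "e \<le> cmod (cis \<theta> - z l s)" if "\<theta> \<in> {c + min u v..c + max u v}" "l \<in> {0..M}" "l \<noteq> k" for \<theta> l
        using arcls[OF bet[OF that(1)] that(2,3)] by simp
      show "(w s has_field_derivative w s (cis \<theta>) * (\<Sum>l\<in>{0..M}. \<rho> l / (cis \<theta> - z l s))) (at (cis \<theta>) within sphere 0 1)"
        if "\<theta> \<in> {c + min u v..c + max u v}" for \<theta>
      proof (rule Ws.ode)
        show "cis \<theta> \<notin> (\<lambda>k. z k s) ` {0..M}" using free[OF that] far[OF that] e by force
      qed simp
      show "e \<le> cmod (cis \<theta> - z l s) \<and> cmod (cis \<theta> - z l s) \<le> D"
        if "\<theta> \<in> {c + min u v..c + max u v}" "l \<in> {0..M}" "l \<noteq> k" for \<theta> l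
        using far[OF that] Ds[OF that(2)] by simp
      show "(c + max u v) - (c + min u v) \<le> 2 * pi" using va u(2) H e pi_ge_two by (auto simp: abs_le_iff)
      show "cis \<theta> \<noteq> z k s" if "\<theta> \<in> {c + min u v..c + max u v}" for \<theta> using free[OF that] .
    qed (use k e D2 in auto)
    have edge: "cmod (w s \<eta>) \<le> cmod (w t \<eta>) * R"
      unfolding R_def
    proof (rule far_bound(2)[OF L sd(1)])
      show "\<eta> \<noteq> z l t \<and> 4 * L * \<bar>s - t\<bar> \<le> cmod (\<eta> - z l t)" if "l \<in> {0..M}" for l
      proof (cases "l = k")
        case True
        thus ?thesis using \<eta>k LT by (auto simp: T_def)
      next
        case False
        thus ?thesis using arcl[of v l] va that LT e by (auto simp: T_def \<eta>_def)
      qed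
    qed (use L1 in \<open>auto simp: \<eta>_def\<close>)
    have loc\<eta>: "if a > 0 then cmod (w t \<eta>) \<le> C * cmod (\<eta> - z k t) powr a else w t \<eta> = 0"
      unfolding a_def using \<eta>k LT H by (intro loc) (auto simp: \<eta>_def)
    show "cmod (w s \<zeta>) \<le> \<bar>s - t\<bar> * h \<zeta>"
    proof (cases "a > 0")
      case False
      hence "w t \<eta> = 0" using loc\<eta> by simp
      hence "w s \<eta> = 0" using edge by simp
      hence "cmod (w s \<zeta>) \<le> 0" using comp by (simp add: u(1))
      thus ?thesis using G by (simp add: h_def)
    next
      case True
      have x: "cmod (\<zeta> - z k t) > 0" using \<zeta>(3) by simp
      have "(cmod (cis (c + u) - z k s) / cmod (\<eta> - z k s)) powr Re (\<rho> k) \<le> 1 powr Re (\<rho> k)"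
      proof (rule powr_mono2)
        have "cmod (\<zeta> - z k s) \<le> cmod (\<zeta> - z k t) + cmod (z k s - z k t)"
          using norm_triangle_ineq4[of "\<zeta> - z k t" "z k s - z k t"] by simp
        moreover have "cmod (\<eta> - z k t) \<le> cmod (\<eta> - z k s) + cmod (z k s - z k t)"
          using norm_triangle_ineq[of "\<eta> - z k s" "z k s - z k t"] by simp
        ultimately have "cmod (\<zeta> - z k s) \<le> cmod (\<eta> - z k s)"
          using zs[OF k] \<eta>k near LT by (simp add: T_def)
        thus "cmod (cis (c + u) - z k s) / cmod (\<eta> - z k s) \<le> 1"
          by (simp add: u(1) divide_le_eq_1)
      qed (use True in \<open>auto simp: a_def\<close>)
      hence "cmod (w s \<zeta>) \<le> cmod (w s \<eta>) * K * 1"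
        using K unfolding u(1) by (intro order_trans[OF comp] mult_left_mono) auto
      also have "\<dots> \<le> (C * H powr a * R) * K * 1"
      proof (intro mult_right_mono)
        have "cmod (w t \<eta>) \<le> C * cmod (\<eta> - z k t) powr a" using loc\<eta> True by simp
        also have "\<dots> \<le> C * H powr a" using \<eta>k C True by (intro mult_left_mono powr_mono2) auto
        finally have "cmod (w t \<eta>) * R \<le> C * H powr a * R" using R by (intro mult_right_mono) auto
        thus "cmod (w s \<eta>) \<le> C * H powr a * R" using edge by linarith
      qed (use K in auto)
      also have "H powr a = (32 * L) powr a * T powr a" using L1 T by (simp add: H_def powr_mult)
      also have "T powr a = T * T powr (a - 1)" using T by (simp add: powr_diff)
      also have "(C * ((32 * L) powr a * (T * T powr (a - 1))) * R) * K * 1 = T * (R * C * (32 * L) powr a * K * T powr (a - 1))"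
        by (simp add: mult_ac)
      \<comment> \<open>Here the power of the time step is exchanged for a power of the distance: in
        the near zone T exceeds |\<zeta> - z_k(t)| / (4 L), and the exponent b - 1 is not positive.
        The factor T in front is the one that a difference quotient divides out.\<close>
      also have "\<dots> \<le> T * (R * C * (32 * L) powr a * K * ((4 * L) powr (1 - b) * cmod (\<zeta> - z k t) powr (b - 1)))"
      proof (intro mult_left_mono)
        have "T powr (a - 1) \<le> T powr (b - 1)" using T sd(2) True by (intro powr_mono') (auto simp: b_def)
        also have "\<dots> \<le> (cmod (\<zeta> - z k t) / (4 * L)) powr (b - 1)"
          using x near L1 b by (intro powr_mono2') (auto simp: T_def divide_le_eq mult_ac)
        also have "\<dots> = (4 * L) powr (1 - b) * cmod (\<zeta> - z k t) powr (b - 1)"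
        proof -
          have "(4 * L) powr (b - 1) = 1 / (4 * L) powr (1 - b)" using powr_minus_divide[of "4 * L" "1 - b"] by simp
          thus ?thesis using L1 x by (simp add: powr_divide)
        qed
        finally show "T powr (a - 1) \<le> (4 * L) powr (1 - b) * cmod (\<zeta> - z k t) powr (b - 1)" .
      qed (use R C K T in auto)
      finally show ?thesis by (simp add: h_def G_def T_def mult_ac)
    qed
  qed
qed

text \<open>In the near zone of z_k there is no cancellation to exploit: w at time s is bounded by
  the near estimate, and w at time t is at most 4 L |s - t| times its own quotient by the distance
  to z_k, because \<zeta> is that close. This explains the summand 4 L in the majorant; the summand
  A |\<rho>_k| comes from the far zone.\<close>

lemma difference_bound:
  assumes t: "t \<in> S"
  obtains H \<delta> where "\<delta> > 0" "\<And>s. \<bar>s - t\<bar> < \<delta> \<Longrightarrow> s \<in> S" "moments_exist (\<lambda>\<zeta>. of_real (H \<zeta>))"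
    "\<And>s \<zeta>. \<bar>s - t\<bar> < \<delta> \<Longrightarrow> cmod \<zeta> = 1 \<Longrightarrow> \<zeta> \<notin> (\<lambda>l. z l s) ` {0..M} \<Longrightarrow> \<zeta> \<notin> (\<lambda>l. z l t) ` {0..M} \<Longrightarrow>
       cmod (w s \<zeta> - w t \<zeta>) \<le> \<bar>s - t\<bar> * H \<zeta>"
proof -
  interpret W: semiclassical_weight "{0..M}" "\<lambda>k. z k t" \<rho> "w t" by (rule semiclassical_weight[OF t])
  obtain L d where L: "L \<ge> 1" "d > 0" "\<And>s. \<bar>s - t\<bar> < d \<Longrightarrow> s \<in> S"
    "\<And>s k. \<bar>s - t\<bar> < d \<Longrightarrow> k \<in> {0..M} \<Longrightarrow> cmod (z k s - z k t) \<le> L * \<bar>s - t\<bar>"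
    using local_Lipschitz[OF t] by metis
  \<comment> \<open>Majorant and radius belong together for each k; they are packed into a pair so
    that a single choice over k yields both.\<close>
  define Q where "Q k p \<longleftrightarrow> snd p > 0 \<and> moments_exist (\<lambda>\<zeta>. of_real (fst p \<zeta>)) \<and> (\<forall>\<zeta>. fst p \<zeta> \<ge> 0) \<and>
    (\<forall>s \<zeta>. \<bar>s - t\<bar> < snd p \<longrightarrow> cmod \<zeta> = 1 \<longrightarrow> \<zeta> \<notin> (\<lambda>l. z l s) ` {0..M} \<longrightarrow> \<zeta> \<noteq> z k t \<longrightarrow>
       cmod (\<zeta> - z k t) < 4 * L * \<bar>s - t\<bar> \<longrightarrow> cmod (w s \<zeta>) \<le> \<bar>s - t\<bar> * fst p \<zeta>)" for k p
  have "\<forall>k\<in>{0..M}. \<exists>p. Q k p"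
  proof
    fix k assume k: "k \<in> {0..M}"
    show "\<exists>p. Q k p"
    proof (rule near_bound[OF t L(3,4,1,2) k])
      fix h \<delta>
      assume "\<delta> > 0" "moments_exist (\<lambda>\<zeta>. of_real (h \<zeta>))" "\<And>\<zeta>. h \<zeta> \<ge> 0"
        "\<And>s \<zeta>. \<bar>s - t\<bar> < \<delta> \<Longrightarrow> cmod \<zeta> = 1 \<Longrightarrow> \<zeta> \<notin> (\<lambda>l. z l s) ` {0..M} \<Longrightarrow> \<zeta> \<noteq> z k t \<Longrightarrow>
          cmod (\<zeta> - z k t) < 4 * L * \<bar>s - t\<bar> \<Longrightarrow> cmod (w s \<zeta>) \<le> \<bar>s - t\<bar> * h \<zeta>"
      hence "Q k (h, \<delta>)" unfolding Q_def fst_conv snd_conv by blast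
      thus "\<exists>p. Q k p" by blast
    qed
  qed
  from bchoice[OF this] obtain P where PQ: "\<And>k. k \<in> {0..M} \<Longrightarrow> Q k (P k)" by blast
  have P: "\<And>k. k \<in> {0..M} \<Longrightarrow> snd (P k) > 0"
    "\<And>k. k \<in> {0..M} \<Longrightarrow> moments_exist (\<lambda>\<zeta>. of_real (fst (P k) \<zeta>))"
    "\<And>k \<zeta>. k \<in> {0..M} \<Longrightarrow> fst (P k) \<zeta> \<ge> 0"
    "\<And>k s \<zeta>. k \<in> {0..M} \<Longrightarrow> \<bar>s - t\<bar> < snd (P k) \<Longrightarrow> cmod \<zeta> = 1 \<Longrightarrow> \<zeta> \<notin> (\<lambda>l. z l s) ` {0..M} \<Longrightarrow> \<zeta> \<noteq> z k t \<Longrightarrow>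
       cmod (\<zeta> - z k t) < 4 * L * \<bar>s - t\<bar> \<Longrightarrow> cmod (w s \<zeta>) \<le> \<bar>s - t\<bar> * fst (P k) \<zeta>"
    using PQ unfolding Q_def by blast+
  define \<delta> where "\<delta> = Min (insert d ((\<lambda>k. snd (P k)) ` {0..M}))"
  have \<delta>: "\<delta> > 0" "\<delta> \<le> d" "\<delta> \<le> snd (P k)" if "k \<in> {0..M}" for k
  proof -
    show "\<delta> > 0" unfolding \<delta>_def using P(1) L(2) by (simp add: Min_gr_iff)
    show "\<delta> \<le> d" unfolding \<delta>_def by (intro Min_le) auto
    show "\<delta> \<le> snd (P k)" unfolding \<delta>_def using that by (intro Min_le) auto
  qed
  define A where "A = exp (\<Sum>k=0..M. cmod (\<rho> k)) * 2 * L"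
  have A: "A > 0" using L by (simp add: A_def)
  define H where "H \<zeta> = (\<Sum>k=0..M. (A * cmod (\<rho> k) + 4 * L) * (cmod (w t \<zeta>) / cmod (\<zeta> - z k t)) + fst (P k) \<zeta>)" for \<zeta>
  show ?thesis
  proof (rule that[of \<delta> H])
    show "\<delta> > 0" using \<delta>(1)[of 0] by simp
    show "s \<in> S" if "\<bar>s - t\<bar> < \<delta>" for s using that \<delta>(2)[of 0] L(3) by auto
    have "moments_exist (\<lambda>\<zeta>. of_real ((A * cmod (\<rho> k) + 4 * L) * (cmod (w t \<zeta>) / cmod (\<zeta> - z k t)) + fst (P k) \<zeta>))"
      if k: "k \<in> {0..M}" for k
      using moments_exist_add[OF moments_exist_mult_left[OF moments_exist_cmod[OF W.moments_exist_pole[OF k]], of "A * cmod (\<rho> k) + 4 * L"] P(2)[OF k]]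
      by (simp add: norm_divide)
    thus "moments_exist (\<lambda>\<zeta>. of_real (H \<zeta>))"
      unfolding H_def of_real_sum by (rule moments_exist_sum)
    fix s \<zeta> assume s: "\<bar>s - t\<bar> < \<delta>" and \<zeta>: "cmod \<zeta> = 1" "\<zeta> \<notin> (\<lambda>l. z l s) ` {0..M}" "\<zeta> \<notin> (\<lambda>l. z l t) ` {0..M}"
    have nn: "0 \<le> (A * cmod (\<rho> k) + 4 * L) * (cmod (w t \<zeta>) / cmod (\<zeta> - z k t)) + fst (P k) \<zeta>" if "k \<in> {0..M}" for k
      using A L P(3)[OF that] by simp
    show "cmod (w s \<zeta> - w t \<zeta>) \<le> \<bar>s - t\<bar> * H \<zeta>"
    proof (cases "\<forall>k\<in>{0..M}. 4 * L * \<bar>s - t\<bar> \<le> cmod (\<zeta> - z k t)")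
      case True
      have "cmod (w s \<zeta> - w t \<zeta>) \<le> \<bar>s - t\<bar> * (A * (\<Sum>k=0..M. cmod (\<rho> k) * (cmod (w t \<zeta>) / cmod (\<zeta> - z k t))))"
        unfolding A_def by (rule far_bound(1)[OF L(3,4)]) (use True \<zeta> s \<delta>(2)[of 0] L in auto)
      also have "\<dots> \<le> \<bar>s - t\<bar> * H \<zeta>"
        unfolding H_def sum_distrib_left[of A]
      proof (intro mult_left_mono sum_mono)
        fix k assume k: "k \<in> {0..M}"
        have "0 \<le> 4 * L * (cmod (w t \<zeta>) / cmod (\<zeta> - z k t))" using L by simp
        thus "A * (cmod (\<rho> k) * (cmod (w t \<zeta>) / cmod (\<zeta> - z k t))) \<le> (A * cmod (\<rho> k) + 4 * L) * (cmod (w t \<zeta>) / cmod (\<zeta> - z k t)) + fst (P k) \<zeta>"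
          using P(3)[OF k, of \<zeta>] unfolding distrib_right mult.assoc by linarith
      qed auto
      finally show ?thesis .
    next
      case False
      then obtain k where k: "k \<in> {0..M}" "cmod (\<zeta> - z k t) < 4 * L * \<bar>s - t\<bar>" by auto
      have zk: "\<zeta> \<noteq> z k t" using \<zeta>(3) k by auto
      have 1: "cmod (w s \<zeta>) \<le> \<bar>s - t\<bar> * fst (P k) \<zeta>"
        using \<delta>(3)[OF k(1)] s by (intro P(4) k \<zeta> zk) auto
      have 2: "cmod (w t \<zeta>) \<le> \<bar>s - t\<bar> * (4 * L * (cmod (w t \<zeta>) / cmod (\<zeta> - z k t)))"
      proof -
        have "cmod (w t \<zeta>) * cmod (\<zeta> - z k t) \<le> cmod (w t \<zeta>) * (4 * L * \<bar>s - t\<bar>)"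
          using k(2) by (intro mult_left_mono) auto
        thus ?thesis using zk by (simp add: field_simps)
      qed
      have "0 \<le> \<bar>s - t\<bar> * (A * cmod (\<rho> k) * (cmod (w t \<zeta>) / cmod (\<zeta> - z k t)))" using A by simp
      hence "cmod (w s \<zeta> - w t \<zeta>) \<le> \<bar>s - t\<bar> * ((A * cmod (\<rho> k) + 4 * L) * (cmod (w t \<zeta>) / cmod (\<zeta> - z k t)) + fst (P k) \<zeta>)"
        using 1 2 norm_triangle_ineq4[of "w s \<zeta>" "w t \<zeta>"] unfolding distrib_left distrib_right by linarith
      also have "\<dots> \<le> \<bar>s - t\<bar> * H \<zeta>"
        unfolding H_def using k nn by (intro mult_left_mono member_le_sum) auto
      finally show ?thesis .
    qed
  qed
qed

text \<open>Dominated convergence with the majorant just built. It is run along sequences of times,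
  because the bound at time s leaves out a finite set of points that depends on s.\<close>

lemma moment_deriv:
  assumes t: "t \<in> S" and g: "continuous_on (sphere 0 1) g"
  shows "((\<lambda>s. circle_mean (\<lambda>\<zeta>. w s \<zeta> * g \<zeta>)) has_vector_derivative
     - (\<Sum>k=1..M. \<rho> k * zd k t * circle_mean (\<lambda>\<zeta>. w t \<zeta> * g \<zeta> / (\<zeta> - z k t)))) (at t)"
proof -
  interpret W: semiclassical_weight "{0..M}" "\<lambda>k. z k t" \<rho> "w t" by (rule semiclassical_weight[OF t])
  obtain H \<delta> where \<delta>: "\<delta> > 0" "\<And>s. \<bar>s - t\<bar> < \<delta> \<Longrightarrow> s \<in> S" and H: "moments_exist (\<lambda>\<zeta>. of_real (H \<zeta>))"
    "\<And>s \<zeta>. \<bar>s - t\<bar> < \<delta> \<Longrightarrow> cmod \<zeta> = 1 \<Longrightarrow> \<zeta> \<notin> (\<lambda>l. z l s) ` {0..M} \<Longrightarrow> \<zeta> \<notin> (\<lambda>l. z l t) ` {0..M} \<Longrightarrow>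
       cmod (w s \<zeta> - w t \<zeta>) \<le> \<bar>s - t\<bar> * H \<zeta>"
    using difference_bound[OF t] by metis
  define D where "D \<zeta> = (- w t \<zeta> * (\<Sum>k=0..M. \<rho> k * zd k t / (\<zeta> - z k t))) * g \<zeta>" for \<zeta>
  have pole: "moments_exist (\<lambda>\<zeta>. w t \<zeta> * g \<zeta> / (\<zeta> - z k t))" if "k \<in> {0..M}" for k
    using moments_exist_times_continuous[OF W.moments_exist_pole[OF that] g] by simp
  have D_eq: "D = (\<lambda>\<zeta>. \<Sum>k=0..M. - (\<rho> k * zd k t) * (w t \<zeta> * g \<zeta> / (\<zeta> - z k t)))"
    by (simp add: D_def fun_eq_iff sum_distrib_left sum_distrib_right sum_negf mult_ac)
  have D_ex: "moments_exist D" unfolding D_eq by (intro moments_exist_sum moments_exist_mult_left pole)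
  have "circle_mean D = (\<Sum>k=0..M. - (\<rho> k * zd k t) * circle_mean (\<lambda>\<zeta>. w t \<zeta> * g \<zeta> / (\<zeta> - z k t)))"
    unfolding D_eq by (subst circle_mean_sum) (auto simp only: circle_mean_mult_left intro!: moments_exist_mult_left pole)
  \<comment> \<open>The term k = 0 drops out, since z_0 stays at the origin.\<close>
  also have "\<dots> = (\<Sum>k=1..M. - (\<rho> k * zd k t) * circle_mean (\<lambda>\<zeta>. w t \<zeta> * g \<zeta> / (\<zeta> - z k t)))"
    using zd0[OF t] by (intro sum.mono_neutral_right) (auto simp: Suc_le_eq)
  finally have D_val: "circle_mean D = - (\<Sum>k=1..M. \<rho> k * zd k t * circle_mean (\<lambda>\<zeta>. w t \<zeta> * g \<zeta> / (\<zeta> - z k t)))"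
    by (simp add: sum_negf)
  have mg: "moments_exist (\<lambda>\<zeta>. w s \<zeta> * g \<zeta>)" if "s \<in> S" for s
    by (rule moments_exist_times_continuous[OF moments[OF that] g])
  have "bounded (g ` sphere 0 1)"
    using g by (intro compact_imp_bounded compact_continuous_image) auto
  then obtain B where B: "\<And>\<zeta>. cmod \<zeta> = 1 \<Longrightarrow> cmod (g \<zeta>) \<le> B"
    unfolding bounded_iff by (metis imageI mem_sphere_0)
  have B0: "B \<ge> 0" using order_trans[OF norm_ge_zero B[of 1]] by simp
  define I where "I = {t - \<delta><..<t + \<delta>}"
  have I: "\<bar>s - t\<bar> < \<delta>" if "s \<in> I" for s using that by (auto simp: I_def)
  have "((\<lambda>s. (circle_mean (\<lambda>\<zeta>. w s \<zeta> * g \<zeta>) - circle_mean (\<lambda>\<zeta>. w t \<zeta> * g \<zeta>)) / of_real (s - t)) \<longlongrightarrow> circle_mean D) (at t within I)"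
    unfolding tendsto_at_iff_sequentially
  proof (intro allI impI)
    fix X assume X: "\<forall>i. X i \<in> I - {t}" "X \<longlonglongrightarrow> t"
    have XS: "X i \<in> S" "X i \<noteq> t" "\<bar>X i - t\<bar> < \<delta>" for i using X(1) I \<delta>(2) by auto
    define q where "q i \<zeta> = (w (X i) \<zeta> * g \<zeta> - w t \<zeta> * g \<zeta>) * (1 / of_real (X i - t))" for i \<zeta>
    have q_ex: "moments_exist (q i)" for i
      unfolding q_def by (intro moments_exist_mult_right moments_exist_diff mg XS t)
    have q_val: "(circle_mean (\<lambda>\<zeta>. w (X i) \<zeta> * g \<zeta>) - circle_mean (\<lambda>\<zeta>. w t \<zeta> * g \<zeta>)) / of_real (X i - t) = circle_mean (q i)" for i
      unfolding q_def by (subst circle_mean_mult_right, subst circle_mean_diff[OF mg[OF XS(1)] mg[OF t]]) simp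
    have q_eq: "q i \<zeta> = (w (X i) \<zeta> - w t \<zeta>) / of_real (X i - t) * g \<zeta>" for i \<zeta>
      unfolding q_def by (subst left_diff_distrib[symmetric]) (simp add: field_simps)
    have AEt: "AE \<theta> in lborel. \<theta> \<in> {0..2*pi} \<longrightarrow> cis \<theta> \<notin> (\<lambda>l. z l t) ` {0..M}" by (rule AE_cis_notin) simp
    have "(\<lambda>i. LINT \<theta>|lborel. indicator {0..2*pi} \<theta> *\<^sub>R q i (cis \<theta>)) \<longlonglongrightarrow> (LINT \<theta>|lborel. indicator {0..2*pi} \<theta> *\<^sub>R D (cis \<theta>))"
    proof (rule integral_dominated_convergence[where w = "\<lambda>\<theta>. B * cmod (indicator {0..2*pi} \<theta> *\<^sub>R complex_of_real (H (cis \<theta>)))"])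
      show "(\<lambda>\<theta>. indicator {0..2*pi} \<theta> *\<^sub>R D (cis \<theta>)) \<in> borel_measurable lborel"
        by (rule moments_exist_measurable[OF D_ex])
      show "(\<lambda>\<theta>. indicator {0..2*pi} \<theta> *\<^sub>R q i (cis \<theta>)) \<in> borel_measurable lborel" for i
        by (rule moments_exist_measurable[OF q_ex])
      show "integrable lborel (\<lambda>\<theta>. B * cmod (indicator {0..2*pi} \<theta> *\<^sub>R complex_of_real (H (cis \<theta>))))"
        using H(1) unfolding moments_exist_def set_integrable_def by (intro integrable_mult_right integrable_norm)
      show "AE \<theta> in lborel. (\<lambda>i. indicator {0..2*pi} \<theta> *\<^sub>R q i (cis \<theta>)) \<longlonglongrightarrow> indicator {0..2*pi} \<theta> *\<^sub>R D (cis \<theta>)"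
        using AEt
      proof eventually_elim
        case (elim \<theta>)
        show ?case
        proof (cases "\<theta> \<in> {0..2*pi}")
          case True
          hence ns: "cis \<theta> \<notin> (\<lambda>l. z l t) ` {0..M}" using elim by simp
          have "((\<lambda>s. (w s (cis \<theta>) - w t (cis \<theta>)) / of_real (s - t)) \<longlongrightarrow> - w t (cis \<theta>) * (\<Sum>k=0..M. \<rho> k * zd k t / (cis \<theta> - z k t))) (at t)"
            using w_time_deriv[OF t _ ns] unfolding has_vector_derivative_quotient by simp
          moreover have "filterlim X (at t) sequentially"
            unfolding filterlim_at using X(2) XS(2) by auto
          ultimately have "(\<lambda>i. (w (X i) (cis \<theta>) - w t (cis \<theta>)) / of_real (X i - t)) \<longlonglongrightarrow> - w t (cis \<theta>) * (\<Sum>k=0..M. \<rho> k * zd k t / (cis \<theta> - z k t))"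
            by (rule filterlim_compose)
          hence "(\<lambda>i. q i (cis \<theta>)) \<longlonglongrightarrow> D (cis \<theta>)"
            unfolding q_eq D_def by (intro tendsto_mult tendsto_const)
          thus ?thesis by (intro tendsto_scaleR tendsto_const)
        qed simp
      qed
      show "AE \<theta> in lborel. cmod (indicator {0..2*pi} \<theta> *\<^sub>R q i (cis \<theta>)) \<le> B * cmod (indicator {0..2*pi} \<theta> *\<^sub>R complex_of_real (H (cis \<theta>)))" for i
      proof -
        have "AE \<theta> in lborel. \<theta> \<in> {0..2*pi} \<longrightarrow> cis \<theta> \<notin> (\<lambda>l. z l (X i)) ` {0..M}" by (rule AE_cis_notin) simp
        thus ?thesis using AEt
        proof eventually_elim
          case (elim \<theta>)
          show ?case
          proof (cases "\<theta> \<in> {0..2*pi}")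
            case True
            have "cmod (w (X i) (cis \<theta>) - w t (cis \<theta>)) \<le> \<bar>X i - t\<bar> * H (cis \<theta>)"
              using elim True XS by (intro H(2)) auto
            hence "cmod (w (X i) (cis \<theta>) - w t (cis \<theta>)) / \<bar>X i - t\<bar> \<le> H (cis \<theta>)"
              using XS(2)[of i] by (simp add: divide_le_eq mult.commute)
            hence 1: "cmod ((w (X i) (cis \<theta>) - w t (cis \<theta>)) / of_real (X i - t)) \<le> H (cis \<theta>)"
              by (simp only: norm_divide norm_of_real)
            have "cmod (q i (cis \<theta>)) \<le> H (cis \<theta>) * B"
              unfolding q_eq norm_mult by (intro mult_mono 1 B order_trans[OF norm_ge_zero 1]) auto
            also have "\<dots> \<le> B * \<bar>H (cis \<theta>)\<bar>" using B0 by (simp add: mult.commute mult_left_mono)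
            finally show ?thesis using True by simp
          qed simp
        qed
      qed
    qed
    hence "(\<lambda>i. circle_mean (q i)) \<longlonglongrightarrow> circle_mean D"
      unfolding circle_mean_def set_lebesgue_integral_def by (intro tendsto_divide tendsto_const) auto
    thus "((\<lambda>s. (circle_mean (\<lambda>\<zeta>. w s \<zeta> * g \<zeta>) - circle_mean (\<lambda>\<zeta>. w t \<zeta> * g \<zeta>)) / of_real (s - t)) \<circ> X) \<longlonglongrightarrow> circle_mean D"
      unfolding o_def q_val .
  qed
  moreover have "at t within I = at t" unfolding I_def using \<delta> by (intro at_within_open) auto
  ultimately show ?thesis unfolding has_vector_derivative_quotient D_val by simp
qed

end

section \<open>Algebra of the bi-orthogonal system\<close>

text \<open>Isolates the linear algebra of a bilinear form with two dual sequences of polynomials,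
  one polynomial of each degree. The hypotheses are symmetric in the two arguments, so every fact
  about \<open>f\<close> yields one about \<open>g\<close> through \<open>flip\<close>.\<close>

locale dual_bases =
  fixes bf :: "complex poly \<Rightarrow> complex poly \<Rightarrow> complex" and f g :: "nat \<Rightarrow> complex poly" and \<kappa> :: "nat \<Rightarrow> complex"
  assumes bf_add: "bf (p + p') q = bf p q + bf p' q" "bf p (q + q') = bf p q + bf p q'"
    and bf_smult: "bf (smult c p) q = c * bf p q" "bf p (smult c q) = c * bf p q"
    and degree_f: "degree (f n) = n" and degree_g: "degree (g n) = n"
    and lead_f: "coeff (f n) n = \<kappa> n" and lead_g: "coeff (g n) n = \<kappa> n"
    and dual: "bf (f m) (g n) = (if m = n then 1 else 0)"
begin

lemma bf_zero: "bf 0 q = 0" "bf p 0 = 0"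
  using bf_smult(1)[of 0 0 q] bf_smult(2)[of p 0 0] by auto

lemma bf_diff: "bf (p - p') q = bf p q - bf p' q" "bf p (q - q') = bf p q - bf p q'"
  by (metis add_diff_cancel_right' bf_add(1) diff_add_cancel, metis add_diff_cancel_right' bf_add(2) diff_add_cancel)

lemma bf_sum: "bf (\<Sum>i\<in>A. P i) q = (\<Sum>i\<in>A. bf (P i) q)" "bf p (\<Sum>i\<in>A. P i) = (\<Sum>i\<in>A. bf p (P i))"
  by (induction A rule: infinite_finite_induct) (auto simp: bf_zero bf_add)

lemma kappa_nz: "\<kappa> n \<noteq> 0"
proof
  assume "\<kappa> n = 0"
  hence "f n = 0" using lead_f[of n] degree_f[of n] leading_coeff_0_iff[of "f n"] by simp
  thus False using dual[of n n] by (simp add: bf_zero)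
qed

text \<open>Induction that removes the top coefficient by a multiple of \<open>g m\<close>. Bounding
  coefficients instead of the degree lets the induction start at the zero polynomial.\<close>

lemma bf_low_degree: "(\<And>i. i \<ge> m \<Longrightarrow> coeff q i = 0) \<Longrightarrow> m \<le> n \<Longrightarrow> bf (f n) q = 0"
proof (induction m arbitrary: q)
  case 0
  hence "q = 0" by (simp add: poly_eq_iff)
  thus ?case by (simp add: bf_zero)
next
  case (Suc m)
  define q' where "q' = q - smult (coeff q m / \<kappa> m) (g m)"
  have "coeff q' i = 0" if "i \<ge> m" for i
    using that Suc.prems(1)[of i] kappa_nz[of m] lead_g[of m] degree_g[of m] coeff_eq_0[of "g m" i]
    by (cases "i = m") (auto simp: q'_def)
  hence "bf (f n) q' = 0" using Suc by auto
  thus ?case using Suc.prems(2) by (simp add: q'_def bf_diff bf_smult dual)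
qed

lemma bf_f: "degree q \<le> n \<Longrightarrow> bf (f n) q = coeff q n / \<kappa> n"
proof -
  assume d: "degree q \<le> n"
  define q' where "q' = q - smult (coeff q n / \<kappa> n) (g n)"
  have "coeff q' i = 0" if "i \<ge> n" for i
    using that d kappa_nz[of n] lead_g[of n] degree_g[of n] coeff_eq_0[of "g n" i] coeff_eq_0[of q i]
    by (cases "i = n") (auto simp: q'_def)
  hence "bf (f n) q' = 0" by (rule bf_low_degree) auto
  thus ?thesis by (simp add: q'_def bf_diff bf_smult dual)
qed

end

sublocale dual_bases \<subseteq> flip: dual_bases "\<lambda>p q. bf q p" g f \<kappa>
  by unfold_locales (auto simp: bf_add bf_smult degree_f degree_g lead_f lead_g dual)

context dual_bases
begin

text \<open>The leading coefficient of a polynomial of degree d is, up to the factor \<kappa>_d, its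
  pairing with \<open>g d\<close>.\<close>

lemma zero_by_dual_basis:
  assumes "\<And>i. i \<ge> n \<Longrightarrow> coeff p i = 0" "\<And>m. m < n \<Longrightarrow> bf p (g m) = 0"
  shows "p = 0"
proof (rule ccontr)
  assume p: "p \<noteq> 0"
  define d where "d = degree p"
  have "d < n" using assms(1)[of d] p by (auto simp: d_def not_less[symmetric])
  hence "coeff p d / \<kappa> d = 0" using assms(2)[of d] flip.bf_f[of p d] by (simp add: d_def)
  thus False using p kappa_nz[of d] by (simp add: d_def)
qed

lemma zero_by_monomials:
  assumes "\<And>i. i \<ge> n \<Longrightarrow> coeff p i = 0" "\<And>m. m < n \<Longrightarrow> bf p (monom 1 m) = 0"
  shows "p = 0"
proof (rule zero_by_dual_basis[OF assms(1)])
  fix m assume m: "m < n"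
  have "g m = (\<Sum>i\<le>m. smult (coeff (g m) i) (monom 1 i))"
    using poly_as_sum_of_monoms[of "g m"] by (simp add: degree_g smult_monom)
  hence "bf p (g m) = bf p (\<Sum>i\<le>m. smult (coeff (g m) i) (monom 1 i))" by simp
  also have "\<dots> = 0" using m assms(2) by (simp add: bf_sum bf_smult)
  finally show "bf p (g m) = 0" .
qed

text \<open>The recursion that carries differentiability in t from the leading coefficients to all
  coefficients.\<close>

lemma Gram_Schmidt: "f n = smult (\<kappa> n) (monom 1 n - (\<Sum>m<n. smult (bf (monom 1 n) (g m)) (f m)))"
proof -
  define r where "r = f n - smult (\<kappa> n) (monom 1 n - (\<Sum>m<n. smult (bf (monom 1 n) (g m)) (f m)))"
  have "r = 0"
  proof (rule zero_by_dual_basis[of n])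
    show "coeff r i = 0" if "i \<ge> n" for i
    proof -
      have "coeff (\<Sum>m<n. smult (bf (monom 1 n) (g m)) (f m)) i = 0"
        using that degree_f by (auto simp: coeff_sum intro!: sum.neutral coeff_eq_0)
      thus ?thesis using that lead_f[of n] degree_f[of n] coeff_eq_0[of "f n" i] by (cases "i = n") (auto simp: r_def)
    qed
    show "bf r (g m) = 0" if "m < n" for m
    proof -
      have "(\<Sum>k<n. bf (monom 1 n) (g k) * bf (f k) (g m)) = bf (monom 1 n) (g m)"
        using that by (simp add: dual if_distrib cong: if_cong)
      thus ?thesis using that by (simp add: r_def bf_diff bf_smult bf_sum dual)
    qed
  qed
  thus ?thesis by (simp add: r_def)
qed

end

section \<open>The pairing of a weight, its resolvents and its functions of the second kind\<close>

locale biorthogonal =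
  fixes w :: "complex \<Rightarrow> complex" and \<phi> \<phi>b :: "nat \<Rightarrow> complex poly"
  assumes moments: "moments_exist w" and system: "biorthogonal_system w \<phi> \<phi>b"
begin

definition "pairing p q = circle_mean (\<lambda>\<zeta>. w \<zeta> * (poly p \<zeta> * poly q (1 / \<zeta>)))"

lemma continuous_poly_compose: "continuous_on A f \<Longrightarrow> continuous_on A (\<lambda>\<zeta>. poly (p :: complex poly) (f \<zeta>))"
  by (induction p) (auto intro!: continuous_on_add continuous_on_mult)

lemma continuous_poly: "continuous_on (sphere 0 1) (\<lambda>\<zeta>. poly (p :: complex poly) \<zeta>)"
  by (rule continuous_poly_compose[OF continuous_on_id])

lemma continuous_poly_inverse: "continuous_on (sphere 0 1) (\<lambda>\<zeta>. poly (q :: complex poly) (1 / \<zeta>))"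
  by (rule continuous_poly_compose) (intro continuous_intros, auto)

lemma continuous_power_inverse: "continuous_on (sphere 0 1) (\<lambda>\<zeta>::complex. (1 / \<zeta>) ^ m)"
  by (intro continuous_intros) auto

lemma moments_exist_pairing: "moments_exist (\<lambda>\<zeta>. w \<zeta> * (poly p \<zeta> * poly q (1 / \<zeta>)))"
  by (intro moments_exist_times_continuous moments continuous_on_mult continuous_poly continuous_poly_inverse)

sublocale dual_bases pairing \<phi> \<phi>b "kappa \<phi>"
proof
  show "pairing (p + p') q = pairing p q + pairing p' q" for p p' q
    unfolding pairing_def poly_add distrib_left distrib_right
    by (intro circle_mean_add moments_exist_pairing)
  show "pairing p (q + q') = pairing p q + pairing p q'" for p q q'
    unfolding pairing_def poly_add distrib_left distrib_right
    by (intro circle_mean_add moments_exist_pairing)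
  show "pairing (smult c p) q = c * pairing p q" for c p q
    unfolding pairing_def circle_mean_mult_left[symmetric] by (simp add: mult_ac)
  show "pairing p (smult c q) = c * pairing p q" for c p q
    unfolding pairing_def circle_mean_mult_left[symmetric] by (simp add: mult_ac)
  show "pairing (\<phi> m) (\<phi>b n) = (if m = n then 1 else 0)" for m n
    using system unfolding biorthogonal_system_def pairing_def by (auto simp: mult.assoc)
  show "degree (\<phi> n) = n" "degree (\<phi>b n) = n" for n
    using system unfolding biorthogonal_system_def by auto
  show "coeff (\<phi> n) n = kappa \<phi> n" "coeff (\<phi>b n) n = kappa \<phi> n" for n
    using system unfolding biorthogonal_system_def kappa_def by metis+
qed

text \<open>The polynomial behind \<open>phi_star\<close>: the degree of \<open>\<phi>b n\<close> is
  exactly n, so reversing the coefficients is inversion followed by multiplication by x^n, and a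
  value at 0 is available as well.\<close>

abbreviation "\<phi>s n \<equiv> reflect_poly (\<phi>b n)"

lemma phi_star_eq: "x \<noteq> 0 \<Longrightarrow> phi_star \<phi>b n x = poly (\<phi>s n) x"
  by (simp add: phi_star_def poly_reflect_poly_nz degree_g inverse_eq_divide)

lemma coeff_phi_s: "coeff (\<phi>s n) i = (if i > n then 0 else coeff (\<phi>b n) (n - i))"
  by (simp add: coeff_reflect_poly degree_g)

lemma phi_s_0: "poly (\<phi>s n) 0 = kappa \<phi> n"
  using lead_g[of n] by (simp add: poly_0_coeff_0 degree_g)

lemma coeff_phi_s_top: "coeff (\<phi>s n) n = poly (\<phi>b n) 0"
  by (simp add: poly_0_coeff_0 coeff_phi_s)

lemma pairing_phi: "m \<le> n \<Longrightarrow> pairing (\<phi> n) (monom 1 m) = (if m = n then 1 / kappa \<phi> n else 0)"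
  using bf_f[of "monom 1 m" n] by (simp add: degree_monom_eq)

text \<open>On the circle \<open>\<phi>s n\<close> times \<zeta>^(-m) is \<zeta>^(n - m) times
  \<phi>b_n(1 / \<zeta>), so this is the orthogonality of the second family; only m = 0 reaches the
  full degree n.\<close>

lemma pairing_phi_s: 
  assumes "m \<le> n" shows "pairing (\<phi>s n) (monom 1 m) = (if m = 0 then 1 / kappa \<phi> n else 0)"
proof -
  have "pairing (\<phi>s n) (monom 1 m) = pairing (monom 1 (n - m)) (\<phi>b n)"
    unfolding pairing_def
  proof (rule circle_mean_cong_strong)
    fix \<zeta> :: complex assume "cmod \<zeta> = 1"
    hence "\<zeta> \<noteq> 0" by auto
    thus "w \<zeta> * (poly (\<phi>s n) \<zeta> * poly (monom 1 m) (1 / \<zeta>)) = w \<zeta> * (poly (monom 1 (n - m)) \<zeta> * poly (\<phi>b n) (1 / \<zeta>))"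
      using assms by (simp add: poly_reflect_poly_nz degree_g inverse_eq_divide poly_monom power_diff power_divide)
  qed
  also have "\<dots> = coeff (monom 1 (n - m)) n / kappa \<phi> n" by (rule flip.bf_f) (simp add: degree_monom_eq)
  finally show ?thesis using assms by auto
qed

text \<open>\<open>x\<close> is off the circle, or a point of it at which the weight vanishes sufficiently fast.\<close>

definition "pole x \<longleftrightarrow> moments_exist (\<lambda>\<zeta>. w \<zeta> / (\<zeta> - x))"

text \<open>The Cauchy transform of h against the weight; under \<open>pole x\<close> it also makes
  sense for x on the circle.\<close>

definition "resolvent x h = circle_mean (\<lambda>\<zeta>. w \<zeta> * h \<zeta> / (\<zeta> - x))"

lemma pole_off_circle: "cmod x \<noteq> 1 \<Longrightarrow> pole x"
  using moments_exist_times_continuous[OF moments continuous_on_resolvent] by (simp add: pole_def)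

lemma moments_exist_resolvent: "pole x \<Longrightarrow> continuous_on (sphere 0 1) h \<Longrightarrow> moments_exist (\<lambda>\<zeta>. w \<zeta> * h \<zeta> / (\<zeta> - x))"
  using moments_exist_times_continuous[of "\<lambda>\<zeta>. w \<zeta> / (\<zeta> - x)" h] by (simp add: pole_def)

lemma resolvent_cong: "(\<And>\<zeta>. cmod \<zeta> = 1 \<Longrightarrow> h \<zeta> = h' \<zeta>) \<Longrightarrow> resolvent x h = resolvent x h'"
  unfolding resolvent_def by (rule circle_mean_cong_strong) simp

lemma resolvent_add:
  assumes "pole x" "continuous_on (sphere 0 1) h" "continuous_on (sphere 0 1) h'"
  shows "resolvent x (\<lambda>\<zeta>. h \<zeta> + h' \<zeta>) = resolvent x h + resolvent x h'"
  unfolding resolvent_def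
  by (subst circle_mean_add[symmetric]) (auto intro!: moments_exist_resolvent assms simp: distrib_left add_divide_distrib)

lemma resolvent_diff:
  assumes "pole x" "continuous_on (sphere 0 1) h" "continuous_on (sphere 0 1) h'"
  shows "resolvent x (\<lambda>\<zeta>. h \<zeta> - h' \<zeta>) = resolvent x h - resolvent x h'"
  unfolding resolvent_def
  by (subst circle_mean_diff[symmetric]) (auto intro!: moments_exist_resolvent assms simp: right_diff_distrib diff_divide_distrib)

lemma resolvent_mult: "resolvent x (\<lambda>\<zeta>. c * h \<zeta>) = c * resolvent x h"
  unfolding resolvent_def circle_mean_mult_left[symmetric] by (simp add: mult_ac)

lemma resolvent_sum:
  assumes "pole x" "\<And>i. i \<in> A \<Longrightarrow> continuous_on (sphere 0 1) (h i)"
  shows "resolvent x (\<lambda>\<zeta>. \<Sum>i\<in>A. h i \<zeta>) = (\<Sum>i\<in>A. resolvent x (h i))"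
  unfolding resolvent_def sum_distrib_left sum_divide_distrib
  by (intro circle_mean_sum moments_exist_resolvent assms)

text \<open>Off the point x one has \<zeta> / (\<zeta> - x) = 1 + x / (\<zeta> - x).\<close>

lemma resolvent_step:
  assumes x: "pole x" and h: "continuous_on (sphere 0 1) h"
  shows "resolvent x (\<lambda>\<zeta>. \<zeta> * h \<zeta>) = x * resolvent x h + circle_mean (\<lambda>\<zeta>. w \<zeta> * h \<zeta>)"
proof -
  have h': "continuous_on (sphere 0 1) (\<lambda>\<zeta>. \<zeta> * h \<zeta>)" by (intro continuous_on_mult continuous_on_id h)
  have "resolvent x (\<lambda>\<zeta>. \<zeta> * h \<zeta>) = circle_mean (\<lambda>\<zeta>. x * (w \<zeta> * h \<zeta> / (\<zeta> - x)) + w \<zeta> * h \<zeta>)"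
    unfolding resolvent_def
  proof (rule circle_mean_cong[of "{x}"])
    show "moments_exist (\<lambda>\<zeta>. w \<zeta> * (\<zeta> * h \<zeta>) / (\<zeta> - x))" by (rule moments_exist_resolvent[OF x h'])
    show "moments_exist (\<lambda>\<zeta>. x * (w \<zeta> * h \<zeta> / (\<zeta> - x)) + w \<zeta> * h \<zeta>)"
      by (intro moments_exist_add moments_exist_mult_left moments_exist_resolvent x h moments_exist_times_continuous moments)
    fix \<zeta> assume "\<zeta> \<notin> {x}"
    thus "w \<zeta> * (\<zeta> * h \<zeta>) / (\<zeta> - x) = x * (w \<zeta> * h \<zeta> / (\<zeta> - x)) + w \<zeta> * h \<zeta>"
      by (simp add: field_simps)
  qed simp
  also have "\<dots> = x * resolvent x h + circle_mean (\<lambda>\<zeta>. w \<zeta> * h \<zeta>)"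
    unfolding resolvent_def circle_mean_mult_left[symmetric]
    by (intro circle_mean_add moments_exist_mult_left moments_exist_resolvent x h moments_exist_times_continuous moments)
  finally show ?thesis .
qed

lemma resolvent_power:
  assumes x: "pole x" and h: "continuous_on (sphere 0 1) h"
  shows "resolvent x (\<lambda>\<zeta>. \<zeta> ^ m * h \<zeta>) = x ^ m * resolvent x h + (\<Sum>i<m. x ^ (m - Suc i) * circle_mean (\<lambda>\<zeta>. w \<zeta> * (\<zeta> ^ i * h \<zeta>)))"
proof (induction m)
  case (Suc m)
  have "resolvent x (\<lambda>\<zeta>. \<zeta> * (\<zeta> ^ m * h \<zeta>)) = x * resolvent x (\<lambda>\<zeta>. \<zeta> ^ m * h \<zeta>) + circle_mean (\<lambda>\<zeta>. w \<zeta> * (\<zeta> ^ m * h \<zeta>))"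
    by (intro resolvent_step x continuous_on_mult continuous_on_power continuous_on_id h)
  moreover have "x * (\<Sum>i<m. x ^ (m - Suc i) * circle_mean (\<lambda>\<zeta>. w \<zeta> * (\<zeta> ^ i * h \<zeta>)))
     = (\<Sum>i<m. x ^ (Suc m - Suc i) * circle_mean (\<lambda>\<zeta>. w \<zeta> * (\<zeta> ^ i * h \<zeta>)))"
    unfolding sum_distrib_left
  proof (rule sum.cong[OF refl])
    fix i assume "i \<in> {..<m}"
    hence "Suc m - Suc i = Suc (m - Suc i)" by auto
    thus "x * (x ^ (m - Suc i) * circle_mean (\<lambda>\<zeta>. w \<zeta> * (\<zeta> ^ i * h \<zeta>))) = x ^ (Suc m - Suc i) * circle_mean (\<lambda>\<zeta>. w \<zeta> * (\<zeta> ^ i * h \<zeta>))"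
      by simp
  qed
  ultimately show ?case using Suc.IH by (simp add: algebra_simps)
qed simp

text \<open>Partial fractions of 1 / ((\<zeta> - x) (\<zeta> - z)); x is off the circle, while z may
  be a singular point on it.\<close>

lemma resolvent_difference:
  assumes x: "cmod x \<noteq> 1" and z: "pole z" and xz: "x \<noteq> z" and h: "continuous_on (sphere 0 1) h"
  shows "resolvent z (\<lambda>\<zeta>. h \<zeta> / (\<zeta> - x)) = (resolvent x h - resolvent z h) / (x - z)"
proof -
  have c: "continuous_on (sphere 0 1) (\<lambda>\<zeta>. h \<zeta> / (\<zeta> - x))"
    using x by (intro continuous_on_divide h continuous_intros) auto
  have "resolvent z (\<lambda>\<zeta>. h \<zeta> / (\<zeta> - x)) = circle_mean (\<lambda>\<zeta>. (w \<zeta> * h \<zeta> / (\<zeta> - x) - w \<zeta> * h \<zeta> / (\<zeta> - z)) * (1 / (x - z)))"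
    unfolding resolvent_def
  proof (rule circle_mean_cong[of "{x, z}"])
    show "moments_exist (\<lambda>\<zeta>. w \<zeta> * (h \<zeta> / (\<zeta> - x)) / (\<zeta> - z))" by (rule moments_exist_resolvent[OF z c])
    show "moments_exist (\<lambda>\<zeta>. (w \<zeta> * h \<zeta> / (\<zeta> - x) - w \<zeta> * h \<zeta> / (\<zeta> - z)) * (1 / (x - z)))"
      by (intro moments_exist_mult_right moments_exist_diff moments_exist_resolvent pole_off_circle x z h)
    fix \<zeta> assume "\<zeta> \<notin> {x, z}"
    thus "w \<zeta> * (h \<zeta> / (\<zeta> - x)) / (\<zeta> - z) = (w \<zeta> * h \<zeta> / (\<zeta> - x) - w \<zeta> * h \<zeta> / (\<zeta> - z)) * (1 / (x - z))"
      using xz by (simp add: divide_simps) (simp add: algebra_simps)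
  qed simp
  also have "\<dots> = (resolvent x h - resolvent z h) * (1 / (x - z))"
    unfolding circle_mean_mult_right resolvent_def
    by (subst circle_mean_diff) (auto intro!: moments_exist_resolvent pole_off_circle x z h)
  finally show ?thesis by simp
qed

definition "second_kind p x = 2 * resolvent x (\<lambda>\<zeta>. \<zeta> * poly p \<zeta>)"

definition "u1 n x = second_kind (\<phi> n) x"

text \<open>Minus \<open>xi_star\<close>, as \<open>u1\<close> is \<open>xi\<close>, but written
  through \<open>\<phi>s n\<close> instead of \<phi>b_n(1 / \<zeta>): moving \<zeta>^n out of the
  integral as x^n leaves the constant 2 / \<kappa>_n behind, which is subtracted here.\<close>

definition "u2 n x = second_kind (\<phi>s n) x - 2 / kappa \<phi> n"

text \<open>Powers of \<zeta> are pulled out of the resolvent one at a time, so that orthogonality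
  can act on the pairings with 1, ..., \<zeta>^m that appear.\<close>

lemma second_kind_shift:
  assumes x: "pole x"
  shows "second_kind p x / 2 = x ^ Suc m * resolvent x (\<lambda>\<zeta>. poly p \<zeta> * (1 / \<zeta>) ^ m) + (\<Sum>i\<le>m. x ^ i * pairing p (monom 1 i))"
proof -
  define h where "h \<zeta> = poly p \<zeta> * (1 / \<zeta>) ^ m" for \<zeta>
  have h: "continuous_on (sphere 0 1) h" unfolding h_def
    by (intro continuous_on_mult continuous_poly continuous_power_inverse)
  have "second_kind p x / 2 = resolvent x (\<lambda>\<zeta>. \<zeta> * poly p \<zeta>)" by (simp add: second_kind_def)
  also have "\<dots> = resolvent x (\<lambda>\<zeta>. \<zeta> ^ Suc m * h \<zeta>)"
    by (rule resolvent_cong) (auto simp: h_def power_divide)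
  also have "\<dots> = x ^ Suc m * resolvent x h + (\<Sum>i<Suc m. x ^ (Suc m - Suc i) * circle_mean (\<lambda>\<zeta>. w \<zeta> * (\<zeta> ^ i * h \<zeta>)))"
    by (rule resolvent_power[OF x h])
  also have "(\<Sum>i<Suc m. x ^ (Suc m - Suc i) * circle_mean (\<lambda>\<zeta>. w \<zeta> * (\<zeta> ^ i * h \<zeta>))) = (\<Sum>i<Suc m. x ^ (Suc m - Suc i) * pairing p (monom 1 (Suc m - Suc i)))"
  proof (rule sum.cong[OF refl])
    fix i assume i: "i \<in> {..<Suc m}"
    have "circle_mean (\<lambda>\<zeta>. w \<zeta> * (\<zeta> ^ i * h \<zeta>)) = pairing p (monom 1 (Suc m - Suc i))"
      unfolding pairing_def
    proof (rule circle_mean_cong_strong)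
      fix \<zeta> :: complex assume "cmod \<zeta> = 1"
      hence "\<zeta> \<noteq> 0" by auto
      thus "w \<zeta> * (\<zeta> ^ i * h \<zeta>) = w \<zeta> * (poly p \<zeta> * poly (monom 1 (Suc m - Suc i)) (1 / \<zeta>))"
        using i by (simp add: h_def poly_monom power_divide power_diff)
    qed
    thus "x ^ (Suc m - Suc i) * circle_mean (\<lambda>\<zeta>. w \<zeta> * (\<zeta> ^ i * h \<zeta>)) = x ^ (Suc m - Suc i) * pairing p (monom 1 (Suc m - Suc i))" by simp
  qed
  also have "\<dots> = (\<Sum>i<Suc m. x ^ i * pairing p (monom 1 i))"
    by (rule sum.nat_diff_reindex)
  finally show ?thesis by (simp add: h_def lessThan_Suc_atMost)
qed

lemma resolvent_phi:
  assumes "pole x" "x \<noteq> 0" "m \<le> n"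
  shows "resolvent x (\<lambda>\<zeta>. poly (\<phi> n) \<zeta> * (1 / \<zeta>) ^ m) = (u1 n x / 2 - (if m = n then x ^ n / kappa \<phi> n else 0)) / x ^ Suc m"
proof -
  have "(\<Sum>i\<le>m. x ^ i * pairing (\<phi> n) (monom 1 i)) = (\<Sum>i\<le>m. if i = n then x ^ n / kappa \<phi> n else 0)"
    using assms(3) by (intro sum.cong) (auto simp: pairing_phi)
  also have "\<dots> = (if m = n then x ^ n / kappa \<phi> n else 0)" using assms(3) by auto
  finally have S: "(\<Sum>i\<le>m. x ^ i * pairing (\<phi> n) (monom 1 i)) = (if m = n then x ^ n / kappa \<phi> n else 0)" .
  have "x ^ Suc m * resolvent x (\<lambda>\<zeta>. poly (\<phi> n) \<zeta> * (1 / \<zeta>) ^ m) = u1 n x / 2 - (if m = n then x ^ n / kappa \<phi> n else 0)"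
    unfolding u1_def second_kind_shift[OF assms(1), of "\<phi> n" m] S by (simp only: add_diff_cancel_right')
  thus ?thesis using assms(2) by (simp add: nonzero_eq_divide_eq mult.commute del: power_Suc)
qed

lemma resolvent_phi_s:
  assumes "pole x" "x \<noteq> 0" "m \<le> n"
  shows "resolvent x (\<lambda>\<zeta>. poly (\<phi>s n) \<zeta> * (1 / \<zeta>) ^ m) = u2 n x / 2 / x ^ Suc m"
proof -
  have "(\<Sum>i\<le>m. x ^ i * pairing (\<phi>s n) (monom 1 i)) = (\<Sum>i\<le>m. if i = 0 then 1 / kappa \<phi> n else 0)"
    using assms(3) by (intro sum.cong) (auto simp: pairing_phi_s)
  also have "\<dots> = 1 / kappa \<phi> n" by simp
  finally show ?thesis using second_kind_shift[OF assms(1), of "\<phi>s n" m] assms(2) by (simp add: u2_def field_simps)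
qed

text \<open>This is det Y_n = - 2 z^n / w with the denominator cleared. The resolvent of
  \<phi>_n(\<zeta>) \<phi>b_n(1 / \<zeta>) is computed twice: expanding \<phi>b_n in powers of 1 /
  \<zeta> gives \<open>u1\<close>, and expanding \<phi>_n gives \<open>u2\<close>, because \<zeta>^i
  \<phi>b_n(1 / \<zeta>) is \<zeta>^(i - n) times \<open>\<phi>s n\<close>.\<close>

lemma Casoratian:
  assumes x: "pole x" "x \<noteq> 0"
  shows "poly (\<phi>s n) x * u1 n x - poly (\<phi> n) x * u2 n x = 2 * x ^ n"
proof -
  define A where "A = resolvent x (\<lambda>\<zeta>. poly (\<phi> n) \<zeta> * poly (\<phi>b n) (1 / \<zeta>))"
  have "A = resolvent x (\<lambda>\<zeta>. \<Sum>m\<le>n. coeff (\<phi>b n) m * (poly (\<phi> n) \<zeta> * (1 / \<zeta>) ^ m))"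
    unfolding A_def by (rule resolvent_cong) (simp add: poly_altdef degree_g sum_distrib_left mult_ac)
  also have "\<dots> = (\<Sum>m\<le>n. coeff (\<phi>b n) m * ((u1 n x / 2 - (if m = n then x ^ n / kappa \<phi> n else 0)) / x ^ Suc m))"
    by (subst resolvent_sum) (auto intro!: x continuous_on_mult continuous_poly continuous_power_inverse
      continuous_on_const simp: resolvent_mult resolvent_phi[OF x])
  also have "\<dots> = (\<Sum>m\<le>n. u1 n x / (2 * x) * (coeff (\<phi>b n) m * (1 / x) ^ m) - (if m = n then 1 / x else 0))"
    using x(2) kappa_nz[of n] lead_g[of n] by (intro sum.cong) (auto simp: field_simps)
  also have "\<dots> = u1 n x / (2 * x) * poly (\<phi>b n) (1 / x) - 1 / x"
    by (simp add: sum_subtractf sum_distrib_left poly_altdef degree_g)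
  also have "poly (\<phi>b n) (1 / x) = poly (\<phi>s n) x / x ^ n"
    using x(2) by (simp add: poly_reflect_poly_nz degree_g inverse_eq_divide)
  finally have A1: "A = u1 n x / (2 * x) * (poly (\<phi>s n) x / x ^ n) - 1 / x" .
  have "A = resolvent x (\<lambda>\<zeta>. \<Sum>i\<le>n. coeff (\<phi> n) i * (poly (\<phi>s n) \<zeta> * (1 / \<zeta>) ^ (n - i)))"
    unfolding A_def
  proof (rule resolvent_cong)
    fix \<zeta> :: complex assume "cmod \<zeta> = 1"
    hence "\<zeta> \<noteq> 0" by auto
    hence "(\<Sum>i\<le>n. coeff (\<phi> n) i * (poly (\<phi>s n) \<zeta> * (1 / \<zeta>) ^ (n - i))) = (\<Sum>i\<le>n. coeff (\<phi> n) i * \<zeta> ^ i * poly (\<phi>b n) (1 / \<zeta>))"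
      by (intro sum.cong) (auto simp: poly_reflect_poly_nz degree_g inverse_eq_divide power_diff power_divide)
    thus "poly (\<phi> n) \<zeta> * poly (\<phi>b n) (1 / \<zeta>) = (\<Sum>i\<le>n. coeff (\<phi> n) i * (poly (\<phi>s n) \<zeta> * (1 / \<zeta>) ^ (n - i)))"
      by (simp add: sum_distrib_right[symmetric] poly_altdef[of "\<phi> n"] degree_f)
  qed
  also have "\<dots> = (\<Sum>i\<le>n. coeff (\<phi> n) i * (u2 n x / 2 / x ^ Suc (n - i)))"
    by (subst resolvent_sum) (auto intro!: x continuous_on_mult continuous_poly continuous_power_inverse
      continuous_on_const simp: resolvent_mult resolvent_phi_s[OF x])
  also have "\<dots> = (\<Sum>i\<le>n. u2 n x / (2 * x) / x ^ n * (coeff (\<phi> n) i * x ^ i))"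
    using x(2) by (intro sum.cong) (auto simp: power_diff mult_ac)
  also have "\<dots> = u2 n x / (2 * x) / x ^ n * poly (\<phi> n) x"
    by (simp add: sum_distrib_left poly_altdef degree_f)
  finally have A2: "A = u2 n x / (2 * x) / x ^ n * poly (\<phi> n) x" .
  have "u1 n x / (2 * x) * (poly (\<phi>s n) x / x ^ n) - u2 n x / (2 * x) / x ^ n * poly (\<phi> n) x = 1 / x"
    using A1 A2 by simp
  hence "x * (poly (\<phi>s n) x * u1 n x - poly (\<phi> n) x * u2 n x) = x * (2 * x ^ n)"
    using x(2) by (simp add: field_simps)
  thus ?thesis using x(2) by simp
qed

lemma Caratheodory_resolvent:
  assumes x: "pole x" and h: "continuous_on (sphere 0 1) h"
  shows "circle_mean (\<lambda>\<zeta>. (\<zeta> + x) / (\<zeta> - x) * w \<zeta> * h \<zeta>) = 2 * resolvent x (\<lambda>\<zeta>. \<zeta> * h \<zeta>) - circle_mean (\<lambda>\<zeta>. w \<zeta> * h \<zeta>)"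
proof -
  have c: "continuous_on (sphere 0 1) (\<lambda>\<zeta>. \<zeta> * h \<zeta>)" "continuous_on (sphere 0 1) (\<lambda>\<zeta>. (\<zeta> + x) * h \<zeta>)"
    by (intro continuous_intros h)+
  have "circle_mean (\<lambda>\<zeta>. (\<zeta> + x) / (\<zeta> - x) * w \<zeta> * h \<zeta>) = circle_mean (\<lambda>\<zeta>. 2 * (w \<zeta> * (\<zeta> * h \<zeta>) / (\<zeta> - x)) - w \<zeta> * h \<zeta>)"
  proof (rule circle_mean_cong[of "{x}"])
    show "moments_exist (\<lambda>\<zeta>. (\<zeta> + x) / (\<zeta> - x) * w \<zeta> * h \<zeta>)"
      using moments_exist_resolvent[OF x c(2)] by (simp add: mult_ac)
    show "moments_exist (\<lambda>\<zeta>. 2 * (w \<zeta> * (\<zeta> * h \<zeta>) / (\<zeta> - x)) - w \<zeta> * h \<zeta>)"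
      by (intro moments_exist_diff moments_exist_mult_left moments_exist_resolvent x c moments_exist_times_continuous moments h)
    fix \<zeta> assume "\<zeta> \<notin> {x}"
    thus "(\<zeta> + x) / (\<zeta> - x) * w \<zeta> * h \<zeta> = 2 * (w \<zeta> * (\<zeta> * h \<zeta>) / (\<zeta> - x)) - w \<zeta> * h \<zeta>"
      by (simp add: divide_simps) (simp add: algebra_simps)
  qed simp
  also have "\<dots> = circle_mean (\<lambda>\<zeta>. 2 * (w \<zeta> * (\<zeta> * h \<zeta>) / (\<zeta> - x))) - circle_mean (\<lambda>\<zeta>. w \<zeta> * h \<zeta>)"
    by (intro circle_mean_diff moments_exist_mult_left moments_exist_resolvent x c moments_exist_times_continuous moments h)
  finally show ?thesis by (simp only: circle_mean_mult_left resolvent_def)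
qed

lemma phi_0: "\<phi> 0 = [:kappa \<phi> 0:]" "\<phi>b 0 = [:kappa \<phi> 0:]"
  by (metis coeff_pCons_0 degree_eq_zeroE degree_f lead_f, metis coeff_pCons_0 degree_eq_zeroE degree_g lead_g)

lemma moment_0: "moment w 0 = circle_mean w" "kappa \<phi> 0 * circle_mean w = 1 / kappa \<phi> 0"
proof -
  show "moment w 0 = circle_mean w" by (simp add: moment_def)
  have "circle_mean (\<lambda>\<zeta>. kappa \<phi> 0 * w \<zeta>) = 1 / kappa \<phi> 0"
    using pairing_phi[of 0 0] phi_0 by (simp add: pairing_def mult.commute)
  thus "kappa \<phi> 0 * circle_mean w = 1 / kappa \<phi> 0" by (simp only: circle_mean_mult_left)
qed

lemma xi_eq:
  assumes x: "pole x" shows "xi w \<phi> n x = u1 n x"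
proof (cases "n = 0")
  case True
  have "Caratheodory_fun w x = 2 * resolvent x (\<lambda>\<zeta>. \<zeta>) - circle_mean w"
    using Caratheodory_resolvent[OF x continuous_on_const[of _ 1]] by (simp add: Caratheodory_fun_def)
  moreover have "u1 0 x = kappa \<phi> 0 * (2 * resolvent x (\<lambda>\<zeta>. \<zeta>))"
    using resolvent_mult[of x "kappa \<phi> 0" "\<lambda>\<zeta>. \<zeta>"] by (subst u1_def, subst second_kind_def, subst phi_0) (simp add: mult_ac)
  ultimately show ?thesis using True by (simp add: xi_def moment_0(1))
next
  case False
  have "circle_mean (\<lambda>\<zeta>. w \<zeta> * poly (\<phi> n) \<zeta>) = 0"
    using pairing_phi[of 0 n] False by (simp add: pairing_def)
  thus ?thesis using False Caratheodory_resolvent[OF x continuous_poly, of "\<phi> n"]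
    by (simp add: xi_def u1_def second_kind_def)
qed

lemma xi_star_eq:
  assumes x: "pole x" shows "xi_star w \<phi> \<phi>b n x = - u2 n x"
proof (cases "n = 0")
  case True
  have "Caratheodory_fun w x = 2 * resolvent x (\<lambda>\<zeta>. \<zeta>) - circle_mean w"
    using Caratheodory_resolvent[OF x continuous_on_const[of _ 1]] by (simp add: Caratheodory_fun_def)
  hence res: "2 * resolvent x (\<lambda>\<zeta>. \<zeta>) = Caratheodory_fun w x + circle_mean w" by simp
  have "u2 0 x = kappa \<phi> 0 * (2 * resolvent x (\<lambda>\<zeta>. \<zeta>)) - 2 / kappa \<phi> 0"
    using resolvent_mult[of x "kappa \<phi> 0" "\<lambda>\<zeta>. \<zeta>"] by (subst u2_def, subst second_kind_def, subst phi_0) (simp add: mult_ac)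
  also have "2 / kappa \<phi> 0 = 2 * (kappa \<phi> 0 * circle_mean w)" using moment_0(2) by simp
  finally show ?thesis using True unfolding res by (simp add: xi_star_def moment_0(1) algebra_simps)
next
  case False
  define h where "h \<zeta> = poly (\<phi>b n) (1 / \<zeta>)" for \<zeta>
  have h: "continuous_on (sphere 0 1) h" "continuous_on (sphere 0 1) (\<lambda>\<zeta>. \<zeta> * h \<zeta>)"
    unfolding h_def by (intro continuous_poly_inverse continuous_on_mult continuous_on_id)+
  have mom: "circle_mean (\<lambda>\<zeta>. w \<zeta> * (\<zeta> ^ i * h \<zeta>)) = (if i = n then 1 / kappa \<phi> n else 0)" if "i \<le> n" for i
    using flip.bf_f[of "monom 1 i" n] that by (simp add: pairing_def poly_monom h_def degree_monom_eq)
  have 0: "circle_mean (\<lambda>\<zeta>. w \<zeta> * h \<zeta>) = 0" using mom[of 0] False by simp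
  have "second_kind (\<phi>s n) x / 2 = resolvent x (\<lambda>\<zeta>. \<zeta> ^ n * (\<zeta> * h \<zeta>))"
    unfolding second_kind_def
  proof (simp, rule resolvent_cong)
    fix \<zeta> :: complex assume "cmod \<zeta> = 1"
    hence "\<zeta> \<noteq> 0" by auto
    thus "\<zeta> * poly (\<phi>s n) \<zeta> = \<zeta> ^ n * (\<zeta> * h \<zeta>)"
      by (simp add: h_def poly_reflect_poly_nz degree_g inverse_eq_divide)
  qed
  also have "\<dots> = x ^ n * resolvent x (\<lambda>\<zeta>. \<zeta> * h \<zeta>) + (\<Sum>i<n. x ^ (n - Suc i) * circle_mean (\<lambda>\<zeta>. w \<zeta> * (\<zeta> ^ i * (\<zeta> * h \<zeta>))))"
    by (rule resolvent_power[OF x h(2)])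
  also have "(\<Sum>i<n. x ^ (n - Suc i) * circle_mean (\<lambda>\<zeta>. w \<zeta> * (\<zeta> ^ i * (\<zeta> * h \<zeta>)))) = (\<Sum>i<n. if i = n - 1 then 1 / kappa \<phi> n else 0)"
  proof (rule sum.cong[OF refl])
    fix i assume "i \<in> {..<n}"
    thus "x ^ (n - Suc i) * circle_mean (\<lambda>\<zeta>. w \<zeta> * (\<zeta> ^ i * (\<zeta> * h \<zeta>))) = (if i = n - 1 then 1 / kappa \<phi> n else 0)"
      using mom[of "Suc i"] by (auto simp: mult_ac)
  qed
  also have "\<dots> = 1 / kappa \<phi> n" using False by simp
  finally have "u2 n x = 2 * (x ^ n * resolvent x (\<lambda>\<zeta>. \<zeta> * h \<zeta>))" by (simp add: u2_def field_simps)
  moreover have "xi_star w \<phi> \<phi>b n x = - (x ^ n) * (2 * resolvent x (\<lambda>\<zeta>. \<zeta> * h \<zeta>) - 0)"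
    using False Caratheodory_resolvent[OF x h(1)] 0 by (simp add: xi_star_def h_def)
  ultimately show ?thesis by simp
qed

text \<open>That the limit exists is a hypothesis; its value is then found along one radius, where
  dominated convergence leads to the integral with its argument on the circle.\<close>

lemma value_at_xi:
  assumes x: "pole x" and ex: "cmod x = 1 \<Longrightarrow> circle_limit_exists (xi w \<phi> n) x"
  shows "value_at (xi w \<phi> n) x = u1 n x"
proof (cases "cmod x = 1")
  case False
  thus ?thesis using xi_eq[OF x] by (simp add: value_at_def)
next
  case True
  \<comment> \<open>The shift by 2 keeps all radii strictly between 0 and 1.\<close>
  define r where "r i = 1 - 1 / real (Suc (Suc i))" for i
  have r: "0 < r i" "r i < 1" for i by (simp_all add: r_def)
  have r1: "r \<longlonglongrightarrow> 1"
    unfolding r_def using tendsto_diff[OF tendsto_const LIMSEQ_Suc[OF LIMSEQ_inverse_real_of_nat], of 1] by (simp add: inverse_eq_divide)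
  have lim: "(\<lambda>i. circle_mean (\<lambda>\<zeta>. (\<zeta> + of_real (r i) * x) / (\<zeta> - of_real (r i) * x) * (w \<zeta> * h \<zeta>)))
     \<longlonglongrightarrow> circle_mean (\<lambda>\<zeta>. (\<zeta> + x) / (\<zeta> - x) * (w \<zeta> * h \<zeta>))" if h: "continuous_on (sphere 0 1) h" for h
    by (rule radial_limit_Caratheodory[OF moments_exist_times_continuous[OF moments h] True moments_exist_resolvent[OF x h] r r1])
  have "(\<lambda>i. xi w \<phi> n (of_real (r i) * x)) \<longlonglongrightarrow> xi w \<phi> n x"
  proof (cases "n = 0")
    case True
    thus ?thesis using lim[of "\<lambda>_. 1"] unfolding xi_def Caratheodory_fun_def by (auto intro!: tendsto_intros)
  next
    case False
    thus ?thesis using lim[OF continuous_poly, of "\<phi> n"] unfolding xi_def by (simp add: mult.assoc)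
  qed
  thus ?thesis using value_at_eqI[OF True ex[OF True] r r1] xi_eq[OF x] by simp
qed

lemma value_at_xi_star:
  assumes x: "pole x" and ex: "cmod x = 1 \<Longrightarrow> circle_limit_exists (xi_star w \<phi> \<phi>b n) x"
  shows "value_at (xi_star w \<phi> \<phi>b n) x = - u2 n x"
proof (cases "cmod x = 1")
  case False
  thus ?thesis using xi_star_eq[OF x] by (simp add: value_at_def)
next
  case True
  define r where "r i = 1 - 1 / real (Suc (Suc i))" for i
  have r: "0 < r i" "r i < 1" for i by (simp_all add: r_def)
  have r1: "r \<longlonglongrightarrow> 1"
    unfolding r_def using tendsto_diff[OF tendsto_const LIMSEQ_Suc[OF LIMSEQ_inverse_real_of_nat], of 1] by (simp add: inverse_eq_divide)
  have lim: "(\<lambda>i. circle_mean (\<lambda>\<zeta>. (\<zeta> + of_real (r i) * x) / (\<zeta> - of_real (r i) * x) * (w \<zeta> * h \<zeta>)))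
     \<longlonglongrightarrow> circle_mean (\<lambda>\<zeta>. (\<zeta> + x) / (\<zeta> - x) * (w \<zeta> * h \<zeta>))" if h: "continuous_on (sphere 0 1) h" for h
    by (rule radial_limit_Caratheodory[OF moments_exist_times_continuous[OF moments h] True moments_exist_resolvent[OF x h] r r1])
  have conv: "(\<lambda>i. of_real (r i) * x) \<longlonglongrightarrow> x"
    using tendsto_mult[OF tendsto_of_real[OF r1, where 'a = complex] tendsto_const[of x]] by simp
  have "(\<lambda>i. xi_star w \<phi> \<phi>b n (of_real (r i) * x)) \<longlonglongrightarrow> xi_star w \<phi> \<phi>b n x"
  proof (cases "n = 0")
    case True
    thus ?thesis using lim[of "\<lambda>_. 1"] unfolding xi_star_def Caratheodory_fun_def by (auto intro!: tendsto_intros)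
  next
    case False
    have "(\<lambda>i. - ((of_real (r i) * x) ^ n) * circle_mean (\<lambda>\<zeta>. (\<zeta> + of_real (r i) * x) / (\<zeta> - of_real (r i) * x) * (w \<zeta> * poly (\<phi>b n) (1 / \<zeta>))))
      \<longlonglongrightarrow> - (x ^ n) * circle_mean (\<lambda>\<zeta>. (\<zeta> + x) / (\<zeta> - x) * (w \<zeta> * poly (\<phi>b n) (1 / \<zeta>)))"
      by (intro tendsto_mult tendsto_minus tendsto_power conv lim continuous_poly_inverse)
    thus ?thesis using False unfolding xi_star_def by (simp add: mult.assoc)
  qed
  thus ?thesis using value_at_eqI[OF True ex[OF True] r r1] xi_star_eq[OF x] by simp
qed

end

section \<open>Bi-orthogonal systems depending on t\<close>

locale deformation_system =
  fixes S :: "real set" and M :: nat and z :: "nat \<Rightarrow> real \<Rightarrow> complex" and \<rho> :: "nat \<Rightarrow> complex"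
    and w :: "real \<Rightarrow> complex \<Rightarrow> complex" and \<phi> \<phi>b :: "real \<Rightarrow> nat \<Rightarrow> complex poly"
  assumes opn: "open S" and mov: "moving_singularities S M z"
    and semi: "semiclassical_deformation S M z \<rho> w"
    and admissible: "admissible_system S M z w \<phi> \<phi>b"
begin

lemma biorthogonal: "t \<in> S \<Longrightarrow> biorthogonal (w t) (\<phi> t) (\<phi>b t)"
  using admissible by (auto simp: admissible_system_def biorthogonal_def)

lemma kappa_nz: "t \<in> S \<Longrightarrow> kappa (\<phi> t) n \<noteq> 0"
proof -
  assume "t \<in> S"
  then interpret B: biorthogonal "w t" "\<phi> t" "\<phi>b t" by (rule biorthogonal)
  show ?thesis by (rule B.kappa_nz)
qed

lemma limits:
  assumes "t \<in> S" "k \<in> {1..M}" "cmod (z k t) = 1"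
  shows "circle_limit_exists (xi (w t) (\<phi> t) n) (z k t)"
    "circle_limit_exists (xi_star (w t) (\<phi> t) (\<phi>b t) n) (z k t)"
  using admissible assms by (auto simp: admissible_system_def)

text \<open>For n = 0 the function \<open>xi\<close> is an affine function of the Caratheodory
  function with nonzero slope \<kappa>_0, so the limit of one gives that of the other.\<close>

lemma Caratheodory_limit:
  assumes t: "t \<in> S" "k \<in> {1..M}" "cmod (z k t) = 1"
  shows "circle_limit_exists (Caratheodory_fun (w t)) (z k t)"
proof -
  obtain l where l: "(xi (w t) (\<phi> t) 0 \<longlongrightarrow> l) (at (z k t) within - sphere 0 1)"
    using limits(1)[OF assms, of 0] by (auto simp: circle_limit_exists_def)
  have "((\<lambda>x. xi (w t) (\<phi> t) 0 x / kappa (\<phi> t) 0 - moment (w t) 0) \<longlongrightarrow> l / kappa (\<phi> t) 0 - moment (w t) 0) (at (z k t) within - sphere 0 1)"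
    by (intro tendsto_intros l kappa_nz t)
  moreover have "(\<lambda>x. xi (w t) (\<phi> t) 0 x / kappa (\<phi> t) 0 - moment (w t) 0) = Caratheodory_fun (w t)"
    using kappa_nz[OF t(1), of 0] by (simp add: fun_eq_iff xi_def)
  ultimately show ?thesis by (auto simp: circle_limit_exists_def)
qed

end

sublocale deformation_system \<subseteq> weight_deformation S M z \<rho> w
proof
  show "moments_exist (w t)" if "t \<in> S" for t
    using admissible that by (auto simp: admissible_system_def)
qed (fact opn mov semi Caratheodory_limit)+

context deformation_system
begin

abbreviation "\<phi>s t n \<equiv> reflect_poly (\<phi>b t n)"
abbreviation "\<kappa> t n \<equiv> kappa (\<phi> t) n"
abbreviation "\<xi>1 t n x \<equiv> biorthogonal.u1 (w t) (\<phi> t) n x"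
abbreviation "\<xi>2 t n x \<equiv> biorthogonal.u2 (w t) (\<phi> t) (\<phi>b t) n x"
abbreviation "resolv t x h \<equiv> biorthogonal.resolvent (w t) x h"
abbreviation "pair t p q \<equiv> biorthogonal.pairing (w t) p q"

lemma z_nz:
  assumes "t \<in> S" "k \<in> {1..M}"
  shows "z k t \<noteq> 0"
proof
  assume "z k t = 0"
  hence "z k t = z 0 t" using z0[OF assms(1)] by simp
  moreover have "inj_on (\<lambda>k. z k t) {0..M}" using mov assms(1) by (simp add: moving_singularities_def)
  ultimately have "k = 0" using assms(2) by (auto dest: inj_onD)
  thus False using assms(2) by simp
qed

lemma pole: "t \<in> S \<Longrightarrow> k \<in> {0..M} \<Longrightarrow> biorthogonal.pole (w t) (z k t)"
proof -
  assume t: "t \<in> S" "k \<in> {0..M}"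
  interpret B: biorthogonal "w t" "\<phi> t" "\<phi>b t" by (rule biorthogonal[OF t(1)])
  interpret W: semiclassical_weight "{0..M}" "\<lambda>k. z k t" \<rho> "w t" by (rule semiclassical_weight[OF t(1)])
  show ?thesis unfolding B.pole_def by (rule W.moments_exist_pole[OF t(2)])
qed

lemma value_at:
  assumes t: "t \<in> S" "k \<in> {1..M}"
  shows "value_at (xi (w t) (\<phi> t) n) (z k t) = \<xi>1 t n (z k t)"
    and "value_at (xi_star (w t) (\<phi> t) (\<phi>b t) n) (z k t) = - \<xi>2 t n (z k t)"
proof -
  interpret B: biorthogonal "w t" "\<phi> t" "\<phi>b t" by (rule biorthogonal[OF t(1)])
  have "B.pole (z k t)" using pole t by auto
  thus "value_at (xi (w t) (\<phi> t) n) (z k t) = B.u1 n (z k t)"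
    "value_at (xi_star (w t) (\<phi> t) (\<phi>b t) n) (z k t) = - B.u2 n (z k t)"
    using limits t by (auto intro!: B.value_at_xi B.value_at_xi_star)
qed

text \<open>Product rule for an integral in which both the polynomial and the weight move.
  Evaluation at \<open>e \<zeta>\<close>, taken as \<zeta> or 1 / \<zeta>, covers both arguments of
  the pairing; \<open>h\<close> is a factor that is fixed in time.\<close>

lemma functional_deriv:
  assumes t: "t \<in> S" and e: "continuous_on (sphere 0 1) e" and h: "continuous_on (sphere 0 1) h"
    and deg: "\<And>s. s \<in> S \<Longrightarrow> degree (P s) \<le> N" "degree P' \<le> N"
    and P': "\<And>i. i \<le> N \<Longrightarrow> ((\<lambda>s. coeff (P s) i) has_vector_derivative coeff P' i) (at t)"
  shows "((\<lambda>s. circle_mean (\<lambda>\<zeta>. w s \<zeta> * (poly (P s) (e \<zeta>) * h \<zeta>))) has_vector_derivative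
     circle_mean (\<lambda>\<zeta>. w t \<zeta> * (poly P' (e \<zeta>) * h \<zeta>)) -
     (\<Sum>k=1..M. \<rho> k * zd k t * resolv t (z k t) (\<lambda>\<zeta>. poly (P t) (e \<zeta>) * h \<zeta>))) (at t)"
proof -
  interpret B: biorthogonal "w t" "\<phi> t" "\<phi>b t" by (rule biorthogonal[OF t])
  define m where "m i s = circle_mean (\<lambda>\<zeta>. w s \<zeta> * (e \<zeta> ^ i * h \<zeta>))" for i s
  have c: "continuous_on (sphere 0 1) (\<lambda>\<zeta>. e \<zeta> ^ i * h \<zeta>)" for i by (intro continuous_intros e h)
  have poly: "circle_mean (\<lambda>\<zeta>. w s \<zeta> * (poly q (e \<zeta>) * h \<zeta>)) = (\<Sum>i\<le>N. coeff q i * m i s)"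
    if "s \<in> S" "degree q \<le> N" for s q
  proof -
    have "poly q x = (\<Sum>i\<le>N. coeff q i * x ^ i)" for x
      unfolding poly_altdef using that(2) by (intro sum.mono_neutral_left) (auto simp: coeff_eq_0)
    hence "circle_mean (\<lambda>\<zeta>. w s \<zeta> * (poly q (e \<zeta>) * h \<zeta>)) = circle_mean (\<lambda>\<zeta>. \<Sum>i\<le>N. coeff q i * (w s \<zeta> * (e \<zeta> ^ i * h \<zeta>)))"
      by (simp add: sum_distrib_left sum_distrib_right mult_ac)
    also have "\<dots> = (\<Sum>i\<le>N. coeff q i * m i s)"
      unfolding m_def circle_mean_mult_left[symmetric]
      by (intro circle_mean_sum moments_exist_mult_left moments_exist_times_continuous moments that c)
    finally show ?thesis .
  qed
  have resolv: "resolv t (z k t) (\<lambda>\<zeta>. poly (P t) (e \<zeta>) * h \<zeta>) = (\<Sum>i\<le>N. coeff (P t) i * resolv t (z k t) (\<lambda>\<zeta>. e \<zeta> ^ i * h \<zeta>))"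
    if "k \<in> {1..M}" for k
  proof -
    have "poly (P t) x = (\<Sum>i\<le>N. coeff (P t) i * x ^ i)" for x
      unfolding poly_altdef using deg(1)[OF t] by (intro sum.mono_neutral_left) (auto simp: coeff_eq_0)
    hence "resolv t (z k t) (\<lambda>\<zeta>. poly (P t) (e \<zeta>) * h \<zeta>) = resolv t (z k t) (\<lambda>\<zeta>. \<Sum>i\<le>N. coeff (P t) i * (e \<zeta> ^ i * h \<zeta>))"
      by (simp add: sum_distrib_right mult.assoc)
    also have "\<dots> = (\<Sum>i\<le>N. resolv t (z k t) (\<lambda>\<zeta>. coeff (P t) i * (e \<zeta> ^ i * h \<zeta>)))"
      using pole[OF t, of k] that by (intro B.resolvent_sum continuous_on_mult[OF continuous_on_const c]) auto
    also have "\<dots> = (\<Sum>i\<le>N. coeff (P t) i * resolv t (z k t) (\<lambda>\<zeta>. e \<zeta> ^ i * h \<zeta>))"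
      by (simp only: B.resolvent_mult)
    finally show ?thesis .
  qed
  have "((\<lambda>s. \<Sum>i\<le>N. coeff (P s) i * m i s) has_vector_derivative
     (\<Sum>i\<le>N. coeff (P t) i * (- (\<Sum>k=1..M. \<rho> k * zd k t * resolv t (z k t) (\<lambda>\<zeta>. e \<zeta> ^ i * h \<zeta>))) + coeff P' i * m i t)) (at t)"
  proof (rule has_vector_derivative_sum)
    fix i assume i: "i \<in> {..N}"
    have "(m i has_vector_derivative - (\<Sum>k=1..M. \<rho> k * zd k t * resolv t (z k t) (\<lambda>\<zeta>. e \<zeta> ^ i * h \<zeta>))) (at t)"
      using moment_deriv[OF t c[of i]] unfolding m_def B.resolvent_def .
    moreover have "((\<lambda>s. coeff (P s) i) has_vector_derivative coeff P' i) (at t)" using P' i by simp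
    ultimately show "((\<lambda>s. coeff (P s) i * m i s) has_vector_derivative
       coeff (P t) i * (- (\<Sum>k=1..M. \<rho> k * zd k t * resolv t (z k t) (\<lambda>\<zeta>. e \<zeta> ^ i * h \<zeta>))) + coeff P' i * m i t) (at t)"
      by (rule has_vector_derivative_mult[rotated])
  qed
  also have "(\<Sum>i\<le>N. coeff (P t) i * (- (\<Sum>k=1..M. \<rho> k * zd k t * resolv t (z k t) (\<lambda>\<zeta>. e \<zeta> ^ i * h \<zeta>))) + coeff P' i * m i t)
    = (\<Sum>i\<le>N. coeff P' i * m i t) - (\<Sum>i\<le>N. \<Sum>k=1..M. \<rho> k * zd k t * (coeff (P t) i * resolv t (z k t) (\<lambda>\<zeta>. e \<zeta> ^ i * h \<zeta>)))"
    by (simp add: sum.distrib sum_subtractf sum_negf sum_distrib_left mult_ac)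
  also have "(\<Sum>i\<le>N. \<Sum>k=1..M. \<rho> k * zd k t * (coeff (P t) i * resolv t (z k t) (\<lambda>\<zeta>. e \<zeta> ^ i * h \<zeta>)))
     = (\<Sum>k=1..M. \<rho> k * zd k t * resolv t (z k t) (\<lambda>\<zeta>. poly (P t) (e \<zeta>) * h \<zeta>))"
    by (subst sum.swap, intro sum.cong refl) (simp only: resolv sum_distrib_left)
  also have "(\<Sum>i\<le>N. coeff P' i * m i t) = circle_mean (\<lambda>\<zeta>. w t \<zeta> * (poly P' (e \<zeta>) * h \<zeta>))"
    using poly[OF t deg(2)] by simp
  finally show ?thesis
    by (rule has_vector_derivative_transform_within_open[OF _ opn t]) (simp add: poly deg)
qed

definition poly_deriv :: "(real \<Rightarrow> complex poly) \<Rightarrow> nat \<Rightarrow> real \<Rightarrow> complex poly" where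
  "poly_deriv P N t = (\<Sum>i\<le>N. monom (vector_derivative (\<lambda>s. coeff (P s) i) (at t)) i)"

lemma coeff_poly_deriv: "coeff (poly_deriv P N t) i = (if i \<le> N then vector_derivative (\<lambda>s. coeff (P s) i) (at t) else 0)"
  by (simp add: poly_deriv_def coeff_sum)

lemma degree_poly_deriv: "degree (poly_deriv P N t) \<le> N"
  by (rule degree_le) (simp add: coeff_poly_deriv)

lemma kappa_deriv: "t \<in> S \<Longrightarrow> ((\<lambda>s. \<kappa> s n) has_vector_derivative vector_derivative (\<lambda>s. \<kappa> s n) (at t)) (at t)"
  unfolding vector_derivative_works[symmetric] using admissible by (simp add: admissible_system_def)

lemma differentiable_transform:
  fixes f g :: "real \<Rightarrow> complex"
  assumes "f differentiable (at t)" "t \<in> S" "\<And>s. s \<in> S \<Longrightarrow> f s = g s"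
  shows "g differentiable (at t)"
proof -
  have "(f has_vector_derivative vector_derivative f (at t)) (at t)"
    using assms(1) by (simp only: vector_derivative_works)
  hence "(g has_vector_derivative vector_derivative f (at t)) (at t)"
    by (rule has_vector_derivative_transform_within_open[OF _ opn assms(2,3)])
  thus ?thesis by (rule differentiableI_vector)
qed

text \<open>Only the leading coefficients are differentiable by assumption. Strong induction on n:
  the lower members have differentiable coefficients, hence differentiable pairings with the n-th
  monomial, and Gram-Schmidt gives the coefficients of the n-th members.\<close>

lemma coeff_differentiable:
  "t \<in> S \<Longrightarrow> (\<lambda>s. coeff (\<phi> s n) i) differentiable (at t) \<and> (\<lambda>s. coeff (\<phi>b s n) i) differentiable (at t)"
proof (induction n arbitrary: i rule: less_induct)
  case (less n)
  have bf: "(\<lambda>s. pair s (monom 1 n) (\<phi>b s m)) differentiable (at t) \<and> (\<lambda>s. pair s (\<phi> s m) (monom 1 n)) differentiable (at t)" if m: "m < n" for m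
  proof
    have D: "((\<lambda>s. coeff (\<phi>b s m) i) has_vector_derivative coeff (poly_deriv (\<lambda>s. \<phi>b s m) m t) i) (at t)"
        "((\<lambda>s. coeff (\<phi> s m) i) has_vector_derivative coeff (poly_deriv (\<lambda>s. \<phi> s m) m t) i) (at t)"
      if "i \<le> m" for i
      using less.IH[OF m less.prems, of i] that by (simp_all add: coeff_poly_deriv vector_derivative_works)
    have deg: "degree (\<phi>b s m) \<le> m" "degree (\<phi> s m) \<le> m" if "s \<in> S" for s
    proof -
      interpret B: biorthogonal "w s" "\<phi> s" "\<phi>b s" by (rule biorthogonal[OF that])
      show "degree (\<phi>b s m) \<le> m" "degree (\<phi> s m) \<le> m" by (simp_all add: B.degree_g B.degree_f)
    qed
    have p: "pair s p q = circle_mean (\<lambda>\<zeta>. w s \<zeta> * (poly p \<zeta> * poly q (1 / \<zeta>)))" if "s \<in> S" for s p q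
      by (simp add: biorthogonal.pairing_def[OF biorthogonal[OF that]])
    have ce: "continuous_on (sphere 0 1) (\<lambda>\<zeta>::complex. 1 / \<zeta>)" by (intro continuous_intros) auto
    have cp: "continuous_on (sphere 0 1) (\<lambda>\<zeta>::complex. poly (monom 1 n) \<zeta>)"
      "continuous_on (sphere 0 1) (\<lambda>\<zeta>::complex. poly (monom 1 n) (1 / \<zeta>))"
      unfolding poly_monom by (intro continuous_intros; force)+
    have "(\<lambda>s. circle_mean (\<lambda>\<zeta>. w s \<zeta> * (poly (\<phi>b s m) (1 / \<zeta>) * poly (monom 1 n) \<zeta>))) differentiable (at t)"
      by (rule differentiableI_vector, rule functional_deriv[OF less.prems ce cp(1) deg(1) degree_poly_deriv D(1)])
    thus "(\<lambda>s. pair s (monom 1 n) (\<phi>b s m)) differentiable (at t)"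
      by (rule differentiable_transform[OF _ less.prems]) (simp add: p mult.commute)
    have "(\<lambda>s. circle_mean (\<lambda>\<zeta>. w s \<zeta> * (poly (\<phi> s m) \<zeta> * poly (monom 1 n) (1 / \<zeta>)))) differentiable (at t)"
      by (rule differentiableI_vector, rule functional_deriv[OF less.prems continuous_on_id cp(2) deg(2) degree_poly_deriv D(2)])
    thus "(\<lambda>s. pair s (\<phi> s m) (monom 1 n)) differentiable (at t)"
      by (rule differentiable_transform[OF _ less.prems]) (simp add: p)
  qed
  have \<kappa>: "(\<lambda>s. \<kappa> s n) differentiable (at t)"
    using kappa_deriv[OF less.prems] by (rule differentiableI_vector)
  have "(\<lambda>s. \<kappa> s n * ((if n = i then 1 else 0) - (\<Sum>m<n. pair s (monom 1 n) (\<phi>b s m) * coeff (\<phi> s m) i))) differentiable (at t)"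
    using bf less.IH[OF _ less.prems] by (intro differentiable_mult differentiable_diff differentiable_const differentiable_sum \<kappa>) auto
  moreover have "\<kappa> s n * ((if n = i then 1 else 0) - (\<Sum>m<n. pair s (monom 1 n) (\<phi>b s m) * coeff (\<phi> s m) i)) = coeff (\<phi> s n) i" if "s \<in> S" for s
  proof -
    interpret B: biorthogonal "w s" "\<phi> s" "\<phi>b s" by (rule biorthogonal[OF that])
    show ?thesis by (subst (2) B.Gram_Schmidt) (simp add: coeff_sum)
  qed
  ultimately have 1: "(\<lambda>s. coeff (\<phi> s n) i) differentiable (at t)" by (rule differentiable_transform[OF _ less.prems])
  have "(\<lambda>s. \<kappa> s n * ((if n = i then 1 else 0) - (\<Sum>m<n. pair s (\<phi> s m) (monom 1 n) * coeff (\<phi>b s m) i))) differentiable (at t)"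
    using bf less.IH[OF _ less.prems] by (intro differentiable_mult differentiable_diff differentiable_const differentiable_sum \<kappa>) auto
  moreover have "\<kappa> s n * ((if n = i then 1 else 0) - (\<Sum>m<n. pair s (\<phi> s m) (monom 1 n) * coeff (\<phi>b s m) i)) = coeff (\<phi>b s n) i" if "s \<in> S" for s
  proof -
    interpret B: biorthogonal "w s" "\<phi> s" "\<phi>b s" by (rule biorthogonal[OF that])
    show ?thesis by (subst (2) B.flip.Gram_Schmidt) (simp add: coeff_sum)
  qed
  ultimately have 2: "(\<lambda>s. coeff (\<phi>b s n) i) differentiable (at t)" by (rule differentiable_transform[OF _ less.prems])
  show ?case using 1 2 ..
qed

end

section \<open>The deformation equation\<close>

context deformation_system
begin

text \<open>Minus the scalar in front of the residue matrix, times the velocity of z_k; the minus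
  sign in front of the sum in B is thereby absorbed.\<close>

definition "\<gamma> n t k = zd k t * \<rho> k / (2 * z k t ^ n)"
definition "\<kappa>d n t = vector_derivative (\<lambda>s. \<kappa> s n) (at t)"
text \<open>The lower left entry of \<open>B_infinity\<close>; it is forced by the top coefficient
  of the t-derivative of \<open>\<phi>s\<close>.\<close>

definition "\<beta> n t = (\<kappa>d n t * poly (\<phi>b t n) 0 + \<kappa> t n * vector_derivative (\<lambda>s. poly (\<phi>b s n) 0) (at t)) / \<kappa> t n ^ 2"

definition "b11 n t x = \<kappa>d n t / \<kappa> t n + (\<Sum>k=1..M. \<gamma> n t k / (x - z k t) * \<xi>1 t n (z k t) * poly (\<phi>s t n) (z k t))"
definition "b12 n t x = - (\<Sum>k=1..M. \<gamma> n t k / (x - z k t) * \<xi>1 t n (z k t) * poly (\<phi> t n) (z k t))"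
definition "b21 n t x = \<beta> n t + (\<Sum>k=1..M. \<gamma> n t k / (x - z k t) * \<xi>2 t n (z k t) * poly (\<phi>s t n) (z k t))"
definition "b22 n t x = - (\<kappa>d n t / \<kappa> t n) - (\<Sum>k=1..M. \<gamma> n t k / (x - z k t) * \<xi>2 t n (z k t) * poly (\<phi> t n) (z k t))"

text \<open>Minus the logarithmic t-derivative of the weight, extended from the circle to all x. The
  second column of Y carries the factor 1 / w; clearing it changes the matrix of the differential
  equation from B to B - \<sigma>.\<close>

definition "\<sigma> t x = (\<Sum>k=1..M. \<rho> k * zd k t / (x - z k t))"

lemma matrix2_eq_iff: "(X :: complex^2^2) = matrix2 a b c d \<longleftrightarrow> X $ 1 $ 1 = a \<and> X $ 1 $ 2 = b \<and> X $ 2 $ 1 = c \<and> X $ 2 $ 2 = d"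
  by (auto simp: matrix2_def vec_eq_iff forall_2)

lemma B_matrix_eq:
  assumes t: "t \<in> S"
  shows "B_matrix M z \<rho> w \<phi> \<phi>b n t x = matrix2 (b11 n t x) (b12 n t x) (b21 n t x) (b22 n t x)"
proof -
  interpret B: biorthogonal "w t" "\<phi> t" "\<phi>b t" by (rule biorthogonal[OF t])
  define c where "c k = zd k t / (x - z k t) * (- \<rho> k / (2 * z k t ^ n))" for k
  have A: "cscale (zd k t / (x - z k t)) (A_matrix (w t) (\<phi> t) (\<phi>b t) (\<rho> k) (z k t) n) $ i $ l
     = c k * matrix2 (poly (\<phi>s t n) (z k t) * \<xi>1 t n (z k t)) (- poly (\<phi> t n) (z k t) * \<xi>1 t n (z k t))
       (poly (\<phi>s t n) (z k t) * \<xi>2 t n (z k t)) (- poly (\<phi> t n) (z k t) * \<xi>2 t n (z k t)) $ i $ l" if "k \<in> {1..M}" for k i l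
    using value_at[OF t that, of n] B.phi_star_eq[OF z_nz[OF t that], of n]
    by (simp add: A_matrix_def cscale_def c_def Let_def)
  have c: "c k = - (\<gamma> n t k / (x - z k t))" for k by (simp add: c_def \<gamma>_def)
  have "(\<Sum>k=1..M. cscale (zd k t / (x - z k t)) (A_matrix (w t) (\<phi> t) (\<phi>b t) (\<rho> k) (z k t) n)) $ i $ l
    = (\<Sum>k=1..M. c k * matrix2 (poly (\<phi>s t n) (z k t) * \<xi>1 t n (z k t)) (- poly (\<phi> t n) (z k t) * \<xi>1 t n (z k t))
       (poly (\<phi>s t n) (z k t) * \<xi>2 t n (z k t)) (- poly (\<phi> t n) (z k t) * \<xi>2 t n (z k t)) $ i $ l)" for i l
    unfolding sum_component using A by (intro sum.cong refl) blast
  thus ?thesis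
    unfolding matrix2_eq_iff B_matrix_def zd_def[symmetric] B_infinity_def Let_def
    by (simp add: matrix2_def b11_def b12_def b21_def b22_def \<beta>_def \<kappa>d_def[symmetric] c sum_negf mult_ac)
qed

lemma degree_phi: "s \<in> S \<Longrightarrow> degree (\<phi> s n) \<le> n" "s \<in> S \<Longrightarrow> degree (\<phi>s s n) \<le> n"
proof -
  assume "s \<in> S"
  then interpret B: biorthogonal "w s" "\<phi> s" "\<phi>b s" by (rule biorthogonal)
  show "degree (\<phi> s n) \<le> n" by (simp add: B.degree_f)
  show "degree (\<phi>s s n) \<le> n" using degree_reflect_poly_le[of "\<phi>b s n"] by (simp add: B.degree_g)
qed

lemma phi_coeff_deriv:
  assumes t: "t \<in> S"
  shows "((\<lambda>s. coeff (\<phi> s n) i) has_vector_derivative coeff (poly_deriv (\<lambda>s. \<phi> s n) n t) i) (at t)"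
    "((\<lambda>s. coeff (\<phi>s s n) i) has_vector_derivative coeff (poly_deriv (\<lambda>s. \<phi>s s n) n t) i) (at t)"
proof -
  have "(\<lambda>s. coeff (\<phi> s n) i) differentiable (at t)" using coeff_differentiable[OF t] by blast
  hence 1: "((\<lambda>s. coeff (\<phi> s n) i) has_vector_derivative vector_derivative (\<lambda>s. coeff (\<phi> s n) i) (at t)) (at t)"
    by (simp only: vector_derivative_works)
  have "(\<lambda>s. if i > n then 0 else coeff (\<phi>b s n) (n - i)) differentiable (at t)"
    using coeff_differentiable[OF t] by (cases "i > n") auto
  hence "(\<lambda>s. coeff (\<phi>s s n) i) differentiable (at t)"
    by (rule differentiable_transform[OF _ t]) (simp add: biorthogonal.coeff_phi_s[OF biorthogonal])
  hence 2: "((\<lambda>s. coeff (\<phi>s s n) i) has_vector_derivative vector_derivative (\<lambda>s. coeff (\<phi>s s n) i) (at t)) (at t)"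
    by (simp only: vector_derivative_works)
  have z: "(f has_vector_derivative 0) (at t)" if "\<And>s. s \<in> S \<Longrightarrow> f s = (0::complex)" for f
    by (rule has_vector_derivative_transform_within_open[OF has_vector_derivative_const opn t]) (simp add: that)
  show "((\<lambda>s. coeff (\<phi> s n) i) has_vector_derivative coeff (poly_deriv (\<lambda>s. \<phi> s n) n t) i) (at t)"
  proof (cases "i \<le> n")
    case False
    have "((\<lambda>s. coeff (\<phi> s n) i) has_vector_derivative 0) (at t)"
    proof (rule z)
      fix s assume "s \<in> S"
      hence "degree (\<phi> s n) \<le> n" by (rule degree_phi)
      thus "coeff (\<phi> s n) i = 0" using False by (intro coeff_eq_0) auto
    qed
    thus ?thesis using False by (simp add: coeff_poly_deriv)
  qed (use 1 in \<open>simp add: coeff_poly_deriv\<close>)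
  show "((\<lambda>s. coeff (\<phi>s s n) i) has_vector_derivative coeff (poly_deriv (\<lambda>s. \<phi>s s n) n t) i) (at t)"
  proof (cases "i \<le> n")
    case False
    have "((\<lambda>s. coeff (\<phi>s s n) i) has_vector_derivative 0) (at t)"
      using False by (intro z) (simp add: biorthogonal.coeff_phi_s[OF biorthogonal])
    thus ?thesis using False by (simp add: coeff_poly_deriv)
  qed (use 2 in \<open>simp add: coeff_poly_deriv\<close>)
qed

lemma pderiv_sum: "pderiv (\<Sum>i\<in>A. f i) = (\<Sum>i\<in>A. pderiv (f i :: complex poly))"
  by (induction A rule: infinite_finite_induct) (auto simp: pderiv_add)

text \<open>Chain rule for a moving polynomial at a moving point; the Schlesinger matrices contain
  such values at the moving singularity.\<close>

lemma poly_has_deriv: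
  fixes P :: "real \<Rightarrow> complex poly" and X :: "real \<Rightarrow> complex"
  assumes "\<And>i. i \<le> N \<Longrightarrow> ((\<lambda>s. coeff (P s) i) has_vector_derivative coeff P' i) (at t)"
    and x: "(X has_vector_derivative X') (at t)"
    and "t \<in> S" "\<And>s. s \<in> S \<Longrightarrow> degree (P s) \<le> N" "degree P' \<le> N"
  shows "((\<lambda>s. poly (P s) (X s)) has_vector_derivative poly P' (X t) + poly (pderiv (P t)) (X t) * X') (at t)"
proof -
  have p: "poly q y = (\<Sum>i\<le>N. coeff q i * y ^ i)" if "degree q \<le> N" for q :: "complex poly" and y
    unfolding poly_altdef using that by (intro sum.mono_neutral_left) (auto simp: coeff_eq_0)
  have pw: "((\<lambda>s. X s ^ i) has_vector_derivative poly (pderiv (monom 1 i)) (X t) * X') (at t)" for i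
  proof -
    have "((\<lambda>y. y ^ i) has_field_derivative poly (pderiv (monom 1 i)) (X t)) (at (X t) within range X)"
      using has_field_derivative_at_within[OF poly_DERIV[of "monom 1 i" "X t"]] by (simp add: poly_monom)
    from field_vector_diff_chain_within[OF x this] show ?thesis by (simp add: o_def mult.commute)
  qed
  have "((\<lambda>s. \<Sum>i\<le>N. coeff (P s) i * X s ^ i) has_vector_derivative
     (\<Sum>i\<le>N. coeff (P t) i * (poly (pderiv (monom 1 i)) (X t) * X') + coeff P' i * X t ^ i)) (at t)"
    using assms(1) by (intro has_vector_derivative_sum has_vector_derivative_mult pw) auto
  also have "(\<Sum>i\<le>N. coeff (P t) i * (poly (pderiv (monom 1 i)) (X t) * X') + coeff P' i * X t ^ i)
    = (\<Sum>i\<le>N. coeff P' i * X t ^ i) + (\<Sum>i\<le>N. coeff (P t) i * poly (pderiv (monom 1 i)) (X t)) * X'"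
    by (simp add: sum.distrib sum_distrib_right sum_distrib_left mult_ac)
  also have "(\<Sum>i\<le>N. coeff (P t) i * poly (pderiv (monom 1 i)) (X t)) = poly (pderiv (P t)) (X t)"
  proof -
    have "P t = (\<Sum>i\<le>N. smult (coeff (P t) i) (monom 1 i))"
      using poly_as_sum_of_monoms'[of "P t" N] assms(3,4) by (simp add: smult_monom)
    hence "pderiv (P t) = pderiv (\<Sum>i\<le>N. smult (coeff (P t) i) (monom 1 i))" by (rule arg_cong)
    also have "\<dots> = (\<Sum>i\<le>N. smult (coeff (P t) i) (pderiv (monom 1 i)))"
      by (simp only: pderiv_sum pderiv_smult)
    finally have "poly (pderiv (P t)) (X t) = poly (\<Sum>i\<le>N. smult (coeff (P t) i) (pderiv (monom 1 i))) (X t)" by simp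
    thus ?thesis by (simp add: poly_sum)
  qed
  also have "(\<Sum>i\<le>N. coeff P' i * X t ^ i) = poly P' (X t)" using p assms(5) by simp
  finally show ?thesis
    by (rule has_vector_derivative_transform_within_open[OF _ opn \<open>t \<in> S\<close>]) (simp add: p assms)
qed

lemma phi_deriv_at:
  assumes "t \<in> S" "(X has_vector_derivative X') (at t)"
  shows "((\<lambda>s. poly (\<phi> s n) (X s)) has_vector_derivative poly (poly_deriv (\<lambda>s. \<phi> s n) n t) (X t) + poly (pderiv (\<phi> t n)) (X t) * X') (at t)"
    "((\<lambda>s. poly (\<phi>s s n) (X s)) has_vector_derivative poly (poly_deriv (\<lambda>s. \<phi>s s n) n t) (X t) + poly (pderiv (\<phi>s t n)) (X t) * X') (at t)"
proof -
  note [simp] = degree_phi degree_poly_deriv assms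
  show "((\<lambda>s. poly (\<phi> s n) (X s)) has_vector_derivative poly (poly_deriv (\<lambda>s. \<phi> s n) n t) (X t) + poly (pderiv (\<phi> t n)) (X t) * X') (at t)"
    by (rule poly_has_deriv[where N = n]) (simp_all add: phi_coeff_deriv)
  show "((\<lambda>s. poly (\<phi>s s n) (X s)) has_vector_derivative poly (poly_deriv (\<lambda>s. \<phi>s s n) n t) (X t) + poly (pderiv (\<phi>s t n)) (X t) * X') (at t)"
    by (rule poly_has_deriv[where N = n]) (simp_all add: phi_coeff_deriv)
qed

text \<open>A quotient of Christoffel-Darboux type: dividing out the root z_k leaves a polynomial in
  x without coefficients from n on. It is the polynomial form of the terms of B with pole 1 / (x -
  z_k).\<close>

definition "CD n t k = synthetic_div (smult (poly (\<phi>s t n) (z k t)) (\<phi> t n) - smult (poly (\<phi> t n) (z k t)) (\<phi>s t n)) (z k t)"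

lemma poly_CD:
  "(x - z k t) * poly (CD n t k) x = poly (\<phi>s t n) (z k t) * poly (\<phi> t n) x - poly (\<phi> t n) (z k t) * poly (\<phi>s t n) x"
proof -
  define p where "p = smult (poly (\<phi>s t n) (z k t)) (\<phi> t n) - smult (poly (\<phi> t n) (z k t)) (\<phi>s t n)"
  have "poly p (z k t) = 0" by (simp add: p_def)
  hence "[:- z k t, 1:] * CD n t k = p"
    using synthetic_div_correct'[of "z k t" p] by (simp add: CD_def p_def)
  hence "poly ([:- z k t, 1:] * CD n t k) x = poly p x" by simp
  thus ?thesis by (simp add: p_def algebra_simps)
qed

lemma coeff_CD:
  assumes t: "t \<in> S" and i: "i \<ge> n" shows "coeff (CD n t k) i = 0"
proof -
  define p where "p = smult (poly (\<phi>s t n) (z k t)) (\<phi> t n) - smult (poly (\<phi> t n) (z k t)) (\<phi>s t n)"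
  have dp: "degree p \<le> n" unfolding p_def
    using degree_phi[OF t, of n] by (intro degree_diff_le order_trans[OF degree_smult_le])
  show ?thesis
  proof (cases "degree p = 0")
    \<comment> \<open>The quotient of a constant is zero; the case is treated apart because
      \<open>degree p - 1\<close> is truncated at 0.\<close>
    case True
    hence "CD n t k = 0" unfolding CD_def p_def[symmetric] by (simp add: synthetic_div_eq_0_iff)
    thus ?thesis by simp
  next
    case False
    have "degree (CD n t k) = degree p - 1" unfolding CD_def p_def[symmetric] by (rule degree_synthetic_div)
    thus ?thesis using False dp i by (intro coeff_eq_0) linarith
  qed
qed

text \<open>Both resolvents at z_k carry the same factor z_k^(-m-1), so the pairing is half the
  Casoratian at z_k times that factor.\<close>

lemma pair_CD:
  assumes t: "t \<in> S" and k: "k \<in> {1..M}" and m: "m < n"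
  shows "pair t (CD n t k) (monom 1 m) = z k t ^ n / z k t ^ Suc m"
proof -
  interpret B: biorthogonal "w t" "\<phi> t" "\<phi>b t" by (rule biorthogonal[OF t])
  define Q where "Q = poly (\<phi>s t n) (z k t)"
  define P where "P = poly (\<phi> t n) (z k t)"
  have pole: "B.pole (z k t)" using pole[OF t, of k] k by simp
  note zk = z_nz[OF t k]
  define h1 where "h1 \<zeta> = poly (\<phi> t n) \<zeta> * (1 / \<zeta>) ^ m" for \<zeta>
  define h2 where "h2 \<zeta> = poly (\<phi>s t n) \<zeta> * (1 / \<zeta>) ^ m" for \<zeta>
  have h: "continuous_on (sphere 0 1) h1" "continuous_on (sphere 0 1) h2"
    unfolding h1_def h2_def by (intro continuous_on_mult B.continuous_poly B.continuous_power_inverse)+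
  have c: "continuous_on (sphere 0 1) (\<lambda>\<zeta>. Q * h1 \<zeta>)" "continuous_on (sphere 0 1) (\<lambda>\<zeta>. P * h2 \<zeta>)"
    by (intro continuous_on_mult continuous_on_const h)+
  have "pair t (CD n t k) (monom 1 m) = B.resolvent (z k t) (\<lambda>\<zeta>. Q * h1 \<zeta> - P * h2 \<zeta>)"
    unfolding B.pairing_def B.resolvent_def
  proof (rule circle_mean_cong[of "{z k t}"])
    show "moments_exist (\<lambda>\<zeta>. w t \<zeta> * (poly (CD n t k) \<zeta> * poly (monom 1 m) (1 / \<zeta>)))" by (rule B.moments_exist_pairing)
    show "moments_exist (\<lambda>\<zeta>. w t \<zeta> * (Q * h1 \<zeta> - P * h2 \<zeta>) / (\<zeta> - z k t))"
      by (intro B.moments_exist_resolvent pole continuous_on_diff c)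
    fix \<zeta> assume "\<zeta> \<notin> {z k t}"
    hence "poly (CD n t k) \<zeta> = (Q * poly (\<phi> t n) \<zeta> - P * poly (\<phi>s t n) \<zeta>) / (\<zeta> - z k t)"
      using poly_CD[of \<zeta> k t n] by (simp add: Q_def P_def eq_divide_eq mult.commute)
    thus "w t \<zeta> * (poly (CD n t k) \<zeta> * poly (monom 1 m) (1 / \<zeta>)) = w t \<zeta> * (Q * h1 \<zeta> - P * h2 \<zeta>) / (\<zeta> - z k t)"
      by (simp add: h1_def h2_def poly_monom left_diff_distrib mult.assoc)
  qed simp
  also have "\<dots> = Q * B.resolvent (z k t) h1 - P * B.resolvent (z k t) h2"
    by (simp only: B.resolvent_diff[OF pole c] B.resolvent_mult)
  also have "\<dots> = (Q * B.u1 n (z k t) - P * B.u2 n (z k t)) / 2 / z k t ^ Suc m"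
    unfolding h1_def h2_def using m by (simp add: B.resolvent_phi[OF pole zk] B.resolvent_phi_s[OF pole zk] diff_divide_distrib)
  also have "\<dots> = z k t ^ n / z k t ^ Suc m"
    using B.Casoratian[OF pole zk, of n] by (simp add: Q_def P_def)
  finally show ?thesis .
qed

text \<open>Differentiate the orthogonality relations, whose right-hand sides are 0 or, for
  \<open>\<phi>s\<close> and m = 0, 1 / \<kappa>_n. The moving weight contributes resolvents at the
  singular points, which are values of the functions of the second kind there.\<close>

lemma pair_poly_deriv:
  assumes t: "t \<in> S" and m: "m < n"
  shows "pair t (poly_deriv (\<lambda>s. \<phi> s n) n t) (monom 1 m) = (\<Sum>k=1..M. \<rho> k * zd k t * (\<xi>1 t n (z k t) / 2 / z k t ^ Suc m))"
    "pair t (poly_deriv (\<lambda>s. \<phi>s s n) n t) (monom 1 m) =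
      (if m = 0 then - \<kappa>d n t / \<kappa> t n ^ 2 else 0) + (\<Sum>k=1..M. \<rho> k * zd k t * (\<xi>2 t n (z k t) / 2 / z k t ^ Suc m))"
proof -
  interpret B: biorthogonal "w t" "\<phi> t" "\<phi>b t" by (rule biorthogonal[OF t])
  have pr: "pair s p (monom 1 m) = circle_mean (\<lambda>\<zeta>. w s \<zeta> * (poly p \<zeta> * (1 / \<zeta>) ^ m))" if "s \<in> S" for s p
    by (simp add: biorthogonal.pairing_def[OF biorthogonal[OF that]] poly_monom)
  have res: "resolv t (z k t) (\<lambda>\<zeta>. poly (\<phi> t n) \<zeta> * (1 / \<zeta>) ^ m) = \<xi>1 t n (z k t) / 2 / z k t ^ Suc m"
    "resolv t (z k t) (\<lambda>\<zeta>. poly (\<phi>s t n) \<zeta> * (1 / \<zeta>) ^ m) = \<xi>2 t n (z k t) / 2 / z k t ^ Suc m" if k: "k \<in> {1..M}" for k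
    using B.resolvent_phi[of "z k t" m n] B.resolvent_phi_s[of "z k t" m n] pole[OF t, of k] z_nz[OF t k] k m by simp_all
  have 1: "((\<lambda>s. pair s (\<phi> s n) (monom 1 m)) has_vector_derivative
     pair t (poly_deriv (\<lambda>s. \<phi> s n) n t) (monom 1 m) - (\<Sum>k=1..M. \<rho> k * zd k t * resolv t (z k t) (\<lambda>\<zeta>. poly (\<phi> t n) \<zeta> * (1 / \<zeta>) ^ m))) (at t)"
    unfolding pr[OF t]
    by (rule has_vector_derivative_transform_within_open[OF functional_deriv[OF t continuous_on_id B.continuous_power_inverse degree_phi(1) degree_poly_deriv phi_coeff_deriv(1)[OF t]] opn t])
       (simp_all add: pr)
  have "((\<lambda>s. pair s (\<phi> s n) (monom 1 m)) has_vector_derivative 0) (at t)"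
    by (rule has_vector_derivative_transform_within_open[OF has_vector_derivative_const opn t])
       (use m in \<open>simp add: biorthogonal.pairing_phi[OF biorthogonal]\<close>)
  from vector_derivative_unique_at[OF 1 this]
  have "pair t (poly_deriv (\<lambda>s. \<phi> s n) n t) (monom 1 m) = (\<Sum>k=1..M. \<rho> k * zd k t * resolv t (z k t) (\<lambda>\<zeta>. poly (\<phi> t n) \<zeta> * (1 / \<zeta>) ^ m))"
    by simp
  also have "\<dots> = (\<Sum>k=1..M. \<rho> k * zd k t * (\<xi>1 t n (z k t) / 2 / z k t ^ Suc m))"
    by (intro sum.cong refl) (simp only: res)
  finally show "pair t (poly_deriv (\<lambda>s. \<phi> s n) n t) (monom 1 m) = \<dots>" .
  have 2: "((\<lambda>s. pair s (\<phi>s s n) (monom 1 m)) has_vector_derivative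
     pair t (poly_deriv (\<lambda>s. \<phi>s s n) n t) (monom 1 m) - (\<Sum>k=1..M. \<rho> k * zd k t * resolv t (z k t) (\<lambda>\<zeta>. poly (\<phi>s t n) \<zeta> * (1 / \<zeta>) ^ m))) (at t)"
    unfolding pr[OF t]
    by (rule has_vector_derivative_transform_within_open[OF functional_deriv[OF t continuous_on_id B.continuous_power_inverse degree_phi(2) degree_poly_deriv phi_coeff_deriv(2)[OF t]] opn t])
       (simp_all add: pr)
  have inv: "((\<lambda>s. 1 / \<kappa> s n) has_vector_derivative - \<kappa>d n t / \<kappa> t n ^ 2) (at t)"
  proof -
    have "(inverse has_field_derivative - (inverse (\<kappa> t n) ^ Suc (Suc 0))) (at (\<kappa> t n) within range (\<lambda>s. \<kappa> s n))"
      by (rule DERIV_inverse[OF kappa_nz[OF t]])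
    from field_vector_diff_chain_within[OF kappa_deriv[OF t] this]
    show ?thesis by (simp add: o_def \<kappa>d_def[symmetric] inverse_eq_divide power2_eq_square)
  qed
  have "((\<lambda>s. if m = 0 then 1 / \<kappa> s n else 0) has_vector_derivative (if m = 0 then - \<kappa>d n t / \<kappa> t n ^ 2 else 0)) (at t)"
    using inv by (cases "m = 0") auto
  hence "((\<lambda>s. pair s (\<phi>s s n) (monom 1 m)) has_vector_derivative (if m = 0 then - \<kappa>d n t / \<kappa> t n ^ 2 else 0)) (at t)"
    by (rule has_vector_derivative_transform_within_open[OF _ opn t])
       (use m in \<open>simp add: biorthogonal.pairing_phi_s[OF biorthogonal]\<close>)
  from vector_derivative_unique_at[OF 2 this]
  have "pair t (poly_deriv (\<lambda>s. \<phi>s s n) n t) (monom 1 m) = (if m = 0 then - \<kappa>d n t / \<kappa> t n ^ 2 else 0) + (\<Sum>k=1..M. \<rho> k * zd k t * resolv t (z k t) (\<lambda>\<zeta>. poly (\<phi>s t n) \<zeta> * (1 / \<zeta>) ^ m))"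
    by (simp only: diff_eq_eq)
  also have "(\<Sum>k=1..M. \<rho> k * zd k t * resolv t (z k t) (\<lambda>\<zeta>. poly (\<phi>s t n) \<zeta> * (1 / \<zeta>) ^ m)) = (\<Sum>k=1..M. \<rho> k * zd k t * (\<xi>2 t n (z k t) / 2 / z k t ^ Suc m))"
    by (intro sum.cong refl) (simp only: res)
  finally show "pair t (poly_deriv (\<lambda>s. \<phi>s s n) n t) (monom 1 m) =
      (if m = 0 then - \<kappa>d n t / \<kappa> t n ^ 2 else 0) + \<dots>" .
qed

text \<open>A polynomial of degree at most n is determined by its top coefficient and its pairings
  with lower monomials. The poles of the weight produce multiples of z_k^(-m-1), which are the
  pairings of \<open>CD\<close>; the multiples of \<phi>_n and \<open>\<phi>s\<close> then match the
  top coefficient and the pairing with 1.\<close>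

lemma poly_deriv_eq:
  assumes t: "t \<in> S"
  shows "poly_deriv (\<lambda>s. \<phi> s n) n t = smult (\<kappa>d n t / \<kappa> t n) (\<phi> t n) + (\<Sum>k=1..M. smult (\<gamma> n t k * \<xi>1 t n (z k t)) (CD n t k))"
    "poly_deriv (\<lambda>s. \<phi>s s n) n t = smult (\<beta> n t) (\<phi> t n) - smult (\<kappa>d n t / \<kappa> t n) (\<phi>s t n) + (\<Sum>k=1..M. smult (\<gamma> n t k * \<xi>2 t n (z k t)) (CD n t k))"
proof -
  interpret B: biorthogonal "w t" "\<phi> t" "\<phi>b t" by (rule biorthogonal[OF t])
  have \<kappa>: "\<kappa> t n \<noteq> 0" by (rule kappa_nz[OF t])
  have CDsum: "coeff (\<Sum>k=1..M. smult (c k) (CD n t k)) i = 0" if "i \<ge> n" for c i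
    using coeff_CD[OF t that] by (simp add: coeff_sum)
  have pCD: "pair t (\<Sum>k=1..M. smult (\<gamma> n t k * u k) (CD n t k)) (monom 1 m) = (\<Sum>k=1..M. \<rho> k * zd k t * (u k / 2 / z k t ^ Suc m))" if "m < n" for u m
  proof -
    have "pair t (\<Sum>k=1..M. smult (\<gamma> n t k * u k) (CD n t k)) (monom 1 m) = (\<Sum>k=1..M. \<gamma> n t k * u k * (z k t ^ n / z k t ^ Suc m))"
      unfolding B.bf_sum B.bf_smult using pair_CD[OF t _ that] by (intro sum.cong refl) simp
    also have "\<dots> = (\<Sum>k=1..M. \<rho> k * zd k t * (u k / 2 / z k t ^ Suc m))"
      using z_nz[OF t] by (intro sum.cong refl) (simp add: \<gamma>_def field_simps)
    finally show ?thesis .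
  qed
  have c: "coeff (poly_deriv (\<lambda>s. \<phi> s n) n t) n = \<kappa>d n t"
  proof -
    have "((\<lambda>s. coeff (\<phi> s n) n) has_vector_derivative \<kappa>d n t) (at t)"
      unfolding \<kappa>d_def
      by (rule has_vector_derivative_transform_within_open[OF kappa_deriv[OF t] opn t]) (metis biorthogonal biorthogonal_def biorthogonal_system_def kappa_def)
    from vector_derivative_unique_at[OF phi_coeff_deriv(1)[OF t] this] show ?thesis .
  qed
  have cs: "coeff (poly_deriv (\<lambda>s. \<phi>s s n) n t) n = vector_derivative (\<lambda>s. poly (\<phi>b s n) 0) (at t)"
  proof -
    have "((\<lambda>s. coeff (\<phi>b s n) 0) has_vector_derivative vector_derivative (\<lambda>s. coeff (\<phi>b s n) 0) (at t)) (at t)"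
      using coeff_differentiable[OF t] by (simp only: vector_derivative_works)
    hence "((\<lambda>s. coeff (\<phi>s s n) n) has_vector_derivative vector_derivative (\<lambda>s. poly (\<phi>b s n) 0) (at t)) (at t)"
      unfolding poly_0_coeff_0
      by (rule has_vector_derivative_transform_within_open[OF _ opn t]) (simp add: biorthogonal.coeff_phi_s[OF biorthogonal])
    from vector_derivative_unique_at[OF phi_coeff_deriv(2)[OF t] this] show ?thesis .
  qed
  have hi: "coeff (\<phi> t n) i = 0" "coeff (\<phi>s t n) i = 0" if "i > n" for i
    using that degree_phi[OF t, of n] by (auto intro!: coeff_eq_0)
  define T where "T = smult (\<kappa>d n t / \<kappa> t n) (\<phi> t n) + (\<Sum>k=1..M. smult (\<gamma> n t k * \<xi>1 t n (z k t)) (CD n t k))"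
  have "poly_deriv (\<lambda>s. \<phi> s n) n t - T = 0"
  proof (rule B.zero_by_monomials)
    show "coeff (poly_deriv (\<lambda>s. \<phi> s n) n t - T) i = 0" if "n \<le> i" for i
      using CDsum[OF that] \<kappa> c B.lead_f[of n] hi[of i] that by (cases "i = n") (auto simp: T_def coeff_poly_deriv)
    show "pair t (poly_deriv (\<lambda>s. \<phi> s n) n t - T) (monom 1 m) = 0" if "m < n" for m
      unfolding T_def B.bf_diff B.bf_add B.bf_smult pCD[OF that] pair_poly_deriv[OF t that]
      using that by (simp add: B.pairing_phi)
  qed
  thus "poly_deriv (\<lambda>s. \<phi> s n) n t = smult (\<kappa>d n t / \<kappa> t n) (\<phi> t n) + (\<Sum>k=1..M. smult (\<gamma> n t k * \<xi>1 t n (z k t)) (CD n t k))"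
    by (simp add: T_def)
  define T2 where "T2 = smult (\<beta> n t) (\<phi> t n) - smult (\<kappa>d n t / \<kappa> t n) (\<phi>s t n) + (\<Sum>k=1..M. smult (\<gamma> n t k * \<xi>2 t n (z k t)) (CD n t k))"
  have "poly_deriv (\<lambda>s. \<phi>s s n) n t - T2 = 0"
  proof (rule B.zero_by_monomials)
    have lead: "vector_derivative (\<lambda>s. poly (\<phi>b s n) 0) (at t) = \<beta> n t * \<kappa> t n - \<kappa>d n t / \<kappa> t n * poly (\<phi>b t n) 0"
      using \<kappa> by (simp add: \<beta>_def field_simps power2_eq_square)
    show "coeff (poly_deriv (\<lambda>s. \<phi>s s n) n t - T2) i = 0" if "n \<le> i" for i
    proof (cases "i = n")
      case True
      thus ?thesis using CDsum[of n] cs lead B.lead_f[of n] B.coeff_phi_s_top[of n] by (simp add: T2_def)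
    next
      case False
      thus ?thesis using CDsum[OF that] hi[of i] that by (simp add: T2_def coeff_poly_deriv)
    qed
    show "pair t (poly_deriv (\<lambda>s. \<phi>s s n) n t - T2) (monom 1 m) = 0" if "m < n" for m
      unfolding T2_def B.bf_diff B.bf_add B.bf_smult pCD[OF that] pair_poly_deriv[OF t that]
      using that by (simp add: B.pairing_phi B.pairing_phi_s power2_eq_square)
  qed
  thus "poly_deriv (\<lambda>s. \<phi>s s n) n t = smult (\<beta> n t) (\<phi> t n) - smult (\<kappa>d n t / \<kappa> t n) (\<phi>s t n) + (\<Sum>k=1..M. smult (\<gamma> n t k * \<xi>2 t n (z k t)) (CD n t k))"
    by (simp add: T2_def)
qed

lemma poly_CD_div: "x \<noteq> z k t \<Longrightarrow> poly (CD n t k) x = (poly (\<phi>s t n) (z k t) * poly (\<phi> t n) x - poly (\<phi> t n) (z k t) * poly (\<phi>s t n) x) / (x - z k t)"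
  using poly_CD[of x k t n] by (simp add: eq_divide_eq mult.commute)

lemma phi_deriv:
  assumes t: "t \<in> S" and x: "\<forall>k\<in>{1..M}. x \<noteq> z k t"
  shows "((\<lambda>s. poly (\<phi> s n) x) has_vector_derivative b11 n t x * poly (\<phi> t n) x + b12 n t x * poly (\<phi>s t n) x) (at t)"
    "((\<lambda>s. poly (\<phi>s s n) x) has_vector_derivative b21 n t x * poly (\<phi> t n) x + b22 n t x * poly (\<phi>s t n) x) (at t)"
proof -
  define f where "f = poly (\<phi> t n) x"
  define fs where "fs = poly (\<phi>s t n) x"
  have CD: "(\<Sum>k=1..M. \<gamma> n t k * u k * poly (CD n t k) x)
    = (\<Sum>k=1..M. \<gamma> n t k / (x - z k t) * u k * poly (\<phi>s t n) (z k t)) * f - (\<Sum>k=1..M. \<gamma> n t k / (x - z k t) * u k * poly (\<phi> t n) (z k t)) * fs" for u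
    unfolding sum_distrib_right sum_subtractf[symmetric]
    using x by (intro sum.cong refl) (simp add: poly_CD_div f_def fs_def diff_divide_distrib right_diff_distrib mult_ac)
  have "poly (poly_deriv (\<lambda>s. \<phi> s n) n t) x = \<kappa>d n t / \<kappa> t n * f + (\<Sum>k=1..M. \<gamma> n t k * \<xi>1 t n (z k t) * poly (CD n t k) x)"
    by (simp add: poly_deriv_eq(1)[OF t] poly_sum f_def)
  also have "\<dots> = b11 n t x * f + b12 n t x * fs"
    unfolding CD b11_def b12_def by (simp only: distrib_right minus_mult_left) simp
  finally show "((\<lambda>s. poly (\<phi> s n) x) has_vector_derivative b11 n t x * poly (\<phi> t n) x + b12 n t x * poly (\<phi>s t n) x) (at t)"
    using phi_deriv_at(1)[OF t has_vector_derivative_const, of n x] by (simp add: f_def fs_def)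
  have "poly (poly_deriv (\<lambda>s. \<phi>s s n) n t) x = \<beta> n t * f - \<kappa>d n t / \<kappa> t n * fs + (\<Sum>k=1..M. \<gamma> n t k * \<xi>2 t n (z k t) * poly (CD n t k) x)"
    by (simp add: poly_deriv_eq(2)[OF t] poly_sum f_def fs_def)
  also have "\<dots> = b21 n t x * f + b22 n t x * fs"
    unfolding CD b21_def b22_def by (simp only: distrib_right left_diff_distrib minus_mult_left) simp
  finally show "((\<lambda>s. poly (\<phi>s s n) x) has_vector_derivative b21 n t x * poly (\<phi> t n) x + b22 n t x * poly (\<phi>s t n) x) (at t)"
    using phi_deriv_at(2)[OF t has_vector_derivative_const, of n x] by (simp add: f_def fs_def)
qed

end

section \<open>Time derivatives of the functions of the second kind\<close>

context biorthogonal
begin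

lemma second_kind_add: "pole x \<Longrightarrow> second_kind (p + q) x = second_kind p x + second_kind q x"
  by (simp add: second_kind_def distrib_left resolvent_add continuous_on_mult continuous_poly)

lemma second_kind_smult: "second_kind (smult c p) x = c * second_kind p x"
  using resolvent_mult[of x c "\<lambda>\<zeta>. \<zeta> * poly p \<zeta>"] by (simp add: second_kind_def mult_ac)

lemma second_kind_diff: "pole x \<Longrightarrow> second_kind (p - q) x = second_kind p x - second_kind q x"
  using second_kind_add[of x "p - q" q] by simp

lemma second_kind_sum: "pole x \<Longrightarrow> second_kind (\<Sum>i\<in>A. P i) x = (\<Sum>i\<in>A. second_kind (P i) x)"
  by (induction A rule: infinite_finite_induct)
    (use second_kind_smult[of 0 0 x] in \<open>auto simp: second_kind_add\<close>)

text \<open>The division by \<zeta> - y inside q becomes the pole of a resolvent at y, after which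
  partial fractions apply; y may lie on the circle.\<close>

lemma second_kind_quotient:
  assumes x: "cmod x \<noteq> 1" and y: "pole y" "x \<noteq> y" and q: "\<And>\<zeta>. (\<zeta> - y) * poly q \<zeta> = poly p \<zeta>"
  shows "second_kind q x = (second_kind p x - second_kind p y) / (x - y)"
proof -
  have c: "continuous_on (sphere 0 1) (\<lambda>\<zeta>. \<zeta> * poly p \<zeta>)" for p :: "complex poly"
    by (intro continuous_on_mult continuous_on_id continuous_poly)
  have "resolvent x (\<lambda>\<zeta>. \<zeta> * poly q \<zeta>) = resolvent y (\<lambda>\<zeta>. \<zeta> * poly p \<zeta> / (\<zeta> - x))"
    unfolding resolvent_def
  proof (rule circle_mean_cong[of "{y}"])
    show "moments_exist (\<lambda>\<zeta>. w \<zeta> * (\<zeta> * poly q \<zeta>) / (\<zeta> - x))"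
      by (intro moments_exist_resolvent pole_off_circle x c)
    show "moments_exist (\<lambda>\<zeta>. w \<zeta> * (\<zeta> * poly p \<zeta> / (\<zeta> - x)) / (\<zeta> - y))"
      using x by (intro moments_exist_resolvent y continuous_on_divide c) (auto intro!: continuous_intros)
    fix \<zeta> assume "\<zeta> \<notin> {y}"
    hence "poly p \<zeta> / (\<zeta> - y) = poly q \<zeta>" using q[of \<zeta>] by (simp add: divide_eq_eq mult.commute)
    thus "w \<zeta> * (\<zeta> * poly q \<zeta>) / (\<zeta> - x) = w \<zeta> * (\<zeta> * poly p \<zeta> / (\<zeta> - x)) / (\<zeta> - y)"
      by (metis (no_types, lifting) divide_divide_eq_left mult.commute times_divide_eq_right)
  qed simp
  thus ?thesis using resolvent_difference[OF x y c, of p] by (simp add: second_kind_def diff_divide_distrib)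
qed

end

context deformation_system
begin

lemma second_kind_deriv:
  assumes t: "t \<in> S" and x: "cmod x \<noteq> 1" "\<forall>k\<in>{1..M}. x \<noteq> z k t"
    and P: "\<And>s. s \<in> S \<Longrightarrow> degree (P s) \<le> N" "degree P' \<le> N" "\<And>i. i \<le> N \<Longrightarrow> ((\<lambda>s. coeff (P s) i) has_vector_derivative coeff P' i) (at t)"
  shows "((\<lambda>s. biorthogonal.second_kind (w s) (P s) x) has_vector_derivative
     biorthogonal.second_kind (w t) P' x - (\<Sum>k=1..M. \<rho> k * zd k t / (x - z k t) *
        (biorthogonal.second_kind (w t) (P t) x - biorthogonal.second_kind (w t) (P t) (z k t)))) (at t)"
proof -
  interpret B: biorthogonal "w t" "\<phi> t" "\<phi>b t" by (rule biorthogonal[OF t])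
  have c: "continuous_on (sphere 0 1) (\<lambda>\<zeta>. \<zeta> / (\<zeta> - x))"
    using x(1) by (intro continuous_intros) auto
  have sk: "biorthogonal.second_kind (w s) p x = 2 * circle_mean (\<lambda>\<zeta>. w s \<zeta> * (poly p \<zeta> * (\<zeta> / (\<zeta> - x))))" if "s \<in> S" for s p
    unfolding biorthogonal.second_kind_def[OF biorthogonal[OF that]] biorthogonal.resolvent_def[OF biorthogonal[OF that]]
    by (simp add: mult_ac)
  have res: "2 * resolv t (z k t) (\<lambda>\<zeta>. poly p \<zeta> * (\<zeta> / (\<zeta> - x))) = (B.second_kind p x - B.second_kind p (z k t)) / (x - z k t)"
    if k: "k \<in> {1..M}" for k p
  proof -
    have cp: "continuous_on (sphere 0 1) (\<lambda>\<zeta>. \<zeta> * poly p \<zeta>)"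
      by (intro continuous_on_mult continuous_on_id B.continuous_poly)
    have "resolv t (z k t) (\<lambda>\<zeta>. poly p \<zeta> * (\<zeta> / (\<zeta> - x))) = resolv t (z k t) (\<lambda>\<zeta>. \<zeta> * poly p \<zeta> / (\<zeta> - x))"
      by (simp add: mult.commute)
    also have "\<dots> = (resolv t x (\<lambda>\<zeta>. \<zeta> * poly p \<zeta>) - resolv t (z k t) (\<lambda>\<zeta>. \<zeta> * poly p \<zeta>)) / (x - z k t)"
      using x(2) k pole[OF t, of k] by (intro B.resolvent_difference[OF x(1) _ _ cp]) auto
    finally show ?thesis by (simp add: B.second_kind_def diff_divide_distrib right_diff_distrib)
  qed
  have "((\<lambda>s. 2 * circle_mean (\<lambda>\<zeta>. w s \<zeta> * (poly (P s) \<zeta> * (\<zeta> / (\<zeta> - x))))) has_vector_derivative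
     2 * (circle_mean (\<lambda>\<zeta>. w t \<zeta> * (poly P' \<zeta> * (\<zeta> / (\<zeta> - x)))) -
     (\<Sum>k=1..M. \<rho> k * zd k t * resolv t (z k t) (\<lambda>\<zeta>. poly (P t) \<zeta> * (\<zeta> / (\<zeta> - x)))))) (at t)"
    by (rule has_vector_derivative_mult_right[OF functional_deriv[OF t continuous_on_id c P]])
  also have "2 * (circle_mean (\<lambda>\<zeta>. w t \<zeta> * (poly P' \<zeta> * (\<zeta> / (\<zeta> - x)))) -
     (\<Sum>k=1..M. \<rho> k * zd k t * resolv t (z k t) (\<lambda>\<zeta>. poly (P t) \<zeta> * (\<zeta> / (\<zeta> - x)))))
     = 2 * circle_mean (\<lambda>\<zeta>. w t \<zeta> * (poly P' \<zeta> * (\<zeta> / (\<zeta> - x)))) -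
     (\<Sum>k=1..M. \<rho> k * zd k t * (2 * resolv t (z k t) (\<lambda>\<zeta>. poly (P t) \<zeta> * (\<zeta> / (\<zeta> - x)))))"
    unfolding right_diff_distrib sum_distrib_left by (simp only: mult.left_commute)
  also have "(\<Sum>k=1..M. \<rho> k * zd k t * (2 * resolv t (z k t) (\<lambda>\<zeta>. poly (P t) \<zeta> * (\<zeta> / (\<zeta> - x)))))
    = (\<Sum>k=1..M. \<rho> k * zd k t / (x - z k t) * (B.second_kind (P t) x - B.second_kind (P t) (z k t)))"
  proof (intro sum.cong refl)
    fix k assume k: "k \<in> {1..M}"
    show "\<rho> k * zd k t * (2 * resolv t (z k t) (\<lambda>\<zeta>. poly (P t) \<zeta> * (\<zeta> / (\<zeta> - x))))
      = \<rho> k * zd k t / (x - z k t) * (B.second_kind (P t) x - B.second_kind (P t) (z k t))"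
      unfolding res[OF k] by simp
  qed
  also have "2 * circle_mean (\<lambda>\<zeta>. w t \<zeta> * (poly P' \<zeta> * (\<zeta> / (\<zeta> - x)))) = B.second_kind P' x"
    by (rule sk[OF t, symmetric])
  finally show ?thesis
    by (rule has_vector_derivative_transform_within_open[OF _ opn t]) (simp add: sk)
qed

text \<open>The transform of \<open>CD\<close> differs from the polynomial case by the Casoratian
  term - 2 z_k^n. This term cancels the values at z_k that come from the moving weight, and only -
  \<sigma> times the function itself remains.\<close>

lemma u_deriv:
  assumes t: "t \<in> S" and x: "cmod x \<noteq> 1" "\<forall>k\<in>{1..M}. x \<noteq> z k t"
  shows "((\<lambda>s. \<xi>1 s n x) has_vector_derivative (b11 n t x - \<sigma> t x) * \<xi>1 t n x + b12 n t x * \<xi>2 t n x) (at t)"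
    "((\<lambda>s. \<xi>2 s n x) has_vector_derivative b21 n t x * \<xi>1 t n x + (b22 n t x - \<sigma> t x) * \<xi>2 t n x) (at t)"
proof -
  interpret B: biorthogonal "w t" "\<phi> t" "\<phi>b t" by (rule biorthogonal[OF t])
  have px: "B.pole x" by (rule B.pole_off_circle[OF x(1)])
  have pz: "B.pole (z k t)" "z k t \<noteq> 0" if "k \<in> {1..M}" for k using pole[OF t, of k] z_nz[OF t that] that by auto
  define U1 where "U1 = \<xi>1 t n x"
  define U2 where "U2 = \<xi>2 t n x"
  have V: "B.second_kind (\<phi> t n) y = \<xi>1 t n y" "B.second_kind (\<phi>s t n) y = \<xi>2 t n y + 2 / \<kappa> t n" for y
    by (simp_all add: B.u1_def B.u2_def)
  have CD: "B.second_kind (CD n t k) x = (poly (\<phi>s t n) (z k t) * U1 - poly (\<phi> t n) (z k t) * U2 - 2 * z k t ^ n) / (x - z k t)"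
    if k: "k \<in> {1..M}" for k
  proof -
    define p where "p = smult (poly (\<phi>s t n) (z k t)) (\<phi> t n) - smult (poly (\<phi> t n) (z k t)) (\<phi>s t n)"
    have quot: "B.second_kind (CD n t k) x = (B.second_kind p x - B.second_kind p (z k t)) / (x - z k t)"
      using x k pz[OF k] poly_CD[of _ k t n] by (intro B.second_kind_quotient) (auto simp: p_def)
    have "B.second_kind p y = poly (\<phi>s t n) (z k t) * \<xi>1 t n y - poly (\<phi> t n) (z k t) * (\<xi>2 t n y + 2 / \<kappa> t n)" if "B.pole y" for y
      unfolding p_def by (simp only: B.second_kind_diff[OF that] B.second_kind_smult V)
    note sk = this
    have "B.second_kind p x - B.second_kind p (z k t) = poly (\<phi>s t n) (z k t) * U1 - poly (\<phi> t n) (z k t) * U2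
       - (poly (\<phi>s t n) (z k t) * \<xi>1 t n (z k t) - poly (\<phi> t n) (z k t) * \<xi>2 t n (z k t))"
      unfolding sk[OF px] sk[OF pz(1)[OF k]] by (simp add: U1_def U2_def algebra_simps)
    also have "poly (\<phi>s t n) (z k t) * \<xi>1 t n (z k t) - poly (\<phi> t n) (z k t) * \<xi>2 t n (z k t) = 2 * z k t ^ n"
      by (rule B.Casoratian[OF pz[OF k]])
    finally show ?thesis unfolding quot by simp
  qed
  have sum: "(\<Sum>k=1..M. \<gamma> n t k * u k * B.second_kind (CD n t k) x) - (\<Sum>k=1..M. \<rho> k * zd k t / (x - z k t) * (U - u k))
    = (\<Sum>k=1..M. \<gamma> n t k / (x - z k t) * u k * poly (\<phi>s t n) (z k t)) * U1
     - (\<Sum>k=1..M. \<gamma> n t k / (x - z k t) * u k * poly (\<phi> t n) (z k t)) * U2 - \<sigma> t x * U" for u U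
    unfolding sum_distrib_right \<sigma>_def sum_subtractf[symmetric]
  proof (intro sum.cong refl)
    fix k assume k: "k \<in> {1..M}"
    have g: "\<gamma> n t k * (2 * z k t ^ n) = \<rho> k * zd k t" using pz(2)[OF k] by (simp add: \<gamma>_def)
    have "\<gamma> n t k * u k * B.second_kind (CD n t k) x = \<gamma> n t k / (x - z k t) * u k * (poly (\<phi>s t n) (z k t) * U1 - poly (\<phi> t n) (z k t) * U2)
      - \<gamma> n t k * (2 * z k t ^ n) / (x - z k t) * u k"
      unfolding CD[OF k] by (simp add: diff_divide_distrib right_diff_distrib mult_ac)
    thus "\<gamma> n t k * u k * B.second_kind (CD n t k) x - \<rho> k * zd k t / (x - z k t) * (U - u k) =
      \<gamma> n t k / (x - z k t) * u k * poly (\<phi>s t n) (z k t) * U1 - \<gamma> n t k / (x - z k t) * u k * poly (\<phi> t n) (z k t) * U2 - \<rho> k * zd k t / (x - z k t) * U"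
      unfolding g by (simp add: right_diff_distrib mult.assoc)
  qed
  have "((\<lambda>s. biorthogonal.second_kind (w s) (\<phi> s n) x) has_vector_derivative
     B.second_kind (poly_deriv (\<lambda>s. \<phi> s n) n t) x - (\<Sum>k=1..M. \<rho> k * zd k t / (x - z k t) *
        (B.second_kind (\<phi> t n) x - B.second_kind (\<phi> t n) (z k t)))) (at t)"
    by (rule second_kind_deriv[OF t x degree_phi(1) degree_poly_deriv phi_coeff_deriv(1)[OF t]])
  also have "B.second_kind (poly_deriv (\<lambda>s. \<phi> s n) n t) x = \<kappa>d n t / \<kappa> t n * U1 + (\<Sum>k=1..M. \<gamma> n t k * \<xi>1 t n (z k t) * B.second_kind (CD n t k) x)"
    unfolding poly_deriv_eq(1)[OF t] by (simp only: B.second_kind_add[OF px] B.second_kind_sum[OF px] B.second_kind_smult V U1_def)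
  also have "\<kappa>d n t / \<kappa> t n * U1 + (\<Sum>k=1..M. \<gamma> n t k * \<xi>1 t n (z k t) * B.second_kind (CD n t k) x) - (\<Sum>k=1..M. \<rho> k * zd k t / (x - z k t) *
        (B.second_kind (\<phi> t n) x - B.second_kind (\<phi> t n) (z k t))) = (b11 n t x - \<sigma> t x) * U1 + b12 n t x * U2"
    unfolding V U1_def[symmetric] add_diff_eq[symmetric] sum b11_def b12_def by (simp only: left_diff_distrib distrib_right minus_mult_left) simp
  finally show "((\<lambda>s. \<xi>1 s n x) has_vector_derivative (b11 n t x - \<sigma> t x) * \<xi>1 t n x + b12 n t x * \<xi>2 t n x) (at t)"
    unfolding U1_def U2_def
    by (rule has_vector_derivative_transform_within_open[OF _ opn t]) (simp add: biorthogonal.u1_def[OF biorthogonal])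
  have inv: "((\<lambda>s. 2 / \<kappa> s n) has_vector_derivative - 2 * \<kappa>d n t / \<kappa> t n ^ 2) (at t)"
  proof -
    have "(inverse has_field_derivative - (inverse (\<kappa> t n) ^ Suc (Suc 0))) (at (\<kappa> t n) within range (\<lambda>s. \<kappa> s n))"
      by (rule DERIV_inverse[OF kappa_nz[OF t]])
    from has_vector_derivative_mult_right[OF field_vector_diff_chain_within[OF kappa_deriv[OF t] this], of 2]
    show ?thesis by (simp add: o_def \<kappa>d_def[symmetric] inverse_eq_divide power2_eq_square)
  qed
  have "((\<lambda>s. biorthogonal.second_kind (w s) (\<phi>s s n) x - 2 / \<kappa> s n) has_vector_derivative
     (B.second_kind (poly_deriv (\<lambda>s. \<phi>s s n) n t) x - (\<Sum>k=1..M. \<rho> k * zd k t / (x - z k t) *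
        (B.second_kind (\<phi>s t n) x - B.second_kind (\<phi>s t n) (z k t)))) - (- 2 * \<kappa>d n t / \<kappa> t n ^ 2)) (at t)"
    by (rule has_vector_derivative_diff[OF second_kind_deriv[OF t x degree_phi(2) degree_poly_deriv phi_coeff_deriv(2)[OF t]] inv])
  also have "B.second_kind (poly_deriv (\<lambda>s. \<phi>s s n) n t) x = \<beta> n t * U1 - \<kappa>d n t / \<kappa> t n * (U2 + 2 / \<kappa> t n) + (\<Sum>k=1..M. \<gamma> n t k * \<xi>2 t n (z k t) * B.second_kind (CD n t k) x)"
    unfolding poly_deriv_eq(2)[OF t] by (simp only: B.second_kind_add[OF px] B.second_kind_diff[OF px] B.second_kind_sum[OF px] B.second_kind_smult V U1_def U2_def)
  also have "(\<beta> n t * U1 - \<kappa>d n t / \<kappa> t n * (U2 + 2 / \<kappa> t n) + (\<Sum>k=1..M. \<gamma> n t k * \<xi>2 t n (z k t) * B.second_kind (CD n t k) x) - (\<Sum>k=1..M. \<rho> k * zd k t / (x - z k t) *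
        (B.second_kind (\<phi>s t n) x - B.second_kind (\<phi>s t n) (z k t)))) - (- 2 * \<kappa>d n t / \<kappa> t n ^ 2)
     = \<beta> n t * U1 - \<kappa>d n t / \<kappa> t n * U2 + ((\<Sum>k=1..M. \<gamma> n t k * \<xi>2 t n (z k t) * B.second_kind (CD n t k) x) - (\<Sum>k=1..M. \<rho> k * zd k t / (x - z k t) * (U2 - \<xi>2 t n (z k t))))"
    unfolding V U2_def[symmetric] by (simp add: algebra_simps power2_eq_square)
  also have "\<dots> = b21 n t x * U1 + (b22 n t x - \<sigma> t x) * U2"
    unfolding sum b21_def b22_def by (simp only: left_diff_distrib distrib_right minus_mult_left) simp
  finally show "((\<lambda>s. \<xi>2 s n x) has_vector_derivative b21 n t x * \<xi>1 t n x + (b22 n t x - \<sigma> t x) * \<xi>2 t n x) (at t)"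
    unfolding U1_def U2_def
    by (rule has_vector_derivative_transform_within_open[OF _ opn t]) (simp add: biorthogonal.u2_def[OF biorthogonal])
qed

end

section \<open>Schlesinger transformations\<close>

context biorthogonal
begin

lemma pairing_pCons: "pairing (pCons 0 q) (monom 1 (Suc m)) = pairing q (monom 1 m)"
  unfolding pairing_def
proof (rule circle_mean_cong_strong)
  fix \<zeta> :: complex assume "cmod \<zeta> = 1"
  hence "\<zeta> \<noteq> 0" by auto
  thus "w \<zeta> * (poly (pCons 0 q) \<zeta> * poly (monom 1 (Suc m)) (1 / \<zeta>)) = w \<zeta> * (poly q \<zeta> * poly (monom 1 m) (1 / \<zeta>))"
    by (simp add: poly_monom)
qed

text \<open>The criterion suited to starred polynomials, which are orthogonal to \<zeta>, ...,
  \<zeta>^n and normalised by their constant term: dividing by \<zeta> leads back to the monomials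
  below n.\<close>

lemma zero_by_shifted_monomials:
  assumes "\<And>i. i > n \<Longrightarrow> coeff r i = 0" "coeff r 0 = 0" "\<And>m. 1 \<le> m \<Longrightarrow> m \<le> n \<Longrightarrow> pairing r (monom 1 m) = 0"
  shows "r = 0"
proof -
  obtain q where r: "r = pCons 0 q" using assms(2) by (metis coeff_pCons_0 pCons_cases)
  have "q = 0"
  proof (rule zero_by_monomials)
    show "coeff q i = 0" if "i \<ge> n" for i using assms(1)[of "Suc i"] that by (simp add: r)
    show "pairing q (monom 1 m) = 0" if "m < n" for m
      using assms(3)[of "Suc m"] that by (simp add: r pairing_pCons)
  qed
  thus ?thesis by (simp add: r)
qed

lemma coeff_phi_high: "i > n \<Longrightarrow> coeff (\<phi> n) i = 0" "i > n \<Longrightarrow> coeff (\<phi>s n) i = 0"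
  by (simp_all add: coeff_eq_0 degree_f coeff_phi_s)

text \<open>All three polynomials are orthogonal to \<zeta>, ..., \<zeta>^n, and the factors are
  such that the top and the constant coefficient of the difference cancel.\<close>

lemma Szego_recurrence:
  "smult (kappa \<phi> n) (\<phi> (Suc n)) = smult (kappa \<phi> (Suc n)) (pCons 0 (\<phi> n)) + smult (poly (\<phi> (Suc n)) 0) (\<phi>s n)"
proof -
  define r where "r = smult (kappa \<phi> n) (\<phi> (Suc n)) - (smult (kappa \<phi> (Suc n)) (pCons 0 (\<phi> n)) + smult (poly (\<phi> (Suc n)) 0) (\<phi>s n))"
  have "r = 0"
  proof (rule zero_by_shifted_monomials[of n])
    show "coeff r i = 0" if "i > n" for i
    proof (cases "i = Suc n")
      case True
      thus ?thesis using lead_f[of n] lead_f[of "Suc n"] by (simp add: r_def coeff_phi_high)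
    next
      case False
      obtain j where "i = Suc j" using \<open>i > n\<close> by (cases i) auto
      moreover from this have "j > n" using that False by simp
      ultimately have "i = Suc j" "j > n" by simp_all
      thus ?thesis by (simp add: r_def coeff_phi_high)
    qed
    show "coeff r 0 = 0" using phi_s_0[of n] by (simp add: r_def poly_0_coeff_0)
    show "pairing r (monom 1 m) = 0" if m: "1 \<le> m" "m \<le> n" for m
    proof -
      obtain j where j: "m = Suc j" using m by (cases m) auto
      have "pairing (\<phi> (Suc n)) (monom 1 m) = 0" "pairing (\<phi>s n) (monom 1 m) = 0" "pairing (pCons 0 (\<phi> n)) (monom 1 m) = 0"
        using m pairing_phi[of m "Suc n"] pairing_phi_s[of m n] pairing_phi[of j n] by (simp_all add: j pairing_pCons)
      thus ?thesis unfolding r_def bf_diff bf_add bf_smult by simp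
    qed
  qed
  thus ?thesis by (simp add: r_def)
qed

text \<open>The combination loses its top coefficient and pairs to zero with \<zeta>, ...,
  \<zeta>^(n - 1), as the starred polynomial of index n - 1 does; the factors \<kappa> make both
  pairings with 1 equal to 1.\<close>

lemma down_recurrence:
  assumes "n \<ge> 1"
  shows "smult (kappa \<phi> n) (\<phi>s n) - smult (poly (\<phi>b n) 0) (\<phi> n) = smult (kappa \<phi> (n - 1)) (\<phi>s (n - 1))"
proof -
  define r where "r = smult (kappa \<phi> n) (\<phi>s n) - smult (poly (\<phi>b n) 0) (\<phi> n) - smult (kappa \<phi> (n - 1)) (\<phi>s (n - 1))"
  have "r = 0"
  proof (rule zero_by_monomials[of n])
    show "coeff r i = 0" if "i \<ge> n" for i
      using that assms lead_f[of n] coeff_phi_s_top[of n] coeff_phi_high[of n i] coeff_phi_high(2)[of "n - 1" i]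
      by (cases "i = n") (auto simp: r_def)
    show "pairing r (monom 1 m) = 0" if "m < n" for m
      using that assms kappa_nz[of n] kappa_nz[of "n - 1"] by (simp add: r_def bf_diff bf_smult pairing_phi pairing_phi_s)
  qed
  thus ?thesis by (simp add: r_def)
qed

lemma second_kind_pCons:
  assumes "pole x"
  shows "second_kind (pCons 0 q) x = x * second_kind q x + 2 * pairing (pCons 0 q) (monom 1 0)"
proof -
  have "resolvent x (\<lambda>\<zeta>. \<zeta> * (\<zeta> * poly q \<zeta>)) = x * resolvent x (\<lambda>\<zeta>. \<zeta> * poly q \<zeta>) + circle_mean (\<lambda>\<zeta>. w \<zeta> * (\<zeta> * poly q \<zeta>))"
    by (intro resolvent_step assms continuous_on_mult continuous_on_id continuous_poly)
  thus ?thesis by (simp add: second_kind_def pairing_def distrib_left)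
qed

lemma second_kind_phi: "second_kind (\<phi> n) x = u1 n x" "second_kind (\<phi>s n) x = u2 n x + 2 / kappa \<phi> n"
  by (simp_all add: u1_def u2_def)

text \<open>The recurrence survives the passage to functions of the second kind, because the
  constants 2 / \<kappa>, multiplied by the respective \<kappa>, become 2 on both sides.\<close>

lemma down_recurrence_u:
  assumes "pole x" "n \<ge> 1"
  shows "kappa \<phi> n * u2 n x - poly (\<phi>b n) 0 * u1 n x = kappa \<phi> (n - 1) * u2 (n - 1) x"
proof -
  have "second_kind (smult (kappa \<phi> n) (\<phi>s n) - smult (poly (\<phi>b n) 0) (\<phi> n)) x = second_kind (smult (kappa \<phi> (n - 1)) (\<phi>s (n - 1))) x"
    by (simp only: down_recurrence[OF assms(2)])
  thus ?thesis using kappa_nz[of n] kappa_nz[of "n - 1"]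
    by (simp only: second_kind_diff[OF assms(1)] second_kind_smult second_kind_phi) (simp add: distrib_left)
qed

end

section \<open>Raising an exponent: the weight times \<zeta> - p\<close>

locale Schlesinger_plus = A: biorthogonal w \<phi> \<phi>b + A': biorthogonal w' \<phi>' \<phi>b'
  for w \<phi> \<phi>b w' \<phi>' \<phi>b' +
  fixes p :: complex and n :: nat
  assumes w': "\<And>\<zeta>. w' \<zeta> = (\<zeta> - p) * w \<zeta>" and p: "p \<noteq> 0" and nz: "poly (\<phi> n) p \<noteq> 0"
begin

definition "k = kappa \<phi> n"
definition "k1 = kappa \<phi> (Suc n)"
definition "k' = kappa \<phi>' n"
definition "a = poly (\<phi> (Suc n)) p / poly (\<phi> n) p"
definition "c = poly (reflect_poly (\<phi>b n)) p / poly (\<phi> n) p"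
definition "f0 = poly (\<phi> (Suc n)) 0"

lemma k_nz: "k \<noteq> 0" "k1 \<noteq> 0" "k' \<noteq> 0"
  by (simp_all add: k_def k1_def k'_def A.kappa_nz A'.kappa_nz)

text \<open>\<open>G\<close> and \<open>T\<close> are the rows of \<open>R_plus\<close> applied to
  \<phi>_n and its starred partner, with the scalar k' / k and the denominator x - p left out. The
  ratios \<open>a\<close> and \<open>c\<close> make both vanish at p, so that x - p can be divided
  out.\<close>

definition "G = pCons 0 (\<phi> n) - smult (k * a / k1) (\<phi> n) + smult (f0 / k1) (A.\<phi>s n)"
definition "T = smult c (pCons 0 (\<phi> n)) - smult p (A.\<phi>s n)"

lemma Szego_at_p: "k * a = k1 * p + f0 * c"
proof -
  have "poly (smult k (\<phi> (Suc n))) p = poly (smult k1 (pCons 0 (\<phi> n)) + smult f0 (A.\<phi>s n)) p"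
    unfolding k_def k1_def f0_def A.Szego_recurrence[of n] ..
  thus ?thesis using nz by (simp add: a_def c_def field_simps)
qed

text \<open>Christoffel's formula: by the Szego recurrence the first numerator is a combination of
  \<phi>_n and its successor, hence orthogonal to all monomials below n, and it vanishes at
  p.\<close>

lemma G_eq: "smult k1 G = smult k (\<phi> (Suc n)) - smult (k * a) (\<phi> n)"
  using A.Szego_recurrence[of n] k_nz unfolding G_def
  by (simp add: k_def[symmetric] k1_def[symmetric] f0_def[symmetric] smult_add_right smult_diff_right)

lemma G_p: "poly G p = 0"
proof -
  have "k1 * poly G p = poly (smult k1 G) p" by simp
  also have "\<dots> = 0" unfolding G_eq using nz by (simp add: a_def)
  finally show ?thesis using k_nz by simp
qed

lemma T_p: "poly T p = 0"
  using nz by (simp add: T_def c_def)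

lemma pairing_shift: "A'.pairing q r = A.pairing ([:- p, 1:] * q) r"
  unfolding A'.pairing_def A.pairing_def w' by (rule circle_mean_cong_strong) (simp add: algebra_simps)

lemma second_kind_shift: "A'.second_kind q x = A.second_kind ([:- p, 1:] * q) x"
proof -
  have "A'.resolvent x (\<lambda>\<zeta>. \<zeta> * poly q \<zeta>) = A.resolvent x (\<lambda>\<zeta>. \<zeta> * poly ([:- p, 1:] * q) \<zeta>)"
    unfolding A'.resolvent_def A.resolvent_def w' by (rule circle_mean_cong_strong) (simp add: algebra_simps)
  thus ?thesis by (simp add: A'.second_kind_def A.second_kind_def)
qed

lemma pairing_G: "m < n \<Longrightarrow> A.pairing G (monom 1 m) = 0" "A.pairing G (monom 1 n) = - a / k1"
proof -
  have 1: "k1 * A.pairing G q = k * A.pairing (\<phi> (Suc n)) q - k * a * A.pairing (\<phi> n) q" for q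
    using G_eq by (metis A.bf_diff(1) A.bf_smult(1))
  have 2: "k1 * A.pairing G (monom 1 m) = 0" if "m < n" for m
    unfolding 1 using that A.pairing_phi[of m "Suc n"] A.pairing_phi[of m n] by simp
  show "A.pairing G (monom 1 m) = 0" if "m < n" using 2[OF that] k_nz by simp
  have "k1 * A.pairing G (monom 1 n) = - a"
    unfolding 1 using A.pairing_phi[of n "Suc n"] A.pairing_phi[of n n] k_nz by (simp add: k_def[symmetric])
  thus "A.pairing G (monom 1 n) = - a / k1" using k_nz(2) by (metis nonzero_mult_div_cancel_left)
qed

lemma coeff_G: "coeff G (Suc n) = k" "i > Suc n \<Longrightarrow> coeff G i = 0"
proof -
  show "coeff G (Suc n) = k" using A.lead_f[of n] by (simp add: G_def A.coeff_phi_high k_def)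
  show "coeff G i = 0" if "i > Suc n"
    using that by (cases i) (auto simp: G_def A.coeff_phi_high)
qed

lemma quotient_coeff:
  assumes "poly q p = 0" "\<And>i. i > Suc n \<Longrightarrow> coeff q i = 0"
  shows "[:- p, 1:] * synthetic_div q p = q" "i > n \<Longrightarrow> coeff (synthetic_div q p) i = 0" "coeff (synthetic_div q p) n = coeff q (Suc n)"
proof -
  show eq: "[:- p, 1:] * synthetic_div q p = q" using synthetic_div_correct'[of p q] assms(1) by simp
  have "degree q \<le> Suc n" using assms(2) by (intro degree_le) auto
  hence d: "degree (synthetic_div q p) \<le> n" using degree_synthetic_div[of q p] by simp
  show high: "coeff (synthetic_div q p) i = 0" if "i > n" for i using that d by (intro coeff_eq_0) simp
  have "coeff ([:- p, 1:] * synthetic_div q p) (Suc n) = coeff (synthetic_div q p) n"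
    using high[of "Suc n"] by simp
  thus "coeff (synthetic_div q p) n = coeff q (Suc n)" unfolding eq by simp
qed

text \<open>The factor \<zeta> - p moves from the weight to the polynomial, so the quotient of
  \<open>G\<close> is orthogonal to the lower monomials for the new weight; once its leading
  coefficient is adjusted it is the new polynomial.\<close>

lemma phi_shift: "[:- p, 1:] * \<phi>' n = smult (k' / k) G"
proof -
  note q = quotient_coeff[OF G_p coeff_G(2)]
  have "\<phi>' n - smult (k' / k) (synthetic_div G p) = 0"
  proof (rule A'.zero_by_monomials)
    show "coeff (\<phi>' n - smult (k' / k) (synthetic_div G p)) i = 0" if "i \<ge> n" for i
      using that q(2)[of i] q(3) coeff_G(1) A'.lead_f[of n] A'.coeff_phi_high(1)[of n i] k_nz
      by (cases "i = n") (auto simp: k'_def)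
    show "A'.pairing (\<phi>' n - smult (k' / k) (synthetic_div G p)) (monom 1 m) = 0" if "m < n" for m
      using that A'.pairing_phi[of m n] pairing_G(1)[OF that]
      by (simp add: A'.bf_diff A'.bf_smult pairing_shift[of "synthetic_div G p"] q(1) del: mult_pCons_left)
  qed
  hence "[:- p, 1:] * \<phi>' n = [:- p, 1:] * smult (k' / k) (synthetic_div G p)" by simp
  thus ?thesis by (simp only: mult_smult_right q(1))
qed

text \<open>Pairing with \<zeta>^n expresses 1 / k' through k' itself, which leaves the sign of k'
  free. The identity later cancels the constant in the second row of the transformation of the
  second kind.\<close>

lemma normalisation: "k'\<^sup>2 * a = - k * k1"
proof -
  have "1 / k' = A'.pairing (\<phi>' n) (monom 1 n)" using A'.pairing_phi[of n n] by (simp add: k'_def)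
  also have "\<dots> = k' / k * (- a / k1)"
    unfolding pairing_shift phi_shift A.bf_smult pairing_G(2) ..
  finally show ?thesis using k_nz by (simp add: field_simps power2_eq_square)
qed

text \<open>The new starred polynomial is recognised by its constant term k' and its orthogonality
  to \<zeta>, ..., \<zeta>^n. The factor x in the first summand of \<open>T\<close> shifts these
  monomials into the range where \<phi>_n is orthogonal.\<close>

lemma phi_s_shift: "[:- p, 1:] * A'.\<phi>s n = smult (k' / k) T"
proof -
  have T: "coeff T i = 0" if "i > Suc n" for i
    using that by (cases i) (auto simp: T_def A.coeff_phi_high)
  note q = quotient_coeff[OF T_p T]
  have "A'.\<phi>s n - smult (k' / k) (synthetic_div T p) = 0"
  proof (rule A'.zero_by_shifted_monomials)
    show "coeff (A'.\<phi>s n - smult (k' / k) (synthetic_div T p)) i = 0" if "i > n" for i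
      using that q(2)[of i] A'.coeff_phi_high(2)[of n i] by simp
    have "coeff ([:- p, 1:] * synthetic_div T p) 0 = coeff T 0" using q(1) by simp
    hence "p * coeff (synthetic_div T p) 0 = p * k"
      using A.phi_s_0[of n] by (simp add: T_def k_def poly_0_coeff_0)
    thus "coeff (A'.\<phi>s n - smult (k' / k) (synthetic_div T p)) 0 = 0"
      using p A'.phi_s_0[of n] k_nz by (simp add: k'_def poly_0_coeff_0)
    show "A'.pairing (A'.\<phi>s n - smult (k' / k) (synthetic_div T p)) (monom 1 m) = 0" if m: "1 \<le> m" "m \<le> n" for m
    proof -
      obtain j where j: "m = Suc j" using m by (cases m) auto
      have "A.pairing T (monom 1 m) = 0"
        using m A.pairing_phi[of j n] A.pairing_phi_s[of m n] by (simp add: T_def A.bf_diff A.bf_smult j A.pairing_pCons)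
      thus ?thesis using A'.pairing_phi_s[of m n] m
        by (simp add: A'.bf_diff A'.bf_smult pairing_shift[of "synthetic_div T p"] q(1) del: mult_pCons_left)
    qed
  qed
  hence "[:- p, 1:] * A'.\<phi>s n = [:- p, 1:] * smult (k' / k) (synthetic_div T p)" by simp
  thus ?thesis by (simp only: mult_smult_right q(1))
qed

text \<open>Orthogonality does not give this pairing of x \<phi>_n directly; it is read off from the
  Szego recurrence paired with 1.\<close>

lemma L1: "A.pairing (pCons 0 (\<phi> n)) (monom 1 0) = - f0 / (k1 * k)"
proof -
  have "A.pairing (smult k (\<phi> (Suc n))) (monom 1 0) = A.pairing (smult k1 (pCons 0 (\<phi> n)) + smult f0 (A.\<phi>s n)) (monom 1 0)"
    unfolding k_def k1_def f0_def A.Szego_recurrence[of n] ..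
  hence "0 = k1 * A.pairing (pCons 0 (\<phi> n)) (monom 1 0) + f0 / k"
    using A.pairing_phi[of 0 "Suc n"] A.pairing_phi_s[of 0 n] by (simp only: A.bf_add A.bf_smult) (simp add: k_def)
  thus ?thesis using k_nz by (simp add: field_simps eq_neg_iff_add_eq_0)
qed

lemma phi_transform:
  "(x - p) * poly (\<phi>' n) x = k' / k * ((x - k * a / k1) * poly (\<phi> n) x + f0 / k1 * poly (A.\<phi>s n) x)"
  "(x - p) * poly (A'.\<phi>s n) x = k' / k * (c * x * poly (\<phi> n) x - p * poly (A.\<phi>s n) x)"
proof -
  have "poly ([:- p, 1:] * \<phi>' n) x = poly (smult (k' / k) G) x" "poly ([:- p, 1:] * A'.\<phi>s n) x = poly (smult (k' / k) T) x"
    by (simp_all only: phi_shift phi_s_shift)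
  thus "(x - p) * poly (\<phi>' n) x = k' / k * ((x - k * a / k1) * poly (\<phi> n) x + f0 / k1 * poly (A.\<phi>s n) x)"
    "(x - p) * poly (A'.\<phi>s n) x = k' / k * (c * x * poly (\<phi> n) x - p * poly (A.\<phi>s n) x)"
    by (simp_all add: G_def T_def algebra_simps)
qed

text \<open>Multiplication by x does not commute with \<open>second_kind\<close>: each
  \<open>pCons\<close> leaves a constant. In the first row it cancels against the 2 / k in
  \<open>u2\<close>; in the second row the constants combine to a multiple of k a, by the recurrence
  at p, and the normalisation removes them.\<close>

lemma u_transform:
  assumes x: "A.pole x"
  shows "A'.u1 n x = k' / k * ((x - k * a / k1) * A.u1 n x + f0 / k1 * A.u2 n x)"
    "A'.u2 n x = k' / k * (c * x * A.u1 n x - p * A.u2 n x)"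
proof -
  have "A'.u1 n x = k' / k * A.second_kind G x"
    by (simp only: A'.u1_def second_kind_shift phi_shift A.second_kind_smult)
  also have "A.second_kind G x = (x - k * a / k1) * A.u1 n x + f0 / k1 * A.u2 n x"
    unfolding G_def A.second_kind_add[OF x] A.second_kind_diff[OF x] A.second_kind_smult A.second_kind_pCons[OF x] A.second_kind_phi L1
    using k_nz by (simp add: k_def[symmetric] field_simps)
  finally show "A'.u1 n x = k' / k * ((x - k * a / k1) * A.u1 n x + f0 / k1 * A.u2 n x)" .
  have "A'.u2 n x = k' / k * A.second_kind T x - 2 / k'"
    by (simp only: A'.u2_def second_kind_shift phi_s_shift A.second_kind_smult k'_def)
  also have "A.second_kind T x = (c * x * A.u1 n x - p * A.u2 n x) - 2 * ((k1 * p + f0 * c) / (k1 * k))"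
    unfolding T_def A.second_kind_diff[OF x] A.second_kind_smult A.second_kind_pCons[OF x] A.second_kind_phi L1
    using k_nz by (simp add: k_def[symmetric] field_simps)
  also have "2 * ((k1 * p + f0 * c) / (k1 * k)) = - 2 * k / k'\<^sup>2"
    unfolding Szego_at_p[symmetric] using k_nz normalisation by (simp add: field_simps)
  also have "k' / k * (c * x * A.u1 n x - p * A.u2 n x - - 2 * k / k'\<^sup>2) - 2 / k' = k' / k * (c * x * A.u1 n x - p * A.u2 n x)"
    using k_nz by (simp add: distrib_left power2_eq_square)
  finally show "A'.u2 n x = k' / k * (c * x * A.u1 n x - p * A.u2 n x)" .
qed

end

section \<open>Lowering an exponent: the weight divided by \<zeta> - p\<close>

locale Schlesinger_minus = A: biorthogonal w \<phi> \<phi>b + A': biorthogonal w' \<phi>' \<phi>b'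
  for w \<phi> \<phi>b w' \<phi>' \<phi>b' +
  fixes p :: complex and n :: nat
  assumes w': "\<And>\<zeta>. w' \<zeta> = w \<zeta> / (\<zeta> - p)" and p: "p \<noteq> 0" and pole: "A.pole p" and n: "n \<ge> 1"
    and nz: "A.u2 (n - 1) p \<noteq> 0"
begin

definition "k = kappa \<phi> n"
definition "km = kappa \<phi> (n - 1)"
definition "k' = kappa \<phi>' n"
definition "b = poly (\<phi>b n) 0"
definition "a = k * A.u2 n p / (km * A.u2 (n - 1) p)"
definition "d = - k * A.u1 n p / (km * A.u2 (n - 1) p)"

lemma k_nz: "k \<noteq> 0" "km \<noteq> 0" "k' \<noteq> 0"
  by (simp_all add: k_def km_def k'_def A.kappa_nz A'.kappa_nz)

text \<open>Two conditions fix \<open>a\<close> and \<open>d\<close>: the combination of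
  \<open>u1\<close> and \<open>u2\<close> with these coefficients vanishes at p, which is
  orthogonality for the new weight, and the top coefficient of \<open>G\<close> is k. The
  determinant of the two conditions is, by the recurrence, a multiple of \<open>u2\<close> of index
  n - 1 at p, whence the assumption on that value.\<close>

definition "G = smult a (\<phi> n) + smult d (A.\<phi>s n)"
definition "T = smult (b * a / (k * p)) (pCons 0 (\<phi> n)) + A.\<phi>s n - smult (a / p) (pCons 0 (A.\<phi>s n))"

lemma down: "k * A.u2 n p - b * A.u1 n p = km * A.u2 (n - 1) p"
  unfolding k_def b_def km_def by (rule A.down_recurrence_u[OF pole n])

lemma ad: "a * A.u1 n p + d * A.u2 n p = 0" "a * k + d * b = k" "b * a / k * A.u1 n p + A.u2 n p - a * A.u2 n p = 0"
proof -
  define y where "y = km * A.u2 (n - 1) p"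
  have y: "y \<noteq> 0" "y = k * A.u2 n p - b * A.u1 n p" using nz k_nz down by (auto simp: y_def)
  have a: "a = k * A.u2 n p / y" and d: "d = - k * A.u1 n p / y" by (simp_all add: a_def d_def y_def)
  show "a * A.u1 n p + d * A.u2 n p = 0" by (simp add: a d)
  have "a * k + d * b = k * (k * A.u2 n p - b * A.u1 n p) / y" by (simp add: a d diff_divide_distrib right_diff_distrib mult_ac)
  thus "a * k + d * b = k" using y by simp
  have "b * a / k * A.u1 n p + A.u2 n p - a * A.u2 n p = A.u2 n p - A.u2 n p * (k * A.u2 n p - b * A.u1 n p) / y"
    using k_nz by (simp add: a diff_divide_distrib right_diff_distrib mult_ac)
  also have "\<dots> = 0" unfolding y(2)[symmetric] using y(1) by simp
  finally show "b * a / k * A.u1 n p + A.u2 n p - a * A.u2 n p = 0" .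
qed

text \<open>A pairing for the new weight is a resolvent at p for the old one; orthogonality thus
  becomes a condition on functions of the second kind at p.\<close>

lemma pairing_shift: "A'.pairing q (monom 1 m) = A.resolvent p (\<lambda>\<zeta>. poly q \<zeta> * (1 / \<zeta>) ^ m)"
  unfolding A'.pairing_def A.resolvent_def w' by (rule circle_mean_cong_strong) (simp add: poly_monom)

lemma pairing_phi_shift:
  assumes "m \<le> n"
  shows "A'.pairing (\<phi> n) (monom 1 m) = (A.u1 n p / 2 - (if m = n then p ^ n / k else 0)) / p ^ Suc m"
    "A'.pairing (A.\<phi>s n) (monom 1 m) = A.u2 n p / 2 / p ^ Suc m"
  unfolding pairing_shift k_def using A.resolvent_phi[OF pole p assms] A.resolvent_phi_s[OF pole p assms] by simp_all

lemma second_kind_shift: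
  assumes x: "cmod x \<noteq> 1" "x \<noteq> p"
  shows "(x - p) * A'.second_kind q x = A.second_kind q x - A.second_kind q p"
proof -
  have c: "continuous_on (sphere 0 1) (\<lambda>\<zeta>. \<zeta> * poly q \<zeta>)"
    by (intro continuous_on_mult continuous_on_id A.continuous_poly)
  have "A'.resolvent x (\<lambda>\<zeta>. \<zeta> * poly q \<zeta>) = A.resolvent p (\<lambda>\<zeta>. \<zeta> * poly q \<zeta> / (\<zeta> - x))"
    unfolding A'.resolvent_def A.resolvent_def w' by (rule circle_mean_cong_strong) (simp add: mult.commute)
  also have "\<dots> = (A.resolvent x (\<lambda>\<zeta>. \<zeta> * poly q \<zeta>) - A.resolvent p (\<lambda>\<zeta>. \<zeta> * poly q \<zeta>)) / (x - p)"
    by (rule A.resolvent_difference[OF x(1) pole x(2) c])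
  finally show ?thesis using x(2) by (simp add: A'.second_kind_def A.second_kind_def)
qed

lemma phi_shift: "\<phi>' n = smult (k' / k) G"
proof -
  have "\<phi>' n - smult (k' / k) G = 0"
  proof (rule A'.zero_by_monomials)
    show "coeff (\<phi>' n - smult (k' / k) G) i = 0" if "i \<ge> n" for i
    proof (cases "i = n")
      case True
      have "coeff G n = k"
        using ad(2) A.lead_f[of n] A.coeff_phi_s_top[of n] by (simp add: G_def k_def b_def)
      thus ?thesis using True A'.lead_f[of n] k_nz by (simp add: k'_def)
    next
      case False
      thus ?thesis using that A'.coeff_phi_high(1)[of n i] A.coeff_phi_high[of n i] by (simp add: G_def)
    qed
    show "A'.pairing (\<phi>' n - smult (k' / k) G) (monom 1 m) = 0" if m: "m < n" for m
    proof -
      have "A'.pairing G (monom 1 m) = (a * A.u1 n p + d * A.u2 n p) / (2 * p ^ Suc m)"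
        using m pairing_phi_shift[of m] by (simp add: G_def A'.bf_add A'.bf_smult add_divide_distrib)
      hence "A'.pairing G (monom 1 m) = 0" unfolding ad by simp
      thus ?thesis using A'.pairing_phi[of m n] m by (simp add: A'.bf_diff A'.bf_smult)
    qed
  qed
  thus ?thesis by simp
qed

text \<open>For m = n the resolvent of \<phi>_n has an extra term, and only this one survives, since
  the rest is the combination that vanishes at p.\<close>

lemma normalisation: "k'\<^sup>2 * a = - k\<^sup>2 * p"
proof -
  have "1 / k' = A'.pairing (\<phi>' n) (monom 1 n)" using A'.pairing_phi[of n n] by (simp add: k'_def)
  also have "\<dots> = k' / k * (a * (A.u1 n p / 2 / p ^ Suc n - 1 / (k * p)) + d * (A.u2 n p / 2 / p ^ Suc n))"
    unfolding phi_shift G_def A'.bf_smult A'.bf_add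
    using p pairing_phi_shift[of n] by (simp add: diff_divide_distrib)
  also have "\<dots> = k' / k * ((a * A.u1 n p + d * A.u2 n p) / 2 / p ^ Suc n - a * (1 / (k * p)))"
  proof -
    have "(a * A.u1 n p + d * A.u2 n p) / 2 / p ^ Suc n = a * (A.u1 n p / 2 / p ^ Suc n) + d * (A.u2 n p / 2 / p ^ Suc n)"
      by (simp only: add_divide_distrib times_divide_eq_right)
    moreover have "a * (X - e) + d * Y = a * X + d * Y - a * e" for X Y e by (simp add: algebra_simps)
    ultimately show ?thesis by (simp only:)
  qed
  also have "\<dots> = - (k' / k * (a / (k * p)))" unfolding ad by simp
  finally show ?thesis using k_nz p by (simp add: field_simps power2_eq_square)
qed

text \<open>In \<open>T\<close> the coefficient of x^(n + 1) cancels, because \<phi>_n and its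
  starred partner have top coefficients k and b; the orthogonality to \<zeta>, ..., \<zeta>^n is the
  third identity of \<open>ad\<close>.\<close>

lemma phi_s_shift: "A'.\<phi>s n = smult (k' / k) T"
proof -
  have "A'.\<phi>s n - smult (k' / k) T = 0"
  proof (rule A'.zero_by_shifted_monomials)
    show "coeff (A'.\<phi>s n - smult (k' / k) T) i = 0" if i: "i > n" for i
    proof -
      obtain j where j: "i = Suc j" using i by (cases i) auto
      have "coeff T i = 0"
      proof (cases "j = n")
        case True
        thus ?thesis using j A.lead_f[of n] A.coeff_phi_s_top[of n] A.coeff_phi_high(2)[OF i] k_nz p
          by (simp add: T_def k_def b_def)
      next
        case False
        hence "j > n" using i j by simp
        thus ?thesis using j A.coeff_phi_high[of n j] A.coeff_phi_high(2)[OF i] by (simp add: T_def)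
      qed
      thus ?thesis using A'.coeff_phi_high(2)[OF i] by simp
    qed
    show "coeff (A'.\<phi>s n - smult (k' / k) T) 0 = 0"
      using A.phi_s_0[of n] A'.phi_s_0[of n] k_nz by (simp add: T_def k_def k'_def poly_0_coeff_0)
    show "A'.pairing (A'.\<phi>s n - smult (k' / k) T) (monom 1 m) = 0" if m: "1 \<le> m" "m \<le> n" for m
    proof -
      obtain j where j: "m = Suc j" using m by (cases m) auto
      have "A'.pairing T (monom 1 m) = b * a / (k * p) * (A.u1 n p / 2 / p ^ m) + A.u2 n p / 2 / p ^ Suc m - a / p * (A.u2 n p / 2 / p ^ m)"
        using pairing_phi_shift[of j] pairing_phi_shift[of m] m
        by (simp add: T_def A'.bf_diff A'.bf_add A'.bf_smult j A'.pairing_pCons)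
      also have "\<dots> = (b * a / k * A.u1 n p + A.u2 n p - a * A.u2 n p) / 2 / p ^ Suc m"
        using p by (simp add: add_divide_distrib diff_divide_distrib mult_ac)
      finally have "A'.pairing T (monom 1 m) = 0" unfolding ad by simp
      thus ?thesis using A'.pairing_phi_s[of m n] m by (simp add: A'.bf_diff A'.bf_smult)
    qed
  qed
  thus ?thesis by simp
qed

lemma phi_transform:
  "poly (\<phi>' n) x = k' / k * (a * poly (\<phi> n) x + d * poly (A.\<phi>s n) x)"
  "poly (A'.\<phi>s n) x = k' / k * (b * a / k * (x / p) * poly (\<phi> n) x + (1 - a * (x / p)) * poly (A.\<phi>s n) x)"
proof -
  have "poly (\<phi>' n) x = poly (smult (k' / k) G) x" "poly (A'.\<phi>s n) x = poly (smult (k' / k) T) x"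
    by (simp_all only: phi_shift phi_s_shift)
  moreover have "poly T x = b * a / k * (x / p) * poly (\<phi> n) x + (1 - a * (x / p)) * poly (A.\<phi>s n) x"
    using p by (simp add: T_def algebra_simps)
  ultimately show "poly (\<phi>' n) x = k' / k * (a * poly (\<phi> n) x + d * poly (A.\<phi>s n) x)"
    "poly (A'.\<phi>s n) x = k' / k * (b * a / k * (x / p) * poly (\<phi> n) x + (1 - a * (x / p)) * poly (A.\<phi>s n) x)"
    by (simp_all add: G_def)
qed

text \<open>The transform for the new weight is a difference of old values at x and at p, so
  additive constants drop out. What survives is a multiple of x - p, from the constant 2 / k under
  the factor x in \<open>T\<close>, and the normalisation cancels it against 2 / k'.\<close>

lemma u_transform:
  assumes x: "cmod x \<noteq> 1" "x \<noteq> p"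
  shows "(x - p) * A'.u1 n x = k' / k * (a * A.u1 n x + d * A.u2 n x)"
    "(x - p) * A'.u2 n x = k' / k * (b * a / k * (x / p) * A.u1 n x + (1 - a * (x / p)) * A.u2 n x)"
proof -
  have px: "A.pole x" by (rule A.pole_off_circle[OF x(1)])
  have sG: "A.second_kind G y = a * A.u1 n y + d * A.u2 n y + d * (2 / k)" if y: "A.pole y" for y
    unfolding G_def A.second_kind_add[OF y] A.second_kind_smult A.second_kind_phi k_def by (simp only: distrib_left add.assoc)
  have "(x - p) * A'.u1 n x = k' / k * ((x - p) * A'.second_kind G x)"
    unfolding A'.u1_def phi_shift A'.second_kind_smult by (simp only: mult.left_commute)
  also have "(x - p) * A'.second_kind G x = (a * A.u1 n x + d * A.u2 n x) - (a * A.u1 n p + d * A.u2 n p)"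
    unfolding second_kind_shift[OF x] sG[OF px] sG[OF pole] by simp
  also have "\<dots> = a * A.u1 n x + d * A.u2 n x" unfolding ad by simp
  finally show "(x - p) * A'.u1 n x = k' / k * (a * A.u1 n x + d * A.u2 n x)" .
  define c1 where "c1 = 2 * A.pairing (pCons 0 (\<phi> n)) (monom 1 0)"
  define c2 where "c2 = 2 * A.pairing (pCons 0 (A.\<phi>s n)) (monom 1 0)"
  have sT: "A.second_kind T y = b * a / (k * p) * (y * A.u1 n y + c1) + (A.u2 n y + 2 / k) - a / p * (y * (A.u2 n y + 2 / k) + c2)"
    if y: "A.pole y" for y
    unfolding T_def A.second_kind_add[OF y] A.second_kind_diff[OF y] A.second_kind_smult A.second_kind_pCons[OF y] A.second_kind_phi
    by (simp only: k_def c1_def c2_def)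
  have "(x - p) * A'.u2 n x = k' / k * ((x - p) * A'.second_kind T x) - (x - p) * (2 / k')"
    unfolding A'.u2_def phi_s_shift A'.second_kind_smult k'_def[symmetric] by (simp only: right_diff_distrib mult.left_commute)
  also have "(x - p) * A'.second_kind T x = (b * a / k * (x / p) * A.u1 n x + (1 - a * (x / p)) * A.u2 n x)
     - (b * a / k * A.u1 n p + A.u2 n p - a * A.u2 n p) - 2 * a * (x - p) / (p * k)"
    unfolding second_kind_shift[OF x] sT[OF px] sT[OF pole] using p k_nz by (simp add: field_simps)
  also have "\<dots> = (b * a / k * (x / p) * A.u1 n x + (1 - a * (x / p)) * A.u2 n x) - 2 * a * (x - p) / (p * k)"
    unfolding ad by simp
  also have "k' / k * \<dots> - (x - p) * (2 / k') = k' / k * (b * a / k * (x / p) * A.u1 n x + (1 - a * (x / p)) * A.u2 n x) - 2 * (x - p) * (k' * a / (k\<^sup>2 * p) + 1 / k')"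
    using p k_nz by (simp add: field_simps power2_eq_square)
  also have "k' * a / (k\<^sup>2 * p) + 1 / k' = (k'\<^sup>2 * a + k\<^sup>2 * p) / (k\<^sup>2 * p * k')"
    using p k_nz by (simp add: field_simps power2_eq_square)
  also have "\<dots> = 0" unfolding normalisation by simp
  finally show "(x - p) * A'.u2 n x = k' / k * (b * a / k * (x / p) * A.u1 n x + (1 - a * (x / p)) * A.u2 n x)" by simp
qed

end

section \<open>Compatibility\<close>

lemma sum_fun_upd_add:
  fixes f :: "'i \<Rightarrow> complex"
  assumes "finite I" "j \<in> I"
  shows "(\<Sum>k\<in>I. (\<rho>(j := \<rho> j + c)) k * f k) = (\<Sum>k\<in>I. \<rho> k * f k) + c * f j"
proof -
  have "(\<Sum>k\<in>I. (\<rho>(j := \<rho> j + c)) k * f k) = (\<rho> j + c) * f j + (\<Sum>k\<in>I - {j}. \<rho> k * f k)"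
    using assms by (subst sum.remove) auto
  also have "\<dots> = (\<Sum>k\<in>I. \<rho> k * f k) + c * f j"
    using assms by (simp add: sum.remove[of I j] algebra_simps)
  finally show ?thesis .
qed

text \<open>With \<rho>_j raised by e the shifted weight solves equations of the same form, so all
  results on deformations hold for it too, with the new exponent in B.\<close>

lemma semiclassical_deformation_shift:
  assumes mov: "moving_singularities S M z" and sc: "semiclassical_deformation S M z \<rho> w" and j: "j \<in> {1..M}"
  shows "semiclassical_deformation S M z (\<rho>(j := \<rho> j + of_int e)) (shift_weight e (z j) w)"
  unfolding semiclassical_deformation_def
proof (intro ballI conjI)
  fix t \<zeta> assume t: "t \<in> S" and \<zeta>: "\<zeta> \<in> sphere 0 1 - (\<lambda>k. z k t) ` {0..M}"
  have nz: "\<zeta> - z j t \<noteq> 0" using \<zeta> j by auto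
  have jI: "j \<in> {0..M}" using j by auto
  have pw: "of_int e * (\<zeta> - z j t) powi (e - 1) = (\<zeta> - z j t) powi e * (of_int e / (\<zeta> - z j t))"
    using nz by (simp add: power_int_diff)
  have w1: "(w t has_field_derivative w t \<zeta> * (\<Sum>k=0..M. \<rho> k / (\<zeta> - z k t))) (at \<zeta> within sphere 0 1)"
    and w2: "((\<lambda>s. w s \<zeta>) has_vector_derivative - w t \<zeta> * (\<Sum>k=0..M. \<rho> k * vector_derivative (z k) (at t) / (\<zeta> - z k t))) (at t)"
    using sc t \<zeta> unfolding semiclassical_deformation_def by auto
  have "((\<lambda>\<zeta>. \<zeta> - z j t) has_field_derivative 1) (at \<zeta> within sphere 0 1)"
    by (auto intro!: derivative_eq_intros)
  from DERIV_mult[OF DERIV_power_int[OF this disjI2[OF nz], of e] w1]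
  have "(shift_weight e (z j) w t has_field_derivative
      of_int e * (\<zeta> - z j t) powi (e - 1) * 1 * w t \<zeta> + w t \<zeta> * (\<Sum>k=0..M. \<rho> k / (\<zeta> - z k t)) * (\<zeta> - z j t) powi e) (at \<zeta> within sphere 0 1)"
    unfolding shift_weight_def[abs_def] .
  also have "of_int e * (\<zeta> - z j t) powi (e - 1) * 1 * w t \<zeta> + w t \<zeta> * (\<Sum>k=0..M. \<rho> k / (\<zeta> - z k t)) * (\<zeta> - z j t) powi e
    = shift_weight e (z j) w t \<zeta> * ((\<Sum>k=0..M. \<rho> k * (1 / (\<zeta> - z k t))) + of_int e * (1 / (\<zeta> - z j t)))"
    unfolding pw by (simp add: shift_weight_def algebra_simps)
  also have "(\<Sum>k=0..M. \<rho> k * (1 / (\<zeta> - z k t))) + of_int e * (1 / (\<zeta> - z j t)) = (\<Sum>k=0..M. (\<rho>(j := \<rho> j + of_int e)) k * (1 / (\<zeta> - z k t)))"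
    by (rule sum_fun_upd_add[symmetric]) (use jI in auto)
  finally show "(shift_weight e (z j) w t has_field_derivative shift_weight e (z j) w t \<zeta> * (\<Sum>k=0..M. (\<rho>(j := \<rho> j + of_int e)) k / (\<zeta> - z k t))) (at \<zeta> within sphere 0 1)"
    by simp
  define zd where "zd k = vector_derivative (z k) (at t)" for k
  have zj: "(z j has_vector_derivative zd j) (at t)"
    using mov t j unfolding zd_def moving_singularities_def by (auto intro!: vector_derivative_works[THEN iffD1])
  have "((\<lambda>s. \<zeta> - z j s) has_vector_derivative 0 - zd j) (at t)"
    by (intro has_vector_derivative_diff has_vector_derivative_const zj)
  moreover have "((\<lambda>y. y powi e) has_field_derivative of_int e * (\<zeta> - z j t) powi (e - 1) * 1) (at (\<zeta> - z j t) within range (\<lambda>s. \<zeta> - z j s))"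
    by (rule DERIV_power_int[OF DERIV_ident disjI2[OF nz]])
  ultimately have "((\<lambda>y. y powi e) \<circ> (\<lambda>s. \<zeta> - z j s) has_vector_derivative (0 - zd j) * (of_int e * (\<zeta> - z j t) powi (e - 1) * 1)) (at t)"
    by (rule field_vector_diff_chain_within)
  from has_vector_derivative_mult[OF this w2]
  have "((\<lambda>s. shift_weight e (z j) w s \<zeta>) has_vector_derivative (\<zeta> - z j t) powi e * (- w t \<zeta> * (\<Sum>k=0..M. \<rho> k * zd k / (\<zeta> - z k t)))
     + (0 - zd j) * (of_int e * (\<zeta> - z j t) powi (e - 1) * 1) * w t \<zeta>) (at t)"
    by (simp add: shift_weight_def o_def zd_def)
  also have "(\<zeta> - z j t) powi e * (- w t \<zeta> * (\<Sum>k=0..M. \<rho> k * zd k / (\<zeta> - z k t)))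
     + (0 - zd j) * (of_int e * (\<zeta> - z j t) powi (e - 1) * 1) * w t \<zeta>
    = - shift_weight e (z j) w t \<zeta> * ((\<Sum>k=0..M. \<rho> k * (zd k / (\<zeta> - z k t))) + of_int e * (zd j / (\<zeta> - z j t)))"
    unfolding pw by (simp add: shift_weight_def algebra_simps)
  also have "(\<Sum>k=0..M. \<rho> k * (zd k / (\<zeta> - z k t))) + of_int e * (zd j / (\<zeta> - z j t)) = (\<Sum>k=0..M. (\<rho>(j := \<rho> j + of_int e)) k * (zd k / (\<zeta> - z k t)))"
    by (rule sum_fun_upd_add[symmetric]) (use jI in auto)
  finally show "((\<lambda>s. shift_weight e (z j) w s \<zeta>) has_vector_derivative - shift_weight e (z j) w t \<zeta> * (\<Sum>k=0..M. (\<rho>(j := \<rho> j + of_int e)) k * vector_derivative (z k) (at t) / (\<zeta> - z k t))) (at t)"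
    by (simp add: zd_def)
qed

text \<open>One row of the compatibility relation: differentiating the row of \<open>Y' = R Y\<close> gives two linear
  equations for the row of \<open>dR/dt + R B - B' R\<close>, whose determinant is the Casoratian.\<close>

lemma row_compatibility:
  fixes r1 r2 f g u v F U c :: "real \<Rightarrow> complex"
  assumes t: "t \<in> S" "open S"
    and r: "(r1 has_vector_derivative d1) (at t)" "(r2 has_vector_derivative d2) (at t)"
    and f: "(f has_vector_derivative b11 * f t + b12 * g t) (at t)" "(g has_vector_derivative b21 * f t + b22 * g t) (at t)"
    and u: "(u has_vector_derivative (b11 - \<sigma>) * u t + b12 * v t) (at t)" "(v has_vector_derivative b21 * u t + (b22 - \<sigma>) * v t) (at t)"
    and F: "(F has_vector_derivative B1 * F t + B2 * G) (at t)" and U: "(U has_vector_derivative (B1 - \<sigma>') * U t + B2 * V) (at t)"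
    and c: "(c has_vector_derivative c t * (\<sigma>' - \<sigma>)) (at t)"
    and F_eq: "\<And>s. s \<in> S \<Longrightarrow> F s = r1 s * f s + r2 s * g s" and G_eq: "G = q1 * f t + q2 * g t"
    and U_eq: "\<And>s. s \<in> S \<Longrightarrow> c s * U s = r1 s * u s + r2 s * v s" and V_eq: "c t * V = q1 * u t + q2 * v t"
    and det: "g t * u t - f t * v t \<noteq> 0"
  shows "d1 + r1 t * b11 + r2 t * b21 = B1 * r1 t + B2 * q1" "d2 + r1 t * b12 + r2 t * b22 = B1 * r2 t + B2 * q2"
proof -
  define e1 where "e1 = d1 + r1 t * b11 + r2 t * b21 - (B1 * r1 t + B2 * q1)"
  define e2 where "e2 = d2 + r1 t * b12 + r2 t * b22 - (B1 * r2 t + B2 * q2)"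
  have "(F has_vector_derivative (r1 t * (b11 * f t + b12 * g t) + d1 * f t) + (r2 t * (b21 * f t + b22 * g t) + d2 * g t)) (at t)"
    by (rule has_vector_derivative_transform_within_open[OF has_vector_derivative_add[OF has_vector_derivative_mult[OF r(1) f(1)] has_vector_derivative_mult[OF r(2) f(2)]] t(2,1)])
       (simp add: F_eq)
  from vector_derivative_unique_at[OF this F]
  have 1: "e1 * f t + e2 * g t = 0" unfolding F_eq[OF t(1)] G_eq by (simp add: e1_def e2_def algebra_simps)
  have "((\<lambda>s. c s * U s) has_vector_derivative (r1 t * ((b11 - \<sigma>) * u t + b12 * v t) + d1 * u t) + (r2 t * (b21 * u t + (b22 - \<sigma>) * v t) + d2 * v t)) (at t)"
    by (rule has_vector_derivative_transform_within_open[OF has_vector_derivative_add[OF has_vector_derivative_mult[OF r(1) u(1)] has_vector_derivative_mult[OF r(2) u(2)]] t(2,1)])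
       (simp add: U_eq)
  from vector_derivative_unique_at[OF this has_vector_derivative_mult[OF c U]]
  have "(r1 t * ((b11 - \<sigma>) * u t + b12 * v t) + d1 * u t) + (r2 t * (b21 * u t + (b22 - \<sigma>) * v t) + d2 * v t)
     = B1 * (c t * U t) + B2 * (c t * V) - \<sigma> * (c t * U t)" by (simp add: algebra_simps)
  hence 2: "e1 * u t + e2 * v t = 0" unfolding U_eq[OF t(1)] V_eq by (simp add: e1_def e2_def algebra_simps)
  have "e1 * (g t * u t - f t * v t) = g t * (e1 * u t + e2 * v t) - v t * (e1 * f t + e2 * g t)" by (simp add: algebra_simps)
  hence "e1 = 0" using 1 2 det by simp
  moreover have "e2 * (g t * u t - f t * v t) = u t * (e1 * f t + e2 * g t) - f t * (e1 * u t + e2 * v t)" by (simp add: algebra_simps)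
  hence "e2 = 0" using 1 2 det by simp
  ultimately show "d1 + r1 t * b11 + r2 t * b21 = B1 * r1 t + B2 * q1" "d2 + r1 t * b12 + r2 t * b22 = B1 * r2 t + B2 * q2"
    by (simp_all add: e1_def e2_def)
qed

text \<open>The exceptional set contains the whole unit circle, so x is approached through points
  with the pairwise distinct moduli |x| + 1 / (i + 1): only finitely many of them can be
  exceptional.\<close>

lemma zero_by_continuity:
  fixes e :: "complex \<Rightarrow> complex"
  assumes "finite A" and cont: "isCont e x" and zero: "\<And>y. cmod y \<noteq> 1 \<Longrightarrow> y \<notin> A \<Longrightarrow> e y = 0"
  shows "e x = 0"
proof -
  \<comment> \<open>A unit vector pointing outwards from x, in which direction the moduli add
    exactly; at the origin any direction does, and 1 is taken.\<close>
  define v where "v = (if x = 0 then 1 else x / of_real (cmod x))"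
  define y where "y i = x + of_real (1 / real (Suc i)) * v" for i
  have y_norm: "cmod (y i) = cmod x + 1 / real (Suc i)" for i
  proof (cases "x = 0")
    case False
    hence "y i = of_real ((cmod x + 1 / real (Suc i)) / cmod x) * x"
      by (simp add: y_def v_def add_divide_distrib distrib_right)
    hence "cmod (y i) = \<bar>(cmod x + 1 / real (Suc i)) / cmod x\<bar> * cmod x" by (simp only: norm_mult norm_of_real)
    thus ?thesis using False by (simp add: abs_of_nonneg)
  next
    case True
    hence "y i = of_real (1 / real (Suc i))" by (simp add: y_def v_def)
    thus ?thesis using True by (simp only: norm_of_real) simp
  qed
  have inj: "inj (\<lambda>i. cmod (y i))" by (rule injI) (simp add: y_norm)
  have "finite {i. y i \<in> A \<or> cmod (y i) = 1}"
  proof (rule finite_subset)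
    show "{i. y i \<in> A \<or> cmod (y i) = 1} \<subseteq> (\<lambda>i. cmod (y i)) -` (insert 1 (cmod ` A))" by auto
    show "finite ((\<lambda>i. cmod (y i)) -` (insert 1 (cmod ` A)))"
      using assms(1) by (intro finite_vimageI[OF _ inj]) simp
  qed
  hence "eventually (\<lambda>i. \<not> (y i \<in> A \<or> cmod (y i) = 1)) cofinite"
    by (simp add: eventually_cofinite)
  hence "eventually (\<lambda>i. \<not> (y i \<in> A \<or> cmod (y i) = 1)) sequentially"
    by (simp only: cofinite_eq_sequentially)
  hence ev: "eventually (\<lambda>i. e (y i) = 0) sequentially"
    by eventually_elim (use zero in auto)
  have "(\<lambda>i. 1 / real (Suc i)) \<longlonglongrightarrow> 0" using LIMSEQ_Suc[OF lim_1_over_n[where 'a = real]] by simp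
  from tendsto_add[OF tendsto_const tendsto_mult[OF tendsto_of_real[OF this] tendsto_const], of x v]
  have "y \<longlonglongrightarrow> x" by (simp add: y_def[abs_def])
  hence "(\<lambda>i. e (y i)) \<longlonglongrightarrow> e x" by (rule isCont_tendsto_compose[OF cont])
  moreover have "(\<lambda>i. e (y i)) \<longlonglongrightarrow> 0" by (rule tendsto_eventually[OF ev])
  ultimately show ?thesis by (rule LIMSEQ_unique)
qed

lemma linear_matrix2: "bounded_linear (\<lambda>a. matrix2 a 0 0 0)" "bounded_linear (\<lambda>a. matrix2 0 a 0 0)"
  "bounded_linear (\<lambda>a. matrix2 0 0 a 0)" "bounded_linear (\<lambda>a. matrix2 0 0 0 a)"
  unfolding linear_conv_bounded_linear[symmetric]
  by (rule linearI; simp add: matrix2_def vec_eq_iff forall_2)+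

lemma has_vector_derivative_matrix2:
  assumes "(a has_vector_derivative a') (at t)" "(b has_vector_derivative b') (at t)"
    "(c has_vector_derivative c') (at t)" "(d has_vector_derivative d') (at t)"
  shows "((\<lambda>s. matrix2 (a s) (b s) (c s) (d s)) has_vector_derivative matrix2 a' b' c' d') (at t)"
proof -
  have eq: "matrix2 a b c d = matrix2 a 0 0 0 + matrix2 0 b 0 0 + (matrix2 0 0 c 0 + matrix2 0 0 0 d)" for a b c d
    by (simp add: matrix2_def vec_eq_iff forall_2)
  have "((\<lambda>s. matrix2 (a s) 0 0 0 + matrix2 0 (b s) 0 0 + (matrix2 0 0 (c s) 0 + matrix2 0 0 0 (d s))) has_vector_derivative
     matrix2 a' 0 0 0 + matrix2 0 b' 0 0 + (matrix2 0 0 c' 0 + matrix2 0 0 0 d')) (at t)"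
    by (rule has_vector_derivative_add[OF
      has_vector_derivative_add[OF bounded_linear.has_vector_derivative[OF linear_matrix2(1) assms(1)] bounded_linear.has_vector_derivative[OF linear_matrix2(2) assms(2)]]
      has_vector_derivative_add[OF bounded_linear.has_vector_derivative[OF linear_matrix2(3) assms(3)] bounded_linear.has_vector_derivative[OF linear_matrix2(4) assms(4)]]])
  thus ?thesis by (simp only: eq[symmetric])
qed

lemma matrix2_mult: "matrix2 a b c d ** matrix2 a' b' c' d' = matrix2 (a * a' + b * c') (a * b' + b * d') (c * a' + d * c') (c * b' + d * d')"
  by (simp add: matrix2_def vec_eq_iff forall_2 matrix_matrix_mult_def sum_2)

lemma matrix2_add: "matrix2 a b c d + matrix2 a' b' c' d' = matrix2 (a + a') (b + b') (c + c') (d + d')"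
  by (simp add: matrix2_def vec_eq_iff forall_2)

lemma cscale_matrix2: "cscale k (matrix2 a b c d) = matrix2 (k * a) (k * b) (k * c) (k * d)"
  by (simp add: matrix2_def cscale_def vec_eq_iff forall_2)

context deformation_system
begin

lemma isCont_b:
  assumes "\<forall>k\<in>{1..M}. x \<noteq> z k t"
  shows "isCont (b11 n t) x" "isCont (b12 n t) x" "isCont (b21 n t) x" "isCont (b22 n t) x"
  unfolding b11_def[abs_def] b12_def[abs_def] b21_def[abs_def] b22_def[abs_def]
  using assms by (intro continuous_intros; simp)+

lemma Casoratian:
  assumes "t \<in> S" "cmod x \<noteq> 1" "x \<noteq> 0"
  shows "poly (\<phi>s t n) x * \<xi>1 t n x - poly (\<phi> t n) x * \<xi>2 t n x \<noteq> 0"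
proof -
  interpret B: biorthogonal "w t" "\<phi> t" "\<phi>b t" by (rule biorthogonal[OF assms(1)])
  show ?thesis using B.Casoratian[OF B.pole_off_circle[OF assms(2)] assms(3), of n] assms(3) by simp
qed

lemma kappa_differentiable: "t \<in> S \<Longrightarrow> (\<lambda>s. \<kappa> s n) differentiable (at t)"
  by (rule differentiableI_vector[OF kappa_deriv])

lemma phi_differentiable:
  assumes "t \<in> S" "(X has_vector_derivative X') (at t)"
  shows "(\<lambda>s. poly (\<phi> s n) (X s)) differentiable (at t)" "(\<lambda>s. poly (\<phi>s s n) (X s)) differentiable (at t)"
  by (rule differentiableI_vector[OF phi_deriv_at(1)[OF assms]], rule differentiableI_vector[OF phi_deriv_at(2)[OF assms]])

end

section \<open>Two systems whose weights differ by a power of \<zeta> - z_j\<close>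

locale deformation_pair =
  D: deformation_system S M z \<rho> w \<phi> \<phi>b +
  D': deformation_system S M z "\<rho>(j := \<rho> j + of_int e)" "shift_weight e (z j) w" \<phi>' \<phi>b'
  for S M z \<rho> w \<phi> \<phi>b and j :: nat and e :: int and \<phi>' \<phi>b' +
  assumes j: "j \<in> {1..M}"
begin

abbreviation "zd \<equiv> D.zd"

lemma zj_deriv: "t \<in> S \<Longrightarrow> (z j has_vector_derivative zd j t) (at t)"
  using j by (intro D.z_deriv) auto

lemma \<sigma>_shift: "D'.\<sigma> t x = D.\<sigma> t x + of_int e * (zd j t / (x - z j t))"
proof -
  have "D'.\<sigma> t x = (\<Sum>k=1..M. (\<rho>(j := \<rho> j + of_int e)) k * (zd k t / (x - z k t)))"
    unfolding D'.\<sigma>_def by (simp only: times_divide_eq_right)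
  also have "\<dots> = (\<Sum>k=1..M. \<rho> k * (zd k t / (x - z k t))) + of_int e * (zd j t / (x - z j t))"
    by (rule sum_fun_upd_add) (use j in auto)
  finally show ?thesis by (simp add: D.\<sigma>_def)
qed

text \<open>The scalar stands for the ratio of the old weight to the new one, so its logarithmic
  derivative is the difference of the two \<sigma>. The exponent is - e because each second column
  is divided by its own weight.\<close>

lemma power_deriv:
  assumes t: "t \<in> S" and y: "y \<noteq> z j t"
  shows "((\<lambda>s. (y - z j s) powi (- e)) has_vector_derivative (y - z j t) powi (- e) * (D'.\<sigma> t y - D.\<sigma> t y)) (at t)"
proof -
  have nz: "y - z j t \<noteq> 0" using y by simp
  have "((\<lambda>s. y - z j s) has_vector_derivative 0 - zd j t) (at t)"
    by (intro has_vector_derivative_diff has_vector_derivative_const zj_deriv t)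
  moreover have "((\<lambda>y. y powi (- e)) has_field_derivative of_int (- e) * (y - z j t) powi (- e - 1) * 1) (at (y - z j t) within range (\<lambda>s. y - z j s))"
    by (rule DERIV_power_int[OF DERIV_ident disjI2[OF nz]])
  ultimately have "((\<lambda>y. y powi (- e)) \<circ> (\<lambda>s. y - z j s) has_vector_derivative (0 - zd j t) * (of_int (- e) * (y - z j t) powi (- e - 1) * 1)) (at t)"
    by (rule field_vector_diff_chain_within)
  also have "(0 - zd j t) * (of_int (- e) * (y - z j t) powi (- e - 1) * 1) = (y - z j t) powi (- e) * (D'.\<sigma> t y - D.\<sigma> t y)"
    unfolding \<sigma>_shift using power_int_diff[of "y - z j t" "- e" 1] nz by simp
  finally show ?thesis by (simp add: o_def)
qed

lemma compatibility_from_transform: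
  fixes r11 r12 r21 r22 :: "real \<Rightarrow> complex \<Rightarrow> complex"
  assumes t: "t \<in> S" and x: "\<forall>k\<in>{1..M}. x \<noteq> z k t"
    and d: "\<And>y. y \<noteq> z j t \<Longrightarrow> ((\<lambda>s. r11 s y) has_vector_derivative d11 y) (at t)"
      "\<And>y. y \<noteq> z j t \<Longrightarrow> ((\<lambda>s. r12 s y) has_vector_derivative d12 y) (at t)"
      "\<And>y. y \<noteq> z j t \<Longrightarrow> ((\<lambda>s. r21 s y) has_vector_derivative d21 y) (at t)"
      "\<And>y. y \<noteq> z j t \<Longrightarrow> ((\<lambda>s. r22 s y) has_vector_derivative d22 y) (at t)"
    and cont: "isCont d11 x" "isCont d12 x" "isCont d21 x" "isCont d22 x"
      "isCont (r11 t) x" "isCont (r12 t) x" "isCont (r21 t) x" "isCont (r22 t) x"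
    and \<Phi>: "\<And>s y. s \<in> S \<Longrightarrow> y \<noteq> z j s \<Longrightarrow> poly (\<phi>' s n) y = r11 s y * poly (\<phi> s n) y + r12 s y * poly (D.\<phi>s s n) y"
      "\<And>s y. s \<in> S \<Longrightarrow> y \<noteq> z j s \<Longrightarrow> poly (D'.\<phi>s s n) y = r21 s y * poly (\<phi> s n) y + r22 s y * poly (D.\<phi>s s n) y"
    and U: "\<And>s y. s \<in> S \<Longrightarrow> y \<noteq> z j s \<Longrightarrow> cmod y \<noteq> 1 \<Longrightarrow> (y - z j s) powi (- e) * D'.\<xi>1 s n y = r11 s y * D.\<xi>1 s n y + r12 s y * D.\<xi>2 s n y"
      "\<And>s y. s \<in> S \<Longrightarrow> y \<noteq> z j s \<Longrightarrow> cmod y \<noteq> 1 \<Longrightarrow> (y - z j s) powi (- e) * D'.\<xi>2 s n y = r21 s y * D.\<xi>1 s n y + r22 s y * D.\<xi>2 s n y"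
  shows "matrix2 (d11 x) (d12 x) (d21 x) (d22 x) + matrix2 (r11 t x) (r12 t x) (r21 t x) (r22 t x) ** B_matrix M z \<rho> w \<phi> \<phi>b n t x
    = B_matrix M z (\<rho>(j := \<rho> j + of_int e)) (shift_weight e (z j) w) \<phi>' \<phi>b' n t x ** matrix2 (r11 t x) (r12 t x) (r21 t x) (r22 t x)"
proof -
  \<comment> \<open>The Casoratian 2 y^n may vanish at the origin, which therefore joins the
    singular points in the exceptional set.\<close>
  define A where "A = insert 0 ((\<lambda>k. z k t) ` {1..M})"
  have A: "finite A" by (simp add: A_def)
  have generic:
    "d11 y + r11 t y * D.b11 n t y + r12 t y * D.b21 n t y = D'.b11 n t y * r11 t y + D'.b12 n t y * r21 t y"
    "d12 y + r11 t y * D.b12 n t y + r12 t y * D.b22 n t y = D'.b11 n t y * r12 t y + D'.b12 n t y * r22 t y"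
    "d21 y + r21 t y * D.b11 n t y + r22 t y * D.b21 n t y = D'.b21 n t y * r11 t y + D'.b22 n t y * r21 t y"
    "d22 y + r21 t y * D.b12 n t y + r22 t y * D.b22 n t y = D'.b21 n t y * r12 t y + D'.b22 n t y * r22 t y"
    if y: "cmod y \<noteq> 1" "y \<notin> A" for y
  proof -
    have yz: "\<forall>k\<in>{1..M}. y \<noteq> z k t" "y \<noteq> 0" "y \<noteq> z j t" using y j by (auto simp: A_def)
    \<comment> \<open>The transformation formulas at y hold at the times when z_j is not at y; by
      continuity of z_j these form an open set, and it contains t.\<close>
    define S' where "S' = S \<inter> z j -` (- {y})"
    have "continuous_on S (z j)"
      by (intro continuous_at_imp_continuous_on ballI has_vector_derivative_continuous[OF zj_deriv])
    hence S': "open S'" unfolding S'_def by (intro continuous_open_preimage D.open_S) auto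
    have tS': "t \<in> S'" using t yz by (auto simp: S'_def)
    have sub: "s \<in> S \<and> y \<noteq> z j s" if "s \<in> S'" for s using that by (auto simp: S'_def)
    have f: "((\<lambda>s. poly (\<phi> s n) y) has_vector_derivative D.b11 n t y * poly (\<phi> t n) y + D.b12 n t y * poly (D.\<phi>s t n) y) (at t)"
      "((\<lambda>s. poly (D.\<phi>s s n) y) has_vector_derivative D.b21 n t y * poly (\<phi> t n) y + D.b22 n t y * poly (D.\<phi>s t n) y) (at t)"
      using D.phi_deriv[OF t yz(1)] by blast+
    have f': "((\<lambda>s. poly (\<phi>' s n) y) has_vector_derivative D'.b11 n t y * poly (\<phi>' t n) y + D'.b12 n t y * poly (D'.\<phi>s t n) y) (at t)"
      "((\<lambda>s. poly (D'.\<phi>s s n) y) has_vector_derivative D'.b22 n t y * poly (D'.\<phi>s t n) y + D'.b21 n t y * poly (\<phi>' t n) y) (at t)"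
      using D'.phi_deriv[OF t yz(1), of n] by (simp_all add: add.commute)
    have u: "((\<lambda>s. D.\<xi>1 s n y) has_vector_derivative (D.b11 n t y - D.\<sigma> t y) * D.\<xi>1 t n y + D.b12 n t y * D.\<xi>2 t n y) (at t)"
      "((\<lambda>s. D.\<xi>2 s n y) has_vector_derivative D.b21 n t y * D.\<xi>1 t n y + (D.b22 n t y - D.\<sigma> t y) * D.\<xi>2 t n y) (at t)"
      using D.u_deriv[OF t y(1) yz(1)] by blast+
    have u': "((\<lambda>s. D'.\<xi>1 s n y) has_vector_derivative (D'.b11 n t y - D'.\<sigma> t y) * D'.\<xi>1 t n y + D'.b12 n t y * D'.\<xi>2 t n y) (at t)"
      "((\<lambda>s. D'.\<xi>2 s n y) has_vector_derivative (D'.b22 n t y - D'.\<sigma> t y) * D'.\<xi>2 t n y + D'.b21 n t y * D'.\<xi>1 t n y) (at t)"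
      using D'.u_deriv[OF t y(1) yz(1), of n] by (simp_all add: add.commute)
    note c = power_deriv[OF t yz(3)]
    note det = D.Casoratian[OF t y(1) yz(2), of n]
    have \<Phi>s: "poly (\<phi>' s n) y = r11 s y * poly (\<phi> s n) y + r12 s y * poly (D.\<phi>s s n) y"
      "poly (D'.\<phi>s s n) y = r21 s y * poly (\<phi> s n) y + r22 s y * poly (D.\<phi>s s n) y"
      "(y - z j s) powi (- e) * D'.\<xi>1 s n y = r11 s y * D.\<xi>1 s n y + r12 s y * D.\<xi>2 s n y"
      "(y - z j s) powi (- e) * D'.\<xi>2 s n y = r21 s y * D.\<xi>1 s n y + r22 s y * D.\<xi>2 s n y" if "s \<in> S'" for s
    proof -
      have s: "s \<in> S" "y \<noteq> z j s" using sub[OF that] by auto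
      show "poly (\<phi>' s n) y = r11 s y * poly (\<phi> s n) y + r12 s y * poly (D.\<phi>s s n) y" by (rule \<Phi>(1)[OF s])
      show "poly (D'.\<phi>s s n) y = r21 s y * poly (\<phi> s n) y + r22 s y * poly (D.\<phi>s s n) y" by (rule \<Phi>(2)[OF s])
      show "(y - z j s) powi (- e) * D'.\<xi>1 s n y = r11 s y * D.\<xi>1 s n y + r12 s y * D.\<xi>2 s n y" by (rule U(1)[OF s y(1)])
      show "(y - z j s) powi (- e) * D'.\<xi>2 s n y = r21 s y * D.\<xi>1 s n y + r22 s y * D.\<xi>2 s n y" by (rule U(2)[OF s y(1)])
    qed
    note row1 = row_compatibility[OF tS' S' d(1)[OF yz(3)] d(2)[OF yz(3)] f u f'(1) u'(1) c \<Phi>s(1) \<Phi>s(2)[OF tS'] \<Phi>s(3) \<Phi>s(4)[OF tS'] det]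
    \<comment> \<open>The second row reuses the row lemma with the two components of the shifted
      system exchanged. The commuted sums in the derivatives above and in the conclusions below
      account for this exchange.\<close>
    note row2 = row_compatibility[OF tS' S' d(3)[OF yz(3)] d(4)[OF yz(3)] f u f'(2) u'(2) c \<Phi>s(2) \<Phi>s(1)[OF tS'] \<Phi>s(4) \<Phi>s(3)[OF tS'] det]
    show "d11 y + r11 t y * D.b11 n t y + r12 t y * D.b21 n t y = D'.b11 n t y * r11 t y + D'.b12 n t y * r21 t y"
      by (rule row1(1))
    show "d12 y + r11 t y * D.b12 n t y + r12 t y * D.b22 n t y = D'.b11 n t y * r12 t y + D'.b12 n t y * r22 t y"
      by (rule row1(2))
    show "d21 y + r21 t y * D.b11 n t y + r22 t y * D.b21 n t y = D'.b21 n t y * r11 t y + D'.b22 n t y * r21 t y"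
      by (rule trans[OF row2(1) add.commute])
    show "d22 y + r21 t y * D.b12 n t y + r22 t y * D.b22 n t y = D'.b21 n t y * r12 t y + D'.b22 n t y * r22 t y"
      by (rule trans[OF row2(2) add.commute])
  qed
  note b = D.isCont_b[OF x, of n] D'.isCont_b[OF x, of n]
  define e11 where "e11 y = d11 y + r11 t y * D.b11 n t y + r12 t y * D.b21 n t y - (D'.b11 n t y * r11 t y + D'.b12 n t y * r21 t y)" for y
  have e11: "e11 x = 0"
  proof (rule zero_by_continuity[OF A, where e = e11 and x = x])
    show "isCont e11 x" unfolding e11_def[abs_def] by (intro isCont_add isCont_mult isCont_diff b cont)
    show "e11 y = 0" if "cmod y \<noteq> 1" "y \<notin> A" for y unfolding e11_def generic[OF that] by simp
  qed
  define e12 where "e12 y = d12 y + r11 t y * D.b12 n t y + r12 t y * D.b22 n t y - (D'.b11 n t y * r12 t y + D'.b12 n t y * r22 t y)" for y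
  have e12: "e12 x = 0"
  proof (rule zero_by_continuity[OF A, where e = e12 and x = x])
    show "isCont e12 x" unfolding e12_def[abs_def] by (intro isCont_add isCont_mult isCont_diff b cont)
    show "e12 y = 0" if "cmod y \<noteq> 1" "y \<notin> A" for y unfolding e12_def generic[OF that] by simp
  qed
  define e21 where "e21 y = d21 y + r21 t y * D.b11 n t y + r22 t y * D.b21 n t y - (D'.b21 n t y * r11 t y + D'.b22 n t y * r21 t y)" for y
  have e21: "e21 x = 0"
  proof (rule zero_by_continuity[OF A, where e = e21 and x = x])
    show "isCont e21 x" unfolding e21_def[abs_def] by (intro isCont_add isCont_mult isCont_diff b cont)
    show "e21 y = 0" if "cmod y \<noteq> 1" "y \<notin> A" for y unfolding e21_def generic[OF that] by simp
  qed
  define e22 where "e22 y = d22 y + r21 t y * D.b12 n t y + r22 t y * D.b22 n t y - (D'.b21 n t y * r12 t y + D'.b22 n t y * r22 t y)" for y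
  have e22: "e22 x = 0"
  proof (rule zero_by_continuity[OF A, where e = e22 and x = x])
    show "isCont e22 x" unfolding e22_def[abs_def] by (intro isCont_add isCont_mult isCont_diff b cont)
    show "e22 y = 0" if "cmod y \<noteq> 1" "y \<notin> A" for y unfolding e22_def generic[OF that] by simp
  qed
  have
    "d11 x + (r11 t x * D.b11 n t x + r12 t x * D.b21 n t x) = D'.b11 n t x * r11 t x + D'.b12 n t x * r21 t x"
    "d12 x + (r11 t x * D.b12 n t x + r12 t x * D.b22 n t x) = D'.b11 n t x * r12 t x + D'.b12 n t x * r22 t x"
    "d21 x + (r21 t x * D.b11 n t x + r22 t x * D.b21 n t x) = D'.b21 n t x * r11 t x + D'.b22 n t x * r21 t x"
    "d22 x + (r21 t x * D.b12 n t x + r22 t x * D.b22 n t x) = D'.b21 n t x * r12 t x + D'.b22 n t x * r22 t x"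
    using e11 e12 e21 e22 unfolding e11_def e12_def e21_def e22_def right_minus_eq by (simp_all only: add.assoc)
  thus ?thesis
    unfolding D.B_matrix_eq[OF t] D'.B_matrix_eq[OF t] matrix2_mult matrix2_add by (simp only:)
qed

end

text \<open>All entries of \<open>R_plus\<close> have the shape m (\<alpha> + \<beta> y) / (y - p),
  with everything but y depending on time; one formula then yields derivatives that are visibly
  continuous in y.\<close>

lemma entry_deriv:
  fixes m \<alpha> \<beta> p :: "real \<Rightarrow> complex"
  assumes "m differentiable (at t)" "\<alpha> differentiable (at t)" "\<beta> differentiable (at t)" "(p has_vector_derivative p') (at t)"
    and "y \<noteq> p t"
  shows "((\<lambda>s. 1 / (y - p s) * (m s * (\<alpha> s + \<beta> s * y))) has_vector_derivative
    1 / (y - p t) * (m t * (vector_derivative \<alpha> (at t) + vector_derivative \<beta> (at t) * y) + vector_derivative m (at t) * (\<alpha> t + \<beta> t * y))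
      + p' / (y - p t) ^ 2 * (m t * (\<alpha> t + \<beta> t * y))) (at t)"
proof -
  have nz: "y - p t \<noteq> 0" using assms(5) by simp
  note d = assms(1-3)[unfolded vector_derivative_works]
  have "((\<lambda>s. y - p s) has_vector_derivative 0 - p') (at t)"
    by (intro has_vector_derivative_diff has_vector_derivative_const assms(4))
  moreover have "(inverse has_field_derivative - (inverse (y - p t) ^ Suc (Suc 0))) (at (y - p t) within range (\<lambda>s. y - p s))"
    by (rule DERIV_inverse[OF nz])
  ultimately have "(inverse \<circ> (\<lambda>s. y - p s) has_vector_derivative (0 - p') * - (inverse (y - p t) ^ Suc (Suc 0))) (at t)"
    by (rule field_vector_diff_chain_within)
  hence inv: "((\<lambda>s. 1 / (y - p s)) has_vector_derivative p' / (y - p t) ^ 2) (at t)"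
    by (simp add: o_def inverse_eq_divide power2_eq_square)
  have "((\<lambda>s. \<alpha> s + \<beta> s * y) has_vector_derivative vector_derivative \<alpha> (at t) + vector_derivative \<beta> (at t) * y) (at t)"
    by (intro has_vector_derivative_add has_vector_derivative_mult_left d)
  from has_vector_derivative_mult[OF inv has_vector_derivative_mult[OF d(1) this]] show ?thesis .
qed

lemma entry_deriv_affine:
  fixes m \<alpha> \<beta> :: "real \<Rightarrow> complex"
  assumes "m differentiable (at t)" "\<alpha> differentiable (at t)" "\<beta> differentiable (at t)"
  shows "((\<lambda>s. m s * (\<alpha> s + \<beta> s * y)) has_vector_derivative
    m t * (vector_derivative \<alpha> (at t) + vector_derivative \<beta> (at t) * y) + vector_derivative m (at t) * (\<alpha> t + \<beta> t * y)) (at t)"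
proof -
  note d = assms[unfolded vector_derivative_works]
  have "((\<lambda>s. \<alpha> s + \<beta> s * y) has_vector_derivative vector_derivative \<alpha> (at t) + vector_derivative \<beta> (at t) * y) (at t)"
    by (intro has_vector_derivative_add has_vector_derivative_mult_left d)
  from has_vector_derivative_mult[OF d(1) this] show ?thesis .
qed

section \<open>Compatibility for an increased exponent\<close>

locale deformation_pair_plus = deformation_pair S M z \<rho> w \<phi> \<phi>b j 1 \<phi>' \<phi>b'
  for S M z \<rho> w \<phi> \<phi>b j \<phi>' \<phi>b' +
  assumes phi_nz: "\<And>s m. s \<in> S \<Longrightarrow> poly (\<phi> s m) (z j s) \<noteq> 0"
begin

lemma Schlesinger:
  assumes s: "s \<in> S"
  shows "Schlesinger_plus (w s) (\<phi> s) (\<phi>b s) (shift_weight 1 (z j) w s) (\<phi>' s) (\<phi>b' s) (z j s) n"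
proof -
  interpret A: biorthogonal "w s" "\<phi> s" "\<phi>b s" by (rule D.biorthogonal[OF s])
  interpret A': biorthogonal "shift_weight 1 (z j) w s" "\<phi>' s" "\<phi>b' s" by (rule D'.biorthogonal[OF s])
  show ?thesis
    by unfold_locales (use D.z_nz[OF s j] phi_nz[OF s] in \<open>simp_all add: shift_weight_def\<close>)
qed

lemma compatibility:
  assumes t: "t \<in> S" and x: "\<forall>k\<in>{1..M}. x \<noteq> z k t"
  shows "\<exists>D. ((\<lambda>s. R_plus (\<phi> s) (\<phi>b s) (kappa (\<phi>' s)) (z j s) n x) has_vector_derivative D) (at t) \<and>
            D + R_plus (\<phi> t) (\<phi>b t) (kappa (\<phi>' t)) (z j t) n x ** B_matrix M z \<rho> w \<phi> \<phi>b n t x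
            = B_matrix M z (\<rho>(j := \<rho> j + 1)) (shift_weight 1 (z j) w) \<phi>' \<phi>b' n t x
              ** R_plus (\<phi> t) (\<phi>b t) (kappa (\<phi>' t)) (z j t) n x"
proof -
  define m where "m s = D'.\<kappa> s n / D.\<kappa> s n" for s
  define al where "al s = - (D.\<kappa> s n * (poly (\<phi> s (Suc n)) (z j s) / poly (\<phi> s n) (z j s)) / D.\<kappa> s (Suc n))" for s
  define be where "be s = poly (\<phi> s (Suc n)) 0 / D.\<kappa> s (Suc n)" for s
  define ga where "ga s = poly (D.\<phi>s s n) (z j s) / poly (\<phi> s n) (z j s)" for s
  define de where "de s = - z j s" for s
  \<comment> \<open>Constant coefficient functions, introduced so that all four entries fit the
    common shape.\<close>
  define one where "one s = (1::complex)" for s :: real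
  define nul where "nul s = (0::complex)" for s :: real
  define r where "r \<alpha> \<beta> s y = 1 / (y - z j s) * (m s * (\<alpha> s + \<beta> s * y))" for \<alpha> \<beta> :: "real \<Rightarrow> complex" and s y
  define d where "d \<alpha> \<beta> y = 1 / (y - z j t) * (m t * (vector_derivative \<alpha> (at t) + vector_derivative \<beta> (at t) * y) + vector_derivative m (at t) * (\<alpha> t + \<beta> t * y))
      + zd j t / (y - z j t) ^ 2 * (m t * (\<alpha> t + \<beta> t * y))" for \<alpha> \<beta> y
  note zj = zj_deriv[OF t]
  have \<kappa>: "(\<lambda>s. D.\<kappa> s n) differentiable (at t)" "(\<lambda>s. D'.\<kappa> s n) differentiable (at t)" for n
    using D.kappa_differentiable[OF t] D'.kappa_differentiable[OF t] by auto
  note \<phi> = D.phi_differentiable[OF t zj] D.phi_differentiable[OF t has_vector_derivative_const, of _ 0]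
  note nz = D.kappa_nz[OF t] phi_nz[OF t]
  have m: "m differentiable (at t)"
    unfolding m_def[abs_def] by (intro differentiable_divide \<kappa> nz)
  have al: "al differentiable (at t)"
    unfolding al_def[abs_def] by (intro differentiable_minus differentiable_divide differentiable_mult \<kappa> \<phi> nz)
  have be: "be differentiable (at t)"
    unfolding be_def[abs_def] by (intro differentiable_divide \<kappa> \<phi> nz)
  have ga: "ga differentiable (at t)"
    unfolding ga_def[abs_def] by (intro differentiable_divide \<phi> nz)
  have de: "de differentiable (at t)"
    unfolding de_def[abs_def] by (intro differentiable_minus differentiableI_vector[OF zj])
  have one: "one differentiable (at t)" "nul differentiable (at t)"
    unfolding one_def[abs_def] nul_def[abs_def] by (rule differentiable_const)+
  have xz: "x \<noteq> z j t" using x j by auto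
  have cont: "isCont (r \<alpha> \<beta> t) x" "isCont (d \<alpha> \<beta>) x" for \<alpha> \<beta>
    unfolding r_def[abs_def] d_def[abs_def] using xz by (intro continuous_intros; simp)+
  have deriv: "((\<lambda>s. r \<alpha> \<beta> s y) has_vector_derivative d \<alpha> \<beta> y) (at t)"
    if "\<alpha> differentiable (at t)" "\<beta> differentiable (at t)" "y \<noteq> z j t" for \<alpha> \<beta> y
    unfolding r_def d_def by (rule entry_deriv[OF m that(1,2) zj that(3)])
  have R: "R_plus (\<phi> s) (\<phi>b s) (kappa (\<phi>' s)) (z j s) n x = matrix2 (r al one s x) (r be nul s x) (r nul ga s x) (r de nul s x)"
    if s: "s \<in> S" for s
  proof -
    interpret A: biorthogonal "w s" "\<phi> s" "\<phi>b s" by (rule D.biorthogonal[OF s])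
    show ?thesis unfolding R_plus_def Let_def cscale_matrix2 A.phi_star_eq[OF D.z_nz[OF s j]]
      by (simp add: r_def m_def al_def be_def ga_def de_def one_def nul_def mult_ac)
  qed
  have Rd: "((\<lambda>s. R_plus (\<phi> s) (\<phi>b s) (kappa (\<phi>' s)) (z j s) n x) has_vector_derivative
      matrix2 (d al one x) (d be nul x) (d nul ga x) (d de nul x)) (at t)"
    by (rule has_vector_derivative_transform_within_open[OF has_vector_derivative_matrix2[OF
        deriv[OF al one(1) xz] deriv[OF be one(2) xz] deriv[OF one(2) ga xz] deriv[OF de one(2) xz]] D.open_S t]) (simp only: R)
  have T: "poly (\<phi>' s n) y = r al one s y * poly (\<phi> s n) y + r be nul s y * poly (D.\<phi>s s n) y"
    "poly (D'.\<phi>s s n) y = r nul ga s y * poly (\<phi> s n) y + r de nul s y * poly (D.\<phi>s s n) y"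
    if s: "s \<in> S" "y \<noteq> z j s" for s y
  proof -
    interpret P: Schlesinger_plus "w s" "\<phi> s" "\<phi>b s" "shift_weight 1 (z j) w s" "\<phi>' s" "\<phi>b' s" "z j s" n
      by (rule Schlesinger[OF s(1)])
    have nz: "y - z j s \<noteq> 0" using s(2) by simp
    have "poly (\<phi>' s n) y = 1 / (y - z j s) * ((y - z j s) * poly (\<phi>' s n) y)" using nz by simp
    also have "\<dots> = r al one s y * poly (\<phi> s n) y + r be nul s y * poly (D.\<phi>s s n) y"
      unfolding P.phi_transform by (simp add: r_def m_def al_def be_def one_def nul_def P.k_def P.k1_def P.k'_def P.a_def P.f0_def algebra_simps)
    finally show "poly (\<phi>' s n) y = r al one s y * poly (\<phi> s n) y + r be nul s y * poly (D.\<phi>s s n) y" .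
    have "poly (D'.\<phi>s s n) y = 1 / (y - z j s) * ((y - z j s) * poly (D'.\<phi>s s n) y)" using nz by simp
    also have "\<dots> = r nul ga s y * poly (\<phi> s n) y + r de nul s y * poly (D.\<phi>s s n) y"
      unfolding P.phi_transform by (simp add: r_def m_def ga_def de_def nul_def P.k_def P.k'_def P.c_def algebra_simps)
    finally show "poly (D'.\<phi>s s n) y = r nul ga s y * poly (\<phi> s n) y + r de nul s y * poly (D.\<phi>s s n) y" .
  qed
  have U: "(y - z j s) powi (- 1) * D'.\<xi>1 s n y = r al one s y * D.\<xi>1 s n y + r be nul s y * D.\<xi>2 s n y"
    "(y - z j s) powi (- 1) * D'.\<xi>2 s n y = r nul ga s y * D.\<xi>1 s n y + r de nul s y * D.\<xi>2 s n y"
    if s: "s \<in> S" "y \<noteq> z j s" "cmod y \<noteq> 1" for s y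
  proof -
    interpret P: Schlesinger_plus "w s" "\<phi> s" "\<phi>b s" "shift_weight 1 (z j) w s" "\<phi>' s" "\<phi>b' s" "z j s" n
      by (rule Schlesinger[OF s(1)])
    note pole = P.A.pole_off_circle[OF s(3)]
    have pw: "(y - z j s) powi (- 1) = 1 / (y - z j s)" by (simp add: power_int_minus inverse_eq_divide)
    show "(y - z j s) powi (- 1) * D'.\<xi>1 s n y = r al one s y * D.\<xi>1 s n y + r be nul s y * D.\<xi>2 s n y"
      unfolding pw P.u_transform[OF pole] by (simp add: r_def m_def al_def be_def one_def nul_def P.k_def P.k1_def P.k'_def P.a_def P.f0_def algebra_simps)
    show "(y - z j s) powi (- 1) * D'.\<xi>2 s n y = r nul ga s y * D.\<xi>1 s n y + r de nul s y * D.\<xi>2 s n y"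
      unfolding pw P.u_transform[OF pole] by (simp add: r_def m_def ga_def de_def nul_def P.k_def P.k'_def P.c_def algebra_simps)
  qed
  have "matrix2 (d al one x) (d be nul x) (d nul ga x) (d de nul x) + matrix2 (r al one t x) (r be nul t x) (r nul ga t x) (r de nul t x) ** B_matrix M z \<rho> w \<phi> \<phi>b n t x
    = B_matrix M z (\<rho>(j := \<rho> j + of_int 1)) (shift_weight 1 (z j) w) \<phi>' \<phi>b' n t x ** matrix2 (r al one t x) (r be nul t x) (r nul ga t x) (r de nul t x)"
    by (rule compatibility_from_transform[OF t x deriv[OF al one(1)] deriv[OF be one(2)] deriv[OF one(2) ga] deriv[OF de one(2)] cont(2) cont(2) cont(2) cont(2) cont(1) cont(1) cont(1) cont(1) T U])
  thus ?thesis using Rd unfolding R[OF t] by (intro exI conjI) (assumption, simp)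
qed

end

section \<open>Compatibility for a decreased exponent\<close>

locale deformation_pair_minus = deformation_pair S M z \<rho> w \<phi> \<phi>b j "- 1" \<phi>' \<phi>b'
  for S M z \<rho> w \<phi> \<phi>b j \<phi>' \<phi>b' +
  assumes xi_nz: "\<And>s m. s \<in> S \<Longrightarrow> value_at (xi_star (w s) (\<phi> s) (\<phi>b s) m) (z j s) \<noteq> 0"
begin

lemma u2_nz: "s \<in> S \<Longrightarrow> D.\<xi>2 s m (z j s) \<noteq> 0"
  using xi_nz[of s m] D.value_at(2)[of s j m] j by simp

lemma weight: "shift_weight (- 1) (z j) w s \<zeta> = w s \<zeta> / (\<zeta> - z j s)"
  by (simp add: shift_weight_def power_int_minus inverse_eq_divide)

lemma Schlesinger:
  assumes s: "s \<in> S" and n: "n \<ge> 1"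
  shows "Schlesinger_minus (w s) (\<phi> s) (\<phi>b s) (shift_weight (- 1) (z j) w s) (\<phi>' s) (\<phi>b' s) (z j s) n"
proof -
  interpret A: biorthogonal "w s" "\<phi> s" "\<phi>b s" by (rule D.biorthogonal[OF s])
  interpret A': biorthogonal "shift_weight (- 1) (z j) w s" "\<phi>' s" "\<phi>b' s" by (rule D'.biorthogonal[OF s])
  show ?thesis
  proof unfold_locales
    show "A.pole (z j s)" using D.pole[OF s, of j] j by simp
  qed (use D.z_nz[OF s j] u2_nz[OF s] weight n in auto)
qed

text \<open>At the moving singular point the functions of the second kind are moments of the shifted
  weight, which are differentiable by the deformation equation of that weight.\<close>

lemma second_kind_differentiable:
  assumes t: "t \<in> S" and P: "\<And>s. s \<in> S \<Longrightarrow> degree (P s) \<le> N" "degree P' \<le> N"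
    "\<And>i. i \<le> N \<Longrightarrow> ((\<lambda>s. coeff (P s) i) has_vector_derivative coeff P' i) (at t)"
  shows "(\<lambda>s. biorthogonal.second_kind (w s) (P s) (z j s)) differentiable (at t)"
proof -
  have eq: "2 * circle_mean (\<lambda>\<zeta>. shift_weight (- 1) (z j) w s \<zeta> * (poly p \<zeta> * \<zeta>)) = biorthogonal.second_kind (w s) p (z j s)"
    if "s \<in> S" for s p
    unfolding biorthogonal.second_kind_def[OF D.biorthogonal[OF that]] biorthogonal.resolvent_def[OF D.biorthogonal[OF that]] weight
    by (simp add: mult_ac)
  have "(\<lambda>s. 2 * circle_mean (\<lambda>\<zeta>. shift_weight (- 1) (z j) w s \<zeta> * (poly (P s) \<zeta> * \<zeta>))) differentiable (at t)"
    by (rule differentiableI_vector[OF has_vector_derivative_mult_right[OF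
        D'.functional_deriv[OF t continuous_on_id continuous_on_id P]]])
  thus ?thesis by (rule D.differentiable_transform[OF _ t]) (simp add: eq)
qed

lemma u_differentiable:
  assumes t: "t \<in> S"
  shows "(\<lambda>s. D.\<xi>1 s m (z j s)) differentiable (at t)" "(\<lambda>s. D.\<xi>2 s m (z j s)) differentiable (at t)"
proof -
  have "(\<lambda>s. biorthogonal.second_kind (w s) (\<phi> s m) (z j s)) differentiable (at t)"
    by (rule second_kind_differentiable[OF t D.degree_phi(1) D.degree_poly_deriv D.phi_coeff_deriv(1)[OF t]])
  thus "(\<lambda>s. D.\<xi>1 s m (z j s)) differentiable (at t)"
    by (rule D.differentiable_transform[OF _ t]) (simp add: biorthogonal.u1_def[OF D.biorthogonal])
  have "(\<lambda>s. biorthogonal.second_kind (w s) (D.\<phi>s s m) (z j s)) differentiable (at t)"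
    by (rule second_kind_differentiable[OF t D.degree_phi(2) D.degree_poly_deriv D.phi_coeff_deriv(2)[OF t]])
  hence "(\<lambda>s. biorthogonal.second_kind (w s) (D.\<phi>s s m) (z j s) - 2 / D.\<kappa> s m) differentiable (at t)"
    by (intro differentiable_diff differentiable_divide differentiable_const D.kappa_differentiable D.kappa_nz t)
  thus "(\<lambda>s. D.\<xi>2 s m (z j s)) differentiable (at t)"
    by (rule D.differentiable_transform[OF _ t]) (simp add: biorthogonal.u2_def[OF D.biorthogonal])
qed

text \<open>Unlike \<open>R_plus\<close> this matrix is affine in x, without a pole at z_j; its
  differentiability in t rests on the functions of the second kind at the moving point z_j, which
  may lie on the circle.\<close>

lemma compatibility:
  assumes t: "t \<in> S" and x: "\<forall>k\<in>{1..M}. x \<noteq> z k t" and n: "n \<ge> 1"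
  shows "\<exists>D. ((\<lambda>s. R_minus (w s) (\<phi> s) (\<phi>b s) (kappa (\<phi>' s)) (z j s) n x) has_vector_derivative D) (at t) \<and>
            D + R_minus (w t) (\<phi> t) (\<phi>b t) (kappa (\<phi>' t)) (z j t) n x ** B_matrix M z \<rho> w \<phi> \<phi>b n t x
            = B_matrix M z (\<rho>(j := \<rho> j - 1)) (shift_weight (- 1) (z j) w) \<phi>' \<phi>b' n t x
              ** R_minus (w t) (\<phi> t) (\<phi>b t) (kappa (\<phi>' t)) (z j t) n x"
proof -
  define m where "m s = D'.\<kappa> s n / D.\<kappa> s n" for s
  define al where "al s = D.\<kappa> s n * D.\<xi>2 s n (z j s) / (D.\<kappa> s (n - 1) * D.\<xi>2 s (n - 1) (z j s))" for s
  define be where "be s = - D.\<kappa> s n * D.\<xi>1 s n (z j s) / (D.\<kappa> s (n - 1) * D.\<xi>2 s (n - 1) (z j s))" for s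
  define ga where "ga s = poly (\<phi>b s n) 0 * al s / D.\<kappa> s n / z j s" for s
  define de where "de s = - (al s / z j s)" for s
  define one where "one s = (1::complex)" for s :: real
  define nul where "nul s = (0::complex)" for s :: real
  define r where "r \<alpha> \<beta> s y = m s * (\<alpha> s + \<beta> s * y)" for \<alpha> \<beta> :: "real \<Rightarrow> complex" and s y
  define d where "d \<alpha> \<beta> y = m t * (vector_derivative \<alpha> (at t) + vector_derivative \<beta> (at t) * y) + vector_derivative m (at t) * (\<alpha> t + \<beta> t * y)" for \<alpha> \<beta> y
  note zj = zj_deriv[OF t]
  have \<kappa>: "(\<lambda>s. D.\<kappa> s n) differentiable (at t)" "(\<lambda>s. D'.\<kappa> s n) differentiable (at t)" for n
    using D.kappa_differentiable[OF t] D'.kappa_differentiable[OF t] by auto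
  note nz = D.kappa_nz[OF t] u2_nz[OF t] D.z_nz[OF t j] no_zero_divisors
  note u = u_differentiable[OF t]
  have zd: "z j differentiable (at t)" by (rule differentiableI_vector[OF zj])
  have b0: "(\<lambda>s. poly (\<phi>b s n) 0) differentiable (at t)"
    using D.coeff_differentiable[OF t] by (simp add: poly_0_coeff_0)
  have m: "m differentiable (at t)"
    unfolding m_def[abs_def] by (intro differentiable_divide \<kappa> nz)
  have al: "al differentiable (at t)"
    unfolding al_def[abs_def] by (intro differentiable_divide differentiable_mult \<kappa> u nz)
  have be: "be differentiable (at t)"
    unfolding be_def[abs_def] by (intro differentiable_divide differentiable_mult differentiable_minus \<kappa> u nz)
  have ga: "ga differentiable (at t)"
    unfolding ga_def[abs_def] by (intro differentiable_divide differentiable_mult \<kappa> b0 al zd nz)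
  have de: "de differentiable (at t)"
    unfolding de_def[abs_def] by (intro differentiable_minus differentiable_divide al zd nz)
  have one: "one differentiable (at t)" "nul differentiable (at t)"
    unfolding one_def[abs_def] nul_def[abs_def] by (rule differentiable_const)+
  have cont: "isCont (r \<alpha> \<beta> t) x" "isCont (d \<alpha> \<beta>) x" for \<alpha> \<beta>
    unfolding r_def[abs_def] d_def[abs_def] by (intro continuous_intros)+
  have deriv: "((\<lambda>s. r \<alpha> \<beta> s y) has_vector_derivative d \<alpha> \<beta> y) (at t)"
    if "\<alpha> differentiable (at t)" "\<beta> differentiable (at t)" for \<alpha> \<beta> y
    unfolding r_def d_def by (rule entry_deriv_affine[OF m that])
  have R: "R_minus (w s) (\<phi> s) (\<phi>b s) (kappa (\<phi>' s)) (z j s) n x = matrix2 (r al nul s x) (r be nul s x) (r nul ga s x) (r one de s x)"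
    if s: "s \<in> S" for s
    unfolding R_minus_def Let_def cscale_matrix2 D.value_at[OF s j]
    using D.kappa_nz[OF s, of n]
    by (simp add: r_def m_def al_def be_def ga_def de_def one_def nul_def mult_ac)
  have Rd: "((\<lambda>s. R_minus (w s) (\<phi> s) (\<phi>b s) (kappa (\<phi>' s)) (z j s) n x) has_vector_derivative
      matrix2 (d al nul x) (d be nul x) (d nul ga x) (d one de x)) (at t)"
    by (rule has_vector_derivative_transform_within_open[OF has_vector_derivative_matrix2[OF
        deriv[OF al one(2)] deriv[OF be one(2)] deriv[OF one(2) ga] deriv[OF one(1) de]] D.open_S t]) (simp only: R)
  have T: "poly (\<phi>' s n) y = r al nul s y * poly (\<phi> s n) y + r be nul s y * poly (D.\<phi>s s n) y"
    "poly (D'.\<phi>s s n) y = r nul ga s y * poly (\<phi> s n) y + r one de s y * poly (D.\<phi>s s n) y"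
    if s: "s \<in> S" for s y
  proof -
    interpret P: Schlesinger_minus "w s" "\<phi> s" "\<phi>b s" "shift_weight (- 1) (z j) w s" "\<phi>' s" "\<phi>b' s" "z j s" n
      by (rule Schlesinger[OF s n])
    show "poly (\<phi>' s n) y = r al nul s y * poly (\<phi> s n) y + r be nul s y * poly (D.\<phi>s s n) y"
      unfolding P.phi_transform(1) by (simp add: r_def m_def al_def be_def nul_def P.k_def P.km_def P.k'_def P.a_def P.d_def algebra_simps)
    show "poly (D'.\<phi>s s n) y = r nul ga s y * poly (\<phi> s n) y + r one de s y * poly (D.\<phi>s s n) y"
      unfolding P.phi_transform(2) by (simp add: r_def m_def al_def ga_def de_def one_def nul_def P.k_def P.km_def P.k'_def P.a_def P.b_def algebra_simps)
  qed
  have U: "(y - z j s) powi (- (- 1)) * D'.\<xi>1 s n y = r al nul s y * D.\<xi>1 s n y + r be nul s y * D.\<xi>2 s n y"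
    "(y - z j s) powi (- (- 1)) * D'.\<xi>2 s n y = r nul ga s y * D.\<xi>1 s n y + r one de s y * D.\<xi>2 s n y"
    if s: "s \<in> S" "y \<noteq> z j s" "cmod y \<noteq> 1" for s y
  proof -
    interpret P: Schlesinger_minus "w s" "\<phi> s" "\<phi>b s" "shift_weight (- 1) (z j) w s" "\<phi>' s" "\<phi>b' s" "z j s" n
      by (rule Schlesinger[OF s(1) n])
    have pw: "(y - z j s) powi (- (- 1)) = y - z j s" by simp
    show "(y - z j s) powi (- (- 1)) * D'.\<xi>1 s n y = r al nul s y * D.\<xi>1 s n y + r be nul s y * D.\<xi>2 s n y"
      unfolding pw P.u_transform(1)[OF s(3,2)] by (simp add: r_def m_def al_def be_def nul_def P.k_def P.km_def P.k'_def P.a_def P.d_def algebra_simps)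
    show "(y - z j s) powi (- (- 1)) * D'.\<xi>2 s n y = r nul ga s y * D.\<xi>1 s n y + r one de s y * D.\<xi>2 s n y"
      unfolding pw P.u_transform(2)[OF s(3,2)] by (simp add: r_def m_def al_def ga_def de_def one_def nul_def P.k_def P.km_def P.k'_def P.a_def P.b_def algebra_simps)
  qed
  have "matrix2 (d al nul x) (d be nul x) (d nul ga x) (d one de x) + matrix2 (r al nul t x) (r be nul t x) (r nul ga t x) (r one de t x) ** B_matrix M z \<rho> w \<phi> \<phi>b n t x
    = B_matrix M z (\<rho>(j := \<rho> j + of_int (- 1))) (shift_weight (- 1) (z j) w) \<phi>' \<phi>b' n t x ** matrix2 (r al nul t x) (r be nul t x) (r nul ga t x) (r one de t x)"
    by (rule compatibility_from_transform[OF t x deriv[OF al one(2)] deriv[OF be one(2)] deriv[OF one(2) ga] deriv[OF one(1) de] cont(2) cont(2) cont(2) cont(2) cont(1) cont(1) cont(1) cont(1) T U])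
  thus ?thesis using Rd unfolding R[OF t] by (intro exI conjI) (assumption, simp)
qed

end

text \<open>The existence of \<open>D\<close> makes the differentiability of R in t part of the
  conclusion. The point x may be 0 or a nonsingular point of the circle: both sides are continuous
  there, so the identity extends from generic x.\<close>

theorem proposition5p6:
  fixes S :: "real set" and M j :: nat
    and z :: "nat \<Rightarrow> real \<Rightarrow> complex" and \<rho> :: "nat \<Rightarrow> complex"
    and w :: "real \<Rightarrow> complex \<Rightarrow> complex"
    and \<phi> \<phi>b \<phi>' \<phi>b' :: "real \<Rightarrow> nat \<Rightarrow> complex poly"
    and t :: real and x :: complex and n :: nat
  assumes "open S" and "M \<ge> 1"
    and "moving_singularities S M z"
    and "\<forall>k\<in>{0..M}. \<rho> k \<notin> \<nat>"
    and "semiclassical_deformation S M z \<rho> w"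
    and "admissible_system S M z w \<phi> \<phi>b"
    and "j \<in> {1..M}"
    and "t \<in> S" and "\<forall>k\<in>{1..M}. x \<noteq> z k t"
  shows
    "(admissible_system S M z (shift_weight 1 (z j) w) \<phi>' \<phi>b' \<and>
      (\<forall>s\<in>S. \<forall>m. poly (\<phi> s m) (z j s) \<noteq> 0) \<longrightarrow>
       (\<exists>D. ((\<lambda>s. R_plus (\<phi> s) (\<phi>b s) (kappa (\<phi>' s)) (z j s) n x) has_vector_derivative D) (at t) \<and>
            D + R_plus (\<phi> t) (\<phi>b t) (kappa (\<phi>' t)) (z j t) n x ** B_matrix M z \<rho> w \<phi> \<phi>b n t x
            = B_matrix M z (\<rho>(j := \<rho> j + 1)) (shift_weight 1 (z j) w) \<phi>' \<phi>b' n t x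
              ** R_plus (\<phi> t) (\<phi>b t) (kappa (\<phi>' t)) (z j t) n x))
     \<and>
     (admissible_system S M z (shift_weight (- 1) (z j) w) \<phi>' \<phi>b' \<and>
      (\<forall>s\<in>S. \<forall>m. value_at (xi_star (w s) (\<phi> s) (\<phi>b s) m) (z j s) \<noteq> 0) \<and>
      n \<ge> 1 \<longrightarrow>
       (\<exists>D. ((\<lambda>s. R_minus (w s) (\<phi> s) (\<phi>b s) (kappa (\<phi>' s)) (z j s) n x) has_vector_derivative D) (at t) \<and>
            D + R_minus (w t) (\<phi> t) (\<phi>b t) (kappa (\<phi>' t)) (z j t) n x ** B_matrix M z \<rho> w \<phi> \<phi>b n t x
            = B_matrix M z (\<rho>(j := \<rho> j - 1)) (shift_weight (- 1) (z j) w) \<phi>' \<phi>b' n t x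
              ** R_minus (w t) (\<phi> t) (\<phi>b t) (kappa (\<phi>' t)) (z j t) n x))"
proof (intro conjI impI, goal_cases)
  case 1
  interpret deformation_pair_plus S M z \<rho> w \<phi> \<phi>b j \<phi>' \<phi>b'
    by unfold_locales (use assms 1 semiclassical_deformation_shift[OF assms(3,5,7)] in blast)+
  show ?case by (rule compatibility[OF assms(8,9)])
next
  case 2
  interpret deformation_pair_minus S M z \<rho> w \<phi> \<phi>b j \<phi>' \<phi>b'
    by unfold_locales (use assms 2 semiclassical_deformation_shift[OF assms(3,5,7)] in blast)+
  show ?case using 2 by (intro compatibility[OF assms(8,9)]) blast
qed

end
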